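(* Suppose that $a(n)/n\to0$ as $n\to\infty$ and $\gamma_*>L^{-1}$. Let $\sigma_n=\sqrt{a(n)/\gamma_n}$. Then, as $n\to\infty$, $$\sigma_n(\boldsymbol\theta_n-\theta_* )\ \text{converges in distribution to}\ \mathcal N(0,V),$$ where $V$ is the solution of the Lyapunov equation $$U_*+\nabla h(\theta_* )V+V\nabla h(\theta_* )^T+(1+\zeta)\gamma_*^{-1}V=0.$$
   Context: Setting. $\Delta=\Delta^o\cup\{0\}$ is a finite set, $\Delta^o=\{1,\dots,d\}$ nonempty, $0\notin\Delta^o$. $P=(P_{x,y})_{x,y\in\Delta}$ is the transition matrix of a Markov chain $\{Y_n\}$ on $\Delta$ with $0$ absorbing ($P_{0,0}=1$); $\Delta^o$ is an irreducible class of the chain and $P_{x,0}>0$ for some $x\in\Delta^o$. $\mathcal{P}(\Delta^o)$ is identified with the simplex $\mathcal S=\{x\in\mathbb{R}_+^d:\sum_i x_i=1\}$. $\theta_*$ is the unique quasi-stationary distribution: the unique $\mu\in\mathcal{P}(\Delta^o)$ with $\mathbf{P}_\mu(Y_n=x\mid Y_n\in\Delta^o)=\mu(x)$ for all $x\in\Delta^o$, $n\in\mathbb{N}$. For $\nu\in\mathcal{P}(\Delta^o)$, $K[\nu]_{x,y}=P_{x,y}+P_{x,0}\,\nu(y)$, $x,y\in\Delta^o$, an irreducible transition matrix with unique invariant distribution $\pi(\nu)$; $h(\nu)=\pi(\nu)-\nu$. Jacobian. $h:\mathcal S\to T\mathcal S=\{x\in\mathbb R^d:\sum_ix_i=0\}$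 is smooth; $\nabla h(\theta_* )$ is its derivative at $\theta_*$, viewed as a linear map $T\mathcal S\to T\mathcal S$. It is known to be Hurwitz; $L>0$ is a fixed constant such that all its eigenvalues have real part $\le -L$. In the Lyapunov equation $V$ is a symmetric $d\times d$ matrix whose columns lie in $T\mathcal S$, $\nabla h(\theta_* )V$ is computed columnwise, and $V\nabla h(\theta_* )^T=(\nabla h(\theta_* )V)^T$. Poisson solution and $U_*$. $\Pi(\nu)_{x,y}=\pi(\nu)_y$; $Q[\nu]=\int_0^\infty[\exp(t(K[\nu]-I))-\Pi(\nu)]\,dt$, so that $(I-K[\nu])Q[\nu]=Q[\nu](I-K[\nu])=I-\Pi(\nu)$. For $z\in\Delta^o$, $F_\theta(z)$ is the $d\times d$ matrix $$F_\theta(z)_{x,y}=\sum_{u\in\Delta^o}K[\theta]_{z,u}Q[\theta]_{u,x}Q[\theta]_{u,y}-(K[\theta]Q[\theta])_{z,x}(K[\theta]Q[\theta])_{z,y},$$ and $U_*=\sum_{w\in\Delta^o}F_{\theta_*}(w)\,(\theta_* )_w$ (nonnegative definite). Step sizes: $\gamma_*>0$, $N_*=\lfloor\gamma_*\rfloor+1$, $\gamma_{k+1}=\gamma_*/(k+N_* )$ for $k\in\mathbb{N}_0$. Algorithm II. Fix $\zeta\in(0,1)$; the $n$-th particle is added at time $b(n)$, where $b(1)=0$ and $b(n)=\lfloor n^{1/\zeta}\rfloor$ for $n\ge2$, and $a(k)=\max\{n\ge1:b(n)\le k\}$, $k\in\mathbb N_0$, is the number of particles at time $k$ (so $a(0)=a(1)=1$,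 $a$ is non-decreasing with increments at most $1$, $a(n)\sim n^\zeta$). Fix $x_0\in\Delta^o$. On a probability space $(\Omega,\mathcal F,\mathbf P)$ there are $\Delta^o$-valued random variables $\boldsymbol X^i_n$ ($1\le i\le a(n+1)$, $n\in\mathbb N_0$), random variables $\iota_n\in\{1,\dots,a(n)\}$, random probability measures $\boldsymbol\theta_n\in\mathcal P(\Delta^o)$ and $\sigma$-fields $\boldsymbol{\mathcal F}_n$ such that $\boldsymbol X^1_0=x_0$, $\iota_0=\iota_1=1$, $\boldsymbol{\mathcal F}_0=\{\emptyset,\Omega\}$, $\boldsymbol\theta_0=\delta_{x_0}$, and for $n\in\mathbb N_0$: (1) if $a(n+2)=a(n+1)$, then on $\{\boldsymbol X^i_n=x_i,\,1\le i\le a(n+1)\}$, $\mathbf P(\boldsymbol X^i_{n+1}=y_i,\,1\le i\le a(n+2)\mid\boldsymbol{\mathcal F}_n)=\prod_{i=1}^{a(n+1)}K[\boldsymbol\theta_n]_{x_i,y_i}$; if $a(n+2)=a(n+1)+1$, then on $\{\boldsymbol X^i_n=x_i,\,1\le i\le a(n+1),\ \iota_{n+1}=\ell\}$ this conditional probability equals $\big(\prod_{i=1}^{a(n+1)}K[\boldsymbol\theta_n]_{x_i,y_i}\big)K[\boldsymbol\theta_n]_{x_\ell,y_{a(n+2)}}$; (2) with $\boldsymbol{\mathcal G}_{n+1}=\boldsymbol{\mathcal F}_n\vee\sigma(\boldsymbol X^1_{n+1},\dots,\boldsymbol X^{a(n+2)}_{n+1})$ and $\boldsymbol{\mathcal H}_{n+1}$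 an arbitrary $\sigma$-field independent of $\boldsymbol{\mathcal G}_{n+1}$, $\iota_{n+2}$ is an arbitrary $\boldsymbol{\mathcal G}_{n+1}\vee\boldsymbol{\mathcal H}_{n+1}$-measurable random variable with values in $\{1,\dots,a(n+2)\}$; (3) $\boldsymbol{\mathcal F}_{n+1}=\boldsymbol{\mathcal G}_{n+1}\vee\sigma(\iota_{n+2})$; (4) $\boldsymbol\theta_{n+1}=(1-\gamma_{n+1})\boldsymbol\theta_n+\gamma_{n+1}\frac1{a(n+1)}\sum_{i=1}^{a(n+1)}\delta_{\boldsymbol X^i_{n+1}}$. *)

theory Defs
  imports "HOL-Probability.Probability"
begin

text \<open>
  The non-absorbed states are the elements of an arbitrary finite type \<open>'d\<close>. The full state space
  is \<open>'d option\<close>, with \<open>None\<close> the absorbing state 0. Vectors indexed by states are row vectors when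
  they are distributions, so one step of a chain is \<open>v v* P\<close>.
\<close>

section \<open>The absorbed chain and its quasi-stationary distribution\<close>

definition prob_simplex :: "(real ^ 'd::finite) set" where
  "prob_simplex = {x. (\<forall>i. 0 \<le> x $ i) \<and> (\<Sum>i\<in>UNIV. x $ i) = 1}"

definition tangent :: "(real ^ 'd::finite) set" where
  "tangent = {x. (\<Sum>i\<in>UNIV. x $ i) = 0}"

definition chain_law :: "real ^ 's::finite ^ 's \<Rightarrow> real ^ 's \<Rightarrow> nat \<Rightarrow> real ^ 's" where
  "chain_law P v n = ((\<lambda>u. u v* P) ^^ n) v"

definition extend0 :: "real ^ 'd::finite \<Rightarrow> real ^ ('d option)" where
  "extend0 \<mu> = (\<chi> s. case s of None \<Rightarrow> 0 | Some x \<Rightarrow> \<mu> $ x)"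

definition transition_matrix :: "real ^ 's::finite ^ 's \<Rightarrow> bool" where
  "transition_matrix P \<longleftrightarrow> (\<forall>x y. 0 \<le> P $ x $ y) \<and> (\<forall>x. (\<Sum>y\<in>UNIV. P $ x $ y) = 1)"

definition absorbed_chain :: "real ^ ('d::finite option) ^ ('d option) \<Rightarrow> bool" where
  "absorbed_chain P \<longleftrightarrow>
     transition_matrix P \<and>
     P $ None $ None = 1 \<and>
     (\<forall>x y. \<exists>n\<ge>1. 0 < chain_law P (axis (Some x) 1) n $ Some y) \<and>
     (\<exists>x. 0 < P $ Some x $ None)"

definition quasi_stationary ::
    "real ^ ('d::finite option) ^ ('d option) \<Rightarrow> real ^ 'd \<Rightarrow> bool" where
  "quasi_stationary P \<mu> \<longleftrightarrow>
     \<mu> \<in> prob_simplex \<and>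
     (\<forall>n x. chain_law P (extend0 \<mu>) n $ Some x
              / (\<Sum>y\<in>UNIV. chain_law P (extend0 \<mu>) n $ Some y) = \<mu> $ x)"

section \<open>The matrices \<open>K[\<nu>]\<close> and the vector field\<close>

definition Kmat ::
    "real ^ ('d::finite option) ^ ('d option) \<Rightarrow> real ^ 'd \<Rightarrow> real ^ 'd ^ 'd" where
  "Kmat P \<nu> = (\<chi> x y. P $ Some x $ Some y + P $ Some x $ None * \<nu> $ y)"

definition invariant_dist ::
    "real ^ ('d::finite option) ^ ('d option) \<Rightarrow> real ^ 'd \<Rightarrow> real ^ 'd" where
  "invariant_dist P \<nu> = (THE p. p \<in> prob_simplex \<and> p v* Kmat P \<nu> = p)"

definition hfield ::
    "real ^ ('d::finite option) ^ ('d option) \<Rightarrow> real ^ 'd \<Rightarrow> real ^ 'd" where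
  "hfield P \<nu> = invariant_dist P \<nu> - \<nu>"

text \<open>
  The derivative within the simplex is determined only on the tangent space. Its values elsewhere
  are an arbitrary choice, so it may only be applied to tangent vectors, as is done below.
\<close>

definition h_jacobian ::
    "real ^ ('d::finite option) ^ ('d option) \<Rightarrow> real ^ 'd \<Rightarrow> real ^ 'd \<Rightarrow> real ^ 'd" where
  "h_jacobian P \<nu> = frechet_derivative (hfield P) (at \<nu> within prob_simplex)"

definition complexify :: "(real ^ 'd::finite \<Rightarrow> real ^ 'd) \<Rightarrow> complex ^ 'd \<Rightarrow> complex ^ 'd" where
  "complexify D z = (\<chi> i. Complex (D (\<chi> j. Re (z $ j)) $ i) (D (\<chi> j. Im (z $ j)) $ i))"

text \<open>Complex eigenvalues of \<open>D\<close> as a linear map of the tangent space into itself.\<close>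

definition tangent_eigenvalue :: "(real ^ 'd::finite \<Rightarrow> real ^ 'd) \<Rightarrow> complex \<Rightarrow> bool" where
  "tangent_eigenvalue D c \<longleftrightarrow>
     (\<exists>z. z \<noteq> 0 \<and> (\<Sum>i\<in>UNIV. z $ i) = 0 \<and> complexify D z = c *s z)"

section \<open>The Poisson solution and the matrix \<open>U\<^sub>*\<close>\<close>

text \<open>
  The type class operations \<open>*\<close>, \<open>^\<close> on \<open>real ^ 'd ^ 'd\<close> are componentwise, so matrix powers and
  the matrix exponential are defined from \<open>**\<close>.
\<close>

definition matrix_power :: "real ^ 'd::finite ^ 'd \<Rightarrow> nat \<Rightarrow> real ^ 'd ^ 'd" where
  "matrix_power A n = ((\<lambda>B. A ** B) ^^ n) (mat 1)"

definition matrix_exp :: "real ^ 'd::finite ^ 'd \<Rightarrow> real ^ 'd ^ 'd" where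
  "matrix_exp A = (\<Sum>n. (1 / fact n) *\<^sub>R matrix_power A n)"

definition Pimat ::
    "real ^ ('d::finite option) ^ ('d option) \<Rightarrow> real ^ 'd \<Rightarrow> real ^ 'd ^ 'd" where
  "Pimat P \<nu> = (\<chi> x y. invariant_dist P \<nu> $ y)"

definition Qmat ::
    "real ^ ('d::finite option) ^ ('d option) \<Rightarrow> real ^ 'd \<Rightarrow> real ^ 'd ^ 'd" where
  "Qmat P \<nu> = integral {0..} (\<lambda>t. matrix_exp (t *\<^sub>R (Kmat P \<nu> - mat 1)) - Pimat P \<nu>)"

definition Fmat ::
    "real ^ ('d::finite option) ^ ('d option) \<Rightarrow> real ^ 'd \<Rightarrow> 'd \<Rightarrow> real ^ 'd ^ 'd" where
  "Fmat P \<nu> z = (\<chi> x y.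
     (\<Sum>u\<in>UNIV. Kmat P \<nu> $ z $ u * Qmat P \<nu> $ u $ x * Qmat P \<nu> $ u $ y)
     - (Kmat P \<nu> ** Qmat P \<nu>) $ z $ x * (Kmat P \<nu> ** Qmat P \<nu>) $ z $ y)"

definition Umat ::
    "real ^ ('d::finite option) ^ ('d option) \<Rightarrow> real ^ 'd \<Rightarrow> real ^ 'd ^ 'd" where
  "Umat P \<nu> = (\<Sum>w\<in>UNIV. \<nu> $ w *\<^sub>R Fmat P \<nu> w)"

section \<open>The Lyapunov equation\<close>

definition columnwise ::
    "(real ^ 'd::finite \<Rightarrow> real ^ 'd) \<Rightarrow> real ^ 'd ^ 'd \<Rightarrow> real ^ 'd ^ 'd" where
  "columnwise D V = (\<chi> i j. D (column j V) $ i)"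

definition lyapunov_solution ::
    "real ^ 'd::finite ^ 'd \<Rightarrow> (real ^ 'd \<Rightarrow> real ^ 'd) \<Rightarrow> real \<Rightarrow> real ^ 'd ^ 'd \<Rightarrow> bool" where
  "lyapunov_solution U D c V \<longleftrightarrow>
     transpose V = V \<and>
     (\<forall>j. column j V \<in> tangent) \<and>
     U + columnwise D V + transpose (columnwise D V) + c *\<^sub>R V = 0"

section \<open>Step sizes and particle numbers\<close>

text \<open>Only \<open>n \<ge> 1\<close> is meaningful: \<open>step_size \<gamma>s (k + 1) = \<gamma>s / (k + N\<^sub>*)\<close>.\<close>

definition step_size :: "real \<Rightarrow> nat \<Rightarrow> real" where
  "step_size \<gamma>s n = \<gamma>s / (real n - 1 + of_int (\<lfloor>\<gamma>s\<rfloor> + 1))"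

definition birth_time :: "real \<Rightarrow> nat \<Rightarrow> nat" where
  "birth_time \<zeta> n = (if n = 1 then 0 else nat \<lfloor>real n powr (1 / \<zeta>)\<rfloor>)"

definition num_particles :: "real \<Rightarrow> nat \<Rightarrow> nat" where
  "num_particles \<zeta> k = Max {n. 1 \<le> n \<and> birth_time \<zeta> n \<le> k}"

section \<open>Algorithm II\<close>

text \<open>
  \<open>X n i\<close> is the position of particle \<open>i\<close> at time \<open>n\<close>. It is constrained only for
  \<open>1 \<le> i \<le> num_particles \<zeta> (n + 1)\<close>. \<sigma>-fields are
  represented by measures, of which only the sets matter.
\<close>

definition sigma_join :: "'w measure \<Rightarrow> 'w measure \<Rightarrow> 'w measure" where
  "sigma_join A B = sigma (space A \<union> space B) (sets A \<union> sets B)"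

locale algorithm_II = prob_space M for M :: "'w measure" +
  fixes P :: "real ^ ('d::finite option) ^ ('d option)"
    and \<gamma>s \<zeta> :: real
    and x0 :: 'd
    and X :: "nat \<Rightarrow> nat \<Rightarrow> 'w \<Rightarrow> 'd"
    and \<iota> :: "nat \<Rightarrow> 'w \<Rightarrow> nat"
    and \<theta> :: "nat \<Rightarrow> 'w \<Rightarrow> real ^ 'd"
    and F G H :: "nat \<Rightarrow> 'w measure"
  assumes X_measurable:
      "\<And>n i. i \<in> {1..num_particles \<zeta> (n + 1)} \<Longrightarrow> X n i \<in> measurable M (count_space UNIV)"
    and \<iota>_range: "\<And>n \<omega>. \<omega> \<in> space M \<Longrightarrow> \<iota> n \<omega> \<in> {1..num_particles \<zeta> n}"
    and X_init: "\<And>\<omega>. \<omega> \<in> space M \<Longrightarrow> X 0 1 \<omega> = x0"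
    and \<iota>_init: "\<And>\<omega>. \<omega> \<in> space M \<Longrightarrow> \<iota> 0 \<omega> = 1" "\<And>\<omega>. \<omega> \<in> space M \<Longrightarrow> \<iota> 1 \<omega> = 1"
    and F_init: "sets (F 0) = {{}, space M}"
    and \<theta>_init: "\<And>\<omega>. \<omega> \<in> space M \<Longrightarrow> \<theta> 0 \<omega> = axis x0 1"
    and transition_same:
      "\<And>n x y. num_particles \<zeta> (n + 2) = num_particles \<zeta> (n + 1) \<Longrightarrow>
         AE \<omega> in M. (\<forall>i\<in>{1..num_particles \<zeta> (n + 1)}. X n i \<omega> = x i) \<longrightarrow>
           real_cond_exp M (F n)
             (indicator {\<omega> \<in> space M. \<forall>i\<in>{1..num_particles \<zeta> (n + 2)}. X (n + 1) i \<omega> = y i}) \<omega>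
           = (\<Prod>i=1..num_particles \<zeta> (n + 1). Kmat P (\<theta> n \<omega>) $ x i $ y i)"
    and transition_birth:
      "\<And>n x y l. num_particles \<zeta> (n + 2) = num_particles \<zeta> (n + 1) + 1 \<Longrightarrow>
       l \<in> {1..num_particles \<zeta> (n + 1)} \<Longrightarrow>
         AE \<omega> in M. (\<forall>i\<in>{1..num_particles \<zeta> (n + 1)}. X n i \<omega> = x i) \<and> \<iota> (n + 1) \<omega> = l \<longrightarrow>
           real_cond_exp M (F n)
             (indicator {\<omega> \<in> space M. \<forall>i\<in>{1..num_particles \<zeta> (n + 2)}. X (n + 1) i \<omega> = y i}) \<omega>
           = (\<Prod>i=1..num_particles \<zeta> (n + 1). Kmat P (\<theta> n \<omega>) $ x i $ y i)
             * Kmat P (\<theta> n \<omega>) $ x l $ y (num_particles \<zeta> (n + 2))"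
    and G_step:
      "\<And>n. sets (G (n + 1)) = sets (sigma_join (F n)
         (vimage_algebra (space M) (\<lambda>\<omega>. \<lambda>i\<in>{1..num_particles \<zeta> (n + 2)}. X (n + 1) i \<omega>)
           (\<Pi>\<^sub>M i\<in>{1..num_particles \<zeta> (n + 2)}. count_space UNIV)))"
    and H_subfield: "\<And>n. subalgebra M (H (n + 1))"
    and H_indep: "\<And>n. indep_set (sets (G (n + 1))) (sets (H (n + 1)))"
    and \<iota>_measurable:
      "\<And>n. \<iota> (n + 2) \<in> measurable (sigma_join (G (n + 1)) (H (n + 1))) (count_space UNIV)"
    and F_step:
      "\<And>n. sets (F (n + 1)) = sets (sigma_join (G (n + 1))
         (vimage_algebra (space M) (\<iota> (n + 2)) (count_space UNIV)))"
    and \<theta>_step: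
      "\<And>n \<omega>. \<omega> \<in> space M \<Longrightarrow>
         \<theta> (n + 1) \<omega> = (1 - step_size \<gamma>s (n + 1)) *\<^sub>R \<theta> n \<omega>
           + step_size \<gamma>s (n + 1) *\<^sub>R
               ((1 / real (num_particles \<zeta> (n + 1))) *\<^sub>R
                 (\<Sum>i=1..num_particles \<zeta> (n + 1). axis (X (n + 1) i \<omega>) 1))"

section \<open>Convergence in distribution to a normal law\<close>

definition converges_weakly :: "(nat \<Rightarrow> 'b::topological_space measure) \<Rightarrow> 'b measure \<Rightarrow> bool" where
  "converges_weakly \<mu> N \<longleftrightarrow>
     (\<forall>f::'b \<Rightarrow> real. continuous_on UNIV f \<longrightarrow> bounded (range f) \<longrightarrow>
        (\<lambda>n. \<integral>x. f x \<partial>\<mu> n) \<longlonglongrightarrow> (\<integral>x. f x \<partial>N))"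

text \<open>
  Normal laws on \<open>real ^ 'd\<close> are specified by their characteristic function because the covariance
  matrices at hand are always singular, so that there is no density.
\<close>

definition normal_law :: "real ^ 'd::finite \<Rightarrow> real ^ 'd ^ 'd \<Rightarrow> (real ^ 'd) measure \<Rightarrow> bool" where
  "normal_law m V N \<longleftrightarrow>
     prob_space N \<and> sets N = sets borel \<and>
     (\<forall>u. (CLINT x|N. iexp (u \<bullet> x)) = iexp (u \<bullet> m) * exp (- of_real (u \<bullet> (V *v u)) / 2))"

end

theory Submission
 imports Defs "HOL-Computational_Algebra.Fundamental_Theorem_Algebra" "HOL-Real_Asymp.Real_Asymp"
begin

text \<open>
  With \<open>m\<close> the empirical measure of the particles at a step, a Poisson equation for \<open>K[\<theta>\<^sub>*]\<close> writes
  \<open>m - \<theta>\<^sub>*\<close> as \<open>\<langle>m, P\<^sub>\<cdot>\<^sub>0\<rangle> (\<theta> - \<theta>\<^sub>*) Q\<close> plus a martingale increment times \<open>Q\<close> plus a telescoping term.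
  Exponential moments of the increments, averages of conditionally independent particles, and
  Borel-Cantelli give \<open>\<theta> \<rightarrow> \<theta>\<^sub>*\<close> and \<open>m \<rightarrow> \<theta>\<^sub>*\<close> almost surely: in the direction of the
  Perron eigenvector of \<open>(I - P\<^sub>0)\<^sup>-\<^sup>1\<close> the recursion for \<open>\<theta>\<close> stays bounded below, and transversally it
  contracts relative to that component.

  After multiplication by \<open>s\<^sub>n \<sim> \<sigma>\<^sub>n\<close>, the error is a linear recursion \<open>Z\<close> with drift \<open>\<nabla>h(\<theta>\<^sub>*) + (1 + \<zeta>) / (2 \<gamma>\<^sub>*)\<close>,
  which is Hurwitz, driven by the martingale, plus a remainder \<open>D\<close>. A norm adapted to the drift makes each
  step a contraction. Hence \<open>D \<rightarrow> 0\<close> in probability; births of particles enter only through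
  \<open>a(n) - n\<^sup>\<zeta>\<close>, which is bounded. The characteristic function of \<open>Z\<close> satisfies, up to \<open>o(\<gamma>\<^sub>n)\<close>, the one-step identity
  that the Lyapunov equation gives for \<open>exp (- \<langle>u, V u\<rangle> / 2)\<close>, so their distance tends to \<open>0\<close> in the dual
  adapted norm.
\<close>

section \<open>Adapted norms and the Lyapunov equation\<close>

text \<open>The rank-one form
  \<open>v v* K[\<nu>] = v v* P0 + (v \<bullet> q0) *\<^sub>R \<nu>\<close> makes the nonlinearity
  scalar: it sits in the mean exit probability of the particles alone. Hence the Poisson
  decomposition carries no Taylor remainder, and the error obeys a linear recursion with one random
  coefficient that tends to \<open>cs\<close>. Its fluctuation multiplies the error itself, whose
  size is not controlled in mean; hence the split into \<open>Z\<close>, which has exponential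
  moments, and \<open>D\<close>, estimated on events where the coefficient stays close to
  \<open>cs\<close>. The bound on \<gamma>s comes from the normalisation. The smooth substitute
  \<open>scl\<close> for the jumping \<sigma> grows like the power \<alpha> = (1 + \<zeta>) / 2 < 1
  of time, that is by factors 1 + \<gamma> \<tau> with \<tau> tending to \<alpha> / \<gamma>s, so
  the scaled drift has spectral bound \<alpha> / \<gamma>s - L < 0. Twice this shift is the
  coefficient of the last term of the Lyapunov equation. Second moments would not give almost sure
  convergence: the variances decay like the power -\<zeta> of time and are not summable. Exponential
  moments replace them.\<close>

lemma linear_dependence_sequence:
 fixes x :: "nat \<Rightarrow> 'a::euclidean_space"
 obtains a where "\<exists>i\<le>DIM('a). a i \<noteq> 0" "(\<Sum>i\<le>DIM('a). a i *\<^sub>R x i) = 0"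
proof (cases "inj_on x {..DIM('a)}")
 case False
 then obtain i j where ij: "i \<le> DIM('a)" "j \<le> DIM('a)" "i \<noteq> j" "x i = x j"
  by (auto simp: inj_on_def)
 \<comment> \<open>A repeated vector is already a dependence, with coefficients 1 and -1 at its two
   indices.\<close>
 define a where "a = (\<lambda>k. (if k = i then 1 else 0) - (if k = j then (1::real) else 0))"
 have "(\<Sum>k\<le>DIM('a). a k *\<^sub>R x k) = (\<Sum>k\<le>DIM('a). (if k = i then x k else 0)) - (\<Sum>k\<le>DIM('a). (if k = j then x k else 0))"
  unfolding sum_subtractf[symmetric] by (intro sum.cong) (auto simp: a_def)
 also have "\<dots> = 0" using ij by simp
 finally have "(\<Sum>k\<le>DIM('a). a k *\<^sub>R x k) = 0" .
 moreover have "a i \<noteq> 0" using ij by (auto simp: a_def)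
 ultimately show ?thesis using that ij(1) by blast
next
 case True
 have "card (x ` {..DIM('a)}) = Suc DIM('a)" using True by (simp add: card_image)
 then have "dependent (x ` {..DIM('a)})" using independent_bound[of "x ` {..DIM('a)}"] by auto
 then obtain u where u: "\<exists>v\<in>x ` {..DIM('a)}. u v \<noteq> 0" "(\<Sum>v\<in>x ` {..DIM('a)}. u v *\<^sub>R v) = 0"
  using dependent_finite[of "x ` {..DIM('a)}"] by auto
 have "(\<Sum>i\<le>DIM('a). u (x i) *\<^sub>R x i) = 0" using u(2) True by (simp add: sum.reindex)
 moreover have "\<exists>i\<le>DIM('a). u (x i) \<noteq> 0" using u(1) by auto
 ultimately show ?thesis using that[of "\<lambda>i. u (x i)"] by blast
qed

section \<open>Complex linear maps and their annihilating polynomials\<close>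

definition clinear_map :: "(complex ^ 'n \<Rightarrow> complex ^ 'n) \<Rightarrow> bool" where
 "clinear_map T \<longleftrightarrow> (\<forall>x y. T (x + y) = T x + T y) \<and> (\<forall>c x. T (c *s x) = c *s T x)"

lemma clinear_map_add: "clinear_map T \<Longrightarrow> T (x + y) = T x + T y"
 and clinear_map_scale: "clinear_map T \<Longrightarrow> T (c *s x) = c *s T x"
 by (auto simp: clinear_map_def)

lemma clinear_map_zero: "clinear_map T \<Longrightarrow> T 0 = 0"
 using clinear_map_scale[of T 0 0] by simp

lemma clinear_map_diff: "clinear_map T \<Longrightarrow> T (x - y) = T x - T y"
 using clinear_map_add[of T "x - y" y] by simp

lemma clinear_map_sum: "clinear_map T \<Longrightarrow> T (sum f A) = (\<Sum>i\<in>A. T (f i))"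
 by (induction A rule: infinite_finite_induct) (auto simp: clinear_map_zero clinear_map_add)

lemma clinear_map_funpow: "clinear_map T \<Longrightarrow> clinear_map (T ^^ n)"
 by (induction n) (auto simp: clinear_map_def)

definition shift_by :: "(complex ^ 'n \<Rightarrow> complex ^ 'n) \<Rightarrow> complex \<Rightarrow> complex ^ 'n \<Rightarrow> complex ^ 'n" where
 "shift_by T c z = T z - c *s z"

lemma clinear_map_shift_by: "clinear_map T \<Longrightarrow> clinear_map (shift_by T c)"
 by (auto simp: clinear_map_def shift_by_def algebra_simps vector_add_ldistrib vector_smult_assoc
   scaleR_conv_of_real vec_eq_iff)

definition poly_act :: "(complex ^ 'n \<Rightarrow> complex ^ 'n) \<Rightarrow> complex poly \<Rightarrow> complex ^ 'n \<Rightarrow> complex ^ 'n" where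
 "poly_act T p z = (\<Sum>i\<le>degree p. coeff p i *s (T ^^ i) z)"

lemma poly_act_eq: "degree p \<le> n \<Longrightarrow> poly_act T p z = (\<Sum>i\<le>n. coeff p i *s (T ^^ i) z)"
 unfolding poly_act_def by (rule sum.mono_neutral_left) (auto simp: coeff_eq_0)

lemma poly_act_linear_factor:
 assumes "clinear_map T"
 shows "poly_act T ([:-c, 1:] * p) z = shift_by T c (poly_act T p z)"
proof -
 have "degree ([:-c, 1:] * p) \<le> Suc (degree p)"
  by (rule order_trans[OF degree_mult_le]) simp
 then have "poly_act T ([:-c, 1:] * p) z = (\<Sum>i\<le>Suc (degree p). coeff ([:-c, 1:] * p) i *s (T ^^ i) z)"
  by (rule poly_act_eq)
 also have "\<dots> = (\<Sum>i\<le>Suc (degree p). (case i of 0 \<Rightarrow> 0 | Suc j \<Rightarrow> coeff p j *s (T ^^ i) z) - c *s (coeff p i *s (T ^^ i) z))"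
  by (intro sum.cong) (auto simp: coeff_pCons vec_eq_iff algebra_simps split: nat.splits)
 also have "\<dots> = (\<Sum>i\<le>degree p. coeff p i *s (T ^^ Suc i) z) - c *s (\<Sum>i\<le>Suc (degree p). coeff p i *s (T ^^ i) z)"
  unfolding sum_subtractf sum.atMost_Suc_shift
  by (simp add: vec.scale_sum_right vec.scale_right_distrib)
 also have "(\<Sum>i\<le>Suc (degree p). coeff p i *s (T ^^ i) z) = poly_act T p z"
  by (rule poly_act_eq[symmetric]) simp
 also have "(\<Sum>i\<le>degree p. coeff p i *s (T ^^ Suc i) z) = T (poly_act T p z)"
  unfolding poly_act_def clinear_map_sum[OF assms] clinear_map_scale[OF assms] by simp
 finally show ?thesis by (simp add: shift_by_def)
qed

lemma poly_act_factorization: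
 assumes T: "clinear_map T" and "p \<noteq> 0"
 shows "\<exists>cs a. a \<noteq> 0 \<and> (\<forall>z. poly_act T p z = a *s foldr (shift_by T) cs z)"
 using \<open>p \<noteq> 0\<close>
proof (induction "degree p" arbitrary: p)
 case 0
 then obtain a where "p = [:a:]" "a \<noteq> 0" by (metis degree_eq_zeroE pCons_0_0)
 then show ?case by (intro exI[of _ "[]"] exI[of _ a]) (auto simp: poly_act_def)
next
 case (Suc n)
 then have "\<not> constant (poly p)" by (simp add: constant_degree)
 then obtain c where "poly p c = 0" using fundamental_theorem_of_algebra by blast
 then obtain q where q: "p = [:-c, 1:] * q" by (metis poly_eq_0_iff_dvd dvdE)
 then have "q \<noteq> 0" using Suc.prems by auto
 have "degree p = Suc (degree q)" unfolding q
  by (subst degree_mult_eq) (use \<open>q \<noteq> 0\<close> in auto)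
 then have "n = degree q" using Suc.hyps(2) by simp
 from Suc.hyps(1)[OF this \<open>q \<noteq> 0\<close>] obtain cs a where
  "a \<noteq> 0" "\<And>z. poly_act T q z = a *s foldr (shift_by T) cs z" by blast
 then show ?case
  by (intro exI[of _ "c # cs"] exI[of _ a])
   (auto simp: q poly_act_linear_factor[OF T] clinear_map_scale[OF clinear_map_shift_by[OF T]] simp del: mult_pCons_left)
qed

text \<open>The powers of \<open>T\<close> live in a space of finite real dimension, so some nonzero
  polynomial kills \<open>T\<close>; the fundamental theorem of algebra splits it into factors
  \<open>T - c\<close>. Any such polynomial serves, since the factors that are not eigenvalues are
  cancelled afterwards.\<close>

lemma annihilating_product:
 fixes T :: "complex ^ 'n::finite \<Rightarrow> complex ^ 'n"
 assumes T: "clinear_map T"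
 obtains cs where "\<And>z. foldr (shift_by T) cs z = 0"
proof -
 \<comment> \<open>Row \<open>j\<close> of \<open>B i\<close> is the image of the basis vector
   \<open>j\<close> under the \<open>i\<close>-th power, so \<open>B i\<close> is the transposed
   matrix of that power.\<close>
 define B :: "nat \<Rightarrow> complex ^ 'n ^ 'n" where "B i = (\<chi> j. (T ^^ i) (axis j 1))" for i
 obtain a where a: "\<exists>i\<le>DIM(complex ^ 'n ^ 'n). a i \<noteq> 0" "(\<Sum>i\<le>DIM(complex ^ 'n ^ 'n). a i *\<^sub>R B i) = 0"
  by (rule linear_dependence_sequence)
 define D where "D = DIM(complex ^ 'n ^ 'n)"
 define p where "p = (\<Sum>i\<le>D. monom (complex_of_real (a i)) i)"
 have coeff: "coeff p i = (if i \<le> D then complex_of_real (a i) else 0)" for i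
  by (auto simp: p_def coeff_sum if_distrib cong: if_cong)
 have "p \<noteq> 0" using a(1) coeff unfolding D_def[symmetric] by (metis coeff_0 of_real_eq_0_iff)
 have deg: "degree p \<le> D" by (rule degree_le) (auto simp: coeff)
 have basis: "poly_act T p (axis j 1) = 0" for j
 proof -
  have "poly_act T p (axis j 1) = (\<Sum>i\<le>D. a i *\<^sub>R B i) $ j"
   unfolding poly_act_eq[OF deg] sum_component
   by (intro sum.cong) (auto simp: coeff B_def vec_eq_iff scaleR_conv_of_real[where 'a=complex])
  then show ?thesis unfolding a(2)[folded D_def] by simp
 qed
 have "poly_act T p z = 0" for z
 proof -
  have "z = (\<Sum>j\<in>UNIV. z $ j *s axis j 1)" by (simp add: basis_expansion)
  then have "poly_act T p z = poly_act T p (\<Sum>j\<in>UNIV. z $ j *s axis j 1)" by simp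
  also have "\<dots> = (\<Sum>j\<in>UNIV. z $ j *s poly_act T p (axis j 1))"
   unfolding poly_act_def
   by (simp add: clinear_map_sum[OF clinear_map_funpow[OF T]] clinear_map_scale[OF clinear_map_funpow[OF T]]
     vec.scale_sum_right) (subst sum.swap, intro sum.cong refl, simp add: mult.commute)
  also have "\<dots> = 0" by (simp add: basis)
  finally show ?thesis .
 qed
 with poly_act_factorization[OF T \<open>p \<noteq> 0\<close>] obtain cs c where
  "c \<noteq> 0" "\<And>z. c *s foldr (shift_by T) cs z = 0" by metis
 then have "foldr (shift_by T) cs z = 0" for z using vector_mul_eq_0[of c "foldr (shift_by T) cs z"] by blast
 then show ?thesis by (rule that)
qed

lemma foldr_shift_commute:
 assumes T: "clinear_map T"
 shows "foldr (shift_by T) cs (shift_by T c z) = shift_by T c (foldr (shift_by T) cs z)"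
proof (induction cs)
 case (Cons d cs)
 have "shift_by T d (shift_by T c w) = shift_by T c (shift_by T d w)" for w
  by (simp add: shift_by_def clinear_map_diff[OF T] clinear_map_scale[OF T] vec_eq_iff algebra_simps)
 then show ?case using Cons by simp
qed simp

text \<open>If \<open>c\<close> is not an eigenvalue, then \<open>T - c\<close> is injective and can
  be cancelled from the product. What survives has eigenvalues as its only roots, so a spectral
  bound applies to each factor.\<close>

lemma annihilating_product_reduce:
 assumes T: "clinear_map T"
 shows "\<exists>cs'. (\<forall>c\<in>set cs'. \<exists>z. z \<noteq> 0 \<and> T z = c *s z) \<and>
   (\<forall>z. foldr (shift_by T) cs z = 0 \<longrightarrow> foldr (shift_by T) cs' z = 0)"
proof (induction cs)
 case Nil
 show ?case by (intro exI[of _ "[]"]) auto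
next
 case (Cons c cs)
 then obtain cs' where cs': "\<forall>c\<in>set cs'. \<exists>z. z \<noteq> 0 \<and> T z = c *s z"
  "\<And>z. foldr (shift_by T) cs z = 0 \<Longrightarrow> foldr (shift_by T) cs' z = 0" by blast
 show ?case
 proof (cases "\<exists>z. z \<noteq> 0 \<and> T z = c *s z")
  case True
  have "foldr (shift_by T) (c # cs') z = 0" if "foldr (shift_by T) (c # cs) z = 0" for z
  proof -
   have "foldr (shift_by T) cs (shift_by T c z) = 0" using that by (simp add: foldr_shift_commute[OF T])
   from cs'(2)[OF this] show ?thesis by (simp add: foldr_shift_commute[OF T])
  qed
  then show ?thesis using True cs'(1) by (intro exI[of _ "c # cs'"]) auto
 next
  case False
  then have "shift_by T c w = 0 \<Longrightarrow> w = 0" for w by (auto simp: shift_by_def)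
  then show ?thesis using cs' by (intro exI[of _ cs']) auto
 qed
qed

text \<open>A substitute for a rescaled Jordan basis: the norms of z, (T - c1) z, (T - c2) (T - c1)
  z, ... are added with weights 1, \<eta>, \<eta>^2, .... A large \<eta> makes the nilpotent part of
  \<open>T\<close> small relative to the norm.\<close>

fun flag_norm :: "(complex ^ 'n::finite \<Rightarrow> complex ^ 'n) \<Rightarrow> real \<Rightarrow> complex list \<Rightarrow> complex ^ 'n \<Rightarrow> real" where
 "flag_norm T \<eta> [] z = norm z"
| "flag_norm T \<eta> (c # cs) z = norm z + \<eta> * flag_norm T \<eta> cs (shift_by T c z)"

lemma norm_cmult_vec: "norm (c *s (z :: complex ^ 'n)) = cmod c * norm z"
 by (simp add: norm_vec_def L2_set_right_distrib norm_mult)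

lemma flag_norm_ge: "\<eta> \<ge> 0 \<Longrightarrow> norm z \<le> flag_norm T \<eta> cs z"
proof (induction cs arbitrary: z)
 case (Cons c cs)
 have "0 \<le> flag_norm T \<eta> cs (shift_by T c z)"
  using Cons.IH[of "shift_by T c z"] Cons.prems norm_ge_zero order_trans by blast
 then show ?case using Cons.prems by simp
qed simp

lemma flag_norm_triangle:
 assumes "clinear_map T" "h \<ge> 0"
 shows "flag_norm T h cs (x + y) \<le> flag_norm T h cs x + flag_norm T h cs y"
proof (induction cs arbitrary: x y)
 case Nil
 show ?case by (simp add: norm_triangle_ineq)
next
 case (Cons c cs)
 have "h * flag_norm T h cs (shift_by T c x + shift_by T c y)
   \<le> h * (flag_norm T h cs (shift_by T c x) + flag_norm T h cs (shift_by T c y))"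
  using Cons assms(2) by (intro mult_left_mono)
 then show ?case using norm_triangle_ineq[of x y]
  by (simp add: clinear_map_add[OF clinear_map_shift_by[OF assms(1)]] algebra_simps)
qed

lemma flag_norm_scale:
 assumes "clinear_map T"
 shows "flag_norm T \<eta> cs (a *s x) = cmod a * flag_norm T \<eta> cs x"
 by (induction cs arbitrary: x)
  (auto simp: norm_cmult_vec clinear_map_scale[OF clinear_map_shift_by[OF assms]] algebra_simps)

text \<open>With w = (T - c) z one has T z = c z + w. The term g * |w| that leaks into the first
  summand is g / h times the weight h * |w| that w already has in the norm, so the leaks of all
  levels add up to g / h times the norm without its first term. The vanishing of the full product
  closes the last level.\<close>

lemma flag_norm_step:
 assumes T: "clinear_map T" and h: "h > 0" and g: "g \<ge> 0" and q: "\<And>c. c \<in> set cs \<Longrightarrow> cmod (1 + of_real g * c) \<le> q"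
  and zero: "foldr (shift_by T) cs z = 0"
 shows "flag_norm T h cs (z + of_real g *s T z)
   \<le> q * flag_norm T h cs z + g / h * (flag_norm T h cs z - norm z)"
 using q zero
proof (induction cs arbitrary: z)
 case Nil
 then show ?case by (simp add: clinear_map_zero[OF T])
next
 case (Cons c cs)
 define w where "w = shift_by T c z"
 define N where "N = flag_norm T h cs w"
 have "foldr (shift_by T) cs w = 0" using Cons.prems(2) by (simp add: w_def foldr_shift_commute[OF T])
 from Cons.IH[OF _ this] Cons.prems(1)
 have IH: "flag_norm T h cs (w + of_real g *s T w) \<le> q * N + g / h * (N - norm w)" by (auto simp: N_def)
 have Tz: "T z = w + c *s z" by (simp add: w_def shift_by_def)
 have "z + of_real g *s T z = (1 + of_real g * c) *s z + of_real g *s w"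
  unfolding Tz by (simp add: vec_eq_iff algebra_simps)
 then have "norm (z + of_real g *s T z) \<le> norm ((1 + of_real g * c) *s z) + norm (of_real g *s w)"
  using norm_triangle_ineq[of "(1 + of_real g * c) *s z" "of_real g *s w"] by metis
 also have "\<dots> = cmod (1 + of_real g * c) * norm z + g * norm w"
  using g unfolding norm_cmult_vec by simp
 finally have "norm (z + of_real g *s T z) \<le> cmod (1 + of_real g * c) * norm z + g * norm w" .
 also have "\<dots> \<le> q * norm z + g * norm w"
  using Cons.prems(1)[of c] by (intro add_mono mult_right_mono) auto
 finally have 1: "norm (z + of_real g *s T z) \<le> q * norm z + g * norm w" .
 have 2: "shift_by T c (z + of_real g *s T z) = w + of_real g *s T w"
  by (simp add: w_def shift_by_def clinear_map_add[OF T] clinear_map_scale[OF T] clinear_map_diff[OF T] vec_eq_iff algebra_simps)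
 have "flag_norm T h (c # cs) (z + of_real g *s T z) \<le> q * norm z + g * norm w + h * (q * N + g / h * (N - norm w))"
  using 1 IH h by (auto simp: 2 intro!: add_mono mult_left_mono)
 also have "\<dots> = q * (norm z + h * N) + g * N" using h by (simp add: field_simps)
 also have "g * N = g / h * (flag_norm T h (c # cs) z - norm z)" using h by (simp add: N_def w_def)
 finally show ?case by (simp add: N_def w_def)
qed

lemma flag_norm_le:
 assumes T: "clinear_map T" and TC: "\<And>z. norm (T z) \<le> B * norm z" and B: "B \<ge> 0" and h: "h \<ge> 0"
 shows "\<exists>C\<ge>1. \<forall>z. flag_norm T h cs z \<le> C * norm z"
proof (induction cs)
 case Nil
 show ?case by (intro exI[of _ 1]) auto
next
 case (Cons c cs)
 then obtain C where C: "C \<ge> 1" "\<And>z. flag_norm T h cs z \<le> C * norm z" by blast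
 have "flag_norm T h (c # cs) z \<le> (1 + h * (C * (B + cmod c))) * norm z" for z
 proof -
  have "norm (shift_by T c z) \<le> norm (T z) + norm (c *s z)" unfolding shift_by_def by (rule norm_triangle_ineq4)
  also have "\<dots> \<le> (B + cmod c) * norm z" using TC[of z] by (simp add: norm_cmult_vec algebra_simps)
  finally have "flag_norm T h cs (shift_by T c z) \<le> C * ((B + cmod c) * norm z)"
   using C by (meson order_trans mult_left_mono zero_le_one)
  then have "h * flag_norm T h cs (shift_by T c z) \<le> h * (C * ((B + cmod c) * norm z))"
   using h by (intro mult_left_mono)
  then show ?thesis by (simp add: algebra_simps)
 qed
 moreover have "1 + h * (C * (B + cmod c)) \<ge> 1" using C B h by simp
 ultimately show ?case by blast
qed

lemma cmod_one_plus_small: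
 assumes "Re c \<le> - l" "k < l" "0 \<le> k" "0 < g" "g * (cmod c)\<^sup>2 \<le> 2 * (l - k)" "g * k \<le> 1"
 shows "cmod (1 + of_real g * c) \<le> 1 - k * g"
proof (rule power2_le_imp_le)
 have "(cmod (1 + of_real g * c))\<^sup>2 = 1 + 2 * g * Re c + g\<^sup>2 * (cmod c)\<^sup>2"
  unfolding cmod_power2 by (simp add: power2_eq_square algebra_simps)
 also have "\<dots> \<le> 1 + 2 * g * (- l) + g * (2 * (l - k))"
  using assms(4,5) mult_left_mono[OF assms(1), of g]
  by (intro add_mono) (auto simp: power2_eq_square mult.assoc)
 also have "\<dots> = (1 - k * g)\<^sup>2 - (k * g)\<^sup>2" by (simp add: power2_eq_square algebra_simps)
 also have "\<dots> \<le> (1 - k * g)\<^sup>2" by simp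
 finally show "(cmod (1 + of_real g * c))\<^sup>2 \<le> (1 - k * g)\<^sup>2" .
 show "0 \<le> 1 - k * g" using assms(6) by (simp add: mult.commute)
qed

text \<open>A norm equivalent to the Euclidean one in which explicit Euler steps along
  \<open>T\<close> contract at rate \<kappa>, with one threshold \<open>g0\<close> for all vectors,
  since the step sizes of the algorithm vary with time.\<close>

definition adapted_norm :: "(real ^ 'd::finite \<Rightarrow> real ^ 'd) \<Rightarrow> real \<Rightarrow> (real ^ 'd \<Rightarrow> real) \<Rightarrow> bool" where
 "adapted_norm T \<kappa> N \<longleftrightarrow>
   (\<forall>x y. N (x + y) \<le> N x + N y) \<and> (\<forall>a x. N (a *\<^sub>R x) = \<bar>a\<bar> * N x) \<and>
   (\<forall>x. norm x \<le> N x) \<and> (\<exists>C\<ge>1. \<forall>x. N x \<le> C * norm x) \<and>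
   (\<exists>g0>0. \<forall>g. 0 < g \<longrightarrow> g \<le> g0 \<longrightarrow> (\<forall>x. N (x + g *\<^sub>R T x) \<le> (1 - \<kappa> * g) * N x))"

lemma clinear_complexify:
 assumes "linear (T :: real ^ 'd::finite \<Rightarrow> real ^ 'd)"
 shows "clinear_map (complexify T)"
proof -
 have eq: "(\<chi> j. Re (c * (x $ j))) = Re c *\<^sub>R (\<chi> j. Re (x $ j)) - Im c *\<^sub>R (\<chi> j. Im (x $ j))"
  "(\<chi> j. Im (c * (x $ j))) = Re c *\<^sub>R (\<chi> j. Im (x $ j)) + Im c *\<^sub>R (\<chi> j. Re (x $ j))" for c and x :: "complex ^ 'd"
  by (auto simp: vec_eq_iff)
 have eq2: "(\<chi> j. Re ((x + y) $ j)) = (\<chi> j. Re (x $ j)) + (\<chi> j. Re (y $ j))"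
  "(\<chi> j. Im ((x + y) $ j)) = (\<chi> j. Im (x $ j)) + (\<chi> j. Im (y $ j))" for x y :: "complex ^ 'd"
  by (auto simp: vec_eq_iff)
 show ?thesis
  unfolding clinear_map_def
 proof (intro conjI allI)
  fix x y :: "complex ^ 'd" and c
  show "complexify T (x + y) = complexify T x + complexify T y"
   unfolding complexify_def eq2 linear_add[OF assms] by (simp add: vec_eq_iff complex_eq_iff)
  show "complexify T (c *s x) = c *s complexify T x"
   unfolding complexify_def vector_smult_component eq linear_add[OF assms] linear_diff[OF assms] linear_cmul[OF assms]
   by (simp add: vec_eq_iff complex_eq_iff)
 qed
qed

lemma adapted_norm_exists:
 fixes T :: "real ^ 'd::finite \<Rightarrow> real ^ 'd"
 assumes lin: "linear T" and eig: "\<And>c z. z \<noteq> 0 \<Longrightarrow> complexify T z = c *s z \<Longrightarrow> Re c \<le> - l"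
  and k: "0 \<le> K" "K < l"
 shows "\<exists>N. adapted_norm T K N"
proof -
 let ?T = "complexify T"
 note T = clinear_complexify[OF lin]
 obtain cs0 where "\<And>z. foldr (shift_by ?T) cs0 z = 0" using annihilating_product[OF T] by blast
 with annihilating_product_reduce[OF T, of cs0] obtain cs where
  cs: "\<And>c. c \<in> set cs \<Longrightarrow> \<exists>z. z \<noteq> 0 \<and> ?T z = c *s z" "\<And>z. foldr (shift_by ?T) cs z = 0" by blast
 have Re: "c \<in> set cs \<Longrightarrow> Re c \<le> - l" for c using cs(1) eig by blast
 \<comment> \<open>An intermediate rate: the gap \<open>l - k'\<close> absorbs the quadratic term of
   |1 + g c|^2, and the gap \<open>k' - K\<close> absorbs the nilpotent part.\<close>
 define k' where "k' = (K + l) / 2"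
 have k': "K < k'" "k' < l" "0 < k'" using k by (auto simp: k'_def)
 \<comment> \<open>With this weight the leak g / h of an Euler step equals g * (k' - K), exactly the
   rate that may be given up.\<close>
 define h where "h = 1 / (k' - K)"
 have h: "h > 0" using k' by (simp add: h_def)
 define S where "S = (\<Sum>c\<leftarrow>cs. (cmod c)\<^sup>2)"
 have S: "c \<in> set cs \<Longrightarrow> (cmod c)\<^sup>2 \<le> S" for c
  unfolding S_def by (rule member_le_sum_list) auto
 have S0: "S \<ge> 0" unfolding S_def by (intro sum_list_nonneg) auto
 define g0 where "g0 = min (1 / k') (2 * (l - k') / (S + 1))"
 have g0: "g0 > 0" using k' S0 by (auto simp: g0_def)
 have step: "flag_norm ?T h cs (z + of_real g *s ?T z) \<le> (1 - K * g) * flag_norm ?T h cs z"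
  if g: "0 < g" "g \<le> g0" for g z
 proof -
  have gk: "g * k' \<le> 1" using g k' by (auto simp: g0_def field_simps)
  have gS: "g * (S + 1) \<le> 2 * (l - k')" using g S0 by (auto simp: g0_def field_simps)
  have "cmod (1 + of_real g * c) \<le> 1 - k' * g" if "c \<in> set cs" for c
  proof (rule cmod_one_plus_small)
   have "g * (cmod c)\<^sup>2 \<le> g * (S + 1)" using S[OF that] g by (intro mult_left_mono) auto
   then show "g * (cmod c)\<^sup>2 \<le> 2 * (l - k')" using gS by simp
  qed (use Re[OF that] k' g gk in auto)
  from flag_norm_step[OF T h _ this cs(2)[of z]] g
  have "flag_norm ?T h cs (z + of_real g *s ?T z)
    \<le> (1 - k' * g) * flag_norm ?T h cs z + g / h * (flag_norm ?T h cs z - norm z)" by auto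
  also have "\<dots> \<le> (1 - k' * g) * flag_norm ?T h cs z + g / h * flag_norm ?T h cs z"
   using g h by (intro add_left_mono mult_left_mono) auto
  also have "\<dots> = (1 - K * g) * flag_norm ?T h cs z" by (simp add: h_def algebra_simps)
  finally show ?thesis .
 qed
 define R :: "real ^ 'd \<Rightarrow> complex ^ 'd" where "R x = (\<chi> i. complex_of_real (x $ i))" for x
 have R1: "R (x + y) = R x + R y" "R (a *\<^sub>R x) = of_real a *s R x" for x y a by (auto simp: R_def vec_eq_iff)
 have R2: "norm (R x) = norm x" for x by (simp add: R_def norm_vec_def)
 have R3: "?T (R x) = R (T x)" for x
 proof -
  have *: "(\<chi> j. Re (R x $ j)) = x" "(\<chi> j. Im (R x $ j)) = 0" by (auto simp: R_def vec_eq_iff)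
  show ?thesis unfolding complexify_def * linear_0[OF lin] by (simp add: R_def vec_eq_iff complex_eq_iff)
 qed
 interpret T: bounded_linear "complexify T"
 proof (rule linear_conv_bounded_linear[THEN iffD1], rule linearI)
  show "?T (r *\<^sub>R x) = r *\<^sub>R ?T x" for r x
   using clinear_map_scale[OF T, of "of_real r" x] by (metis scaleR_conv_of_real vec_eq_iff vector_scaleR_component vector_smult_component)
 qed (rule clinear_map_add[OF T])
 obtain B where B: "0 \<le> B" "\<And>z. norm (?T z) \<le> norm z * B" using T.nonneg_bounded by blast
 then obtain C where C: "C \<ge> 1" "\<And>z. flag_norm ?T h cs z \<le> C * norm z"
  using flag_norm_le[OF T, of B h cs] h by (metis less_imp_le mult.commute)
 have "adapted_norm T K (\<lambda>x. flag_norm ?T h cs (R x))"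
  unfolding adapted_norm_def
 proof (intro conjI allI)
  show "flag_norm ?T h cs (R (x + y)) \<le> flag_norm ?T h cs (R x) + flag_norm ?T h cs (R y)" for x y
   unfolding R1 using flag_norm_triangle[OF T] h by simp
  show "flag_norm ?T h cs (R (a *\<^sub>R x)) = \<bar>a\<bar> * flag_norm ?T h cs (R x)" for a x
   unfolding R1 by (simp add: flag_norm_scale[OF T])
  show "norm x \<le> flag_norm ?T h cs (R x)" for x
   using flag_norm_ge[of h "R x"] h by (simp add: R2)
  show "\<exists>C\<ge>1. \<forall>x. flag_norm ?T h cs (R x) \<le> C * norm x" using C by (metis R2)
  show "\<exists>g0>0. \<forall>g>0. g \<le> g0 \<longrightarrow> (\<forall>x. flag_norm ?T h cs (R (x + g *\<^sub>R T x)) \<le> (1 - K * g) * flag_norm ?T h cs (R x))"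
   using step g0 unfolding R1 R3[symmetric] by blast
 qed
 then show ?thesis by blast
qed

lemma complexify_matrix:
 "complexify ((*v) J) z = (\<chi> i j. complex_of_real (J $ i $ j)) *v z"
 by (auto simp: complexify_def matrix_vector_mult_def vec_eq_iff complex_eq_iff)

lemma eigenvector_iff_det:
 fixes A :: "complex ^ 'n::finite ^ 'n"
 shows "(\<exists>z. z \<noteq> 0 \<and> A *v z = c *s z) \<longleftrightarrow> det (A - mat c) = 0"
proof -
 have mc: "mat c *v z = c *s z" for z :: "complex ^ 'n"
  by (simp add: matrix_vector_mult_def mat_def vec_eq_iff if_distrib[of "\<lambda>t. t * _"] cong: if_cong)
 have "(A - mat c) *v z = A *v z - c *s z" for z
  by (simp add: matrix_vector_mult_diff_rdistrib mc)
 then have "(\<exists>z. z \<noteq> 0 \<and> A *v z = c *s z) \<longleftrightarrow> \<not> (\<forall>z. (A - mat c) *v z = 0 \<longrightarrow> z = 0)" by auto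
 also have "\<dots> \<longleftrightarrow> \<not> invertible (A - mat c)"
  unfolding invertible_left_inverse matrix_left_invertible_ker ..
 also have "\<dots> \<longleftrightarrow> det (A - mat c) = 0" by (simp add: invertible_det_nz)
 finally show ?thesis .
qed

text \<open>A determinant argument passes the spectral bound to the transpose. Both versions occur
  later: the remainder evolves under the drift matrix, the argument of a characteristic function
  under its transpose.\<close>

lemma eigenvalue_transpose:
 fixes J :: "real ^ 'n::finite ^ 'n"
 assumes "complexify ((*v) (transpose J)) z = c *s z" "z \<noteq> 0"
 shows "\<exists>z. z \<noteq> 0 \<and> complexify ((*v) J) z = c *s z"
proof -
 let ?J = "\<chi> i j. complex_of_real (J $ i $ j)"
 have "transpose (?J - mat c) = (\<chi> i j. complex_of_real (transpose J $ i $ j)) - mat c"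
  by (auto simp: vec_eq_iff transpose_def mat_def)
 then have "det (?J - mat c) = det ((\<chi> i j. complex_of_real (transpose J $ i $ j)) - mat c)"
  using det_transpose[of "?J - mat c"] by simp
 also have "\<dots> = 0" using assms unfolding eigenvector_iff_det[symmetric] complexify_matrix by blast
 finally show ?thesis unfolding eigenvector_iff_det[symmetric] complexify_matrix .
qed

lemma adapted_normD:
 assumes "adapted_norm T \<kappa> N"
 shows adapted_norm_triangle: "N (x + y) \<le> N x + N y"
  and adapted_norm_scale: "N (a *\<^sub>R x) = \<bar>a\<bar> * N x"
  and adapted_norm_ge: "norm x \<le> N x"
 using assms by (auto simp: adapted_norm_def)

lemma adapted_norm_nonneg: "adapted_norm T \<kappa> N \<Longrightarrow> 0 \<le> N x"
 using adapted_norm_ge norm_ge_zero order_trans by blast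

lemma adapted_norm_le:
 assumes "adapted_norm T \<kappa> N" obtains C where "C \<ge> 1" "\<And>x. N x \<le> C * norm x"
 using assms that unfolding adapted_norm_def by blast

lemma adapted_norm_contract:
 assumes "adapted_norm T \<kappa> N"
 obtains g0 where "g0 > 0" "\<And>g x. 0 < g \<Longrightarrow> g \<le> g0 \<Longrightarrow> N (x + g *\<^sub>R T x) \<le> (1 - \<kappa> * g) * N x"
 using assms that unfolding adapted_norm_def by blast

text \<open>An Euler step would expand such an eigenvector, against the contraction. This later
  excludes a nonzero vector of column sums of the Lyapunov solution.\<close>

lemma adapted_norm_eigenvector:
 assumes N: "adapted_norm T k N" and "k \<ge> 0" and "T x = b *\<^sub>R x" "b > 0"
 shows "x = 0"
proof -
 obtain g where g: "g > 0" "\<And>h x. 0 < h \<Longrightarrow> h \<le> g \<Longrightarrow> N (x + h *\<^sub>R T x) \<le> (1 - k * h) * N x"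
  using adapted_norm_contract[OF N] by blast
 have "x + g *\<^sub>R T x = (1 + g * b) *\<^sub>R x" by (simp add: assms(3) algebra_simps)
 then have "(1 + g * b) * N x \<le> (1 - k * g) * N x"
  using g(1) g(2)[of g x] assms(4) by (simp add: adapted_norm_scale[OF N])
 then have "(g * b + k * g) * N x \<le> 0" by (simp add: algebra_simps)
 moreover have "g * b + k * g > 0" using g assms(2,4) by (simp add: add_pos_nonneg)
 ultimately have "N x \<le> 0" using mult_pos_pos[of "g * b + k * g" "N x"] by linarith
 then have "norm x \<le> 0" using adapted_norm_ge[OF N, of x] by linarith
 then show ?thesis by simp
qed

text \<open>The equation says that the bilinear form b(x, y) = x \<bullet> V y has no first-order
  change when both arguments make an Euler step along T, the transpose of J. So b(x, y) equals b at
  the moved points minus g^2 b(T x, T y). Any bound of b by m N(x) N(y) thereby improves to m q with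
  q < 1, and iteration forces b = 0.\<close>

lemma lyapunov_injective:
 fixes J V :: "real ^ 'n::finite ^ 'n"
 assumes N: "adapted_norm ((*v) (transpose J)) k N" and k: "k > 0"
  and eq: "J ** V + V ** transpose J = 0"
 shows "V = 0"
proof -
 define b where "b x y = x \<bullet> (V *v y)" for x y
 let ?T = "(*v) (transpose J)"
 have bl: "b (x + x') y = b x y + b x' y" "b x (y + y') = b x y + b x y'"
   "b (a *\<^sub>R x) y = a * b x y" "b x (a *\<^sub>R y) = a * b x y" for x x' y y' a
  by (auto simp: b_def inner_add_left matrix_vector_right_distrib inner_add_right matrix_vector_mult_scaleR)
 have b0: "b (?T x) y + b x (?T y) = 0" for x y
 proof -
  have "b (?T x) y + b x (?T y) = x \<bullet> ((J ** V + V ** transpose J) *v y)"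
   unfolding b_def matrix_vector_mult_add_rdistrib inner_add_right matrix_vector_mul_assoc[symmetric]
   by (simp add: transpose_matrix_vector dot_lmul_matrix)
  then show ?thesis using eq by simp
 qed
 obtain C where C: "C \<ge> 1" "\<And>x. N x \<le> C * norm x" using adapted_norm_le[OF N] by blast
 obtain B where B: "B > 0" "\<And>x. norm (?T x) \<le> norm x * B"
  using bounded_linear.pos_bounded[OF matrix_vector_mul_bounded_linear] by blast
 have NT: "N (?T x) \<le> C * B * N x" for x
 proof -
  have "N (?T x) \<le> C * norm (?T x)" by (rule C)
  also have "\<dots> \<le> C * (norm x * B)" using C(1) by (intro mult_left_mono B) auto
  also have "\<dots> \<le> C * (N x * B)" using C B adapted_norm_ge[OF N] by (intro mult_left_mono mult_right_mono) auto
  finally show ?thesis by (simp add: mult_ac)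
 qed
 note N0 = adapted_norm_nonneg[OF N]
 obtain g0 where g0: "g0 > 0" "\<And>g x. 0 < g \<Longrightarrow> g \<le> g0 \<Longrightarrow> N (x + g *\<^sub>R ?T x) \<le> (1 - k * g) * N x"
  using adapted_norm_contract[OF N] by blast
 \<comment> \<open>The third entry makes the second-order terms g^2 (k^2 + (C B)^2) at most g k,
   half of the first-order gain; hence q \<le> 1 - g k.\<close>
 define g where "g = Min {g0, 1 / (2 * k), k / (k\<^sup>2 + (C * B)\<^sup>2)}"
 have pos: "k\<^sup>2 + (C * B)\<^sup>2 > 0" using k by (simp add: add_pos_nonneg)
 have g: "g > 0" "g \<le> g0" "g * k \<le> 1/2" "g * (k\<^sup>2 + (C * B)\<^sup>2) \<le> k"
 proof -
  show "g > 0" using g0 k pos by (simp add: g_def)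
  show "g \<le> g0" by (simp add: g_def)
  have "g \<le> 1 / (2 * k)" by (simp add: g_def)
  then show "g * k \<le> 1/2" using k by (simp add: field_simps)
  have "g \<le> k / (k\<^sup>2 + (C * B)\<^sup>2)" by (simp add: g_def)
  then show "g * (k\<^sup>2 + (C * B)\<^sup>2) \<le> k" using pos by (simp add: pos_le_divide_eq)
 qed
 define q where "q = (1 - k * g)\<^sup>2 + g\<^sup>2 * (C * B)\<^sup>2"
 have "q = 1 - 2 * k * g + g * (g * (k\<^sup>2 + (C * B)\<^sup>2))" by (simp add: q_def power2_eq_square algebra_simps)
 also have "\<dots> \<le> 1 - 2 * k * g + g * k" using g by (intro add_left_mono mult_left_mono) auto
 finally have "q \<le> 1 - g * k" by (simp add: mult.commute)
 then have q1: "q < 1" using mult_pos_pos[OF g(1) k] by linarith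
 have q0: "q \<ge> 0" by (simp add: q_def)
 have step: "\<bar>b x y\<bar> \<le> m * q * (N x * N y)" if m: "\<And>x y. \<bar>b x y\<bar> \<le> m * (N x * N y)" "m \<ge> 0" for m x y
 proof -
  have "b (x + g *\<^sub>R ?T x) (y + g *\<^sub>R ?T y) = b x y + g * (b (?T x) y + b x (?T y)) + g\<^sup>2 * b (?T x) (?T y)"
   by (simp add: bl power2_eq_square algebra_simps)
  then have "b x y = b (x + g *\<^sub>R ?T x) (y + g *\<^sub>R ?T y) - g\<^sup>2 * b (?T x) (?T y)" unfolding b0 by simp
  then have "\<bar>b x y\<bar> \<le> \<bar>b (x + g *\<^sub>R ?T x) (y + g *\<^sub>R ?T y)\<bar> + \<bar>g\<^sup>2 * b (?T x) (?T y)\<bar>"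
   by linarith
  also have "\<bar>g\<^sup>2 * b (?T x) (?T y)\<bar> = g\<^sup>2 * \<bar>b (?T x) (?T y)\<bar>" by (simp add: abs_mult)
  also have "\<bar>b (x + g *\<^sub>R ?T x) (y + g *\<^sub>R ?T y)\<bar> \<le> m * (((1 - k * g) * N x) * ((1 - k * g) * N y))"
  proof -
   have "0 \<le> (1 - k * g) * N x" using N0 g(3) by (simp add: mult.commute)
   then show ?thesis
    by (intro order_trans[OF m(1)] mult_left_mono mult_mono g0(2) g(1,2) N0 m(2))
  qed
  also have "\<bar>b (?T x) (?T y)\<bar> \<le> m * ((C * B * N x) * (C * B * N y))"
   using NT N0 m(2) C B by (intro order_trans[OF m(1)] mult_left_mono mult_mono) auto
  finally have "\<bar>b x y\<bar> \<le> m * ((1 - k * g) * N x * ((1 - k * g) * N y)) + g\<^sup>2 * (m * (C * B * N x * (C * B * N y)))"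
   by (simp add: mult_left_mono)
  also have "\<dots> = m * q * (N x * N y)" by (simp add: q_def power2_eq_square algebra_simps)
  finally show ?thesis .
 qed
 obtain K where K: "K > 0" "\<And>x. norm (V *v x) \<le> norm x * K"
  using bounded_linear.pos_bounded[OF matrix_vector_mul_bounded_linear] by blast
 have init: "\<bar>b x y\<bar> \<le> K * (N x * N y)" for x y
 proof -
  have "\<bar>b x y\<bar> \<le> norm x * norm (V *v y)" unfolding b_def by (rule Cauchy_Schwarz_ineq2)
  also have "\<dots> \<le> norm x * (norm y * K)" using K by (intro mult_left_mono) auto
  also have "\<dots> \<le> N x * (N y * K)" using K adapted_norm_ge[OF N] N0 by (intro mult_mono) auto
  finally show ?thesis by (simp add: mult_ac)
 qed
 have iter: "\<bar>b x y\<bar> \<le> K * q ^ n * (N x * N y)" for n x y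
 proof (induction n arbitrary: x y)
  case (Suc n)
  from step[OF this] K q0 show ?case by (simp add: mult_ac)
 qed (use init in simp)
 have bz: "b x y = 0" for x y
 proof -
  have "(\<lambda>n. K * q ^ n * (N x * N y)) \<longlonglongrightarrow> K * 0 * (N x * N y)"
   by (intro tendsto_intros LIMSEQ_power_zero) (use q0 q1 in auto)
  then have "\<bar>b x y\<bar> \<le> 0" using iter by (intro LIMSEQ_le_const) auto
  then show ?thesis by simp
 qed
 have "V *v y = 0" for y using bz[of "V *v y" y] by (simp add: b_def)
 then show ?thesis by (simp add: matrix_eq)
qed

text \<open>The Lyapunov operator is linear on the finite-dimensional space of matrices, so its
  injectivity also yields existence.\<close>

lemma lyapunov_equation_unique_solution:
 fixes J U :: "real ^ 'n::finite ^ 'n"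
 assumes N: "adapted_norm ((*v) (transpose J)) \<kappa> N" and \<kappa>: "\<kappa> > 0"
 shows "\<exists>!V. U + J ** V + V ** transpose J = 0"
proof -
 define \<Lambda> where "\<Lambda> V = J ** V + V ** transpose J" for V
 have lin: "linear \<Lambda>"
 proof (rule linearI)
  show "\<Lambda> (x + y) = \<Lambda> x + \<Lambda> y" for x y
   by (simp add: \<Lambda>_def matrix_matrix_mult_def vec_eq_iff sum.distrib distrib_left distrib_right)
  show "\<Lambda> (r *\<^sub>R x) = r *\<^sub>R \<Lambda> x" for r x
   by (simp add: \<Lambda>_def matrix_matrix_mult_def vec_eq_iff distrib_left sum_distrib_left mult_ac)
 qed
 have inj: "inj \<Lambda>"
 proof (subst linear_injective_0[OF lin], intro allI impI)
  fix V assume "\<Lambda> V = 0"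
  then show "V = 0" unfolding \<Lambda>_def by (rule lyapunov_injective[OF N \<kappa>])
 qed
 then have "surj \<Lambda>" using linear_injective_imp_surjective[OF lin] by blast
 from surjD[OF this, of "- U"] obtain V where "\<Lambda> V = - U" by (blast dest: sym)
 have assoc: "U + J ** W + W ** transpose J = U + \<Lambda> W" for W by (simp only: \<Lambda>_def add.assoc)
 have "U + J ** V + V ** transpose J = 0" unfolding assoc \<open>\<Lambda> V = - U\<close> by (rule add.right_inverse)
 moreover have "V' = V" if "U + J ** V' + V' ** transpose J = 0" for V'
 proof -
  have "U + \<Lambda> V' = 0" using that unfolding assoc .
  then have "\<Lambda> V' = - U" by (rule add_eq_0_iff[THEN iffD1])
  then have "\<Lambda> V' = \<Lambda> V" using \<open>\<Lambda> V = - U\<close> by (rule trans[OF _ sym])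
  then show ?thesis by (rule injD[OF inj])
 qed
 ultimately show ?thesis by blast
qed

section \<open>The killed chain\<close>

lemma sum_option_UNIV: "(\<Sum>s\<in>UNIV. f s) = f None + (\<Sum>x\<in>UNIV. f (Some (x :: 'd::finite)))"
 by (simp add: UNIV_option_conv sum.reindex)

lemma vector_matrix_component: "(v v* B) $ j = (\<Sum>i\<in>UNIV. v $ i * B $ i $ j)"
 for v :: "real ^ 'm::finite"
 by (simp add: vector_matrix_mult_def mult.commute)

lemma matrix_vector_component: "(B *v x) $ i = (\<Sum>j\<in>UNIV. B $ i $ j * x $ j)"
 by (simp add: matrix_vector_mult_def)

lemma vector_matrix_scaleR: "(c *\<^sub>R v) v* B = c *\<^sub>R (v v* B)"
 for v :: "real ^ 'm::finite"
 by (simp add: vec_eq_iff vector_matrix_component sum_distrib_left mult.assoc)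

locale qsd_chain =
 fixes P :: "real ^ ('d::finite option) ^ ('d option)" and \<theta>s :: "real ^ 'd"
 assumes chain: "absorbed_chain P" and qsd: "quasi_stationary P \<theta>s"
begin

definition P0 :: "real ^ 'd ^ 'd" where "P0 = (\<chi> x y. P $ Some x $ Some y)"
definition q0 :: "real ^ 'd" where "q0 = (\<chi> x. P $ Some x $ None)"

lemma P0_nonneg: "0 \<le> P0 $ x $ y" and q0_nonneg: "0 \<le> q0 $ x"
 using chain by (auto simp: absorbed_chain_def transition_matrix_def P0_def q0_def)

lemma P0_row_sum: "(\<Sum>y\<in>UNIV. P0 $ x $ y) = 1 - q0 $ x"
proof -
 have "(\<Sum>s\<in>UNIV. P $ Some x $ s) = 1" using chain by (auto simp: absorbed_chain_def transition_matrix_def)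
 then show ?thesis unfolding sum_option_UNIV by (simp add: P0_def q0_def)
qed

lemma absorbing: "P $ None $ Some y = 0"
proof -
 have "P $ None $ None + (\<Sum>x\<in>UNIV. P $ None $ Some x) = 1" "P $ None $ None = 1" "\<And>x. 0 \<le> P $ None $ Some x"
  using chain unfolding sum_option_UNIV[symmetric] by (auto simp: absorbed_chain_def transition_matrix_def)
 then have "(\<Sum>x\<in>UNIV. P $ None $ Some x) = 0" by linarith
 then show ?thesis using \<open>\<And>x. 0 \<le> P $ None $ Some x\<close> by (simp add: sum_nonneg_eq_0_iff)
qed

lemma P_step_component: "(u v* P) $ Some y = (\<Sum>x\<in>UNIV. u $ Some x * P0 $ x $ y)"
 by (simp add: vector_matrix_component sum_option_UNIV absorbing P0_def)

text \<open>Irreducibility in the form used throughout: the laws of the chain started in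
  \<open>S\<close> put no mass on the live states outside \<open>S\<close>, yet every live state is
  charged at some time.\<close>

lemma irreducible_closed:
 assumes closed: "\<And>x y. x \<in> S \<Longrightarrow> 0 < P0 $ x $ y \<Longrightarrow> y \<in> S" and "S \<noteq> {}"
 shows "S = UNIV"
proof -
 obtain x where x: "x \<in> S" using assms(2) by blast
 let ?u = "chain_law P (axis (Some x) 1)"
 have Suc: "?u (Suc n) = ?u n v* P" for n by (simp add: chain_law_def)
 have *: "0 \<le> ?u n $ Some y \<and> (0 < ?u n $ Some y \<longrightarrow> y \<in> S)" for n y
 proof (induction n arbitrary: y)
  case 0
  then show ?case using x by (auto simp: chain_law_def axis_def)
 next
  case (Suc n)
  have nn: "0 \<le> ?u n $ Some z * P0 $ z $ y" for z using Suc P0_nonneg by simp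
  moreover have "y \<in> S" if "0 < ?u (Suc n) $ Some y"
  proof -
   have "\<not> (\<forall>z. ?u n $ Some z * P0 $ z $ y = 0)"
   proof
    assume *: "\<forall>z. ?u n $ Some z * P0 $ z $ y = 0"
    show False using that unfolding \<open>?u (Suc n) = ?u n v* P\<close> P_step_component * [rule_format] by simp
   qed
   then obtain z where "?u n $ Some z * P0 $ z $ y \<noteq> 0" by blast
   then have "0 < P0 $ z $ y" "0 < ?u n $ Some z"
    using Suc[of z] P0_nonneg[of z y] by (auto simp: less_le)
   then show ?thesis using Suc[of z] closed by blast
  qed
  ultimately show ?case unfolding \<open>?u (Suc n) = ?u n v* P\<close> P_step_component by (auto intro: sum_nonneg)
 qed
 have "y \<in> S" for y
 proof -
  obtain n where "0 < ?u n $ Some y" using chain unfolding absorbed_chain_def by blast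
  then show ?thesis using * by blast
 qed
 then show ?thesis by blast
qed

lemma theta_nonneg: "0 \<le> \<theta>s $ x" and theta_sum: "(\<Sum>x\<in>UNIV. \<theta>s $ x) = 1" and theta_simplex: "\<theta>s \<in> prob_simplex"
 using qsd by (auto simp: quasi_stationary_def prob_simplex_def)

text \<open>The probability of absorption in one step under the quasi-stationary
  distribution.\<close>

definition cs :: real where "cs = \<theta>s \<bullet> q0"

lemma theta_P0: "\<theta>s v* P0 = (1 - cs) *\<^sub>R \<theta>s" and cs_less_1: "cs < 1"
proof -
 have step: "chain_law P (extend0 \<theta>s) 1 $ Some x = (\<theta>s v* P0) $ x" for x
 proof -
  have "chain_law P (extend0 \<theta>s) 1 = extend0 \<theta>s v* P" by (simp add: chain_law_def)
  then have "chain_law P (extend0 \<theta>s) 1 $ Some x = (extend0 \<theta>s v* P) $ Some x" by (rule arg_cong)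
  then show ?thesis unfolding P_step_component unfolding vector_matrix_component by (simp add: extend0_def)
 qed
 have "(\<Sum>y\<in>UNIV. (\<theta>s v* P0) $ y) = (\<Sum>x\<in>UNIV. \<theta>s $ x * (\<Sum>y\<in>UNIV. P0 $ x $ y))"
  unfolding vector_matrix_component sum_distrib_left by (rule sum.swap)
 also have "\<dots> = 1 - cs"
  by (simp add: P0_row_sum cs_def inner_vec_def algebra_simps sum_subtractf theta_sum)
 finally have sum: "(\<Sum>y\<in>UNIV. (\<theta>s v* P0) $ y) = 1 - cs" .
 have "chain_law P (extend0 \<theta>s) 1 $ Some x / (\<Sum>y\<in>UNIV. chain_law P (extend0 \<theta>s) 1 $ Some y) = \<theta>s $ x" for x
  using qsd unfolding quasi_stationary_def by blast
 then have eq: "(\<theta>s v* P0) $ x / (1 - cs) = \<theta>s $ x" for x unfolding step sum .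
 \<comment> \<open>Division by zero yields 0, so a vanishing survival probability would turn the
   quasi-stationarity condition into \<theta>s = 0.\<close>
 have "1 - cs \<noteq> 0"
 proof
  assume "1 - cs = 0"
  then have "\<theta>s $ x = 0" for x using eq[of x] by simp
  then show False using theta_sum by simp
 qed
 moreover have "0 \<le> 1 - cs" unfolding sum[symmetric] vector_matrix_component
  by (auto intro!: sum_nonneg mult_nonneg_nonneg P0_nonneg theta_nonneg)
 ultimately show "cs < 1" by simp
 show "\<theta>s v* P0 = (1 - cs) *\<^sub>R \<theta>s"
  using eq \<open>1 - cs \<noteq> 0\<close> by (simp add: vec_eq_iff field_simps)
qed

lemma theta_pos: "0 < \<theta>s $ x"
proof -
 have "{x. 0 < \<theta>s $ x} = UNIV"
 proof (rule irreducible_closed)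
  fix x y assume xy: "x \<in> {x. 0 < \<theta>s $ x}" "0 < P0 $ x $ y"
  have "0 < \<theta>s $ x * P0 $ x $ y" using xy by simp
  also have "\<dots> \<le> (\<Sum>x\<in>UNIV. \<theta>s $ x * P0 $ x $ y)"
   by (rule member_le_sum) (auto intro!: mult_nonneg_nonneg P0_nonneg theta_nonneg)
  also have "\<dots> = (1 - cs) * \<theta>s $ y"
   using arg_cong[OF theta_P0, of "\<lambda>v. v $ y"] by (simp add: vector_matrix_component)
  finally show "y \<in> {x. 0 < \<theta>s $ x}" using cs_less_1 by (simp add: zero_less_mult_iff)
 next
  show "{x. 0 < \<theta>s $ x} \<noteq> {}"
  proof
   assume "{x. 0 < \<theta>s $ x} = {}"
   then have "\<theta>s $ x = 0" for x using theta_nonneg[of x] by (auto simp: less_le)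
   then show False using theta_sum by simp
  qed
 qed
 then show ?thesis by auto
qed

lemma theta_nonzero: "\<theta>s $ x \<noteq> 0"
 using theta_pos[of x] by simp

lemma exists_exit: "\<exists>z. 0 < q0 $ z"
 using chain by (auto simp: absorbed_chain_def q0_def)

lemma cs_pos: "0 < cs"
proof -
 obtain z where z: "0 < q0 $ z" using exists_exit by blast
 then have "0 < \<theta>s $ z * q0 $ z" using theta_pos by simp
 also have "\<dots> \<le> cs" unfolding cs_def inner_vec_def inner_real_def
  by (rule member_le_sum) (auto intro!: mult_nonneg_nonneg q0_nonneg theta_nonneg)
 finally show ?thesis .
qed

text \<open>A maximum principle. Pairing with \<theta>s, a left eigenvector of \<open>P0\<close>
  with eigenvalue 1 - cs < 1, gives cs * (\<theta>s \<bullet> x) \<le> 0, and \<theta>s is strictly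
  positive. It is applied to the modulus of a kernel vector and to the negative part of a
  solution.\<close>

lemma subharmonic_zero:
 assumes "\<And>i. 0 \<le> x $ i" "\<And>i. x $ i \<le> (P0 *v x) $ i"
 shows "x = 0"
proof -
 have "\<theta>s \<bullet> x \<le> \<theta>s \<bullet> (P0 *v x)" unfolding inner_vec_def inner_real_def
  by (intro sum_mono mult_left_mono assms theta_nonneg)
 also have "\<dots> = (1 - cs) * (\<theta>s \<bullet> x)" unfolding dot_lmul_matrix[symmetric] theta_P0 by simp
 finally have "cs * (\<theta>s \<bullet> x) \<le> 0" by (simp add: algebra_simps)
 then have "\<theta>s \<bullet> x \<le> 0" using cs_pos by (simp add: mult_le_0_iff)
 moreover have nn: "0 \<le> \<theta>s $ i * x $ i" for i using theta_nonneg assms(1) by simp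
 ultimately have "(\<Sum>i\<in>UNIV. \<theta>s $ i * x $ i) = 0"
  unfolding inner_vec_def inner_real_def by (intro antisym sum_nonneg) auto
 then have "\<theta>s $ i * x $ i = 0" for i using nn by (simp add: sum_nonneg_eq_0_iff)
 then have "x $ i = 0" for i using theta_nonzero[of i] unfolding mult_eq_0_iff by blast
 then show ?thesis by (simp add: vec_eq_iff)
qed

text \<open>The Green kernel of the killed chain, that is the sum of all powers of
  \<open>P0\<close>.\<close>

definition A :: "real ^ 'd ^ 'd" where "A = matrix_inv (mat 1 - P0)"

lemma I_minus_P0_inverse: "A ** (mat 1 - P0) = mat 1" "(mat 1 - P0) ** A = mat 1"
proof -
 have "x = 0" if "(mat 1 - P0) *v x = 0" for x
 proof -
  have eq: "x $ i = (P0 *v x) $ i" for i using that by (simp add: matrix_vector_mult_diff_rdistrib vec_eq_iff)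
  define y :: "real ^ 'd" where "y = (\<chi> i. \<bar>x $ i\<bar>)"
  have "y = 0"
  proof (rule subharmonic_zero)
   fix i
   show "0 \<le> y $ i" by (simp add: y_def)
   have "\<bar>(P0 *v x) $ i\<bar> \<le> (\<Sum>j\<in>UNIV. \<bar>P0 $ i $ j * x $ j\<bar>)"
    unfolding matrix_vector_mult_def by (simp add: sum_abs)
   also have "\<dots> = (P0 *v y) $ i"
    unfolding matrix_vector_mult_def y_def by (simp add: abs_mult abs_of_nonneg[OF P0_nonneg])
   finally show "y $ i \<le> (P0 *v y) $ i" unfolding eq[symmetric] by (simp add: y_def)
  qed
  then show ?thesis by (simp add: y_def vec_eq_iff)
 qed
 then have "invertible (mat 1 - P0)" unfolding invertible_left_inverse matrix_left_invertible_ker by blast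
 then have "\<exists>B. (mat 1 - P0) ** B = mat 1 \<and> B ** (mat 1 - P0) = mat 1" unfolding invertible_def .
 from someI_ex[OF this] show "A ** (mat 1 - P0) = mat 1" "(mat 1 - P0) ** A = mat 1"
  unfolding A_def matrix_inv_def by auto
qed

lemma A_eq: "A *v x = P0 *v (A *v x) + x"
proof -
 have "(mat 1 - P0) *v (A *v x) = x" by (simp add: matrix_vector_mul_assoc I_minus_P0_inverse)
 then show ?thesis by (simp add: matrix_vector_mult_diff_rdistrib algebra_simps)
qed

lemma A_nonneg_vec:
 assumes "\<And>i. 0 \<le> x $ i" shows "0 \<le> (A *v x) $ i"
proof -
 define y where "y = A *v x"
 define z :: "real ^ 'd" where "z = (\<chi> i. max 0 (- (y $ i)))"
 have "z = 0"
 proof (rule subharmonic_zero)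
  fix i
  show "0 \<le> z $ i" by (simp add: z_def)
  have "0 \<le> (P0 *v z) $ i" unfolding matrix_vector_mult_def z_def
   by (auto intro!: sum_nonneg mult_nonneg_nonneg P0_nonneg)
  moreover have "- (y $ i) \<le> (P0 *v z) $ i"
  proof -
   have "y $ i = (P0 *v y) $ i + x $ i" unfolding y_def by (subst A_eq) simp
   moreover have "- ((P0 *v y) $ i) \<le> (P0 *v z) $ i"
    unfolding matrix_vector_component sum_negf[symmetric]
   proof (rule sum_mono)
    fix j
    have "P0 $ i $ j * (- (y $ j)) \<le> P0 $ i $ j * z $ j"
     by (rule mult_left_mono[OF _ P0_nonneg]) (simp add: z_def)
    then show "- (P0 $ i $ j * y $ j) \<le> P0 $ i $ j * z $ j" by simp
   qed
   ultimately show ?thesis using assms[of i] by linarith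
  qed
  ultimately show "z $ i \<le> (P0 *v z) $ i" by (simp add: z_def)
 qed
 then have "z $ i = 0" by simp
 then show ?thesis by (simp add: z_def y_def max_def split: if_splits)
qed

text \<open>The zeros of a column \<open>j\<close> of the Green kernel form a set closed under
  \<open>P0\<close>, so they would be all states if there were any; but the diagonal entry is at
  least 1.\<close>

lemma A_pos: "0 < A $ i $ j"
proof -
 define x where "x = A *v axis j 1"
 have xA: "x $ i = A $ i $ j" for i
  by (simp add: x_def matrix_vector_mult_basis column_def)
 have nn: "0 \<le> x $ i" for i unfolding x_def by (rule A_nonneg_vec) (simp add: axis_def)
 have eq: "x $ i = (P0 *v x) $ i + axis j 1 $ i" for i unfolding x_def by (subst A_eq) simp
 have Pn: "0 \<le> (P0 *v x) $ i" for i unfolding matrix_vector_mult_def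
  by (auto intro!: sum_nonneg mult_nonneg_nonneg P0_nonneg nn)
 have "{i. x $ i = 0} = {}"
 proof (rule ccontr)
  assume ne: "{i. x $ i = 0} \<noteq> {}"
  have "{i. x $ i = 0} = UNIV"
  proof (rule irreducible_closed[OF _ ne])
   fix k l assume kl: "k \<in> {i. x $ i = 0}" "0 < P0 $ k $ l"
   have "0 \<le> axis j (1::real) $ k" by (simp add: axis_def)
   then have "(P0 *v x) $ k = 0" using eq[of k] kl(1) Pn[of k] by simp
   then have "P0 $ k $ l * x $ l = 0" unfolding matrix_vector_mult_def
    by (simp add: sum_nonneg_eq_0_iff P0_nonneg nn)
   then show "l \<in> {i. x $ i = 0}" using kl(2) by simp
  qed
  then have "x $ j = 0" by blast
  then show False using eq[of j] Pn[of j] by (simp add: axis_def)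
 qed
 then have "x $ i \<noteq> 0" by blast
 then show ?thesis using nn[of i] by (simp add: xA)
qed

lemma theta_A: "\<theta>s v* A = (1 / cs) *\<^sub>R \<theta>s"
proof -
 have "\<theta>s v* (mat 1 - P0) = cs *\<^sub>R \<theta>s"
  by (simp add: vector_matrix_mult_diff_rdistrib theta_P0 algebra_simps)
 then have "(\<theta>s v* (mat 1 - P0)) v* A = cs *\<^sub>R (\<theta>s v* A)"
  by (simp add: vec_eq_iff vector_matrix_component sum_distrib_left mult.assoc)
 then have *: "\<theta>s = cs *\<^sub>R (\<theta>s v* A)" by (simp add: vector_matrix_mul_assoc I_minus_P0_inverse)
 have "(1 / cs) *\<^sub>R \<theta>s = (1 / cs) *\<^sub>R (cs *\<^sub>R (\<theta>s v* A))" by (subst *) (rule refl)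
 then show ?thesis using cs_pos by simp
qed

text \<open>The right Perron vector. The left eigenvector \<theta>s shows that 1 / cs is an
  eigenvalue of \<open>A\<close>, so a right eigenvector x exists. Its modulus y satisfies y / cs
  \<le> A y; pairing with the positive \<theta>s forces equality, and the positivity of
  \<open>A\<close> makes y positive.\<close>

lemma ex_phi: "\<exists>\<phi>. (\<forall>i. 0 < \<phi> $ i) \<and> A *v \<phi> = (1 / cs) *\<^sub>R \<phi>"
proof -
 have "\<not> invertible (A - mat (1 / cs))"
 proof
  assume "invertible (A - mat (1 / cs))"
  then obtain B where B: "(A - mat (1 / cs)) ** B = mat 1" unfolding invertible_right_inverse by blast
  have "\<theta>s v* mat (1 / cs) = (1 / cs) *\<^sub>R \<theta>s"
   by (simp add: vec_eq_iff vector_matrix_component mat_def if_distrib[of "\<lambda>t. _ * t"] cong: if_cong)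
  then have "\<theta>s v* (A - mat (1 / cs)) = 0" by (simp add: vector_matrix_mult_diff_rdistrib theta_A)
  then have "\<theta>s v* ((A - mat (1 / cs)) ** B) = 0" by (simp add: vector_matrix_mul_assoc[symmetric])
  then have "\<theta>s = 0" by (simp add: B)
  then show False using theta_sum by simp
 qed
 then obtain x where x: "(A - mat (1 / cs)) *v x = 0" "x \<noteq> 0"
  unfolding invertible_left_inverse matrix_left_invertible_ker by blast
 have "mat (1 / cs) *v x = (1 / cs) *\<^sub>R x"
  by (simp add: vec_eq_iff matrix_vector_mult_def mat_def if_distrib[of "\<lambda>t. t * _"] cong: if_cong)
 then have Ax: "A *v x = (1 / cs) *\<^sub>R x" using x by (simp add: matrix_vector_mult_diff_rdistrib)
 define y :: "real ^ 'd" where "y = (\<chi> i. \<bar>x $ i\<bar>)"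
 have le: "(1 / cs) * y $ i \<le> (A *v y) $ i" for i
 proof -
  have "(1 / cs) * y $ i = \<bar>(A *v x) $ i\<bar>" using cs_pos unfolding Ax by (simp add: y_def abs_mult)
  also have "\<dots> \<le> (\<Sum>j\<in>UNIV. \<bar>A $ i $ j * x $ j\<bar>)" unfolding matrix_vector_mult_def by (simp add: sum_abs)
  also have "\<dots> = (A *v y) $ i" unfolding matrix_vector_mult_def y_def
   by (simp add: abs_mult abs_of_pos[OF A_pos])
  finally show ?thesis .
 qed
 have "\<theta>s \<bullet> (A *v y - (1 / cs) *\<^sub>R y) = 0"
  by (simp add: inner_diff_right dot_lmul_matrix[symmetric] theta_A)
 moreover have nn: "0 \<le> \<theta>s $ i * (A *v y - (1 / cs) *\<^sub>R y) $ i" for i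
  using theta_nonneg[of i] le[of i] by (intro mult_nonneg_nonneg) auto
 ultimately have *: "\<theta>s $ i * (A *v y - (1 / cs) *\<^sub>R y) $ i = 0" for i
  unfolding inner_vec_def inner_real_def by (subst (asm) sum_nonneg_eq_0_iff) (auto simp del: vector_minus_component)
 have Ay: "(A *v y - (1 / cs) *\<^sub>R y) $ i = 0" for i
  using *[of i] theta_nonzero[of i] unfolding mult_eq_0_iff by blast
 then have Ay': "A *v y = (1 / cs) *\<^sub>R y" by (simp add: vec_eq_iff)
 moreover have "0 < y $ i" for i
 proof -
  obtain k where k: "x $ k \<noteq> 0" using x(2) by (auto simp: vec_eq_iff)
  have "0 < A $ i $ k * y $ k" using k A_pos by (simp add: y_def)
  also have "\<dots> \<le> (A *v y) $ i" unfolding matrix_vector_mult_def vec_lambda_beta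
   by (rule member_le_sum) (auto simp: y_def intro!: mult_nonneg_nonneg less_imp_le[OF A_pos])
  finally show ?thesis using cs_pos unfolding Ay' by (simp add: zero_less_divide_iff)
 qed
 ultimately show ?thesis by blast
qed

definition \<phi> :: "real ^ 'd" where "\<phi> = (SOME \<phi>. (\<forall>i. 0 < \<phi> $ i) \<and> A *v \<phi> = (1 / cs) *\<^sub>R \<phi>)"

lemma phi_pos: "0 < \<phi> $ i" and A_phi: "A *v \<phi> = (1 / cs) *\<^sub>R \<phi>"
 using someI_ex[OF ex_phi] unfolding \<phi>_def by auto

definition wnorm :: "real ^ 'd \<Rightarrow> real" where "wnorm v = (\<Sum>i\<in>UNIV. \<bar>v $ i\<bar> * \<phi> $ i)"

text \<open>The matrix with entries cs * A i j * \<phi> j / \<phi> i is stochastic with positive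
  entries. The estimate is the Doeblin contraction of this matrix, written in the l1 norm weighted
  by \<phi>; the condition v \<bullet> \<phi> = 0 says that the transformed signed measure has mass
  zero.\<close>

lemma wnorm_contract: "\<exists>k. 0 < k \<and> k < 1 \<and> (\<forall>v. v \<bullet> \<phi> = 0 \<longrightarrow> wnorm (v v* A) \<le> (1 / cs) * (1 - k) * wnorm v)"
proof -
 define e where "e = Min (range (\<lambda>(i, j). A $ i $ j * \<phi> $ j / \<phi> $ i))"
 have e: "e \<le> A $ i $ j * \<phi> $ j / \<phi> $ i" for i j
  unfolding e_def by (rule Min_le) auto
 have "e \<in> range (\<lambda>(i, j). A $ i $ j * \<phi> $ j / \<phi> $ i)" unfolding e_def by (rule Min_in) auto
 then have e0: "0 < e" using A_pos phi_pos by auto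
 define d where "d = real CARD('d)"
 have rs: "(\<Sum>j\<in>UNIV. A $ i $ j * \<phi> $ j / \<phi> $ i) = 1 / cs" for i
 proof -
  have "(\<Sum>j\<in>UNIV. A $ i $ j * \<phi> $ j) = (1 / cs) * \<phi> $ i"
   using A_phi by (simp add: vec_eq_iff matrix_vector_mult_def)
  then show ?thesis using phi_pos[of i] by (simp add: sum_divide_distrib[symmetric])
 qed
 have main: "wnorm (v v* A) \<le> (1 / cs - d * e) * wnorm v" if v: "v \<bullet> \<phi> = 0" for v
 proof -
  have "\<bar>(v v* A) $ j\<bar> * \<phi> $ j \<le> (\<Sum>i\<in>UNIV. \<bar>v $ i\<bar> * \<phi> $ i * (A $ i $ j * \<phi> $ j / \<phi> $ i - e))" for j
  proof -
   \<comment> \<open>Orthogonality to \<phi> is used here: subtracting the minorant e from all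
     transition weights changes nothing in the sum, but makes the absolute values smaller.\<close>
   have "(\<Sum>i\<in>UNIV. v $ i * \<phi> $ i * (A $ i $ j * \<phi> $ j / \<phi> $ i - e))
     = (\<Sum>i\<in>UNIV. v $ i * A $ i $ j * \<phi> $ j) - e * (\<Sum>i\<in>UNIV. v $ i * \<phi> $ i)"
    unfolding sum_distrib_left sum_subtractf[symmetric]
   proof (intro sum.cong refl)
    fix i show "v $ i * \<phi> $ i * (A $ i $ j * \<phi> $ j / \<phi> $ i - e) = v $ i * A $ i $ j * \<phi> $ j - e * (v $ i * \<phi> $ i)"
     using phi_pos[of i] by (simp add: field_simps)
   qed
   then have "(v v* A) $ j * \<phi> $ j = (\<Sum>i\<in>UNIV. v $ i * \<phi> $ i * (A $ i $ j * \<phi> $ j / \<phi> $ i - e))"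
    using v by (simp add: vector_matrix_component inner_vec_def sum_distrib_right)
   then have "\<bar>(v v* A) $ j * \<phi> $ j\<bar> \<le> (\<Sum>i\<in>UNIV. \<bar>v $ i * \<phi> $ i * (A $ i $ j * \<phi> $ j / \<phi> $ i - e)\<bar>)"
    by (simp add: sum_abs)
   also have "\<dots> = (\<Sum>i\<in>UNIV. \<bar>v $ i\<bar> * \<phi> $ i * (A $ i $ j * \<phi> $ j / \<phi> $ i - e))"
    using e[of _ j] by (intro sum.cong refl) (simp add: abs_mult abs_of_pos[OF phi_pos])
   finally show ?thesis using phi_pos[of j] by (simp add: abs_mult)
  qed
  then have "wnorm (v v* A) \<le> (\<Sum>j\<in>UNIV. \<Sum>i\<in>UNIV. \<bar>v $ i\<bar> * \<phi> $ i * (A $ i $ j * \<phi> $ j / \<phi> $ i - e))"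
   unfolding wnorm_def by (intro sum_mono)
  also have "\<dots> = (\<Sum>i\<in>UNIV. \<bar>v $ i\<bar> * \<phi> $ i * (\<Sum>j\<in>UNIV. A $ i $ j * \<phi> $ j / \<phi> $ i - e))"
   unfolding sum_distrib_left by (rule sum.swap)
  also have "\<dots> = (1 / cs - d * e) * wnorm v"
   unfolding sum_subtractf rs wnorm_def sum_distrib_left by (intro sum.cong) (auto simp: d_def)
  finally show ?thesis .
 qed
 have d: "d > 0" unfolding d_def by (simp add: zero_less_card_finite)
 \<comment> \<open>The cap 1/2 only keeps k below 1.\<close>
 define k where "k = min (1/2) (cs * d * e)"
 have "0 < k" "k < 1" using e0 d cs_pos by (auto simp: k_def)
 moreover have "wnorm (v v* A) \<le> (1 / cs) * (1 - k) * wnorm v" if v: "v \<bullet> \<phi> = 0" for v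
 proof -
  have "(1 / cs) * k \<le> (1 / cs) * (cs * d * e)" using cs_pos by (intro mult_left_mono) (auto simp: k_def)
  then have "(1 / cs) * k \<le> d * e" using cs_pos by simp
  then have "1 / cs - d * e \<le> (1 / cs) * (1 - k)" unfolding right_diff_distrib by simp
  moreover have "0 \<le> wnorm v" unfolding wnorm_def by (intro sum_nonneg mult_nonneg_nonneg less_imp_le[OF phi_pos]) auto
  ultimately have "(1 / cs - d * e) * wnorm v \<le> (1 / cs) * (1 - k) * wnorm v" by (rule mult_right_mono)
  then show ?thesis using main[OF v] by linarith
 qed
 ultimately show ?thesis by blast
qed


section \<open>The kernels with redistribution and their invariant distributions\<close>

lemma Kmat_component: "Kmat P \<nu> $ x $ y = P0 $ x $ y + q0 $ x * \<nu> $ y"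
 by (simp add: Kmat_def P0_def q0_def)

lemma vector_Kmat: "v v* Kmat P \<nu> = v v* P0 + (v \<bullet> q0) *\<^sub>R \<nu>"
 by (simp add: vec_eq_iff vector_matrix_component Kmat_component inner_vec_def sum.distrib
   distrib_left sum_distrib_right mult.assoc)

lemma Kmat_row_sum: "\<nu> \<in> prob_simplex \<Longrightarrow> (\<Sum>y\<in>UNIV. Kmat P \<nu> $ x $ y) = 1"
 by (simp add: Kmat_component sum.distrib P0_row_sum sum_distrib_left[symmetric] prob_simplex_def)

lemma Kmat_nonneg: "\<nu> \<in> prob_simplex \<Longrightarrow> 0 \<le> Kmat P \<nu> $ x $ y"
 by (simp add: Kmat_component P0_nonneg q0_nonneg prob_simplex_def)

lemma sum_vector_Kmat:
 assumes "\<nu> \<in> prob_simplex" shows "(\<Sum>y\<in>UNIV. (v v* Kmat P \<nu>) $ y) = (\<Sum>x\<in>UNIV. v $ x)"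
proof -
 have "(\<Sum>y\<in>UNIV. (v v* Kmat P \<nu>) $ y) = (\<Sum>x\<in>UNIV. v $ x * (\<Sum>y\<in>UNIV. Kmat P \<nu> $ x $ y))"
  unfolding vector_matrix_component sum_distrib_left by (rule sum.swap)
 then show ?thesis by (simp add: Kmat_row_sum[OF assms])
qed

lemma sum_vector_I_minus_P0: "(\<Sum>y\<in>UNIV. (v v* (mat 1 - P0)) $ y) = v \<bullet> q0"
proof -
 have "(\<Sum>y\<in>UNIV. (v v* P0) $ y) = (\<Sum>x\<in>UNIV. v $ x * (\<Sum>y\<in>UNIV. P0 $ x $ y))"
  unfolding vector_matrix_component sum_distrib_left by (rule sum.swap)
 then show ?thesis
  by (simp add: vector_matrix_mult_diff_rdistrib sum_subtractf P0_row_sum inner_vec_def algebra_simps)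
qed

text \<open>The redistribution term of \<open>Kmat\<close> has rank one, so invariance reads p (I -
  P0) = (p \<bullet> q0) \<nu>, and the Green kernel solves it. The invariant distribution is
  therefore the normalised \<nu> A.\<close>

lemma invariant_iff: "p v* Kmat P \<nu> = p \<longleftrightarrow> p = (p \<bullet> q0) *\<^sub>R (\<nu> v* A)"
proof -
 note scale = vector_matrix_scaleR
 have "p v* Kmat P \<nu> = p \<longleftrightarrow> p v* (mat 1 - P0) = (p \<bullet> q0) *\<^sub>R \<nu>"
  unfolding vector_Kmat vector_matrix_mult_diff_rdistrib vector_matrix_mul_rid by (auto simp: algebra_simps)
 also have "\<dots> \<longleftrightarrow> p = (p \<bullet> q0) *\<^sub>R (\<nu> v* A)"
 proof
  assume "p v* (mat 1 - P0) = (p \<bullet> q0) *\<^sub>R \<nu>"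
  then have "(p v* (mat 1 - P0)) v* A = ((p \<bullet> q0) *\<^sub>R \<nu>) v* A" by simp
  then show "p = (p \<bullet> q0) *\<^sub>R (\<nu> v* A)" by (simp add: vector_matrix_mul_assoc I_minus_P0_inverse scale)
 next
  assume *: "p = (p \<bullet> q0) *\<^sub>R (\<nu> v* A)"
  have "p v* (mat 1 - P0) = ((p \<bullet> q0) *\<^sub>R (\<nu> v* A)) v* (mat 1 - P0)" using * by metis
  then show "p v* (mat 1 - P0) = (p \<bullet> q0) *\<^sub>R \<nu>" by (simp add: vector_matrix_mul_assoc I_minus_P0_inverse scale)
 qed
 finally show ?thesis .
qed

text \<open>Existence comes from normalising \<nu> A by its total mass s; since summing p (I - P0)
  gives p \<bullet> q0, the factor in the fixed-point form is 1 / s. Any other solution is a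
  multiple of \<nu> A of mass one.\<close>

lemma invariant_dist:
 assumes \<nu>: "\<nu> \<in> prob_simplex"
 shows invariant_dist_simplex: "invariant_dist P \<nu> \<in> prob_simplex"
  and invariant_dist_invariant: "invariant_dist P \<nu> v* Kmat P \<nu> = invariant_dist P \<nu>"
  and invariant_dist_unique: "\<And>p. p \<in> prob_simplex \<Longrightarrow> p v* Kmat P \<nu> = p \<Longrightarrow> p = invariant_dist P \<nu>"
proof -
 define s where "s = (\<Sum>j\<in>UNIV. (\<nu> v* A) $ j)"
 have \<nu>': "0 \<le> \<nu> $ i" "(\<Sum>i\<in>UNIV. \<nu> $ i) = 1" for i using \<nu> by (auto simp: prob_simplex_def)
 have nn: "0 \<le> (\<nu> v* A) $ j" for j unfolding vector_matrix_component
  by (intro sum_nonneg mult_nonneg_nonneg \<nu>' less_imp_le[OF A_pos])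
 have "s \<noteq> 0"
 proof
  assume "s = 0"
  then have *: "(\<nu> v* A) $ j = 0" for j unfolding s_def using nn by (simp add: sum_nonneg_eq_0_iff)
  have "\<nu> $ i = 0" for i
  proof -
   have "\<nu> $ i * A $ i $ i = 0" using *[of i] unfolding vector_matrix_component
    by (subst (asm) sum_nonneg_eq_0_iff) (auto intro!: mult_nonneg_nonneg \<nu>' less_imp_le[OF A_pos])
   then show ?thesis using A_pos[of i i] by simp
  qed
  then show False using \<nu>' by simp
 qed
 moreover have "s \<ge> 0" unfolding s_def by (intro sum_nonneg nn)
 ultimately have s: "s > 0" by simp
 define p where "p = (1 / s) *\<^sub>R (\<nu> v* A)"
 have p: "p \<in> prob_simplex" unfolding prob_simplex_def p_def using nn s
  by (auto simp: sum_distrib_left[symmetric] s_def[symmetric] sum_divide_distrib[symmetric])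
 have "p v* (mat 1 - P0) = (1 / s) *\<^sub>R ((\<nu> v* A) v* (mat 1 - P0))"
  unfolding p_def by (rule vector_matrix_scaleR)
 also have "\<dots> = (1 / s) *\<^sub>R \<nu>" by (simp add: vector_matrix_mul_assoc I_minus_P0_inverse)
 finally have "p \<bullet> q0 = 1 / s" unfolding sum_vector_I_minus_P0[symmetric] using \<nu>'
  by (simp add: sum_divide_distrib[symmetric])
 then have inv: "p v* Kmat P \<nu> = p" unfolding invariant_iff by (simp add: p_def)
 have uniq: "p' = p" if "p' \<in> prob_simplex" "p' v* Kmat P \<nu> = p'" for p'
 proof -
  have eq: "p' = (p' \<bullet> q0) *\<^sub>R (\<nu> v* A)" using that(2) unfolding invariant_iff .
  have "(\<Sum>j\<in>UNIV. p' $ j) = (\<Sum>j\<in>UNIV. ((p' \<bullet> q0) *\<^sub>R (\<nu> v* A)) $ j)" by (subst eq) (rule refl)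
  also have "\<dots> = (p' \<bullet> q0) * s" by (simp add: s_def sum_distrib_left)
  finally have "(p' \<bullet> q0) * s = 1" using that(1) by (simp add: prob_simplex_def)
  then have "p' \<bullet> q0 = 1 / s" using s by (simp add: field_simps)
  then show ?thesis unfolding p_def using eq by (rule subst)
 qed
 have "invariant_dist P \<nu> = p" unfolding invariant_dist_def
  using p inv uniq by (intro the_equality conjI) blast+
 then show "invariant_dist P \<nu> \<in> prob_simplex" "invariant_dist P \<nu> v* Kmat P \<nu> = invariant_dist P \<nu>"
  "\<And>p. p \<in> prob_simplex \<Longrightarrow> p v* Kmat P \<nu> = p \<Longrightarrow> p = invariant_dist P \<nu>"
  using p inv uniq by blast+
qed

abbreviation Ks :: "real ^ 'd ^ 'd" where "Ks \<equiv> Kmat P \<theta>s"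

lemma theta_Ks: "\<theta>s v* Ks = \<theta>s"
 unfolding vector_Kmat theta_P0 cs_def[symmetric] by (simp add: algebra_simps)

lemma invariant_dist_theta: "invariant_dist P \<theta>s = \<theta>s"
 using invariant_dist_unique[OF theta_simplex theta_simplex theta_Ks] by simp

end

section \<open>Doeblin contraction and geometric ergodicity\<close>

definition l1 :: "real ^ 'd::finite \<Rightarrow> real" where "l1 v = (\<Sum>i\<in>UNIV. \<bar>v $ i\<bar>)"

lemma l1_triangle: "l1 (x + y) \<le> l1 x + l1 y"
 unfolding l1_def sum.distrib[symmetric] by (intro sum_mono) (simp add: abs_triangle_ineq)

lemma norm_le_l1: "norm v \<le> l1 v"
 unfolding l1_def by (rule norm_le_l1_cart)

lemma l1_le_norm: "l1 (v :: real ^ 'd::finite) \<le> real CARD('d) * norm v"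
 unfolding l1_def using sum_bounded_above[of UNIV "\<lambda>i. \<bar>v $ i\<bar>" "norm v"] by (simp add: component_le_norm_cart)

lemma l1_nonneg: "0 \<le> l1 v" by (simp add: l1_def sum_nonneg)

text \<open>The last premise covers two uses: e = 0 with arbitrary v says that a stochastic matrix
  does not expand, and a v of total mass zero with e > 0 gives a strict contraction.\<close>

lemma l1_stochastic:
 fixes B :: "real ^ 'd::finite ^ 'd"
 assumes "\<And>x y. e \<le> B $ x $ y" "\<And>x. (\<Sum>y\<in>UNIV. B $ x $ y) = 1" "e * (\<Sum>x\<in>UNIV. v $ x) = 0"
 shows "l1 (v v* B) \<le> (1 - real CARD('d) * e) * l1 v"
proof -
 have "\<bar>(v v* B) $ y\<bar> \<le> (\<Sum>x\<in>UNIV. \<bar>v $ x\<bar> * (B $ x $ y - e))" for y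
 proof -
  have "(v v* B) $ y = (\<Sum>x\<in>UNIV. v $ x * (B $ x $ y - e))"
   using assms(3) by (simp add: vector_matrix_component right_diff_distrib sum_subtractf sum_distrib_left mult.commute)
  then have "\<bar>(v v* B) $ y\<bar> \<le> (\<Sum>x\<in>UNIV. \<bar>v $ x * (B $ x $ y - e)\<bar>)" by (simp add: sum_abs)
  then show ?thesis using assms(1) by (simp add: abs_mult)
 qed
 then have "l1 (v v* B) \<le> (\<Sum>y\<in>UNIV. \<Sum>x\<in>UNIV. \<bar>v $ x\<bar> * (B $ x $ y - e))"
  unfolding l1_def by (intro sum_mono)
 also have "\<dots> = (\<Sum>x\<in>UNIV. \<bar>v $ x\<bar> * (\<Sum>y\<in>UNIV. B $ x $ y - e))"
  unfolding sum_distrib_left by (rule sum.swap)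
 also have "\<dots> = (1 - real CARD('d) * e) * l1 v"
  unfolding sum_subtractf assms(2) l1_def sum_distrib_left by (intro sum.cong) auto
 finally show ?thesis .
qed

lemma matrix_power_0: "matrix_power B 0 = mat 1"
 and matrix_power_Suc: "matrix_power B (Suc n) = B ** matrix_power B n"
 by (simp_all add: matrix_power_def)

lemma matrix_power_Suc2: "matrix_power B (Suc n) = matrix_power B n ** B"
proof (induction n)
 case (Suc n)
 have "matrix_power B (Suc (Suc n)) = B ** (matrix_power B n ** B)" by (simp only: matrix_power_Suc Suc[symmetric])
 then show ?case by (simp only: matrix_mul_assoc matrix_power_Suc)
qed (simp add: matrix_power_0 matrix_power_Suc)

lemma matrix_mult_component: "(B ** C) $ x $ y = (\<Sum>z\<in>UNIV. B $ x $ z * C $ z $ y)"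
 by (simp add: matrix_matrix_mult_def)

context qsd_chain begin

abbreviation Kn :: "nat \<Rightarrow> real ^ 'd ^ 'd" where "Kn n \<equiv> matrix_power Ks n"

lemmas Ks_nonneg = Kmat_nonneg[OF theta_simplex] and Ks_row_sum = Kmat_row_sum[OF theta_simplex]

lemma Kn_nonneg: "0 \<le> Kn n $ x $ y"
 by (induction n arbitrary: x y)
  (auto simp: matrix_power_0 matrix_power_Suc matrix_mult_component mat_def intro!: sum_nonneg mult_nonneg_nonneg Ks_nonneg)

lemma Kn_row_sum: "(\<Sum>y\<in>UNIV. Kn n $ x $ y) = 1"
proof (induction n arbitrary: x)
 case (Suc n)
 have "(\<Sum>y\<in>UNIV. Kn (Suc n) $ x $ y) = (\<Sum>z\<in>UNIV. Ks $ x $ z * (\<Sum>y\<in>UNIV. Kn n $ z $ y))"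
  unfolding matrix_power_Suc matrix_mult_component sum_distrib_left by (rule sum.swap)
 then show ?case by (simp add: Suc Ks_row_sum)
qed (simp add: matrix_power_0 mat_def)

text \<open>A state z with positive exit probability can jump to every state, itself included,
  through the redistribution by \<theta>s. Every state reaches z, the loop at z equalises the
  lengths, and one more step spreads the mass everywhere; periodicity of \<open>P0\<close> is thus
  harmless.\<close>

lemma Kn_minorized: "\<exists>m e. 0 < e \<and> (\<forall>x y. e \<le> Kn (Suc m) $ x $ y)"
proof -
 obtain z where z: "0 < q0 $ z" using exists_exit by blast
 have Kz: "0 < Ks $ z $ y" for y
  unfolding Kmat_component using z theta_pos[of y] P0_nonneg[of z y] by (simp add: add_nonneg_pos)
 have "{x. \<forall>n. Kn n $ x $ z = 0} = {}"
 proof (rule ccontr)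
  assume ne: "{x. \<forall>n. Kn n $ x $ z = 0} \<noteq> {}"
  have "{x. \<forall>n. Kn n $ x $ z = 0} = UNIV"
  proof (rule irreducible_closed[OF _ ne])
   fix x y assume x: "x \<in> {x. \<forall>n. Kn n $ x $ z = 0}" and "0 < P0 $ x $ y"
   then have xy: "0 < Ks $ x $ y" unfolding Kmat_component
    using q0_nonneg theta_nonneg by (simp add: add_pos_nonneg)
   have "Kn n $ y $ z = 0" for n
   proof -
    have "(\<Sum>y\<in>UNIV. Ks $ x $ y * Kn n $ y $ z) = 0"
     using x unfolding matrix_mult_component[symmetric] matrix_power_Suc[symmetric] by blast
    then have "Ks $ x $ y * Kn n $ y $ z = 0"
     by (subst (asm) sum_nonneg_eq_0_iff) (auto intro!: mult_nonneg_nonneg Ks_nonneg Kn_nonneg)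
    then show ?thesis using xy by simp
   qed
   then show "y \<in> {x. \<forall>n. Kn n $ x $ z = 0}" by blast
  qed
  then have "Kn 0 $ z $ z = 0" by blast
  then show False by (simp add: matrix_power_0 mat_def)
 qed
 then have "\<forall>x. \<exists>n. Kn n $ x $ z \<noteq> 0" by blast
 then obtain n where n: "\<And>x. Kn (n x) $ x $ z \<noteq> 0" by metis
 \<comment> \<open>Waiting at z extends a path of length n x to any greater length, so that one
   length serves all starting states.\<close>
 have pos: "0 < Kn (n x + k) $ x $ z" for x k
 proof (induction k)
  case 0
  show ?case using n[of x] Kn_nonneg[of "n x" x z] by (simp add: less_le)
 next
  case (Suc k)
  have "0 < Kn (n x + k) $ x $ z * Ks $ z $ z" using Suc Kz by simp
  also have "\<dots> \<le> (\<Sum>y\<in>UNIV. Kn (n x + k) $ x $ y * Ks $ y $ z)"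
   by (rule member_le_sum) (auto intro!: mult_nonneg_nonneg Ks_nonneg Kn_nonneg)
  finally show ?case unfolding add_Suc_right matrix_power_Suc2 matrix_mult_component .
 qed
 define m where "m = Max (range n)"
 have m: "0 < Kn m $ x $ z" for x
 proof -
  have "n x \<le> m" unfolding m_def by (rule Max_ge) auto
  then show ?thesis using pos[of x "m - n x"] by simp
 qed
 have all: "0 < Kn (Suc m) $ x $ y" for x y
 proof -
  have "0 < Kn m $ x $ z * Ks $ z $ y" using m Kz by simp
  also have "\<dots> \<le> (\<Sum>w\<in>UNIV. Kn m $ x $ w * Ks $ w $ y)"
   by (rule member_le_sum) (auto intro!: mult_nonneg_nonneg Ks_nonneg Kn_nonneg)
  finally show ?thesis unfolding matrix_power_Suc2 matrix_mult_component .
 qed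
 define e where "e = Min (range (\<lambda>(x, y). Kn (Suc m) $ x $ y))"
 have "e \<in> range (\<lambda>(x, y). Kn (Suc m) $ x $ y)" unfolding e_def by (rule Min_in) auto
 then have "0 < e" using all by auto
 moreover have "e \<le> Kn (Suc m) $ x $ y" for x y unfolding e_def by (rule Min_le) auto
 ultimately show ?thesis by blast
qed

text \<open>A power contracts, but the recursions need a contraction in one step. The sum of s^j |v
  K^j| over j \<le> m achieves it: multiplying N (v K) by s shifts the sum by one index, and the new
  last term is at most the dropped first one because s^(m+1) (1 - d) = 1.\<close>

lemma Ks_contraction:
 obtains N r C where "0 < r" "r < 1" "1 \<le> C" "\<And>x y. N (x + y) \<le> N x + N y"
  "\<And>x. norm x \<le> N x" "\<And>x. N x \<le> C * norm x"
  "\<And>v. (\<Sum>i\<in>UNIV. v $ i) = 0 \<Longrightarrow> N (v v* Ks) \<le> r * N v"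
proof -
 obtain m e where e: "0 < e" "\<And>x y. e \<le> Kn (Suc m) $ x $ y" using Kn_minorized by blast
 define d where "d = min (1/2) (real CARD('d) * e)"
 have d: "0 < d" "d < 1" using e by (auto simp: d_def zero_less_card_finite)
 have contr: "l1 (v v* Kn (Suc m)) \<le> (1 - d) * l1 v" if "(\<Sum>i\<in>UNIV. v $ i) = 0" for v
 proof -
  have "l1 (v v* Kn (Suc m)) \<le> (1 - real CARD('d) * e) * l1 v"
   by (rule l1_stochastic) (use e Kn_row_sum that in auto)
  also have "\<dots> \<le> (1 - d) * l1 v" by (intro mult_right_mono l1_nonneg) (simp add: d_def)
  finally show ?thesis .
 qed
 have nonexp: "l1 (v v* Kn j) \<le> l1 v" for v j
  using l1_stochastic[of 0 "Kn j" v] Kn_nonneg Kn_row_sum by simp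
 define s where "s = root (Suc m) (1 / (1 - d))"
 have s1: "1 < s" using d unfolding s_def by (subst real_root_gt_1_iff) auto
 have sm: "s ^ Suc m = 1 / (1 - d)" using d unfolding s_def by (subst real_root_pow_pos2) auto
 define N where "N v = (\<Sum>j<Suc m. s ^ j * l1 (v v* Kn j))" for v
 define C where "C = (\<Sum>j<Suc m. s ^ j) * real CARD('d)"
 show thesis
 proof
  show "0 < 1 / s" "1 / s < 1" using s1 by auto
  have "1 \<le> (\<Sum>j<Suc m. s ^ j)" unfolding sum.lessThan_Suc_shift using s1 by (simp add: sum_nonneg)
  then show "1 \<le> C" unfolding C_def using mult_mono[of 1 _ 1 "real CARD('d)"]
   by (simp add: Suc_le_eq zero_less_card_finite)
  show "N (x + y) \<le> N x + N y" for x y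
   unfolding N_def sum.distrib[symmetric] vector_matrix_left_distrib distrib_left[symmetric]
   using s1 by (intro sum_mono mult_left_mono l1_triangle) auto
  show "norm x \<le> N x" for x
  proof -
   have "norm x \<le> s ^ 0 * l1 (x v* Kn 0)" by (simp add: matrix_power_0 norm_le_l1)
   also have "\<dots> \<le> N x" unfolding N_def
    by (rule member_le_sum) (use s1 in \<open>auto intro!: mult_nonneg_nonneg l1_nonneg\<close>)
   finally show ?thesis .
  qed
  show "N x \<le> C * norm x" for x
  proof -
   have "N x \<le> (\<Sum>j<Suc m. s ^ j * l1 x)" unfolding N_def
    using s1 by (intro sum_mono mult_left_mono nonexp) auto
   also have "\<dots> = (\<Sum>j<Suc m. s ^ j) * l1 x" by (rule sum_distrib_right[symmetric])
   also have "\<dots> \<le> (\<Sum>j<Suc m. s ^ j) * (real CARD('d) * norm x)"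
    using s1 by (intro mult_left_mono l1_le_norm sum_nonneg) auto
   finally show ?thesis by (simp add: C_def mult.assoc)
  qed
  show "N (v v* Ks) \<le> 1 / s * N v" if v: "(\<Sum>i\<in>UNIV. v $ i) = 0" for v
  proof -
   have shift: "(v v* Ks) v* Kn j = v v* Kn (Suc j)" for j
    by (simp add: vector_matrix_mul_assoc matrix_power_Suc)
   have "s * N (v v* Ks) = (\<Sum>j<Suc m. s ^ Suc j * l1 (v v* Kn (Suc j)))"
    unfolding N_def sum_distrib_left shift by (simp add: mult.assoc)
   also have "\<dots> = (\<Sum>j<Suc (Suc m). s ^ j * l1 (v v* Kn j)) - l1 v"
    by (subst (2) sum.lessThan_Suc_shift) (simp add: matrix_power_0)
   also have "\<dots> = N v + s ^ Suc m * l1 (v v* Kn (Suc m)) - l1 v" by (simp add: N_def)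
   also have "\<dots> \<le> N v + s ^ Suc m * ((1 - d) * l1 v) - l1 v"
    using s1 contr[OF v] by (intro diff_mono add_left_mono mult_left_mono) auto
   also have "\<dots> = N v" unfolding sm using d by simp
   finally show ?thesis using s1 by (simp add: field_simps)
  qed
 qed
qed

lemma Kn_geometric:
 obtains C r where "0 < r" "r < 1" "\<And>n x y. \<bar>Kn n $ x $ y - \<theta>s $ y\<bar> \<le> C * r ^ n"
proof -
 obtain N r C where N: "0 < r" "r < 1" "1 \<le> C" "\<And>x. norm x \<le> N x" "\<And>x. N x \<le> C * norm x"
  "\<And>v. (\<Sum>i\<in>UNIV. v $ i) = 0 \<Longrightarrow> N (v v* Ks) \<le> r * N v"
  by (rule Ks_contraction) blast
 have iter: "(\<Sum>i\<in>UNIV. (v v* Kn n) $ i) = 0 \<and> N (v v* Kn n) \<le> r ^ n * N v"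
  if v: "(\<Sum>i\<in>UNIV. v $ i) = 0" for v n
 proof (induction n)
  case 0
  show ?case using v by (simp add: matrix_power_0)
 next
  case (Suc n)
  have eq: "v v* Kn (Suc n) = (v v* Kn n) v* Ks" by (simp add: vector_matrix_mul_assoc matrix_power_Suc2)
  have "N (v v* Kn (Suc n)) \<le> r * N (v v* Kn n)" unfolding eq using Suc by (intro N(6)) auto
  also have "\<dots> \<le> r * (r ^ n * N v)" using Suc N(1) by (intro mult_left_mono) auto
  finally show ?case using Suc unfolding eq by (simp add: sum_vector_Kmat[OF theta_simplex])
 qed
 have th: "\<theta>s v* Kn n = \<theta>s" for n
  by (induction n) (simp_all add: matrix_power_0 matrix_power_Suc vector_matrix_mul_assoc[symmetric] theta_Ks)
 have "\<bar>Kn n $ x $ y - \<theta>s $ y\<bar> \<le> (\<Sum>x\<in>UNIV. N (axis x 1 - \<theta>s)) * r ^ n" for n x y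
 proof -
  have s0: "(\<Sum>i\<in>UNIV. (axis x 1 - \<theta>s) $ i) = 0" by (simp add: sum_subtractf theta_sum axis_def)
  have "(axis x 1 - \<theta>s) v* Kn n = Kn n $ x - \<theta>s"
   unfolding vector_matrix_mult_diff_distrib th
   by (simp add: vec_eq_iff vector_matrix_component axis_def if_distrib[of "\<lambda>t. t * _"] cong: if_cong)
  then have "\<bar>Kn n $ x $ y - \<theta>s $ y\<bar> \<le> norm ((axis x 1 - \<theta>s) v* Kn n)"
   using component_le_norm_cart[of "Kn n $ x - \<theta>s" y] by simp
  also have "\<dots> \<le> r ^ n * N (axis x 1 - \<theta>s)" using iter[OF s0, of n] N(4) order_trans by blast
  also have "\<dots> \<le> r ^ n * (\<Sum>x\<in>UNIV. N (axis x 1 - \<theta>s))"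
   using N(1) order_trans[OF norm_ge_zero N(4)]
   by (intro mult_left_mono member_le_sum) auto
  finally show ?thesis by (simp add: mult.commute)
 qed
 then show thesis using that N(1,2) by blast
qed

end

section \<open>The Poisson solution as a series of matrix powers\<close>

lemma binomial_transform:
 fixes f :: "nat \<Rightarrow> nat \<Rightarrow> real"
 assumes "\<And>n j. f (Suc n) j = f n j + f n (Suc j)"
 shows "f n j = (\<Sum>k\<le>n. real (n choose k) * f 0 (j + k))"
proof (induction n arbitrary: j)
 case (Suc n)
 have "(\<Sum>k\<le>Suc n. real (Suc n choose k) * f 0 (j + k))
   = f 0 j + (\<Sum>k\<le>n. (real (n choose k) + real (n choose Suc k)) * f 0 (j + Suc k))"
  unfolding sum.atMost_Suc_shift by simp
 also have "\<dots> = (f 0 j + (\<Sum>k\<le>n. real (n choose Suc k) * f 0 (j + Suc k)))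
   + (\<Sum>k\<le>n. real (n choose k) * f 0 (Suc j + k))"
  by (simp add: sum.distrib distrib_right)
 also have "f 0 j + (\<Sum>k\<le>n. real (n choose Suc k) * f 0 (j + Suc k)) = (\<Sum>k\<le>Suc n. real (n choose k) * f 0 (j + k))"
  unfolding sum.atMost_Suc_shift by simp
 also have "\<dots> = f n j" by (simp add: Suc[of j])
 also have "f n j + (\<Sum>k\<le>n. real (n choose k) * f 0 (Suc j + k)) = f (Suc n) j"
  unfolding assms by (simp only: Suc[of "Suc j"])
 finally show ?case by simp
qed simp

lemma summable_exp_bounded:
 fixes b :: "nat \<Rightarrow> real"
 assumes "\<And>n. \<bar>b n\<bar> \<le> C * R ^ n"
 shows "summable (\<lambda>n. \<bar>b n / fact n * t ^ n\<bar>)" "summable (\<lambda>n. b n / fact n * t ^ n)"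
proof -
 have "summable (\<lambda>n. C * (inverse (fact n) * (R * \<bar>t\<bar>) ^ n))"     by (rule summable_mult[OF summable_exp])
 moreover have "norm (\<bar>b n / fact n * t ^ n\<bar>) \<le> C * (inverse (fact n) * (R * \<bar>t\<bar>) ^ n)" for n
  using mult_right_mono[OF assms[of n], of "inverse (fact n) * \<bar>t\<bar> ^ n"]
  by (simp add: abs_mult power_abs power_mult_distrib field_simps)
 ultimately show "summable (\<lambda>n. \<bar>b n / fact n * t ^ n\<bar>)" by (rule summable_comparison_test')
 then show "summable (\<lambda>n. b n / fact n * t ^ n)" by (rule summable_rabs_cancel)
qed

text \<open>The function is the mean of b at a Poisson variable of parameter t, and its derivative
  is the mean of the forward difference of b.\<close>

lemma poisson_mixture_deriv:
 fixes b :: "nat \<Rightarrow> real"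
 assumes b: "\<And>n. \<bar>b n\<bar> \<le> C"
 shows "((\<lambda>t. exp (- t) * (\<Sum>n. b n / fact n * t ^ n)) has_real_derivative
   exp (- t) * (\<Sum>n. (b (Suc n) - b n) / fact n * t ^ n)) (at t)"
proof -
 have sm: "summable (\<lambda>n. b n / fact n * t ^ n)" "summable (\<lambda>n. b (Suc n) / fact n * t ^ n)" for t
  using summable_exp_bounded(2)[of b C 1] summable_exp_bounded(2)[of "\<lambda>n. b (Suc n)" C 1] b by auto
 have "((\<lambda>t. \<Sum>n. b n / fact n * t ^ n) has_real_derivative (\<Sum>n. diffs (\<lambda>n. b n / fact n) n * t ^ n)) (at t)"
  by (rule termdiffs_strong_converges_everywhere) (rule sm)
 moreover have "diffs (\<lambda>n. b n / fact n) n = b (Suc n) / fact n" for n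
  by (simp add: diffs_def field_simps del: of_nat_Suc)
 ultimately have "((\<lambda>t. \<Sum>n. b n / fact n * t ^ n) has_real_derivative (\<Sum>n. b (Suc n) / fact n * t ^ n)) (at t)" by simp
 note D = this
 have diff: "(\<Sum>n. (b (Suc n) - b n) / fact n * t ^ n) = (\<Sum>n. b (Suc n) / fact n * t ^ n) - (\<Sum>n. b n / fact n * t ^ n)"
  using suminf_diff[OF sm(2) sm(1), of t] by (simp add: diff_divide_distrib left_diff_distrib)
 show ?thesis unfolding diff
  by (rule derivative_eq_intros D refl)+ (simp add: algebra_simps)
qed

text \<open>The forward difference of the tail sums Z k = b k + b (k + 1) + ... is -b, so minus the
  Poisson mean of Z is a primitive. It decays exponentially at infinity and equals -Z 0 at 0.
  Nonnegativity of b admits the fundamental theorem for nonnegative integrands on a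
  half-line.\<close>

lemma poisson_mixture_integral_nonneg:
 fixes b :: "nat \<Rightarrow> real"
 assumes b0: "\<And>n. 0 \<le> b n" and b: "\<And>n. b n \<le> C * r ^ n" and r: "0 < r" "r < 1"
 shows "((\<lambda>t. exp (- t) * (\<Sum>n. b n / fact n * t ^ n)) has_integral (\<Sum>n. b n)) {0..}"
proof -
 define f where "f = (\<lambda>t. exp (- t) * (\<Sum>n. b n / fact n * t ^ n))"
 have sg: "summable (\<lambda>n. C * r ^ (n + k))" for k
  by (intro summable_mult summable_ignore_initial_segment[of "\<lambda>n. r ^ n"] summable_geometric) (use r in auto)
 have sb: "summable (\<lambda>n. b (n + k))" for k
  by (rule summable_comparison_test'[OF sg[of k]]) (use b b0 in auto)
 define Z where "Z k = (\<Sum>n. b (n + k))" for k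
 have Z0: "0 \<le> Z k" for k unfolding Z_def by (intro suminf_nonneg sb b0)
 have Zle: "Z k \<le> C / (1 - r) * r ^ k" for k
 proof -
  have "Z k \<le> (\<Sum>n. C * r ^ (n + k))" unfolding Z_def by (intro suminf_le sb sg b)
  also have "\<dots> = (\<Sum>n. (C * r ^ k) * r ^ n)" by (simp add: power_add mult_ac)
  also have "\<dots> = C * r ^ k * (1 / (1 - r))"
   using r by (subst suminf_mult) (auto simp: suminf_geometric summable_geometric)
  finally show ?thesis by simp
 qed
 have C0: "0 \<le> C" using order_trans[OF b0 b, of 0] by simp
 have Zle': "\<bar>Z k\<bar> \<le> C / (1 - r)" for k
 proof -
  have "Z k \<le> C / (1 - r) * r ^ k" by (rule Zle)
  also have "\<dots> \<le> C / (1 - r) * 1" using r C0 by (intro mult_left_mono) (auto simp: power_le_one)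
  finally show ?thesis using Z0 by simp
 qed
 have Zdiff: "Z k - Z (Suc k) = b k" for k
  unfolding Z_def using suminf_split_initial_segment[OF sb[of k], of 1] by simp
 define F where "F = (\<lambda>t. - (exp (- t) * (\<Sum>n. Z n / fact n * t ^ n)))"
 have dF: "DERIV F t :> f t" for t
 proof -
  have "DERIV F t :> - (exp (- t) * (\<Sum>n. (Z (Suc n) - Z n) / fact n * t ^ n))"
   unfolding F_def by (intro DERIV_minus poisson_mixture_deriv[OF Zle'])
  also have "(\<Sum>n. (Z (Suc n) - Z n) / fact n * t ^ n) = (\<Sum>n. - (b n / fact n * t ^ n))"
   by (intro suminf_cong) (simp add: Zdiff[symmetric] field_simps)
  also have "\<dots> = - (\<Sum>n. b n / fact n * t ^ n)"
   by (rule suminf_minus) (rule summable_exp_bounded[of b C r], use b b0 in simp)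
  finally show ?thesis by (simp add: f_def)
 qed
 have bC: "\<bar>b n\<bar> \<le> C" for n
  using order_trans[OF b[of n] mult_left_mono[OF power_le_one[of r n] C0]] r b0 by simp
 have f_meas: "f \<in> borel_measurable borel"
 proof (rule borel_measurable_continuous_onI)
  show "continuous_on UNIV f" unfolding f_def
   by (rule DERIV_continuous_on[of UNIV _ "\<lambda>t. exp (- t) * (\<Sum>n. (b (Suc n) - b n) / fact n * t ^ n)"])
    (use poisson_mixture_deriv[OF bC] in \<open>simp add: has_field_derivative_at_within\<close>)
 qed
 have f0: "0 \<le> f t" if "0 \<le> t" for t unfolding f_def using that b0
  by (intro mult_nonneg_nonneg suminf_nonneg summable_exp_bounded(2)[of b C r]) (use b b0 in auto)
 have lim: "(F \<longlongrightarrow> 0) at_top"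
 proof (rule Lim_null_comparison)
  have "\<bar>F t\<bar> \<le> C / (1 - r) * exp (- (1 - r) * t)" if t: "0 \<le> t" for t
  proof -
   have s1: "summable (\<lambda>n. Z n / fact n * t ^ n)" by (rule summable_exp_bounded(2)[of Z "C / (1 - r)" r]) (use Zle Z0 in auto)
   have e: "(\<lambda>n. (r * t) ^ n /\<^sub>R fact n) sums exp (r * t)" by (rule exp_converges)
   then have e': "(\<lambda>n. C / (1 - r) * ((r * t) ^ n /\<^sub>R fact n)) sums (C / (1 - r) * exp (r * t))" by (rule sums_mult)
   have "(\<Sum>n. Z n / fact n * t ^ n) \<le> (\<Sum>n. C / (1 - r) * ((r * t) ^ n /\<^sub>R fact n))"
   proof (intro suminf_le s1 sums_summable[OF e'])
    fix n
    have "Z n * (t ^ n / fact n) \<le> (C / (1 - r) * r ^ n) * (t ^ n / fact n)" using t by (intro mult_right_mono Zle) auto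
    then show "Z n / fact n * t ^ n \<le> C / (1 - r) * ((r * t) ^ n /\<^sub>R fact n)" by (simp add: power_mult_distrib field_simps)
   qed
   also have "\<dots> = C / (1 - r) * exp (r * t)" by (rule sums_unique[OF e', symmetric])
   finally have "(\<Sum>n. Z n / fact n * t ^ n) \<le> C / (1 - r) * exp (r * t)" .
   moreover have "0 \<le> (\<Sum>n. Z n / fact n * t ^ n)" using t Z0 by (intro suminf_nonneg s1) auto
   ultimately have "exp (- t) * \<bar>\<Sum>n. Z n / fact n * t ^ n\<bar> \<le> exp (- t) * (C / (1 - r) * exp (r * t))"
    by (intro mult_left_mono) (simp_all only: abs_of_nonneg exp_ge_zero)
   then have "\<bar>F t\<bar> \<le> exp (- t) * (C / (1 - r) * exp (r * t))"
    unfolding F_def abs_minus_cancel abs_mult abs_exp_cancel .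
   also have "\<dots> = C / (1 - r) * exp (- (1 - r) * t)" by (simp add: exp_add[symmetric] algebra_simps)
   finally show ?thesis .
  qed
  then show "eventually (\<lambda>t. norm (F t) \<le> C / (1 - r) * exp (- (1 - r) * t)) at_top"
   by (intro eventually_at_top_linorderI[of 0]) auto
  show "((\<lambda>t. C / (1 - r) * exp (- (1 - r) * t)) \<longlongrightarrow> 0) at_top"
   using r by real_asymp
 qed
 have F0: "F 0 = - Z 0" unfolding F_def powser_zero by simp
 have "(\<integral>\<^sup>+x. ennreal (f x) * indicator {0..} x \<partial>lborel) = ennreal (0 - F 0)"
  by (rule nn_integral_FTC_atLeast[OF f_meas dF f0 lim])
 then have nn: "(\<integral>\<^sup>+x. ennreal (indicator {0..} x * f x) \<partial>lborel) = ennreal (Z 0)"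
 proof -
  have "(\<lambda>x. ennreal (indicator {0..} x * f x)) = (\<lambda>x. ennreal (f x) * indicator {0..} x)"
   by (auto simp: fun_eq_iff indicator_def)
  then show "(\<integral>\<^sup>+x. ennreal (f x) * indicator {0..} x \<partial>lborel) = ennreal (0 - F 0) \<Longrightarrow> ?thesis" unfolding F0 by simp
 qed
 have "has_bochner_integral lborel (\<lambda>x. indicator {0..} x * f x) (Z 0)"
  using f_meas f0 Z0 nn by (intro has_bochner_integral_nn_integral AE_I2) (auto simp: indicator_def)
 then have "((\<lambda>x. indicator {0..} x * f x) has_integral Z 0) UNIV"
  using has_integral_integral_lborel[of "\<lambda>x. indicator {0..} x * f x"] unfolding has_bochner_integral_iff by auto
 moreover have "(\<lambda>x. indicator {0..} x * f x) = (\<lambda>x. if x \<in> {0..} then f x else 0)" by (auto simp: fun_eq_iff)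
 ultimately have "(f has_integral Z 0) {0..}" by (simp only: has_integral_restrict_UNIV)
 then show ?thesis by (simp add: f_def Z_def)
qed

text \<open>Adding the dominating geometric sequence C r^n makes the integrand nonnegative; its own
  integral is then subtracted.\<close>

lemma poisson_mixture_integral:
 fixes b :: "nat \<Rightarrow> real"
 assumes b: "\<And>n. \<bar>b n\<bar> \<le> C * r ^ n" and r: "0 < r" "r < 1"
 shows "((\<lambda>t. exp (- t) * (\<Sum>n. b n / fact n * t ^ n)) has_integral (\<Sum>n. b n)) {0..}"
proof -
 define p q where "p n = b n + C * r ^ n" and "q n = C * r ^ n" for n
 have C0: "0 \<le> C" using order_trans[OF abs_ge_zero b, of 0] by simp
 have le: "b n \<le> C * r ^ n" "- (C * r ^ n) \<le> b n" for n using b[of n] by auto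
 have p: "0 \<le> p n" "p n \<le> 2 * C * r ^ n" for n using le[of n] by (auto simp: p_def)
 have q: "0 \<le> q n" "q n \<le> C * r ^ n" for n using r C0 by (auto simp: q_def)
 have sp: "summable (\<lambda>n. p n / fact n * t ^ n)" "summable (\<lambda>n. q n / fact n * t ^ n)" for t
  using summable_exp_bounded(2)[of p "2 * C" r] summable_exp_bounded(2)[of q C r] p q by auto
 have geo: "summable (\<lambda>n. C * r ^ n)" by (intro summable_mult summable_geometric) (use r in auto)
 have sb: "summable b" by (rule summable_comparison_test'[OF geo]) (use b in auto)
 have eq: "exp (- t) * (\<Sum>n. p n / fact n * t ^ n) - exp (- t) * (\<Sum>n. q n / fact n * t ^ n) = exp (- t) * (\<Sum>n. b n / fact n * t ^ n)" for t
 proof -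
  have "(\<Sum>n. p n / fact n * t ^ n) - (\<Sum>n. q n / fact n * t ^ n) = (\<Sum>n. b n / fact n * t ^ n)"
   unfolding suminf_diff[OF sp] by (intro suminf_cong) (simp add: p_def q_def field_simps)
  then show ?thesis by (simp add: right_diff_distrib[symmetric])
 qed
 have eq2: "(\<Sum>n. p n) - (\<Sum>n. q n) = (\<Sum>n. b n)"
 proof -
  have "summable p" unfolding p_def by (intro summable_add sb geo)
  moreover have "summable q" unfolding q_def by (rule geo)
  ultimately have "(\<Sum>n. p n) - (\<Sum>n. q n) = (\<Sum>n. p n - q n)" by (rule suminf_diff)
  then show ?thesis by (simp add: p_def q_def)
 qed
 show ?thesis
  using has_integral_diff[OF poisson_mixture_integral_nonneg[OF p r] poisson_mixture_integral_nonneg[OF q r]]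
  unfolding eq eq2 .
qed

lemma matrix_power_scaleR: "matrix_power (t *\<^sub>R B) n = t ^ n *\<^sub>R matrix_power B n"
 by (induction n) (simp_all add: matrix_power_0 matrix_power_Suc vec_eq_iff matrix_mult_component sum_distrib_left mult_ac)

lemma suminf_matrix_component:
 fixes f :: "nat \<Rightarrow> real ^ 'm ^ 'n"
 assumes "\<And>i j. summable (\<lambda>k. f k $ i $ j)"
 shows "(\<Sum>k. f k) $ i $ j = (\<Sum>k. f k $ i $ j)"
proof -
 have "f sums (\<chi> i j. \<Sum>k. f k $ i $ j)"
  unfolding sums_def
  by (intro vec_tendstoI) (simp add: sum_component summable_LIMSEQ assms)
 then show ?thesis by (simp add: sums_unique[symmetric])
qed

lemma matrix_add_rdistrib': "(B + C) ** D = B ** D + C ** D"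
 for B C D :: "real ^ 'n ^ 'n"
 by (simp add: vec_eq_iff matrix_mult_component distrib_right sum.distrib)

context qsd_chain begin

abbreviation Qs :: "real ^ 'd ^ 'd" where "Qs \<equiv> Qmat P \<theta>s"

text \<open>Uniformisation of the jump chain. With D = K - I the entries of the powers of K are
  binomial sums of those of the powers of D, so the series on the right is the Cauchy product of the
  series of exp (t D) with exp t.\<close>

lemma matrix_exp_generator:
 "matrix_exp (t *\<^sub>R (Ks - mat 1)) $ x $ y = exp (- t) * (\<Sum>n. Kn n $ x $ y / fact n * t ^ n)"
proof -
 define D where "D = Ks - mat 1"
 have Ks: "Ks = mat 1 + D" by (simp add: D_def)
 define d where "d n = matrix_power D n $ x $ y" for n
 have Dabs: "(\<Sum>z\<in>UNIV. \<bar>D $ x $ z\<bar>) \<le> 2" for x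
 proof -
  have "(\<Sum>z\<in>UNIV. \<bar>D $ x $ z\<bar>) \<le> (\<Sum>z\<in>UNIV. Ks $ x $ z + (mat 1 :: real ^ 'd ^ 'd) $ x $ z)"
   using Ks_nonneg by (intro sum_mono) (auto simp: D_def mat_def abs_if)
  also have "\<dots> = 2" by (simp add: sum.distrib Ks_row_sum mat_def)
  finally show ?thesis .
 qed
 have dbound: "\<bar>matrix_power D n $ x $ y\<bar> \<le> 2 ^ n" for n x y
 proof (induction n arbitrary: x)
  case (Suc n)
  have "\<bar>matrix_power D (Suc n) $ x $ y\<bar> \<le> (\<Sum>z\<in>UNIV. \<bar>D $ x $ z * matrix_power D n $ z $ y\<bar>)"
   unfolding matrix_power_Suc matrix_mult_component by (rule sum_abs)
  also have "\<dots> \<le> (\<Sum>z\<in>UNIV. \<bar>D $ x $ z\<bar> * 2 ^ n)"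
   unfolding abs_mult by (intro sum_mono mult_left_mono Suc) auto
  also have "\<dots> \<le> 2 * 2 ^ n" unfolding sum_distrib_right[symmetric] by (intro mult_right_mono Dabs) auto
  finally show ?case by simp
 qed (simp add: matrix_power_0 mat_def)
 have db: "\<bar>d n\<bar> \<le> 1 * 2 ^ n" for n using dbound by (simp add: d_def)
 have comm: "Kn n ** D = D ** Kn n" for n
 proof (induction n)
  case (Suc n)
  have KD: "Ks ** D = D ** Ks" unfolding Ks matrix_add_ldistrib matrix_add_rdistrib' by simp
  have "Kn (Suc n) ** D = Ks ** (D ** Kn n)" by (simp only: matrix_power_Suc matrix_mul_assoc[symmetric] Suc)
  also have "\<dots> = D ** Kn (Suc n)" by (simp only: matrix_power_Suc matrix_mul_assoc KD)
  finally show ?case .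
 qed (simp add: matrix_power_0)
 define f where "f n j = (Kn n ** matrix_power D j) $ x $ y" for n j
 have f: "f (Suc n) j = f n j + f n (Suc j)" for n j
 proof -
  have "Kn (Suc n) ** matrix_power D j = Kn n ** (Ks ** matrix_power D j)" by (simp only: matrix_power_Suc2 matrix_mul_assoc)
  also have "Ks ** matrix_power D j = matrix_power D j + matrix_power D (Suc j)"
   unfolding matrix_power_Suc Ks matrix_add_rdistrib' by simp
  finally show ?thesis by (simp add: f_def matrix_add_ldistrib)
 qed
 have K: "Kn n $ x $ y = (\<Sum>k\<le>n. real (n choose k) * d k)" for n
  using binomial_transform[of f, OF f, of n 0] by (simp add: f_def d_def matrix_power_0)
 have sd: "summable (\<lambda>k. norm (d k / fact k * t ^ k))" using summable_exp_bounded(1)[of d 1 2, OF db] by simp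
 have se: "summable (\<lambda>k. norm (t ^ k /\<^sub>R fact k))" by (rule summable_norm_exp)
 have "(\<lambda>n. \<Sum>k\<le>n. (d k / fact k * t ^ k) * (t ^ (n - k) /\<^sub>R fact (n - k))) sums
   ((\<Sum>k. d k / fact k * t ^ k) * (\<Sum>k. t ^ k /\<^sub>R fact k))"
  by (rule Cauchy_product_sums[OF sd se])
 moreover have "(\<Sum>k\<le>n. (d k / fact k * t ^ k) * (t ^ (n - k) /\<^sub>R fact (n - k))) = Kn n $ x $ y / fact n * t ^ n" for n
  unfolding K sum_divide_distrib sum_distrib_right
 proof (intro sum.cong refl)
  fix k assume "k \<in> {..n}"
  then have k: "k \<le> n" by simp
  have "t ^ k * t ^ (n - k) = t ^ n" using k by (simp add: power_add[symmetric])
  then show "d k / fact k * t ^ k * (t ^ (n - k) /\<^sub>R fact (n - k)) = real (n choose k) * d k / fact n * t ^ n"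
   by (simp add: binomial_fact[OF k] field_simps)
 qed
 ultimately have "(\<lambda>n. Kn n $ x $ y / fact n * t ^ n) sums ((\<Sum>k. d k / fact k * t ^ k) * exp t)"
  by (simp add: exp_def)
 then have 1: "(\<Sum>n. Kn n $ x $ y / fact n * t ^ n) = (\<Sum>k. d k / fact k * t ^ k) * exp t" by (rule sums_unique[symmetric])
 have comp: "((1 / fact n) *\<^sub>R matrix_power (t *\<^sub>R D) n) $ i $ j = matrix_power D n $ i $ j / fact n * t ^ n" for n i j
  by (simp add: matrix_power_scaleR)
 have sm: "summable (\<lambda>n. ((1 / fact n) *\<^sub>R matrix_power (t *\<^sub>R D) n) $ i $ j)" for i j
  unfolding comp by (rule summable_exp_bounded(2)[of _ 1 2]) (use dbound in simp)
 have "matrix_exp (t *\<^sub>R D) $ x $ y = (\<Sum>n. d n / fact n * t ^ n)"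
  unfolding matrix_exp_def suminf_matrix_component[OF sm] comp d_def ..
 then show ?thesis unfolding 1 by (simp add: D_def exp_minus)
qed

text \<open>Integrating the Poisson mean of K^n - \<Pi> over all times gives the sum over n, since a
  rate-one Poisson process spends mean time one at each level. From here on only the series is
  used.\<close>

lemma Qs_eq_sums: "(\<lambda>n. Kn n $ x $ y - \<theta>s $ y) sums (Qs $ x $ y)"
 and Qs_eq: "Qs $ x $ y = (\<Sum>n. Kn n $ x $ y - \<theta>s $ y)"
proof -
 obtain C r where r: "0 < r" "r < 1" and b: "\<And>n x y. \<bar>Kn n $ x $ y - \<theta>s $ y\<bar> \<le> C * r ^ n"
  by (rule Kn_geometric) blast
 define Z :: "real ^ 'd ^ 'd" where "Z = (\<chi> x y. \<Sum>n. Kn n $ x $ y - \<theta>s $ y)"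
 have Kb: "\<bar>Kn n $ x $ y\<bar> \<le> 1 * 1 ^ n" for n x y
 proof -
  have "Kn n $ x $ y \<le> (\<Sum>y\<in>UNIV. Kn n $ x $ y)" by (rule member_le_sum) (auto intro: Kn_nonneg)
  then show ?thesis using Kn_nonneg[of n x y] by (simp add: Kn_row_sum)
 qed
 have comp: "(matrix_exp (t *\<^sub>R (Ks - mat 1)) - Pimat P \<theta>s) $ x $ y
   = exp (- t) * (\<Sum>n. (Kn n $ x $ y - \<theta>s $ y) / fact n * t ^ n)" for t x y
 proof -
  have s1: "summable (\<lambda>n. Kn n $ x $ y / fact n * t ^ n)" by (rule summable_exp_bounded(2)[OF Kb])
  have s2: "(\<lambda>n. \<theta>s $ y * (t ^ n /\<^sub>R fact n)) sums (\<theta>s $ y * exp t)" by (intro sums_mult exp_converges)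
  have "(\<Sum>n. (Kn n $ x $ y - \<theta>s $ y) / fact n * t ^ n) = (\<Sum>n. Kn n $ x $ y / fact n * t ^ n - \<theta>s $ y * (t ^ n /\<^sub>R fact n))"
   by (intro suminf_cong) (simp add: field_simps)
  also have "\<dots> = (\<Sum>n. Kn n $ x $ y / fact n * t ^ n) - \<theta>s $ y * exp t"
   using suminf_diff[OF s1 sums_summable[OF s2]] sums_unique[OF s2] by simp
  finally have S: "(\<Sum>n. (Kn n $ x $ y - \<theta>s $ y) / fact n * t ^ n) = (\<Sum>n. Kn n $ x $ y / fact n * t ^ n) - \<theta>s $ y * exp t" .
  have e1: "exp (- t) * (a * exp t) = a" for a :: real by (simp add: exp_minus)
  show ?thesis unfolding vector_minus_component matrix_exp_generator S right_diff_distrib e1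
   by (simp only: Pimat_def invariant_dist_theta vec_lambda_beta)
 qed
 have "((\<lambda>t. matrix_exp (t *\<^sub>R (Ks - mat 1)) - Pimat P \<theta>s) has_integral Z) {0..}"
 proof (rule has_integral_componentwise_iff[THEN iffD2], rule ballI)
  fix B :: "real ^ 'd ^ 'd" assume "B \<in> Basis"
  then obtain i j where B: "B = axis i (axis j 1)" unfolding Basis_vec_def by auto
  have inn: "M \<bullet> B = M $ i $ j" for M :: "real ^ 'd ^ 'd" unfolding B by (simp add: inner_axis)
  show "((\<lambda>t. (matrix_exp (t *\<^sub>R (Ks - mat 1)) - Pimat P \<theta>s) \<bullet> B) has_integral (Z \<bullet> B)) {0..}"
   unfolding inn comp using poisson_mixture_integral[of "\<lambda>n. Kn n $ i $ j - \<theta>s $ j" C r, OF b r] unfolding Z_def by (simp only: vec_lambda_beta)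
 qed
 then have "Qs = Z" unfolding Qmat_def by (rule integral_unique)
 then show *: "Qs $ x $ y = (\<Sum>n. Kn n $ x $ y - \<theta>s $ y)" for x y by (simp add: Z_def)
 have "summable (\<lambda>n. Kn n $ x $ y - \<theta>s $ y)"
  by (rule summable_comparison_test'[of "\<lambda>n. C * r ^ n" 0]) (use b r in \<open>auto intro!: summable_mult summable_geometric\<close>)
 then show "(\<lambda>n. Kn n $ x $ y - \<theta>s $ y) sums (Qs $ x $ y)" unfolding * by (rule summable_sums)
qed

lemma Qs_row_sum: "(\<Sum>y\<in>UNIV. Qs $ x $ y) = 0"
proof -
 have "(\<lambda>n. \<Sum>y\<in>UNIV. Kn n $ x $ y - \<theta>s $ y) sums (\<Sum>y\<in>UNIV. Qs $ x $ y)"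
  by (intro sums_sum Qs_eq_sums)
 then have "(\<lambda>n::nat. 0) sums (\<Sum>y\<in>UNIV. Qs $ x $ y)" by (simp add: sum_subtractf Kn_row_sum theta_sum)
 then show ?thesis using sums_unique2[OF _ sums_zero] by blast
qed

lemma Qs_poisson: "Qs $ x $ y - (Ks ** Qs) $ x $ y = (if x = y then 1 else 0) - \<theta>s $ y"
proof -
 have "(\<lambda>n. \<Sum>z\<in>UNIV. Ks $ x $ z * (Kn n $ z $ y - \<theta>s $ y)) sums (Ks ** Qs) $ x $ y"
  unfolding matrix_mult_component by (intro sums_sum sums_mult Qs_eq_sums)
 moreover have "(\<Sum>z\<in>UNIV. Ks $ x $ z * (Kn n $ z $ y - \<theta>s $ y)) = Kn (Suc n) $ x $ y - \<theta>s $ y" for n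
  unfolding matrix_power_Suc matrix_mult_component
  by (simp add: right_diff_distrib sum_subtractf sum_distrib_right[symmetric] Ks_row_sum)
 ultimately have "(\<lambda>n. Kn (Suc n) $ x $ y - \<theta>s $ y) sums (Ks ** Qs) $ x $ y" by simp
 have "(\<lambda>n. Kn n $ x $ y - \<theta>s $ y) sums ((Ks ** Qs) $ x $ y + (Kn 0 $ x $ y - \<theta>s $ y))"
  using \<open>(\<lambda>n. Kn (Suc n) $ x $ y - \<theta>s $ y) sums (Ks ** Qs) $ x $ y\<close> by (subst sums_Suc_iff[symmetric])
 then have "Qs $ x $ y = (Ks ** Qs) $ x $ y + (Kn 0 $ x $ y - \<theta>s $ y)" using sums_unique2[OF Qs_eq_sums] by blast
 then show ?thesis by (simp add: matrix_power_0 mat_def)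
qed

lemma sum_vector_Qs: "(\<Sum>y\<in>UNIV. (v v* Qs) $ y) = 0"
proof -
 have "(\<Sum>y\<in>UNIV. (v v* Qs) $ y) = (\<Sum>x\<in>UNIV. v $ x * (\<Sum>y\<in>UNIV. Qs $ x $ y))"
  unfolding vector_matrix_component sum_distrib_left by (rule sum.swap)
 then show ?thesis by (simp add: Qs_row_sum)
qed

lemma poisson_decomposition: "v v* Qs - (v v* Ks) v* Qs = v - (\<Sum>x\<in>UNIV. v $ x) *\<^sub>R \<theta>s"
proof -
 have "(v v* Qs - (v v* Ks) v* Qs) $ y = (\<Sum>x\<in>UNIV. v $ x * (Qs $ x $ y - (Ks ** Qs) $ x $ y))" for y
  unfolding vector_matrix_mul_assoc by (simp add: vector_matrix_component right_diff_distrib sum_subtractf)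
 then show ?thesis
  by (simp add: vec_eq_iff Qs_poisson right_diff_distrib sum_subtractf sum_distrib_right if_distrib[of "\<lambda>t. _ * t"] cong: if_cong)
qed


text \<open>An exact formula, not a linearisation: p - p K[\<theta>s] = (p \<bullet> q0) (\<nu> -
  \<theta>s) for the invariant p of K[\<nu>], and the Poisson equation inverts I - K[\<theta>s] on
  it.\<close>

lemma invariant_dist_expansion:
 assumes \<nu>: "\<nu> \<in> prob_simplex"
 shows "invariant_dist P \<nu> - \<theta>s = (invariant_dist P \<nu> \<bullet> q0) *\<^sub>R ((\<nu> - \<theta>s) v* Qs)"
proof -
 define p where "p = invariant_dist P \<nu>"
 have inv: "p = p v* P0 + (p \<bullet> q0) *\<^sub>R \<nu>"
  using invariant_dist_invariant[OF \<nu>] unfolding vector_Kmat p_def by simp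
 have "p - p v* Ks = (p \<bullet> q0) *\<^sub>R (\<nu> - \<theta>s)"
  unfolding vector_Kmat by (subst (1) inv) (simp add: algebra_simps)
 then have "(p - p v* Ks) v* Qs = (p \<bullet> q0) *\<^sub>R ((\<nu> - \<theta>s) v* Qs)" by (simp only: vector_matrix_scaleR)
 moreover have "(p - p v* Ks) v* Qs = p - \<theta>s"
  using poisson_decomposition[of p] invariant_dist_simplex[OF \<nu>]
  by (simp only: vector_matrix_mult_diff_distrib) (simp add: p_def prob_simplex_def)
 ultimately show ?thesis by (simp only: p_def)
qed

lemma linear_vector_Qs: "bounded_linear (\<lambda>v. v v* Qs)"
 by (intro linear_conv_bounded_linear[THEN iffD1] linearI)
  (simp_all add: vector_matrix_left_distrib vector_matrix_scaleR)

text \<open>In the exact expansion only the scalar factor depends on \<nu>. It differs from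
  \<open>cs\<close> by a term of first order in \<nu> - \<theta>s, so the remainder is
  quadratic.\<close>

lemma hfield_has_derivative:
 "(hfield P has_derivative (\<lambda>v. cs *\<^sub>R (v v* Qs) - v)) (at \<theta>s within prob_simplex)"
 unfolding has_derivative_at_within
proof
 show "bounded_linear (\<lambda>v. cs *\<^sub>R (v v* Qs) - v)"
  by (intro bounded_linear_sub bounded_linear_const_scaleR bounded_linear_ident linear_vector_Qs)
 obtain B where B: "0 < B" "\<And>v. norm (v v* Qs) \<le> norm v * B"
  using bounded_linear.pos_bounded[OF linear_vector_Qs] by blast
 define R where "R = (\<lambda>\<nu>. (hfield P \<nu> - hfield P \<theta>s - (cs *\<^sub>R ((\<nu> - \<theta>s) v* Qs) - (\<nu> - \<theta>s))) /\<^sub>R norm (\<nu> - \<theta>s))"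
 define C where "C = norm q0 * B * norm q0 * B"
 have bound: "norm (R \<nu>) \<le> C * norm (\<nu> - \<theta>s)" if \<nu>: "\<nu> \<in> prob_simplex" "\<nu> \<noteq> \<theta>s" for \<nu>
 proof -
  define p where "p = invariant_dist P \<nu>"
  define w where "w = (\<nu> - \<theta>s) v* Qs"
  have w: "norm w \<le> norm (\<nu> - \<theta>s) * B" unfolding w_def by (rule B)
  have exp: "p - \<theta>s = (p \<bullet> q0) *\<^sub>R w" unfolding p_def w_def by (rule invariant_dist_expansion[OF \<nu>(1)])
  have "norm p \<le> l1 p" by (rule norm_le_l1)
  also have "l1 p = 1" using invariant_dist_simplex[OF \<nu>(1)] by (simp add: l1_def p_def prob_simplex_def)
  finally have "\<bar>p \<bullet> q0\<bar> \<le> norm q0"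
   using Cauchy_Schwarz_ineq2[of p q0] mult_right_mono[of "norm p" 1 "norm q0"] by simp
  then have "norm (p - \<theta>s) \<le> norm q0 * (norm (\<nu> - \<theta>s) * B)"
   unfolding exp norm_scaleR using w by (intro mult_mono) auto
  then have "\<bar>(p - \<theta>s) \<bullet> q0\<bar> \<le> norm q0 * (norm (\<nu> - \<theta>s) * B) * norm q0"
   using Cauchy_Schwarz_ineq2[of "p - \<theta>s" q0] by (meson mult_right_mono norm_ge_zero order_trans)
  moreover have "hfield P \<nu> - hfield P \<theta>s - (cs *\<^sub>R w - (\<nu> - \<theta>s)) = ((p - \<theta>s) \<bullet> q0) *\<^sub>R w"
  proof -
   have "hfield P \<nu> - hfield P \<theta>s - (cs *\<^sub>R w - (\<nu> - \<theta>s)) = (p - \<theta>s) - cs *\<^sub>R w"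
    by (simp add: hfield_def p_def invariant_dist_theta)
   also have "\<dots> = (p \<bullet> q0) *\<^sub>R w - (\<theta>s \<bullet> q0) *\<^sub>R w" unfolding exp cs_def ..
   finally show ?thesis by (simp add: inner_diff_left scaleR_diff_left)
  qed
  ultimately have "norm (hfield P \<nu> - hfield P \<theta>s - (cs *\<^sub>R w - (\<nu> - \<theta>s)))
    \<le> (norm q0 * (norm (\<nu> - \<theta>s) * B) * norm q0) * (norm (\<nu> - \<theta>s) * B)"
   using w B(1) by (simp only: norm_scaleR) (intro mult_mono, auto)
  also have "\<dots> = C * norm (\<nu> - \<theta>s) * norm (\<nu> - \<theta>s)" by (simp add: C_def)
  finally have "norm (hfield P \<nu> - hfield P \<theta>s - (cs *\<^sub>R w - (\<nu> - \<theta>s))) / norm (\<nu> - \<theta>s) \<le> C * norm (\<nu> - \<theta>s)"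
   using \<nu>(2) by (simp add: pos_divide_le_eq)
  then show ?thesis by (simp add: R_def w_def divide_inverse mult.commute)
 qed
 have "(R \<longlongrightarrow> 0) (at \<theta>s within prob_simplex)"
 proof (rule Lim_null_comparison)
  show "eventually (\<lambda>\<nu>. norm (R \<nu>) \<le> C * norm (\<nu> - \<theta>s)) (at \<theta>s within prob_simplex)"
   unfolding eventually_at_filter using bound by (intro always_eventually) auto
  have "((\<lambda>\<nu>. C * norm (\<nu> - \<theta>s)) \<longlongrightarrow> C * norm (\<theta>s - \<theta>s)) (at \<theta>s within prob_simplex)"
   by (intro tendsto_intros)
  then show "((\<lambda>\<nu>. C * norm (\<nu> - \<theta>s)) \<longlongrightarrow> 0) (at \<theta>s within prob_simplex)" by simp
 qed
 then show "((\<lambda>y. (hfield P y - hfield P \<theta>s - (cs *\<^sub>R ((y - \<theta>s) v* Qs) - (y - \<theta>s))) /\<^sub>R norm (y - \<theta>s)) \<longlongrightarrow> 0)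
   (at \<theta>s within prob_simplex)" by (simp only: R_def)
qed

text \<open>\<open>frechet_derivative\<close> selects one of many derivatives, because the simplex
  has empty interior. Along a line through \<theta>s in a tangent direction all choices agree, being
  the derivative of the same function of one real variable.\<close>

lemma h_jacobian_tangent:
 assumes v: "(\<Sum>i\<in>UNIV. v $ i) = 0"
 shows "h_jacobian P \<theta>s v = cs *\<^sub>R (v v* Qs) - v"
proof -
 define D where "D = h_jacobian P \<theta>s"
 have D: "(hfield P has_derivative D) (at \<theta>s within prob_simplex)"
  unfolding D_def h_jacobian_def frechet_derivative_works[symmetric]
  using hfield_has_derivative by (rule differentiableI)
 define m where "m = Min (range (($) \<theta>s))"
 have m: "m \<le> \<theta>s $ i" for i unfolding m_def by (rule Min_le) auto
 have "m \<in> range (($) \<theta>s)" unfolding m_def by (rule Min_in) auto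
 then have m0: "0 < m" using theta_pos by auto
 \<comment> \<open>\<theta>s has all coordinates at least m > 0, so the segment of parameter length
   e around it stays in the simplex.\<close>
 define e where "e = m / (norm v + 1)"
 have e0: "0 < e" unfolding e_def using m0 by (simp add: add_nonneg_pos)
 define T where "T = ball (0::real) e"
 have sub: "(\<lambda>t. \<theta>s + t *\<^sub>R v) ` T \<subseteq> prob_simplex"
 proof (rule image_subsetI)
  fix t assume "t \<in> T"
  then have t: "\<bar>t\<bar> \<le> e" by (simp add: T_def dist_real_def)
  have "0 \<le> \<theta>s $ i + t * v $ i" for i
  proof -
   have "\<bar>t * v $ i\<bar> \<le> e * (norm v + 1)" unfolding abs_mult
    using t component_le_norm_cart[of v i] e0 by (intro mult_mono) auto
   also have "\<dots> = m" unfolding e_def using norm_ge_zero[of v] by (simp add: add_nonneg_eq_0_iff)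
   finally show ?thesis using m[of i] by linarith
  qed
  then show "\<theta>s + t *\<^sub>R v \<in> prob_simplex"
   by (simp add: prob_simplex_def sum.distrib theta_sum sum_distrib_left[symmetric] v)
 qed
 have g: "((\<lambda>t. \<theta>s + t *\<^sub>R v) has_derivative (\<lambda>t. t *\<^sub>R v)) (at 0 within T)"
  by (auto intro!: derivative_eq_intros)
 have comp: "((\<lambda>t. hfield P (\<theta>s + t *\<^sub>R v)) has_derivative (\<lambda>t. E (t *\<^sub>R v))) (at 0)"
  if E: "(hfield P has_derivative E) (at \<theta>s within prob_simplex)" for E
 proof -
  have "(hfield P has_derivative E) (at (\<theta>s + 0 *\<^sub>R v) within (\<lambda>t. \<theta>s + t *\<^sub>R v) ` T)"
   using has_derivative_subset[OF E sub] by simp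
  from has_derivative_in_compose[OF g this]
  have "((\<lambda>t. hfield P (\<theta>s + t *\<^sub>R v)) has_derivative (\<lambda>t. E (t *\<^sub>R v))) (at 0 within T)" .
  then show ?thesis using e0 by (subst (asm) at_within_open) (auto simp: T_def)
 qed
 have "(\<lambda>t. D (t *\<^sub>R v)) = (\<lambda>t. cs *\<^sub>R ((t *\<^sub>R v) v* Qs) - t *\<^sub>R v)"
  by (rule has_derivative_unique[OF comp[OF D] comp[OF hfield_has_derivative]])
 from fun_cong[OF this, of 1] show ?thesis by (simp add: D_def)
qed

text \<open>The Jacobian on the tangent space, extended by \<open>-L\<close> on the direction \<open>\<theta>s\<close>, which keeps all
 eigenvalues in the half-plane \<open>Re c \<le> -L\<close>.\<close>

definition Jm :: "real \<Rightarrow> real ^ 'd ^ 'd" where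
 "Jm L = (\<chi> i j. cs * Qs $ j $ i - (if i = j then 1 else 0) - (L - 1) * \<theta>s $ i)"

lemma Jm_vector: "Jm L *v v = cs *\<^sub>R (v v* Qs) - v - ((L - 1) * (\<Sum>i\<in>UNIV. v $ i)) *\<^sub>R \<theta>s"
proof -
 have "(Jm L *v v) $ i = (cs *\<^sub>R (v v* Qs) - v - ((L - 1) * (\<Sum>i\<in>UNIV. v $ i)) *\<^sub>R \<theta>s) $ i" for i
 proof -
  have "(Jm L *v v) $ i = (\<Sum>j\<in>UNIV. cs * (v $ j * Qs $ j $ i) - (if i = j then v $ j else 0) - (L - 1) * \<theta>s $ i * v $ j)"
   unfolding matrix_vector_component by (intro sum.cong refl) (auto simp: Jm_def algebra_simps)
  also have "\<dots> = cs * (\<Sum>j\<in>UNIV. v $ j * Qs $ j $ i) - v $ i - (L - 1) * \<theta>s $ i * (\<Sum>j\<in>UNIV. v $ j)"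
   by (simp add: sum_subtractf sum_distrib_left)
  finally show ?thesis by (simp add: vector_matrix_component mult_ac)
 qed
 then show ?thesis by (simp add: vec_eq_iff)
qed

lemma Jm_tangent: "(\<Sum>i\<in>UNIV. v $ i) = 0 \<Longrightarrow> Jm L *v v = h_jacobian P \<theta>s v"
 by (simp add: Jm_vector h_jacobian_tangent)

lemma sum_Jm: "(\<Sum>i\<in>UNIV. (Jm L *v v) $ i) = - L * (\<Sum>i\<in>UNIV. v $ i)"
proof -
 define s where "s = (\<Sum>i\<in>UNIV. v $ i)"
 have "(\<Sum>i\<in>UNIV. (Jm L *v v) $ i) = cs * (\<Sum>i\<in>UNIV. (v v* Qs) $ i) - s - (L - 1) * s * (\<Sum>i\<in>UNIV. \<theta>s $ i)"
  unfolding Jm_vector s_def[symmetric] vector_minus_component vector_scaleR_component sum_subtractf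
  by (simp add: sum_distrib_left[symmetric] s_def[symmetric])
 then show ?thesis unfolding sum_vector_Qs theta_sum s_def[symmetric] by (simp add: algebra_simps)
qed

text \<open>\<open>Jm L\<close> multiplies coordinate sums by -L. An eigenvector with sum zero is
  tangent, where the spectral hypothesis applies; any other one has eigenvalue exactly -L.\<close>

lemma Jm_eigenvalue:
 assumes L: "\<And>c. tangent_eigenvalue (h_jacobian P \<theta>s) c \<Longrightarrow> Re c \<le> - L"
  and z: "z \<noteq> 0" "complexify ((*v) (Jm L)) z = c *s z"
 shows "Re c \<le> - L"
proof -
 define zr zi where "zr = (\<chi> j. Re (z $ j))" and "zi = (\<chi> j. Im (z $ j))"
 have s: "(\<Sum>i\<in>UNIV. z $ i) = Complex (\<Sum>i\<in>UNIV. zr $ i) (\<Sum>i\<in>UNIV. zi $ i)"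
  by (simp add: zr_def zi_def complex_eq_iff)
 have "c * (\<Sum>i\<in>UNIV. z $ i) = (\<Sum>i\<in>UNIV. complexify ((*v) (Jm L)) z $ i)"
  unfolding z(2) by (simp add: sum_distrib_left)
 also have "\<dots> = Complex (\<Sum>i\<in>UNIV. (Jm L *v zr) $ i) (\<Sum>i\<in>UNIV. (Jm L *v zi) $ i)"
  unfolding complexify_def zr_def[symmetric] zi_def[symmetric] by (simp add: complex_eq_iff)
 also have "\<dots> = - of_real L * (\<Sum>i\<in>UNIV. z $ i)" unfolding sum_Jm s by (simp add: complex_eq_iff)
 finally have c: "(c + of_real L) * (\<Sum>i\<in>UNIV. z $ i) = 0" by (simp add: algebra_simps)
 show ?thesis
 proof (cases "(\<Sum>i\<in>UNIV. z $ i) = 0")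
  case True
  then have "(\<Sum>i\<in>UNIV. zr $ i) = 0" "(\<Sum>i\<in>UNIV. zi $ i) = 0" unfolding s by (auto simp: complex_eq_iff)
  then have "complexify (h_jacobian P \<theta>s) z = c *s z"
   using z(2) unfolding complexify_def zr_def[symmetric] zi_def[symmetric] by (simp add: Jm_tangent)
  then show ?thesis using L z(1) True unfolding tangent_eigenvalue_def by blast
 next
  case False
  then have "c = - of_real L" using c by (simp add: eq_neg_iff_add_eq_0)
  then show ?thesis by simp
 qed
qed

text \<open>The variance of the function w after one step of K[\<nu>] from x.\<close>

definition cvar :: "real ^ 'd \<Rightarrow> 'd \<Rightarrow> real ^ 'd \<Rightarrow> real" where
 "cvar \<nu> x w = (\<Sum>y\<in>UNIV. Kmat P \<nu> $ x $ y * (w $ y)\<^sup>2) - (\<Sum>y\<in>UNIV. Kmat P \<nu> $ x $ y * w $ y)\<^sup>2"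

abbreviation Us :: "real ^ 'd ^ 'd" where "Us \<equiv> Umat P \<theta>s"

lemma quadratic_sum_product: "(\<Sum>x\<in>UNIV. u $ x * (\<Sum>y\<in>UNIV. a x * a y * u $ y)) = (\<Sum>x\<in>UNIV. a x * u $ x)\<^sup>2"
 for u :: "real ^ 'n"
proof -
 have "(\<Sum>y\<in>UNIV. a x * a y * u $ y) = a x * (\<Sum>y\<in>UNIV. a y * u $ y)" for x
  unfolding sum_distrib_left by (simp add: mult.assoc)
 then show ?thesis unfolding power2_eq_square sum_distrib_right by (simp add: mult_ac)
qed

text \<open>F(z) is the covariance matrix of the row of Q at the state reached from z, so its
  quadratic form is the variance of the function Q u.\<close>

lemma Fmat_quadratic: "u \<bullet> (Fmat P \<theta>s z *v u) = cvar \<theta>s z (Qs *v u)"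
proof -
 have "u \<bullet> (Fmat P \<theta>s z *v u) = (\<Sum>x\<in>UNIV. u $ x * (\<Sum>y\<in>UNIV. (\<Sum>w\<in>UNIV. Ks $ z $ w * Qs $ w $ x * Qs $ w $ y) * u $ y))
   - (\<Sum>x\<in>UNIV. u $ x * (\<Sum>y\<in>UNIV. (Ks ** Qs) $ z $ x * (Ks ** Qs) $ z $ y * u $ y))"
  by (simp add: inner_vec_def matrix_vector_component Fmat_def left_diff_distrib sum_subtractf right_diff_distrib)
 also have "(\<Sum>x\<in>UNIV. u $ x * (\<Sum>y\<in>UNIV. (\<Sum>w\<in>UNIV. Ks $ z $ w * Qs $ w $ x * Qs $ w $ y) * u $ y))
   = (\<Sum>w\<in>UNIV. Ks $ z $ w * (\<Sum>x\<in>UNIV. u $ x * (\<Sum>y\<in>UNIV. Qs $ w $ x * Qs $ w $ y * u $ y)))"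
 proof -
  have "(\<Sum>x\<in>UNIV. u $ x * (\<Sum>y\<in>UNIV. (\<Sum>w\<in>UNIV. Ks $ z $ w * Qs $ w $ x * Qs $ w $ y) * u $ y))
    = (\<Sum>x\<in>UNIV. \<Sum>y\<in>UNIV. \<Sum>w\<in>UNIV. Ks $ z $ w * (u $ x * (Qs $ w $ x * Qs $ w $ y * u $ y)))"
   unfolding sum_distrib_left sum_distrib_right by (intro sum.cong refl) (simp add: mult_ac)
  also have "\<dots> = (\<Sum>x\<in>UNIV. \<Sum>w\<in>UNIV. \<Sum>y\<in>UNIV. Ks $ z $ w * (u $ x * (Qs $ w $ x * Qs $ w $ y * u $ y)))"
   by (intro sum.cong refl sum.swap)
  also have "\<dots> = (\<Sum>w\<in>UNIV. \<Sum>x\<in>UNIV. \<Sum>y\<in>UNIV. Ks $ z $ w * (u $ x * (Qs $ w $ x * Qs $ w $ y * u $ y)))"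
   by (rule sum.swap)
  finally show ?thesis unfolding sum_distrib_left .
 qed
 also have "\<dots> = (\<Sum>w\<in>UNIV. Ks $ z $ w * ((Qs *v u) $ w)\<^sup>2)"
  unfolding quadratic_sum_product by (simp add: matrix_vector_component)
 also have "(\<Sum>x\<in>UNIV. u $ x * (\<Sum>y\<in>UNIV. (Ks ** Qs) $ z $ x * (Ks ** Qs) $ z $ y * u $ y)) = (((Ks ** Qs) *v u) $ z)\<^sup>2"
  unfolding quadratic_sum_product by (simp add: matrix_vector_component)
 also have "(Ks ** Qs) *v u = Ks *v (Qs *v u)" by (simp add: matrix_vector_mul_assoc)
 finally show ?thesis by (simp add: cvar_def matrix_vector_component)
qed

lemma Us_component: "Us $ x $ y = (\<Sum>w\<in>UNIV. \<theta>s $ w * Fmat P \<theta>s w $ x $ y)"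
 by (simp add: Umat_def sum_component)

lemma Us_quadratic: "u \<bullet> (Us *v u) = (\<Sum>w\<in>UNIV. \<theta>s $ w * cvar \<theta>s w (Qs *v u))"
proof -
 have lin: "linear (\<lambda>B :: real ^ 'd ^ 'd. u \<bullet> (B *v u))"
  by (rule linearI) (simp_all add: matrix_vector_mult_add_rdistrib inner_add_right scaleR_matrix_vector_assoc[symmetric])
 show ?thesis unfolding Umat_def linear_sum[OF lin] linear_cmul[OF lin] Fmat_quadratic by simp
qed

lemma Us_symmetric: "transpose Us = Us"
 by (simp add: vec_eq_iff transpose_def Us_component Fmat_def mult_ac)

text \<open>The rows of Q sum to zero, hence so do those of the covariance matrices: the noise is
  tangent to the simplex. This makes the Lyapunov solution tangent as well.\<close>

lemma Us_column_sum: "(\<Sum>x\<in>UNIV. Us $ x $ y) = 0"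
proof -
 have KQ: "(\<Sum>x\<in>UNIV. (Ks ** Qs) $ z $ x) = 0" for z
  unfolding matrix_mult_component by (subst sum.swap) (simp add: sum_distrib_left[symmetric] Qs_row_sum)
 have "(\<Sum>x\<in>UNIV. Fmat P \<theta>s z $ x $ y) = 0" for z
 proof -
  have "(\<Sum>x\<in>UNIV. \<Sum>u\<in>UNIV. Ks $ z $ u * Qs $ u $ x * Qs $ u $ y) = (\<Sum>u\<in>UNIV. Ks $ z $ u * (\<Sum>x\<in>UNIV. Qs $ u $ x) * Qs $ u $ y)"
   by (subst sum.swap) (simp add: sum_distrib_left sum_distrib_right)
  then show ?thesis by (simp add: Fmat_def sum_subtractf sum_distrib_right[symmetric] KQ Qs_row_sum)
 qed
 then show ?thesis unfolding Us_component by (subst sum.swap) (simp add: sum_distrib_left[symmetric])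
qed

text \<open>Moving c / 2 times the identity into the drift on both sides absorbs the term c V. The
  extension \<open>Jm L\<close> to the whole space makes the equation one for all matrices; symmetry
  and tangency of its solution are then derived.\<close>

lemma lyapunov_solution_unique:
 assumes N: "adapted_norm ((*v) (Jm L + (c / 2) *\<^sub>R mat 1)) \<kappa> N"
  and N': "adapted_norm ((*v) (transpose (Jm L + (c / 2) *\<^sub>R mat 1))) \<kappa>' N'"
  and pos: "\<kappa> > 0" "\<kappa>' > 0" and cL: "c / 2 < L"
 shows "\<exists>!V. lyapunov_solution Us (h_jacobian P \<theta>s) c V"
  and "\<And>V. lyapunov_solution Us (h_jacobian P \<theta>s) c V \<Longrightarrow>
   Us + (Jm L + (c / 2) *\<^sub>R mat 1) ** V + V ** transpose (Jm L + (c / 2) *\<^sub>R mat 1) = 0"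
proof -
 let ?J = "Jm L + (c / 2) *\<^sub>R mat 1"
 have scl: "((c / 2) *\<^sub>R mat 1) ** V = (c / 2) *\<^sub>R V" "V ** ((c / 2) *\<^sub>R mat 1) = (c / 2) *\<^sub>R V" for V :: "real ^ 'd ^ 'd"
  by (simp_all add: vec_eq_iff matrix_mult_component mat_def if_distrib[of "\<lambda>t. t * _"] if_distrib[of "\<lambda>t. _ * t"]
    if_distrib[of "\<lambda>t. _ * t / _"] cong: if_cong)
 have tr: "transpose ?J = transpose (Jm L) + (c / 2) *\<^sub>R mat 1"
  by (simp add: vec_eq_iff transpose_def mat_def eq_commute)
 have expand: "?J ** V + V ** transpose ?J = Jm L ** V + V ** transpose (Jm L) + c *\<^sub>R V" for V
  unfolding tr matrix_add_ldistrib matrix_add_rdistrib' scl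
  by (simp add: vec_eq_iff)
 have colw: "columnwise (h_jacobian P \<theta>s) V = Jm L ** V" if "\<And>j. column j V \<in> tangent" for V
 proof -
  have "h_jacobian P \<theta>s (column j V) = Jm L *v column j V" for j
   using that[of j] by (simp add: tangent_def Jm_tangent)
  then show ?thesis by (simp add: columnwise_def vec_eq_iff matrix_vector_component matrix_mult_component column_def)
 qed
 have tr2: "transpose (Jm L ** V) = V ** transpose (Jm L)" if "transpose V = V" for V
  using that by (simp add: matrix_transpose_mul)
 have iff: "Us + ?J ** V + V ** transpose ?J = 0 \<longleftrightarrow> Us + Jm L ** V + V ** transpose (Jm L) + c *\<^sub>R V = 0" for V
  using expand[of V] by (simp only: add.assoc)
 show *: "Us + ?J ** V + V ** transpose ?J = 0" if "lyapunov_solution Us (h_jacobian P \<theta>s) c V" for V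
  using that unfolding iff lyapunov_solution_def by (auto simp: colw tr2)
 from lyapunov_equation_unique_solution[OF N' pos(2), of Us]
 obtain V where V: "Us + ?J ** V + V ** transpose ?J = 0"
  and uniq: "\<And>V'. Us + ?J ** V' + V' ** transpose ?J = 0 \<Longrightarrow> V' = V" by blast
 \<comment> \<open>The transpose of V solves the same equation, so uniqueness makes V
   symmetric.\<close>
 have sym: "transpose V = V"
 proof (rule uniq)
  have "transpose (Us + ?J ** V + V ** transpose ?J) = 0" unfolding V by (simp add: transpose_def vec_eq_iff)
  moreover have "transpose (Us + ?J ** V + V ** transpose ?J) = transpose Us + transpose (?J ** V) + transpose (V ** transpose ?J)"
   by (simp add: transpose_def vec_eq_iff)
  ultimately show "Us + ?J ** transpose V + transpose V ** transpose ?J = 0"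
   by (simp add: matrix_transpose_mul Us_symmetric add_ac)
 qed
 \<comment> \<open>The column sums: summing the equation over rows makes s an eigenvector with the
   positive eigenvalue L - c / 2, hence zero.\<close>
 define s :: "real ^ 'd" where "s = (\<chi> j. \<Sum>i\<in>UNIV. V $ i $ j)"
 have "?J *v s = (L - c / 2) *\<^sub>R s"
 proof -
  have "(\<Sum>i\<in>UNIV. (Us + Jm L ** V + V ** transpose (Jm L) + c *\<^sub>R V) $ i $ j) = 0" for j
   using V unfolding iff by simp
  moreover have "(\<Sum>i\<in>UNIV. (Jm L ** V) $ i $ j) = - L * s $ j" for j
   using sum_Jm[of L "column j V"] by (simp add: s_def column_def matrix_vector_component matrix_mult_component)
  moreover have "(\<Sum>i\<in>UNIV. (V ** transpose (Jm L)) $ i $ j) = (Jm L *v s) $ j" for j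
   unfolding matrix_mult_component matrix_vector_component s_def
   by (subst sum.swap) (simp add: transpose_def sum_distrib_left mult.commute)
  ultimately have "- L * s $ j + (Jm L *v s) $ j + c * s $ j = 0" for j
   by (simp add: sum.distrib Us_column_sum s_def sum_distrib_left)
  then have e: "(Jm L *v s) $ j = (L - c) * s $ j" for j by (simp add: algebra_simps eq_neg_iff_add_eq_0 add_eq_0_iff)
  have "?J *v s = Jm L *v s + (c / 2) *\<^sub>R s"
   by (simp add: matrix_vector_mult_add_rdistrib scaleR_matrix_vector_assoc[symmetric])
  then show ?thesis by (simp add: vec_eq_iff e algebra_simps)
 qed
 from adapted_norm_eigenvector[OF N less_imp_le[OF pos(1)] this] cL have "s = 0" by simp
 then have tang: "column j V \<in> tangent" for j by (simp add: s_def tangent_def column_def vec_eq_iff)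
 have "lyapunov_solution Us (h_jacobian P \<theta>s) c V"
  unfolding lyapunov_solution_def using sym tang V[unfolded iff] by (simp add: colw tr2)
 then show "\<exists>!V. lyapunov_solution Us (h_jacobian P \<theta>s) c V" using uniq * by blast
qed

end

section \<open>Weak convergence from characteristic functions\<close>

text \<open>The algebra on which convergence of characteristic functions gives convergence of
  integrals at once; closure under products follows from the addition formulas.\<close>

inductive trig_polynomial :: "('a::real_inner \<Rightarrow> real) \<Rightarrow> bool" where
 trig_cos: "trig_polynomial (\<lambda>x. cos (u \<bullet> x))"
| trig_sin: "trig_polynomial (\<lambda>x. sin (u \<bullet> x))"
| trig_add: "trig_polynomial f \<Longrightarrow> trig_polynomial g \<Longrightarrow> trig_polynomial (\<lambda>x. f x + g x)"
| trig_scale: "trig_polynomial f \<Longrightarrow> trig_polynomial (\<lambda>x. c * f x)"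

lemma trig_diff: "trig_polynomial f \<Longrightarrow> trig_polynomial g \<Longrightarrow> trig_polynomial (\<lambda>x. f x - g x)"
 using trig_add[OF _ trig_scale[of g "-1"], of f] by simp

lemma trig_const: "trig_polynomial (\<lambda>x. c)"
 using trig_scale[OF trig_cos[of 0], of c] by simp

lemma trig_cos_mult: "trig_polynomial g \<Longrightarrow> trig_polynomial (\<lambda>x. cos (u \<bullet> x) * g x)"
proof (induction rule: trig_polynomial.induct)
 case (trig_cos v)
 have "trig_polynomial (\<lambda>x. (1/2) * (cos ((u - v) \<bullet> x) + cos ((u + v) \<bullet> x)))"
  by (intro trig_polynomial.intros)
 then show ?case by (simp add: cos_times_cos inner_diff_left inner_add_left)
next
 case (trig_sin v)
 have "trig_polynomial (\<lambda>x. (1/2) * (sin ((u + v) \<bullet> x) - sin ((u - v) \<bullet> x)))"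
  by (intro trig_polynomial.intros trig_diff)
 then show ?case by (simp add: cos_times_sin inner_diff_left inner_add_left)
next
 case (trig_add f g)
 show ?case using trig_polynomial.trig_add[OF trig_add.IH] by (simp add: distrib_left)
next
 case (trig_scale f c)
 show ?case using trig_polynomial.trig_scale[OF trig_scale.IH, of c] by (simp add: mult.left_commute)
qed

lemma trig_sin_mult: "trig_polynomial g \<Longrightarrow> trig_polynomial (\<lambda>x. sin (u \<bullet> x) * g x)"
proof (induction rule: trig_polynomial.induct)
 case (trig_cos v)
 have "trig_polynomial (\<lambda>x. (1/2) * (sin ((u + v) \<bullet> x) + sin ((u - v) \<bullet> x)))"
  by (intro trig_polynomial.intros)
 then show ?case by (simp add: sin_times_cos inner_diff_left inner_add_left)
next
 case (trig_sin v)
 have "trig_polynomial (\<lambda>x. (1/2) * (cos ((u - v) \<bullet> x) - cos ((u + v) \<bullet> x)))"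
  by (intro trig_polynomial.intros trig_diff)
 then show ?case by (simp add: sin_times_sin inner_diff_left inner_add_left)
next
 case (trig_add f g)
 show ?case using trig_polynomial.trig_add[OF trig_add.IH] by (simp add: distrib_left)
next
 case (trig_scale f c)
 show ?case using trig_polynomial.trig_scale[OF trig_scale.IH, of c] by (simp add: mult.left_commute)
qed

lemma trig_mult: "trig_polynomial f \<Longrightarrow> trig_polynomial g \<Longrightarrow> trig_polynomial (\<lambda>x. f x * g x)"
proof (induction rule: trig_polynomial.induct)
 case (trig_add f1 f2)
 show ?case using trig_polynomial.trig_add[OF trig_add.IH[OF trig_add.prems]] by (simp add: distrib_right)
next
 case (trig_scale f c)
 show ?case using trig_polynomial.trig_scale[OF trig_scale.IH[OF trig_scale.prems], of c] by (simp add: mult.assoc)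
qed (auto intro: trig_cos_mult trig_sin_mult)

lemma trig_polynomial_compose:
 "real_polynomial_function q \<Longrightarrow> trig_polynomial g \<Longrightarrow> trig_polynomial (\<lambda>x. q (g x))"
proof (induction rule: real_polynomial_function.induct)
 case (linear f)
 then obtain c where "f = (\<lambda>x. x * c)" using real_bounded_linear by blast
 then show ?case using trig_scale[OF linear.prems, of c] by (simp add: mult.commute)
qed (auto intro: trig_const trig_add trig_mult)

lemma trig_polynomial_continuous: "trig_polynomial f \<Longrightarrow> continuous_on S f"
 by (induction rule: trig_polynomial.induct) (auto intro!: continuous_intros)

lemma trig_polynomial_bounded: "trig_polynomial f \<Longrightarrow> \<exists>B. \<forall>x. \<bar>f x\<bar> \<le> B"
proof (induction rule: trig_polynomial.induct)
 case (trig_add f g)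
 then obtain B C where "\<forall>x. \<bar>f x\<bar> \<le> B" "\<forall>x. \<bar>g x\<bar> \<le> C" by blast
 then have "\<bar>f x + g x\<bar> \<le> B + C" for x using abs_triangle_ineq[of "f x" "g x"] by (meson add_mono order_trans)
 then show ?case by blast
next
 case (trig_scale f c)
 then obtain B where B: "\<forall>x. \<bar>f x\<bar> \<le> B" by blast
 then have "\<bar>c * f x\<bar> \<le> \<bar>c\<bar> * B" for x unfolding abs_mult by (intro mult_left_mono) auto
 then show ?case by blast
qed (auto intro: exI[of _ 1])

text \<open>The frequency is normalised so that the phases at x and y differ by 1, which is not a
  multiple of 2 pi.\<close>

lemma trig_polynomial_separates:
 assumes "x \<noteq> y" shows "\<exists>f. trig_polynomial f \<and> f x \<noteq> f y"
proof -
 define u where "u = (1 / (norm (x - y))\<^sup>2) *\<^sub>R (x - y)"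
 have "u \<bullet> (x - y) = (1 / (norm (x - y))\<^sup>2) * (norm (x - y))\<^sup>2"
  unfolding u_def inner_scaleR_left dot_square_norm ..
 then have "u \<bullet> x - u \<bullet> y = 1" using assms unfolding inner_diff_right by simp
 then have "cos (u \<bullet> x - u \<bullet> y) < 1" using cos_monotone_0_pi[of 0 1] pi_gt3 by simp
 then have "cos (u \<bullet> x) \<noteq> cos (u \<bullet> y) \<or> sin (u \<bullet> x) \<noteq> sin (u \<bullet> y)"
  unfolding cos_diff using sin_cos_squared_add[of "u \<bullet> y"] by (auto simp: power2_eq_square)
 then show ?thesis using trig_cos[of u] trig_sin[of u] by blast
qed

text \<open>Approximation on K alone leaves the polynomial uncontrolled elsewhere. It is therefore
  composed with an ordinary polynomial close to the truncation at level B on the whole range of the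
  first approximant; the result is still trigonometric and obeys a global bound.\<close>

lemma trig_polynomial_approx:
 fixes f :: "'a::euclidean_space \<Rightarrow> real"
 assumes f: "continuous_on UNIV f" "\<And>x. \<bar>f x\<bar> \<le> B" and K: "compact K" and e: "0 < e"
 obtains p where "trig_polynomial p" "\<And>x. \<bar>p x\<bar> \<le> B + e" "\<And>x. x \<in> K \<Longrightarrow> \<bar>f x - p x\<bar> \<le> e"
proof -
 interpret function_ring_on "Collect trig_polynomial" K
  by unfold_locales
   (auto intro: K trig_polynomial_continuous trig_add trig_mult trig_const dest: trig_polynomial_separates)
 have "continuous_on K f" using f(1) by (rule continuous_on_subset) auto
 from Stone_Weierstrass_basic[OF this, of "e/2"] e obtain g where
  g: "trig_polynomial g" "\<And>x. x \<in> K \<Longrightarrow> \<bar>f x - g x\<bar> < e/2" by auto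
 obtain G where G: "\<And>x. \<bar>g x\<bar> \<le> G" using trig_polynomial_bounded[OF g(1)] by blast
 \<comment> \<open>The truncation is 1-Lipschitz and fixes the values of f, so it does not increase
   the error on K.\<close>
 define h where "h y = max (- B) (min B y)" for y
 have B0: "0 \<le> B" using order_trans[OF abs_ge_zero f(2)] .
 have "continuous_on {-G..G} h" unfolding h_def by (intro continuous_intros)
 then obtain q where q: "real_polynomial_function q" "\<And>y. y \<in> {-G..G} \<Longrightarrow> \<bar>h y - q y\<bar> < e/2"
  using Stone_Weierstrass_real_polynomial_function[of "{-G..G}" h "e/2"] e by auto
 have gG: "g x \<in> {-G..G}" for x using G[of x] by auto
 show thesis
 proof
  show "trig_polynomial (\<lambda>x. q (g x))" by (rule trig_polynomial_compose[OF q(1) g(1)])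
  show "\<bar>q (g x)\<bar> \<le> B + e" for x
  proof -
   have "\<bar>h (g x)\<bar> \<le> B" unfolding h_def using B0 by (auto simp: max_def min_def)
   then show ?thesis using q(2)[OF gG, of x] e by linarith
  qed
  show "\<bar>f x - q (g x)\<bar> \<le> e" if "x \<in> K" for x
  proof -
   have "h (f x) = f x" unfolding h_def using f(2)[of x] by auto
   moreover have "\<bar>h (f x) - h (g x)\<bar> \<le> \<bar>f x - g x\<bar>" unfolding h_def by (auto simp: max_def min_def)
   ultimately show ?thesis using q(2)[OF gG, of x] g(2)[OF that] by linarith
  qed
 qed
qed

lemma integral_close_on_large_set:
 fixes f p :: "'a::euclidean_space \<Rightarrow> real"
 assumes "prob_space \<mu>" and sets: "sets \<mu> = sets borel"
  and f: "continuous_on UNIV f" "\<And>x. \<bar>f x\<bar> \<le> B" and p: "continuous_on UNIV p" "\<And>x. \<bar>p x\<bar> \<le> B + e"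
  and close: "\<And>x. x \<in> K \<Longrightarrow> \<bar>f x - p x\<bar> \<le> e" and K: "closed K" and e: "0 \<le> e" and m: "measure \<mu> (- K) \<le> d"
 shows "\<bar>(\<integral>x. f x \<partial>\<mu>) - (\<integral>x. p x \<partial>\<mu>)\<bar> \<le> e + (2 * B + e) * d"
proof -
 interpret prob_space \<mu> by fact
 have meas: "f \<in> borel_measurable \<mu>" "p \<in> borel_measurable \<mu>"
  using f p borel_measurable_continuous_onI unfolding measurable_cong_sets[OF sets refl] by blast+
 have int: "integrable \<mu> f" "integrable \<mu> p"
  by (rule integrable_const_bound[of _ B], use f meas in simp_all)
   (rule integrable_const_bound[of _ "B + e"], use p meas in simp_all)
 have Kc: "- K \<in> sets \<mu>" unfolding sets using K by (simp add: open_Compl)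
 have B0: "0 \<le> B" using order_trans[OF abs_ge_zero f(2)] .
 have "\<bar>(\<integral>x. f x \<partial>\<mu>) - (\<integral>x. p x \<partial>\<mu>)\<bar> = \<bar>\<integral>x. f x - p x \<partial>\<mu>\<bar>" using int by simp
 also have "\<dots> \<le> (\<integral>x. \<bar>f x - p x\<bar> \<partial>\<mu>)" by (rule integral_abs_bound)
 also have "\<dots> \<le> (\<integral>x. e + (2 * B + e) * indicator (- K) x \<partial>\<mu>)"
 proof (rule integral_mono)
  show "integrable \<mu> (\<lambda>x. \<bar>f x - p x\<bar>)" using int by simp
  show "integrable \<mu> (\<lambda>x. e + (2 * B + e) * indicator (- K) x)" using Kc by (simp add: emeasure_eq_measure)
  show "\<bar>f x - p x\<bar> \<le> e + (2 * B + e) * indicator (- K) x" for x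
   using close[of x] f(2)[of x] p(2)[of x] e by (auto simp: indicator_def)
 qed
 also have "\<dots> = e + (2 * B + e) * measure \<mu> (- K)" using Kc
  by (simp add: emeasure_eq_measure prob_space)
 also have "\<dots> \<le> e + (2 * B + e) * d" using m e B0 by (intro add_left_mono mult_left_mono) auto
 finally show ?thesis .
qed

section \<open>Levy continuity in several dimensions\<close>

context
 fixes \<mu> :: "nat \<Rightarrow> (real ^ 'd::finite) measure" and N :: "(real ^ 'd) measure"
 assumes \<mu>: "\<And>n. prob_space (\<mu> n)" "\<And>n. sets (\<mu> n) = sets borel"
  and N: "prob_space N" "sets N = sets borel"
  and chf: "\<And>u. (\<lambda>n. CLINT x|\<mu> n. iexp (u \<bullet> x)) \<longlonglongrightarrow> (CLINT x|N. iexp (u \<bullet> x))"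
begin

private lemma borel_meas: "continuous_on UNIV f \<Longrightarrow> f \<in> borel_measurable (\<mu> n)"
 "continuous_on UNIV f \<Longrightarrow> f \<in> borel_measurable N"
 for f :: "real ^ 'd \<Rightarrow> 'b::topological_space"
 using borel_measurable_continuous_onI[of f]
 unfolding measurable_cong_sets[OF \<mu>(2) refl] measurable_cong_sets[OF N(2) refl] by blast+

private lemma trig_integral_tendsto:
 "trig_polynomial f \<Longrightarrow> (\<lambda>n. \<integral>x. f x \<partial>\<mu> n) \<longlonglongrightarrow> (\<integral>x. f x \<partial>N)"
proof -
 have int: "integrable (\<mu> n) f" "integrable N f" if "trig_polynomial f" for f n
 proof -
  note tp = that
  obtain B where B: "\<forall>x. \<bar>f x\<bar> \<le> B" using trig_polynomial_bounded[OF tp] by blast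
  interpret prob_space "\<mu> n" by (rule \<mu>)
  interpret N: prob_space N by (rule N)
  show "integrable (\<mu> n) f" "integrable N f"
   using B borel_meas[OF trig_polynomial_continuous[OF tp]]
   by (auto intro!: integrable_const_bound[of _ B] N.integrable_const_bound[of _ B])
 qed
 have inti: "integrable (\<mu> n) (\<lambda>x. iexp (u \<bullet> x))" "integrable N (\<lambda>x. iexp (u \<bullet> x))" for u n
 proof -
  interpret prob_space "\<mu> n" by (rule \<mu>)
  interpret N: prob_space N by (rule N)
  have "continuous_on UNIV (\<lambda>x :: real ^ 'd. iexp (u \<bullet> x))" by (intro continuous_intros)
  from borel_meas[OF this] show "integrable (\<mu> n) (\<lambda>x. iexp (u \<bullet> x))" "integrable N (\<lambda>x. iexp (u \<bullet> x))"
   by (auto intro!: integrable_const_bound[of _ 1] N.integrable_const_bound[of _ 1])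
 qed
 show "trig_polynomial f \<Longrightarrow> (\<lambda>n. \<integral>x. f x \<partial>\<mu> n) \<longlonglongrightarrow> (\<integral>x. f x \<partial>N)"
 proof (induction rule: trig_polynomial.induct)
  case (trig_cos u)
  have "Re (CLINT x|M. iexp (u \<bullet> x)) = (\<integral>x. cos (u \<bullet> x) \<partial>M)" if "integrable M (\<lambda>x. iexp (u \<bullet> x))" for M
   using integral_Re[OF that] by (simp add: Re_exp)
  then show ?case using tendsto_Re[OF chf[of u]] inti by simp
 next
  case (trig_sin u)
  have "Im (CLINT x|M. iexp (u \<bullet> x)) = (\<integral>x. sin (u \<bullet> x) \<partial>M)" if "integrable M (\<lambda>x. iexp (u \<bullet> x))" for M
   using integral_Im[OF that] by (simp add: Im_exp)
  then show ?case using tendsto_Im[OF chf[of u]] inti by simp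
 next
  case (trig_add f g)
  then show ?case using int by (simp add: tendsto_add)
 next
  case (trig_scale f c)
  then show ?case by (simp add: tendsto_mult_left)
 qed
qed

text \<open>Tightness is a matter of the coordinates, and their characteristic functions are
  restrictions to the axes; so the one-dimensional continuity theorem suffices.\<close>

private lemma marginals_tight:
 assumes e: "0 < e"
 shows "\<exists>R. \<forall>i. eventually (\<lambda>n. measure (\<mu> n) {x. R < \<bar>x $ i\<bar>} \<le> e) sequentially \<and> measure N {x. R < \<bar>x $ i\<bar>} \<le> e"
proof -
 interpret \<mu>: prob_space "\<mu> n" for n by (rule \<mu>)
 interpret N: prob_space N by (rule N)
 have op: "open {x :: real ^ 'd. R < \<bar>x $ i\<bar>}" for R i
  by (intro open_Collect_less continuous_intros)
 have op': "open {x :: real ^ 'd. R < norm x}" for R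
  by (intro open_Collect_less continuous_intros)
 have "(\<lambda>k. measure N {x. real k < norm x}) \<longlonglongrightarrow> measure N (\<Inter>k. {x. real k < norm x})"
  by (rule N.finite_Lim_measure_decseq) (use op' N(2) in \<open>auto simp: decseq_def\<close>)
 moreover have "(\<Inter>k. {x :: real ^ 'd. real k < norm x}) = {}"
 proof (rule equals0I)
  fix x :: "real ^ 'd" assume x: "x \<in> (\<Inter>k. {x. real k < norm x})"
  obtain k where "norm x \<le> real k" using real_arch_simple by blast
  moreover have "real k < norm x" using x by blast
  ultimately show False by simp
 qed
 ultimately have "(\<lambda>k. measure N {x. real k < norm x}) \<longlonglongrightarrow> 0" by simp
 then have "eventually (\<lambda>k. measure N {x. real k < norm x} < e) sequentially"
  using e by (rule order_tendstoD)
 then obtain k where k: "measure N {x. real k < norm x} < e" by (auto simp: eventually_sequentially)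
 \<comment> \<open>A continuous cutoff between the indicators of |y| > k + 1 and |y| > k, to which
   weak convergence of the marginals applies.\<close>
 define c where "c y = max 0 (min 1 (\<bar>y\<bar> - real k))" for y :: real
 have c_cont: "isCont c y" for y unfolding c_def by (intro continuous_intros)
 have c01: "0 \<le> c y" "c y \<le> 1" for y by (auto simp: c_def)
 have Nk: "measure N {x. real k < \<bar>x $ i\<bar>} < e" for i
 proof (rule le_less_trans[OF N.finite_measure_mono k])
  show "{x. real k < \<bar>x $ i\<bar>} \<subseteq> {x. real k < norm x}"
   using component_le_norm_cart[of _ i] by (auto intro: less_le_trans)
 qed (simp add: op' N(2))
 show ?thesis
 proof (intro exI[of _ "real k + 1"] allI conjI)
  fix i :: 'd
  have cm: "(\<lambda>x. x $ i) \<in> borel_measurable (\<mu> n)" "(\<lambda>x. x $ i) \<in> borel_measurable N" for n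
   by (intro borel_meas continuous_intros)+
  have rd: "real_distribution (distr (\<mu> n) borel (\<lambda>x. x $ i))" "real_distribution (distr N borel (\<lambda>x. x $ i))" for n
   using cm by (auto intro!: \<mu>.real_distribution_distr N.real_distribution_distr)
  have ch: "char (distr M borel (\<lambda>x. x $ i)) t = (CLINT x|M. iexp ((t *\<^sub>R axis i 1) \<bullet> x))"
   if "(\<lambda>x. x $ i) \<in> borel_measurable M" for M :: "(real ^ 'd) measure" and t
   unfolding char_def using that
   by (subst integral_distr) (auto simp: inner_axis' intro!: borel_measurable_continuous_onI continuous_intros)
  have "weak_conv_m (\<lambda>n. distr (\<mu> n) borel (\<lambda>x. x $ i)) (distr N borel (\<lambda>x. x $ i))"
   by (rule levy_continuity[OF rd]) (unfold ch[OF cm(1)] ch[OF cm(2)], rule chf)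
  from weak_conv_imp_integral_bdd_continuous_conv[OF rd this c_cont, of 1] c01
  have "(\<lambda>n. integral\<^sup>L (distr (\<mu> n) borel (\<lambda>x. x $ i)) c) \<longlonglongrightarrow> integral\<^sup>L (distr N borel (\<lambda>x. x $ i)) c" by simp
  moreover have cb: "c \<in> borel_measurable borel"
   by (intro borel_measurable_continuous_onI continuous_at_imp_continuous_on ballI c_cont)
  ultimately have conv: "(\<lambda>n. \<integral>x. c (x $ i) \<partial>\<mu> n) \<longlonglongrightarrow> (\<integral>x. c (x $ i) \<partial>N)"
   using cm by (simp add: integral_distr)
  have cxm: "(\<lambda>x. c (x $ i)) \<in> borel_measurable (\<mu> n)" "(\<lambda>x. c (x $ i)) \<in> borel_measurable N" for n
   using measurable_compose[OF cm(1) cb] measurable_compose[OF cm(2) cb] by auto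
  have sets: "{x. R < \<bar>x $ i\<bar>} \<in> sets (\<mu> n)" "{x. R < \<bar>x $ i\<bar>} \<in> sets N" for R n
   using op by (simp_all add: \<mu>(2) N(2))
  have "(\<integral>x. c (x $ i) \<partial>N) \<le> (\<integral>x. indicator {x. real k < \<bar>x $ i\<bar>} x \<partial>N)"
  proof (rule integral_mono)
   show "integrable N (\<lambda>x. c (x $ i))" using c01 cxm by (intro N.integrable_const_bound[of _ 1]) auto
   show "integrable N (\<lambda>x. indicator {x. real k < \<bar>x $ i\<bar>} x :: real)" using sets by (simp add: N.emeasure_eq_measure)
  qed (auto simp: indicator_def c_def)
  also have "\<dots> < e" using Nk[of i] sets by simp
  finally have "eventually (\<lambda>n. (\<integral>x. c (x $ i) \<partial>\<mu> n) < e) sequentially" by (rule order_tendstoD[OF conv])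
  moreover have "measure (\<mu> n) {x. real k + 1 < \<bar>x $ i\<bar>} \<le> (\<integral>x. c (x $ i) \<partial>\<mu> n)" for n
  proof -
   have "measure (\<mu> n) {x. real k + 1 < \<bar>x $ i\<bar>} = (\<integral>x. indicator {x. real k + 1 < \<bar>x $ i\<bar>} x \<partial>\<mu> n)"
    using sets by simp
   also have "\<dots> \<le> (\<integral>x. c (x $ i) \<partial>\<mu> n)"
   proof (rule integral_mono)
    show "integrable (\<mu> n) (\<lambda>x. c (x $ i))" using c01 cxm by (intro \<mu>.integrable_const_bound[of _ 1]) auto
    show "integrable (\<mu> n) (\<lambda>x. indicator {x. real k + 1 < \<bar>x $ i\<bar>} x :: real)" using sets by (simp add: \<mu>.emeasure_eq_measure)
   qed (auto simp: indicator_def c_def)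
   finally show ?thesis .
  qed
  ultimately show "eventually (\<lambda>n. measure (\<mu> n) {x. real k + 1 < \<bar>x $ i\<bar>} \<le> e) sequentially"
   by (auto elim!: eventually_mono intro: order_trans less_imp_le)
  have "measure N {x. real k + 1 < \<bar>x $ i\<bar>} \<le> measure N {x. real k < \<bar>x $ i\<bar>}"
   by (rule N.finite_measure_mono) (use sets in auto)
  then show "measure N {x. real k + 1 < \<bar>x $ i\<bar>} \<le> e" using Nk[of i] by simp
 qed
qed

text \<open>On a large box the test function is replaced by a trigonometric polynomial with a global
  bound; outside, the mass is small uniformly for large n. Integrals of the polynomial converge by
  hypothesis.\<close>

lemma multivariate_levy_continuity: "converges_weakly \<mu> N"
 unfolding converges_weakly_def
proof (intro allI impI)
 fix f :: "real ^ 'd \<Rightarrow> real" assume f: "continuous_on UNIV f" and "bounded (range f)"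
 then obtain B where B: "\<And>x. \<bar>f x\<bar> \<le> B" by (auto simp: bounded_iff)
 have B0: "0 \<le> B" using order_trans[OF abs_ge_zero B] .
 define d where "d = real CARD('d)"
 have d: "0 < d" by (simp add: d_def zero_less_card_finite)
 show "(\<lambda>n. \<integral>x. f x \<partial>\<mu> n) \<longlonglongrightarrow> (\<integral>x. f x \<partial>N)"
 proof (rule tendstoI)
  fix e0 :: real assume e0: "0 < e0"
  \<comment> \<open>Chosen so that the exchange of f for the polynomial costs at most e0 / 4 under
    each law; the cap 1 bounds e^2 by e.\<close>
  define e where "e = min 1 (e0 / (4 * (2 * B + 3)))"
  have e: "0 < e" "e \<le> 1" using e0 B0 by (auto simp: e_def)
  have "(2 * B + 3) * e \<le> (2 * B + 3) * (e0 / (4 * (2 * B + 3)))"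
   using B0 by (intro mult_left_mono) (auto simp: e_def)
  also have "\<dots> = e0 / 4"
  proof -
   have "c * (e0 / (4 * c)) = e0 / 4" if "c \<noteq> 0" for c using that by simp
   moreover have "2 * B + 3 \<noteq> 0" using B0 by linarith
   ultimately show ?thesis by blast
  qed
  finally have e_e0: "(2 * B + 3) * e \<le> e0 / 4" .
  obtain R where R: "\<And>i. eventually (\<lambda>n. measure (\<mu> n) {x. R < \<bar>x $ i\<bar>} \<le> e / d) sequentially"
   "\<And>i. measure N {x. R < \<bar>x $ i\<bar>} \<le> e / d" using marginals_tight[of "e / d"] e d by auto
  define K where "K = cbox (\<chi> i. - R) ((\<chi> i. R) :: real ^ 'd)"
  have Kc: "- K \<subseteq> (\<Union>i. {x. R < \<bar>x $ i\<bar>})"    proof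
   fix x assume "x \<in> - K"
   then obtain i where "x $ i < - R \<or> R < x $ i" unfolding K_def by (auto simp: mem_box_cart not_le)
   then have "R < \<bar>x $ i\<bar>" by auto
   then show "x \<in> (\<Union>i. {x. R < \<bar>x $ i\<bar>})" by blast
  qed
  have mK: "measure M (- K) \<le> e" if "\<And>i. measure M {x. R < \<bar>x $ i\<bar>} \<le> e / d" "prob_space M" "sets M = sets borel" for M
  proof -
   interpret prob_space M by fact
   have op: "open {x :: real ^ 'd. R < \<bar>x $ i\<bar>}" for i by (intro open_Collect_less continuous_intros)
   then have sets: "{x :: real ^ 'd. R < \<bar>x $ i\<bar>} \<in> sets M" for i using that(3) by simp
   have "measure M (- K) \<le> measure M (\<Union>i. {x. R < \<bar>x $ i\<bar>})" by (rule finite_measure_mono[OF Kc]) (use sets in auto)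
   also have "\<dots> \<le> (\<Sum>i\<in>UNIV. measure M {x. R < \<bar>x $ i\<bar>})" by (rule finite_measure_subadditive_finite) (use sets in auto)
   also have "\<dots> \<le> (\<Sum>i\<in>(UNIV :: 'd set). e / d)" by (intro sum_mono that)
   also have "\<dots> = e" using d by (simp add: d_def)
   finally show ?thesis .
  qed
  obtain p where p: "trig_polynomial p" "\<And>x. \<bar>p x\<bar> \<le> B + e" "\<And>x. x \<in> K \<Longrightarrow> \<bar>f x - p x\<bar> \<le> e"
   using trig_polynomial_approx[OF f B, of K e] e compact_cbox unfolding K_def by blast
  have close: "\<bar>(\<integral>x. f x \<partial>M) - (\<integral>x. p x \<partial>M)\<bar> \<le> e0 / 4"
   if M: "\<And>i. measure M {x. R < \<bar>x $ i\<bar>} \<le> e / d" "prob_space M" "sets M = sets borel" for M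
  proof -
   have "\<bar>(\<integral>x. f x \<partial>M) - (\<integral>x. p x \<partial>M)\<bar> \<le> e + (2 * B + e) * e"
    by (rule integral_close_on_large_set[OF M(2,3) f B trig_polynomial_continuous[OF p(1)] p(2) p(3) _ _ mK[OF M]])
     (use e in \<open>auto simp: K_def closed_cbox\<close>)
   also have "\<dots> \<le> (2 * B + 3) * e" using e B0 mult_mono[of e 1 e 1] by (simp add: algebra_simps)
   finally show ?thesis using e_e0 by simp
  qed
  have "eventually (\<lambda>n. \<forall>i. measure (\<mu> n) {x. R < \<bar>x $ i\<bar>} \<le> e / d) sequentially"
   using R(1) by (rule eventually_all_finite)
  moreover have "eventually (\<lambda>n. dist (\<integral>x. p x \<partial>\<mu> n) (\<integral>x. p x \<partial>N) < e0 / 4) sequentially"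
   using trig_integral_tendsto[OF p(1)] by (rule tendstoD) (use e0 in simp)
  ultimately show "eventually (\<lambda>n. dist (\<integral>x. f x \<partial>\<mu> n) (\<integral>x. f x \<partial>N) < e0) sequentially"
  proof eventually_elim
   case (elim n)
   have "\<bar>(\<integral>x. f x \<partial>\<mu> n) - (\<integral>x. p x \<partial>\<mu> n)\<bar> \<le> e0 / 4" by (rule close) (use elim \<mu> in auto)
   moreover have "\<bar>(\<integral>x. f x \<partial>N) - (\<integral>x. p x \<partial>N)\<bar> \<le> e0 / 4" by (rule close) (use R N in auto)
   ultimately show ?case using elim(2) e0 unfolding dist_real_def by linarith
  qed
 qed
qed

end

text \<open>Lagrange reduction of a quadratic form, one coordinate at a time: splitting off the
  square that contains coordinate k leaves a semidefinite form supported on the remaining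
  coordinates. A zero diagonal entry forces its whole row to vanish.\<close>

lemma psd_rank_one_decomposition:
 fixes V :: "real ^ 'd::finite ^ 'd"
 assumes "finite S" "\<And>i j. V $ i $ j = V $ j $ i" "\<And>u. 0 \<le> u \<bullet> (V *v u)" "\<And>i j. i \<notin> S \<Longrightarrow> V $ i $ j = 0"
 shows "\<exists>ls. \<forall>u. u \<bullet> (V *v u) = (\<Sum>l\<leftarrow>ls. (u \<bullet> l)\<^sup>2)"
 using assms
proof (induction S arbitrary: V rule: finite_induct)
 case empty
 then have "V = 0" by (simp add: vec_eq_iff)
 then show ?case by (intro exI[of _ "[]"]) simp
next
 case (insert k S)
 note sym = insert.prems(1) and psd = insert.prems(2) and supp = insert.prems(3)
 define e where "e i = (axis i 1 :: real ^ 'd)" for i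
 have Ve: "V *v e j = (\<chi> i. V $ i $ j)" for j by (simp add: e_def matrix_vector_mult_basis column_def)
 have symb: "u \<bullet> (V *v w) = w \<bullet> (V *v u)" for u w
 proof -
  have "transpose V = V" by (simp add: transpose_def vec_eq_iff sym)
  then have "w v* V = V *v w" for w by (metis transpose_matrix_vector)
  then show ?thesis by (metis dot_lmul_matrix inner_commute)
 qed
 have comp: "u \<bullet> (V *v e k) = (V *v u) $ k" for u
  unfolding symb[of u] by (simp add: e_def inner_axis')
 have quad: "(u - t *\<^sub>R e k) \<bullet> (V *v (u - t *\<^sub>R e k)) = u \<bullet> (V *v u) - 2 * t * (V *v u) $ k + t\<^sup>2 * V $ k $ k" for u t
  using symb[of "e k" u] comp[of u] comp[of "e k"]
  by (simp add: matrix_vector_mult_diff_distrib matrix_vector_mult_scaleR inner_diff_left inner_diff_right Ve power2_eq_square algebra_simps)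
 have kk: "0 \<le> V $ k $ k" using psd[of "e k"] comp[of "e k"] by (simp add: Ve)
 show ?case
 proof (cases "V $ k $ k = 0")
  case True
  have "V $ k $ j = 0" for j
  proof -
   define b where "b = V $ k $ j"
   have "0 \<le> e j \<bullet> (V *v e j) - 2 * t * b" for t
    using psd[of "e j - t *\<^sub>R e k"] unfolding quad True by (simp add: Ve b_def)
   \<comment> \<open>At this value of t the affine lower bound equals -1 unless b = 0.\<close>
   from this[of "(e j \<bullet> (V *v e j) + 1) / (2 * b)"] show ?thesis by (cases "b = 0") (auto simp: b_def)
  qed
  then have "V $ i $ j = 0" if "i \<notin> S" for i j using supp[of i j] that by (cases "i = k") auto
  then show ?thesis by (intro insert.IH sym psd) auto
 next
  case False
  then have kp: "0 < V $ k $ k" using kk by simp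
  define l where "l = (1 / sqrt (V $ k $ k)) *\<^sub>R (\<chi> i. V $ i $ k)"
  define W where "W = (\<chi> i j. V $ i $ j - l $ i * l $ j)"
  have ul: "u \<bullet> l = (V *v u) $ k / sqrt (V $ k $ k)" for u
   using comp[of u] unfolding Ve l_def by (simp add: inner_commute)
  have Wq: "u \<bullet> (W *v u) = u \<bullet> (V *v u) - (u \<bullet> l)\<^sup>2" for u
  proof -
   have "W *v u = V *v u - (l \<bullet> u) *\<^sub>R l"
    by (simp add: vec_eq_iff W_def matrix_vector_mult_def inner_vec_def left_diff_distrib right_diff_distrib sum_subtractf sum_distrib_left mult_ac)
   then show ?thesis by (simp add: inner_diff_right power2_eq_square inner_commute)
  qed
  have "\<exists>ls. \<forall>u. u \<bullet> (W *v u) = (\<Sum>l\<leftarrow>ls. (u \<bullet> l)\<^sup>2)"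
  proof (rule insert.IH)
   show "W $ i $ j = W $ j $ i" for i j by (simp add: W_def sym[of i j] mult.commute)
   show "0 \<le> u \<bullet> (W *v u)" for u
   proof -
    have "0 \<le> u \<bullet> (V *v u) - ((V *v u) $ k)\<^sup>2 / V $ k $ k"
     using psd[of "u - ((V *v u) $ k / V $ k $ k) *\<^sub>R e k"] kp unfolding quad
     by (simp add: power2_eq_square field_simps)
    then show ?thesis unfolding Wq ul using kp by (simp add: power_divide)
   qed
   show "W $ i $ j = 0" if "i \<notin> S" for i j
   proof (cases "i = k")
    case True
    have "l $ k * l $ j = V $ k $ k * V $ j $ k / (sqrt (V $ k $ k) * sqrt (V $ k $ k))" by (simp add: l_def)
    also have "\<dots> = V $ j $ k" using kp by simp
    finally show ?thesis using True by (simp add: W_def sym[of k j])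
   next
    case False
    then have "V $ i $ j = 0" "V $ i $ k = 0" using supp that by auto
    then show ?thesis by (simp add: W_def l_def)
   qed
  qed
  then obtain ls where "\<forall>u. u \<bullet> (W *v u) = (\<Sum>l\<leftarrow>ls. (u \<bullet> l)\<^sup>2)" by blast
  then have "\<forall>u. u \<bullet> (V *v u) = (\<Sum>l\<leftarrow>l # ls. (u \<bullet> l)\<^sup>2)" unfolding Wq by (simp add: algebra_simps)
  then show ?thesis by blast
 qed
qed

text \<open>The law of a sum of independent standard normal multiples of the vectors in the list,
  built by one product measure per vector; the covariance may be singular.\<close>

lemma degenerate_normal_exists:
 fixes ls :: "(real ^ 'd::finite) list"
 shows "\<exists>N. prob_space N \<and> sets N = sets borel \<and>
   (\<forall>u. (CLINT x|N. iexp (u \<bullet> x)) = exp (- of_real (\<Sum>l\<leftarrow>ls. (u \<bullet> l)\<^sup>2) / 2))"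
proof (induction ls)
 case Nil
 show ?case
  by (intro exI[of _ "return borel 0"]) (auto intro!: prob_space_return simp: integral_return)
next
 case (Cons l ls)
 then obtain N where N: "prob_space N" "sets N = sets borel"
  "\<And>u. (CLINT x|N. iexp (u \<bullet> x)) = exp (- of_real (\<Sum>l\<leftarrow>ls. (u \<bullet> l)\<^sup>2) / 2)" by blast
 interpret N: prob_space N by (rule N)
 interpret G: prob_space std_normal_distribution by (rule real_distribution.axioms(1)[OF real_dist_normal_dist])
 interpret pair_prob_space N std_normal_distribution ..
 define T where "T = (\<lambda>p :: (real ^ 'd) \<times> real. fst p + snd p *\<^sub>R l)"
 have "sets (N \<Otimes>\<^sub>M std_normal_distribution) = sets ((borel :: (real ^ 'd) measure) \<Otimes>\<^sub>M (borel :: real measure))"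
  by (rule sets_pair_measure_cong) (simp_all add: N(2))
 also have "\<dots> = sets borel" by (simp only: borel_prod)
 finally have sets: "sets (N \<Otimes>\<^sub>M std_normal_distribution) = sets borel" .
 have Tm: "T \<in> measurable (N \<Otimes>\<^sub>M std_normal_distribution) borel"
  unfolding measurable_cong_sets[OF sets refl] T_def
  by (intro borel_measurable_continuous_onI continuous_intros)
 have "(CLINT x|distr (N \<Otimes>\<^sub>M std_normal_distribution) borel T. iexp (u \<bullet> x))
   = exp (- of_real (\<Sum>l\<leftarrow>l # ls. (u \<bullet> l)\<^sup>2) / 2)" for u
 proof -
  have m: "(\<lambda>p. iexp (u \<bullet> T p)) \<in> borel_measurable (N \<Otimes>\<^sub>M std_normal_distribution)"
   unfolding measurable_cong_sets[OF sets refl] T_def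
   by (intro borel_measurable_continuous_onI continuous_intros)
  have "(CLINT x|distr (N \<Otimes>\<^sub>M std_normal_distribution) borel T. iexp (u \<bullet> x))
    = (CLINT p|N \<Otimes>\<^sub>M std_normal_distribution. iexp (u \<bullet> T p))"
   by (rule integral_distr[OF Tm]) (intro borel_measurable_continuous_onI continuous_intros)
  also have "\<dots> = (CLINT x|N. CLINT g|std_normal_distribution. iexp (u \<bullet> T (x, g)))"
   by (rule integral_fst'[symmetric]) (intro integrable_const_bound[of _ 1] m, simp)
  also have "\<dots> = (CLINT x|N. iexp (u \<bullet> x) * char std_normal_distribution (u \<bullet> l))"
   unfolding char_def T_def
   by (intro Bochner_Integration.integral_cong refl)
    (simp add: inner_add_right distrib_left exp_add mult_ac)
  also have "\<dots> = (CLINT x|N. iexp (u \<bullet> x)) * char std_normal_distribution (u \<bullet> l)"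
   by (rule integral_mult_left_zero)
  also have "\<dots> = exp (- of_real (\<Sum>l\<leftarrow>l # ls. (u \<bullet> l)\<^sup>2) / 2)"
   unfolding char_std_normal_distribution N(3) exp_of_real[symmetric] exp_add[symmetric]
   by (simp add: add_divide_distrib diff_divide_distrib algebra_simps)
  finally show ?thesis .
 qed
 moreover have "prob_space (distr (N \<Otimes>\<^sub>M std_normal_distribution) borel T)" by (rule prob_space_distr[OF Tm])
 ultimately show ?case by (intro exI[of _ "distr (N \<Otimes>\<^sub>M std_normal_distribution) borel T"]) auto
qed

lemma normal_law_exists:
 fixes V :: "real ^ 'd::finite ^ 'd"
 assumes "transpose V = V" "\<And>u. 0 \<le> u \<bullet> (V *v u)"
 shows "\<exists>N. normal_law 0 V N"
proof -
 have sym: "V $ i $ j = V $ j $ i" for i j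
  using arg_cong[OF assms(1), of "\<lambda>V. V $ i $ j"] by (simp add: transpose_def)
 obtain ls where ls: "\<And>u. u \<bullet> (V *v u) = (\<Sum>l\<leftarrow>ls. (u \<bullet> l)\<^sup>2)"
  using psd_rank_one_decomposition[of UNIV V, OF _ sym assms(2)] by auto
 show ?thesis unfolding normal_law_def ls using degenerate_normal_exists[of ls] by simp
qed

section \<open>Contraction recursions\<close>

text \<open>Once e is below d / 2, the excess x - d / 2 shrinks by 1 - g \<le> exp (-g) at each
  step, and the sum of g diverges.\<close>

lemma contraction_recursion:
 fixes x g e :: "nat \<Rightarrow> real"
 assumes rec: "eventually (\<lambda>n. x (Suc n) \<le> (1 - g n) * x n + g n * e n) sequentially"
  and g: "eventually (\<lambda>n. 0 \<le> g n \<and> g n \<le> 1) sequentially"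
  and div: "filterlim (\<lambda>n. \<Sum>k<n. g k) at_top sequentially"
  and e: "e \<longlonglongrightarrow> 0" and d: "0 < d"
 shows "eventually (\<lambda>n. x n \<le> d) sequentially"
proof -
 have "eventually (\<lambda>n. e n < d / 2) sequentially" using e d by (intro order_tendstoD) auto
 with rec g have "eventually (\<lambda>n. x (Suc n) \<le> (1 - g n) * x n + g n * e n \<and> 0 \<le> g n \<and> g n \<le> 1 \<and> e n < d / 2) sequentially"
  by eventually_elim auto
 then obtain n0 where n0: "\<And>n. n \<ge> n0 \<Longrightarrow> x (Suc n) \<le> (1 - g n) * x n + g n * e n"
  "\<And>n. n \<ge> n0 \<Longrightarrow> 0 \<le> g n" "\<And>n. n \<ge> n0 \<Longrightarrow> g n \<le> 1" "\<And>n. n \<ge> n0 \<Longrightarrow> e n < d / 2"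
  unfolding eventually_sequentially by blast
 define c where "c = max 0 (x n0 - d / 2)"
 have bound: "x n - d / 2 \<le> exp (- (\<Sum>k\<in>{n0..<n}. g k)) * c" if "n \<ge> n0" for n
  using that
 proof (induction n rule: dec_induct)
  case (step n)
  have "x (Suc n) - d / 2 \<le> (1 - g n) * x n + g n * e n - d / 2" using n0(1)[OF step(1)] by simp
  also have "\<dots> \<le> (1 - g n) * x n + g n * (d / 2) - d / 2"
   using n0(2,4)[OF step(1)] by (intro diff_right_mono add_left_mono mult_left_mono) auto
  also have "\<dots> = (1 - g n) * (x n - d / 2)"
  proof -
   have "(1 - a) * y + a * h - h = (1 - a) * (y - h)" for a y h :: real by (simp add: algebra_simps)
   then show ?thesis .
  qed
  also have "\<dots> \<le> (1 - g n) * (exp (- (\<Sum>k\<in>{n0..<n}. g k)) * c)"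
   using n0(3)[OF step(1)] step.IH by (intro mult_left_mono) auto
  also have "\<dots> \<le> exp (- g n) * (exp (- (\<Sum>k\<in>{n0..<n}. g k)) * c)"
   using exp_ge_add_one_self[of "- g n"] by (intro mult_right_mono) (auto simp: c_def)
  also have "\<dots> = exp (- (\<Sum>k\<in>{n0..<Suc n}. g k)) * c" using step(1) by (simp add: exp_add[symmetric])
  finally show ?case .
 qed (auto simp: c_def)
 have "filterlim (\<lambda>n. - (\<Sum>k<n0. g k) + (\<Sum>k<n. g k)) at_top sequentially"
  by (intro filterlim_tendsto_add_at_top[OF tendsto_const] div)
 moreover have "eventually (\<lambda>n. - (\<Sum>k<n0. g k) + (\<Sum>k<n. g k) = (\<Sum>k\<in>{n0..<n}. g k)) sequentially"
  using eventually_ge_at_top[of n0]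
 proof eventually_elim
  case (elim n)
  then show ?case using sum.atLeastLessThan_concat[of 0 n0 n g] by (simp add: atLeast0LessThan)
 qed
 ultimately have "filterlim (\<lambda>n. \<Sum>k\<in>{n0..<n}. g k) at_top sequentially"
  using filterlim_cong[OF refl refl] by fast
 then have "(\<lambda>n. exp (- (\<Sum>k\<in>{n0..<n}. g k))) \<longlonglongrightarrow> 0"
  by (intro filterlim_compose[OF exp_at_bot]) (simp add: filterlim_uminus_at_top[symmetric])
 then have "(\<lambda>n. exp (- (\<Sum>k\<in>{n0..<n}. g k)) * c) \<longlonglongrightarrow> 0" by (rule tendsto_mult_left_zero)
 then have "eventually (\<lambda>n. exp (- (\<Sum>k\<in>{n0..<n}. g k)) * c < d / 2) sequentially"
  using d by (intro order_tendstoD) auto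
 then show ?thesis using eventually_ge_at_top[of n0] by eventually_elim (use bound in fastforce)
qed

lemma contraction_recursion_tendsto:
 fixes x g e :: "nat \<Rightarrow> real"
 assumes rec: "eventually (\<lambda>n. x (Suc n) \<le> (1 - g n) * x n + g n * e n) sequentially"
  and g: "eventually (\<lambda>n. 0 \<le> g n \<and> g n \<le> 1) sequentially"
  and div: "filterlim (\<lambda>n. \<Sum>k<n. g k) at_top sequentially"
  and e: "e \<longlonglongrightarrow> 0" and x: "eventually (\<lambda>n. 0 \<le> x n) sequentially"
 shows "x \<longlonglongrightarrow> 0"
proof (rule tendstoI)
 fix d :: real assume "0 < d"
 then have "eventually (\<lambda>n. x n \<le> d / 2) sequentially" by (intro contraction_recursion[OF rec g div e]) auto
 with x show "eventually (\<lambda>n. dist (x n) 0 < d) sequentially" by eventually_elim (use \<open>0 < d\<close> in auto)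
qed

text \<open>\<open>o n / s n\<close> contracts by \<open>1 - d n * c n * K / (1 + X)\<close>. The coefficients \<open>c n\<close> are bounded below only up
 to the telescoping term \<open>g (n + 1) - g n\<close>, which the factor \<open>1 + k2 * d n * g n\<close> absorbs.\<close>

lemma ratio_recursion_tendsto:
 fixes ob s c d h3 h4 h6 g :: "nat \<Rightarrow> real"
 assumes d: "\<And>n. 0 < d n" "\<And>n. d n \<le> 1" "d \<longlonglongrightarrow> 0" "(\<lambda>n. d (Suc n) / d n) \<longlonglongrightarrow> 1"
   "filterlim (\<lambda>n. \<Sum>k<n. d k) at_top sequentially"
  and ob: "\<And>n. 0 \<le> ob n" "\<And>n. ob n \<le> C"
  and s: "eventually (\<lambda>n. b \<le> s n) sequentially" "0 < b" "\<And>n. s n \<le> S"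
  and c: "\<And>n. 0 \<le> c n" "\<And>n. c n \<le> X"
  and srec: "\<And>n. s (Suc n) = (1 - d n + d n * c n) * s n + d n * h4 n"
  and orec: "\<And>n. ob (Suc n) \<le> (1 - d n + d n * c n * (1 - K)) * ob n + d n * h3 n"
  and K: "0 < K" "K < 1"
  and g: "\<And>n. \<bar>g n\<bar> \<le> G"
  and lower: "\<And>n. 1 + g (Suc n) - g n - h6 n \<le> a * c n" "0 < a"
  and h: "h3 \<longlonglongrightarrow> 0" "h4 \<longlonglongrightarrow> 0" "h6 \<longlonglongrightarrow> 0"
 shows "ob \<longlonglongrightarrow> 0"
proof -
 have C0: "0 \<le> C" using order_trans[OF ob] .
 have X0: "0 \<le> X" using order_trans[OF c] .
 have G0: "0 \<le> G" using order_trans[OF abs_ge_zero g] .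
 \<comment> \<open>The growth factor of s in one step is at most 1 + X, so a loss d c K measured
   against 1 is at least a loss d c k1 measured against that factor.\<close>
 define k1 where "k1 = K / (1 + X)"
 have k1: "0 < k1" using K X0 by (simp add: k1_def)
 \<comment> \<open>Dividing by a converts the lower bound on a * c n into a decay rate of the
   ratio.\<close>
 define k2 where "k2 = k1 / a"
 have k2: "0 < k2" using k1 lower(2) by (simp add: k2_def)
 define D where "D = C / b"
 have D0: "0 \<le> D" using C0 s(2) by (simp add: D_def)
 define \<rho> where "\<rho> n = ob n / s n" for n
 define e5 where "e5 n = (\<bar>h4 n\<bar> * D + \<bar>h3 n\<bar>) / b" for n
 define e6 where "e6 n = e5 n + k2 * \<bar>h6 n\<bar> * D" for n
 \<comment> \<open>Summation by parts: the factor at time n + 1 cancels the term with g (n + 1) to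
   first order in d, and the factor at time n takes up the one with g n.\<close>
 define r where "r n = \<rho> n * (1 + k2 * d n * g n)" for n
 \<comment> \<open>Collects the products of two factors d, the earlier errors, and the variation of
   d between consecutive steps; all of them tend to zero.\<close>
 define e9 where "e9 n = d n * k2\<^sup>2 * G * D + d n * k2\<^sup>2 * G * (1 + 2 * G) * D + e6 n * (1 + k2 * d n * G)
   + k2 * \<bar>d (Suc n) / d n - 1\<bar> * G * D" for n
 have h': "(\<lambda>n. \<bar>h4 n\<bar>) \<longlonglongrightarrow> 0" "(\<lambda>n. \<bar>h3 n\<bar>) \<longlonglongrightarrow> 0" "(\<lambda>n. \<bar>h6 n\<bar>) \<longlonglongrightarrow> 0"
  using h by (auto intro: tendsto_rabs_zero)
 have "e6 \<longlonglongrightarrow> (0 * D + 0) / b + k2 * 0 * D"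
  unfolding e6_def e5_def by (intro tendsto_intros h') (use s(2) in simp)
 then have e6: "e6 \<longlonglongrightarrow> 0" by simp
 have "e9 \<longlonglongrightarrow> 0 * k2\<^sup>2 * G * D + 0 * k2\<^sup>2 * G * (1 + 2 * G) * D + 0 * (1 + k2 * 0 * G) + k2 * \<bar>1 - 1\<bar> * G * D"
  unfolding e9_def by (intro tendsto_intros d(3,4) e6)
 then have e9: "e9 \<longlonglongrightarrow> 0" by simp
 have "(\<lambda>n. k2 * d n * G) \<longlonglongrightarrow> k2 * 0 * G" by (intro tendsto_intros d)
 then have "eventually (\<lambda>n. k2 * d n * G < 1/2) sequentially" by (intro order_tendstoD(2)) auto
 moreover have "(\<lambda>n. k2 * d n) \<longlonglongrightarrow> k2 * 0" by (intro tendsto_intros d)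
 then have "eventually (\<lambda>n. k2 * d n < 1) sequentially" by (intro order_tendstoD(2)) auto
 moreover have "(\<lambda>n. k1 * d n * X) \<longlonglongrightarrow> k1 * 0 * X" by (intro tendsto_intros d)
 then have "eventually (\<lambda>n. k1 * d n * X < 1) sequentially" by (intro order_tendstoD(2)) auto
 ultimately have ev: "eventually (\<lambda>n. k2 * d n * G < 1/2 \<and> k2 * d n < 1 \<and> k1 * d n * X < 1 \<and> b \<le> s n) sequentially"
  using s(1) by eventually_elim auto
 then obtain n0 where n0: "\<And>n. n \<ge> n0 \<Longrightarrow> k2 * d n * G < 1/2" "\<And>n. n \<ge> n0 \<Longrightarrow> k2 * d n < 1"
  "\<And>n. n \<ge> n0 \<Longrightarrow> k1 * d n * X < 1" "\<And>n. n \<ge> n0 \<Longrightarrow> b \<le> s n" unfolding eventually_sequentially by blast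
 have \<rho>: "0 \<le> \<rho> n" "\<rho> n \<le> D" if "n \<ge> n0" for n
 proof -
  show "0 \<le> \<rho> n" using n0(4)[OF that] s(2) ob(1) by (simp add: \<rho>_def)
  show "\<rho> n \<le> D" unfolding \<rho>_def D_def using n0(4)[OF that] s(2) ob C0 by (intro frac_le) auto
 qed
 have gb: "\<bar>k2 * d n * g m\<bar> \<le> 1/2" if "n \<ge> n0" for n m
 proof -
  have "\<bar>k2 * d n * g m\<bar> = (k2 * d n) * \<bar>g m\<bar>" using k2 d(1)[of n] by (simp add: abs_mult)
  also have "\<dots> \<le> (k2 * d n) * G" using k2 d(1)[of n] g by (intro mult_left_mono) auto
  finally show ?thesis using n0(1)[OF that] by simp
 qed
 have step1: "\<rho> (Suc n) \<le> (1 - d n * c n * k1) * \<rho> n + d n * e5 n" if n: "n \<ge> n0" for n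
 proof -
  define x where "x = 1 - d n + d n * c n"
  have sn: "0 < s n" "0 < s (Suc n)" "b \<le> s (Suc n)" using n0(4)[of n] n0(4)[of "Suc n"] n s(2) by auto
  have xX: "x \<le> 1 + X" "0 \<le> x"
  proof -
   have "d n * c n \<le> 1 * X" using d(1,2)[of n] c[of n] by (intro mult_mono) auto
   then show "x \<le> 1 + X" using d(1)[of n] by (simp add: x_def)
   show "0 \<le> x" using d(1,2)[of n] c(1)[of n] by (simp add: x_def)
  qed
  define q where "q = 1 - d n * c n * k1"
  have "d n * c n * k1 \<le> d n * X * k1" using d(1)[of n] c[of n] k1 by (intro mult_right_mono mult_left_mono) auto
  also have "\<dots> = k1 * d n * X" by (simp add: mult_ac)
  finally have "d n * c n * k1 < 1" using n0(3)[OF n] by simp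
  then have q: "0 \<le> q" "q \<le> 1" using d(1)[of n] c[of n] k1 by (auto simp: q_def)
  have "x * k1 \<le> K" using xX X0 K by (simp add: k1_def pos_divide_le_eq mult.commute)
  then have "d n * c n * (x * k1) \<le> d n * c n * K" using d(1)[of n] c(1)[of n] by (intro mult_left_mono) auto
  then have xq: "x - d n * c n * K \<le> q * x" by (simp add: q_def algebra_simps)
  have "ob (Suc n) \<le> (x - d n * c n * K) * ob n + d n * h3 n"
   using orec[of n] by (simp add: x_def algebra_simps)
  also have "\<dots> \<le> q * x * ob n + d n * \<bar>h3 n\<bar>"
   using xq ob(1) d(1)[of n] by (intro add_mono mult_right_mono mult_left_mono) auto
  also have "q * x * ob n = q * \<rho> n * (x * s n)" using sn by (simp add: \<rho>_def)
  also have "x * s n = s (Suc n) - d n * h4 n" unfolding srec x_def by simp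
  also have "q * \<rho> n * (s (Suc n) - d n * h4 n) \<le> q * \<rho> n * s (Suc n) + d n * (\<bar>h4 n\<bar> * D)"
  proof -
   have "q * \<rho> n * (- h4 n) \<le> (q * \<rho> n) * \<bar>h4 n\<bar>" using q \<rho>[OF n] by (intro mult_left_mono) auto
   also have "\<dots> \<le> (1 * D) * \<bar>h4 n\<bar>" using q \<rho>[OF n] by (intro mult_right_mono mult_mono) auto
   finally have "d n * (q * \<rho> n * (- h4 n)) \<le> d n * ((1 * D) * \<bar>h4 n\<bar>)" using d(1)[of n] by (intro mult_left_mono) auto
   then show ?thesis by (simp add: algebra_simps)
  qed
  finally have "ob (Suc n) \<le> q * \<rho> n * s (Suc n) + d n * (\<bar>h4 n\<bar> * D + \<bar>h3 n\<bar>)" by (simp add: algebra_simps)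
  then have "\<rho> (Suc n) \<le> (q * \<rho> n * s (Suc n) + d n * (\<bar>h4 n\<bar> * D + \<bar>h3 n\<bar>)) / s (Suc n)"
   unfolding \<rho>_def[of "Suc n"] using sn by (intro divide_right_mono) auto
  also have "\<dots> = q * \<rho> n + d n * (\<bar>h4 n\<bar> * D + \<bar>h3 n\<bar>) / s (Suc n)" using sn by (simp add: add_divide_distrib)
  also have "\<dots> \<le> q * \<rho> n + d n * (\<bar>h4 n\<bar> * D + \<bar>h3 n\<bar>) / b"
   using sn s(2) d(1)[of n] D0 by (intro add_left_mono divide_left_mono) auto
  finally show ?thesis by (simp add: q_def e5_def)
 qed
 have step2: "\<rho> (Suc n) \<le> (1 - d n * k2 - d n * k2 * (g (Suc n) - g n)) * \<rho> n + d n * e6 n" if n: "n \<ge> n0" for n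
 proof -
  have "k2 * (1 + g (Suc n) - g n - h6 n) \<le> k2 * (a * c n)" using k2 lower(1) by (intro mult_left_mono) auto
  also have "\<dots> = c n * k1" using lower(2) by (simp add: k2_def)
  finally have "d n * \<rho> n * (k2 * (1 + g (Suc n) - g n - h6 n)) \<le> d n * \<rho> n * (c n * k1)"
   using d(1)[of n] \<rho>[OF n] by (intro mult_left_mono) auto
  moreover have "d n * (k2 * (\<rho> n * h6 n)) \<le> d n * (k2 * (D * \<bar>h6 n\<bar>))"
  proof -
   have "\<rho> n * h6 n \<le> \<rho> n * \<bar>h6 n\<bar>" using \<rho>[OF n] by (intro mult_left_mono) auto
   also have "\<dots> \<le> D * \<bar>h6 n\<bar>" using \<rho>[OF n] by (intro mult_right_mono) auto
   finally show ?thesis using k2 d(1)[of n] by (intro mult_left_mono) auto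
  qed
  ultimately show ?thesis using step1[OF n] by (simp add: e6_def algebra_simps)
 qed
 have step3: "r (Suc n) \<le> (1 - k2 * d n) * r n + k2 * d n * (e9 n / k2)" if n: "n \<ge> n0" for n
 proof -
  have Sn: "Suc n \<ge> n0" using n by simp
  define w where "w = 1 + k2 * d n * g (Suc n)"
  have w: "0 \<le> w" using gb[OF n, of "Suc n"] by (simp add: w_def)
  have E60: "0 \<le> e6 n" unfolding e6_def e5_def using D0 s(2) k2 by (intro add_nonneg_nonneg divide_nonneg_pos mult_nonneg_nonneg) auto
  have "r (Suc n) = \<rho> (Suc n) * w + k2 * (d (Suc n) - d n) * g (Suc n) * \<rho> (Suc n)"
   by (simp add: r_def w_def algebra_simps)
  also have "\<rho> (Suc n) * w \<le> ((1 - d n * k2 - d n * k2 * (g (Suc n) - g n)) * \<rho> n + d n * e6 n) * w"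
   using step2[OF n] w by (intro mult_right_mono)
  also have "\<dots> = (1 - k2 * d n) * r n + d n * (d n * k2\<^sup>2 * g n * \<rho> n
    - d n * k2\<^sup>2 * (g (Suc n) * (1 + g (Suc n) - g n)) * \<rho> n + e6 n * w)"
   by (simp add: r_def w_def power2_eq_square algebra_simps)
  also have "k2 * (d (Suc n) - d n) * g (Suc n) * \<rho> (Suc n) = d n * (k2 * (d (Suc n) / d n - 1) * g (Suc n) * \<rho> (Suc n))"
   using d(1)[of n] by (simp add: field_simps)
  finally have main: "r (Suc n) \<le> (1 - k2 * d n) * r n + d n * (d n * k2\<^sup>2 * g n * \<rho> n
    - d n * k2\<^sup>2 * (g (Suc n) * (1 + g (Suc n) - g n)) * \<rho> n + e6 n * w
    + k2 * (d (Suc n) / d n - 1) * g (Suc n) * \<rho> (Suc n))" by (simp add: algebra_simps)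
  have absb: "\<bar>p * t\<bar> \<le> p * T" if "0 \<le> p" "\<bar>t\<bar> \<le> T" for p t T :: real
   using that by (simp add: abs_mult mult_left_mono)
  have abs2: "\<bar>t * v\<bar> \<le> T * V" if "\<bar>t\<bar> \<le> T" "\<bar>v\<bar> \<le> V" for t v T V :: real
   using that unfolding abs_mult by (intro mult_mono) auto
  have r1: "\<bar>\<rho> n\<bar> \<le> D" "\<bar>\<rho> (Suc n)\<bar> \<le> D" using \<rho>[OF n] \<rho>[OF Sn] by auto
  have gg: "\<bar>1 + g (Suc n) - g n\<bar> \<le> 1 + 2 * G" using g[of n] g[of "Suc n"] by auto
  have k2g: "0 \<le> d n * k2\<^sup>2" using d(1)[of n] by simp
  have t1: "\<bar>d n * k2\<^sup>2 * g n * \<rho> n\<bar> \<le> d n * k2\<^sup>2 * G * D"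
   by (intro abs2 absb k2g g r1)
  have t2: "\<bar>d n * k2\<^sup>2 * (g (Suc n) * (1 + g (Suc n) - g n)) * \<rho> n\<bar> \<le> d n * k2\<^sup>2 * (G * (1 + 2 * G)) * D"
   by (intro abs2 absb k2g g r1 gg)
  have "k2 * d n * g (Suc n) \<le> k2 * d n * G" using k2 d(1)[of n] g[of "Suc n"] by (intro mult_left_mono) auto
  then have t3: "e6 n * w \<le> e6 n * (1 + k2 * d n * G)" unfolding w_def using E60 by (intro mult_left_mono) auto
  have "\<bar>k2 * (d (Suc n) / d n - 1) * g (Suc n) * \<rho> (Suc n)\<bar> \<le> k2 * \<bar>d (Suc n) / d n - 1\<bar> * G * D"
   using k2 by (intro abs2 g r1) auto
  then have "d n * k2\<^sup>2 * g n * \<rho> n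
    - d n * k2\<^sup>2 * (g (Suc n) * (1 + g (Suc n) - g n)) * \<rho> n + e6 n * w
    + k2 * (d (Suc n) / d n - 1) * g (Suc n) * \<rho> (Suc n) \<le> e9 n"
   using t1 t2 t3 unfolding e9_def by (simp only: abs_le_iff mult.assoc) linarith
  then have "d n * (d n * k2\<^sup>2 * g n * \<rho> n
    - d n * k2\<^sup>2 * (g (Suc n) * (1 + g (Suc n) - g n)) * \<rho> n + e6 n * w
    + k2 * (d (Suc n) / d n - 1) * g (Suc n) * \<rho> (Suc n)) \<le> d n * e9 n"
   using d(1)[of n] by (intro mult_left_mono) auto
  also have "\<dots> = k2 * d n * (e9 n / k2)" using k2 by simp
  finally show ?thesis using main by linarith
 qed
 have r0: "\<rho> n \<le> 2 * r n" "0 \<le> r n" if "n \<ge> n0" for n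
 proof -
  have "\<rho> n * (1/2) \<le> \<rho> n * (1 + k2 * d n * g n)" using \<rho>[OF that] gb[OF that, of n] by (intro mult_left_mono) auto
  then show "\<rho> n \<le> 2 * r n" by (simp add: r_def)
  then show "0 \<le> r n" using \<rho>[OF that] by linarith
 qed
 have "r \<longlonglongrightarrow> 0"
 proof (rule contraction_recursion_tendsto)
  show "eventually (\<lambda>n. r (Suc n) \<le> (1 - k2 * d n) * r n + k2 * d n * (e9 n / k2)) sequentially"
   using eventually_ge_at_top[of n0] by eventually_elim (rule step3)
  show "eventually (\<lambda>n. 0 \<le> k2 * d n \<and> k2 * d n \<le> 1) sequentially"
   using eventually_ge_at_top[of n0] by eventually_elim (use n0(2) k2 d(1) in \<open>auto intro: less_imp_le\<close>)
  show "filterlim (\<lambda>n. \<Sum>k<n. k2 * d k) at_top sequentially"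
   unfolding sum_distrib_left[symmetric] by (intro filterlim_tendsto_pos_mult_at_top[OF tendsto_const k2] d(5))
  show "(\<lambda>n. e9 n / k2) \<longlonglongrightarrow> 0" using tendsto_divide[OF e9 tendsto_const, of k2] k2 by simp
  show "eventually (\<lambda>n. 0 \<le> r n) sequentially" using eventually_ge_at_top[of n0] by eventually_elim (rule r0)
 qed
 then have "(\<lambda>n. 2 * r n * S) \<longlonglongrightarrow> 2 * 0 * S" by (intro tendsto_intros)
 then have lim: "(\<lambda>n. 2 * r n * S) \<longlonglongrightarrow> 0" by simp
 show ?thesis
 proof (rule tendsto_sandwich[OF _ _ tendsto_const lim])
  show "eventually (\<lambda>n. 0 \<le> ob n) sequentially" using ob(1) by simp
  show "eventually (\<lambda>n. ob n \<le> 2 * r n * S) sequentially"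
   using eventually_ge_at_top[of n0]
  proof eventually_elim
   case (elim n)
   have sn: "0 < s n" using n0(4)[OF elim] s(2) by simp
   have "ob n = \<rho> n * s n" using sn by (simp add: \<rho>_def)
   also have "\<dots> \<le> 2 * r n * S" using r0[OF elim] \<rho>[OF elim] sn s(3)[of n] by (intro mult_mono) auto
   finally show ?case .
  qed
 qed
qed

section \<open>Particle numbers\<close>

context
 fixes \<zeta> :: real
 assumes \<zeta>: "0 < \<zeta>" "\<zeta> < 1"
begin

text \<open>Since floor y \<le> k means y < k + 1, the number of particles at time k is the largest
  integer strictly below (k + 1)^\<zeta>.\<close>

lemma birth_time_le_iff:
 assumes "1 \<le> n" "1 \<le> k"
 shows "birth_time \<zeta> n \<le> k \<longleftrightarrow> real n < (real k + 1) powr \<zeta>"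
proof (cases "n = 1")
 case True
 have "1 < (real k + 1) powr \<zeta>" using assms \<zeta> by (intro gr_one_powr) auto
 then show ?thesis using True by (simp add: birth_time_def)
next
 case False
 have "birth_time \<zeta> n \<le> k \<longleftrightarrow> real n powr (1 / \<zeta>) < real k + 1"
  using False by (simp add: birth_time_def nat_le_iff floor_le_iff)
 also have "\<dots> \<longleftrightarrow> (real n powr (1 / \<zeta>)) powr \<zeta> < (real k + 1) powr \<zeta>"
 proof
  show "(real n powr (1 / \<zeta>)) powr \<zeta> < (real k + 1) powr \<zeta>" if "real n powr (1 / \<zeta>) < real k + 1"
   using that \<zeta> by (intro powr_less_mono2) auto
  show "real n powr (1 / \<zeta>) < real k + 1" if "(real n powr (1 / \<zeta>)) powr \<zeta> < (real k + 1) powr \<zeta>"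
  proof (rule ccontr)
   assume "\<not> real n powr (1 / \<zeta>) < real k + 1"
   then have "(real k + 1) powr \<zeta> \<le> (real n powr (1 / \<zeta>)) powr \<zeta>" using \<zeta> by (intro powr_mono2) auto
   then show False using that by simp
  qed
 qed
 also have "(real n powr (1 / \<zeta>)) powr \<zeta> = real n" using \<zeta> assms by (simp add: powr_powr)
 finally show ?thesis .
qed

lemma num_particles_bounds:
 assumes k: "1 \<le> k"
 shows "1 \<le> num_particles \<zeta> k" "real (num_particles \<zeta> k) < (real k + 1) powr \<zeta>"
  "(real k + 1) powr \<zeta> \<le> real (num_particles \<zeta> k) + 1"
proof -
 define S where "S = {n. 1 \<le> n \<and> birth_time \<zeta> n \<le> k}"
 have S: "S = {n. 1 \<le> n \<and> real n < (real k + 1) powr \<zeta>}" unfolding S_def using birth_time_le_iff[OF _ k] by blast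
 have "S \<subseteq> {..nat \<lceil>(real k + 1) powr \<zeta>\<rceil>}" unfolding S by (auto simp: le_nat_iff) linarith
 then have fin: "finite S" by (rule finite_subset) simp
 have "1 \<in> S" unfolding S_def by (simp add: birth_time_def)
 have a: "num_particles \<zeta> k = Max S" by (simp add: num_particles_def S_def)
 have "Max S \<in> S" using fin \<open>1 \<in> S\<close> by (intro Max_in) auto
 then show "1 \<le> num_particles \<zeta> k" "real (num_particles \<zeta> k) < (real k + 1) powr \<zeta>" unfolding a S by auto
 have mem: "n \<in> S \<longleftrightarrow> 1 \<le> n \<and> real n < (real k + 1) powr \<zeta>" for n by (simp add: S)
 have "Suc (Max S) \<notin> S" using Max_ge[OF fin, of "Suc (Max S)"] by auto
 then have "\<not> real (Suc (num_particles \<zeta> k)) < (real k + 1) powr \<zeta>" unfolding a mem by simp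
 then show "(real k + 1) powr \<zeta> \<le> real (num_particles \<zeta> k) + 1" by simp
qed

lemma powr_add_one_le: "1 \<le> x \<Longrightarrow> (x + 1) powr \<zeta> \<le> x powr \<zeta> + 1"
proof -
 assume x: "1 \<le> x"
 have "(x + 1) powr \<zeta> = x powr \<zeta> * (1 + 1 / x) powr \<zeta>"
 proof -
  have "1 + 1 / x = (x + 1) / x" using x by (simp add: field_simps)
  then show ?thesis using x by (simp add: powr_divide)
 qed
 also have "\<dots> \<le> x powr \<zeta> * (1 + 1 / x) powr 1" using x \<zeta> by (intro mult_left_mono powr_mono) auto
 also have "\<dots> = x powr \<zeta> + x powr \<zeta> / x" using x by (simp add: distrib_left)
 also have "x powr \<zeta> / x \<le> 1" using powr_mono[of \<zeta> 1 x] x \<zeta> by simp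
 finally show ?thesis by simp
qed

lemma num_particles_0: "num_particles \<zeta> 0 = 1" and num_particles_1: "num_particles \<zeta> 1 = 1"
proof -
 have "birth_time \<zeta> n \<le> 0 \<longleftrightarrow> n = 1" if "1 \<le> n" for n
 proof (cases "n = 1")
  case False
  have "1 \<le> real n powr (1 / \<zeta>)" using that \<zeta> by (intro ge_one_powr_ge_zero) auto
  then show ?thesis using False by (simp add: birth_time_def)
 qed (simp add: birth_time_def)
 then have "{n. 1 \<le> n \<and> birth_time \<zeta> n \<le> 0} = {1}" by auto
 then show "num_particles \<zeta> 0 = 1" by (simp add: num_particles_def)
 have "(real 1 + 1) powr \<zeta> < 2 powr 1" using \<zeta> powr_less_mono[of \<zeta> 1 2] by simp
 then have "real (num_particles \<zeta> 1) < 2" using num_particles_bounds(2)[of 1] by simp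
 then show "num_particles \<zeta> 1 = 1" using num_particles_bounds(1)[of 1] by simp
qed

lemma num_particles_pos: "1 \<le> num_particles \<zeta> k"
 using num_particles_bounds(1)[of k] num_particles_0 by (cases "k = 0") auto

lemma num_particles_step:
 "num_particles \<zeta> (Suc k) = num_particles \<zeta> k \<or> num_particles \<zeta> (Suc k) = num_particles \<zeta> k + 1"
proof (cases "k = 0")
 case True
 then show ?thesis using num_particles_0 num_particles_1 by simp
next
 case False
 then have k: "1 \<le> k" by simp
 have "(real k + 1) powr \<zeta> \<le> (real (Suc k) + 1) powr \<zeta>" using \<zeta> by (intro powr_mono2) auto
 then have "real (num_particles \<zeta> k) < real (num_particles \<zeta> (Suc k)) + 1"
  using num_particles_bounds(2)[OF k] num_particles_bounds(3)[of "Suc k"] by simp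
 moreover have "(real (Suc k) + 1) powr \<zeta> \<le> (real k + 1) powr \<zeta> + 1"
  using powr_add_one_le[of "real k + 1"] by (simp add: add.commute)
 then have "real (num_particles \<zeta> (Suc k)) < real (num_particles \<zeta> k) + 2"
  using num_particles_bounds(3)[OF k] num_particles_bounds(2)[of "Suc k"] by simp
 ultimately show ?thesis by linarith
qed

text \<open>The particle number follows a smooth power up to a bounded error. This is what later
  allows single births to be replaced by a smooth growth.\<close>

lemma num_particles_deviation: "\<bar>real (num_particles \<zeta> k) - real k powr \<zeta>\<bar> \<le> 1"
proof (cases "k = 0")
 case False
 then have k: "1 \<le> k" by simp
 have "(real k + 1) powr \<zeta> \<le> real k powr \<zeta> + 1" using k by (intro powr_add_one_le) auto
 moreover have "real k powr \<zeta> \<le> (real k + 1) powr \<zeta>" using \<zeta> by (intro powr_mono2) auto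
 ultimately show ?thesis using num_particles_bounds[OF k] by simp
qed (simp add: num_particles_0)

lemma num_particles_asymp: "(\<lambda>k. real (num_particles \<zeta> k) / real k powr \<zeta>) \<longlonglongrightarrow> 1"
proof -
 have "(\<lambda>k. real (num_particles \<zeta> k) / real k powr \<zeta> - 1) \<longlonglongrightarrow> 0"
 proof (rule Lim_null_comparison)
  show "eventually (\<lambda>k. norm (real (num_particles \<zeta> k) / real k powr \<zeta> - 1) \<le> 1 / real k powr \<zeta>) sequentially"
   using eventually_gt_at_top[of 0]
  proof eventually_elim
   case (elim k)
   have "real (num_particles \<zeta> k) / real k powr \<zeta> - 1 = (real (num_particles \<zeta> k) - real k powr \<zeta>) / real k powr \<zeta>"
    using elim by (simp add: diff_divide_distrib)
   then show ?case using num_particles_deviation[of k] elim by (simp add: abs_divide divide_right_mono)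
  qed
  show "(\<lambda>k. 1 / real k powr \<zeta>) \<longlonglongrightarrow> 0" using \<zeta> by real_asymp
 qed
 then show ?thesis by (simp add: LIM_zero_iff)
qed

lemma num_particles_at_top: "filterlim (\<lambda>k. real (num_particles \<zeta> k)) at_top sequentially"
proof (rule filterlim_at_top_mono)
 show "filterlim (\<lambda>k. real k powr \<zeta> - 1) at_top sequentially" using \<zeta> by real_asymp
 show "eventually (\<lambda>k. real k powr \<zeta> - 1 \<le> real (num_particles \<zeta> k)) sequentially"
 proof (intro always_eventually allI)
  fix k show "real k powr \<zeta> - 1 \<le> real (num_particles \<zeta> k)" using num_particles_deviation[of k] by linarith
 qed
qed

end

section \<open>Convergence of the empirical measures\<close>

lemma simplex_norm_le_1: "x \<in> prob_simplex \<Longrightarrow> norm x \<le> 1"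
 using norm_le_l1[of x] by (simp add: l1_def prob_simplex_def)

lemma bounded_linear_vector_matrix: "bounded_linear (\<lambda>v. v v* B)" for B :: "real ^ 'd::finite ^ 'd"
 by (intro linear_conv_bounded_linear[THEN iffD1] linearI)
  (simp_all add: vector_matrix_left_distrib vector_matrix_scaleR)

lemma tendsto_zero_scaleR_bounded:
 fixes a :: "nat \<Rightarrow> real" and x :: "nat \<Rightarrow> 'a::real_normed_vector"
 assumes "a \<longlonglongrightarrow> 0" "\<And>n. norm (x n) \<le> C"
 shows "(\<lambda>n. a n *\<^sub>R x n) \<longlonglongrightarrow> 0"
proof (rule Lim_null_comparison)
 show "eventually (\<lambda>n. norm (a n *\<^sub>R x n) \<le> \<bar>a n\<bar> * C) sequentially"
  using assms(2) by (intro always_eventually) (simp add: mult_left_mono)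
 show "(\<lambda>n. \<bar>a n\<bar> * C) \<longlonglongrightarrow> 0"
  using tendsto_mult[OF tendsto_rabs_zero[OF assms(1)] tendsto_const] by simp
qed

context qsd_chain begin

lemma wnorm_triangle: "wnorm (x + y) \<le> wnorm x + wnorm y"
 unfolding wnorm_def sum.distrib[symmetric] distrib_right[symmetric]
 by (intro sum_mono mult_right_mono) (auto intro: less_imp_le phi_pos abs_triangle_ineq)

lemma wnorm_scale: "wnorm (a *\<^sub>R x) = \<bar>a\<bar> * wnorm x"
 by (simp add: wnorm_def sum_distrib_left abs_mult mult.assoc)

lemma wnorm_nonneg: "0 \<le> wnorm x"
 unfolding wnorm_def by (intro sum_nonneg mult_nonneg_nonneg less_imp_le[OF phi_pos]) auto

lemma wnorm_le: "wnorm x \<le> (\<Sum>i\<in>UNIV. \<phi> $ i) * norm x"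
 unfolding wnorm_def sum_distrib_right
 by (intro sum_mono) (simp add: mult.commute mult_right_mono component_le_norm_cart less_imp_le[OF phi_pos])

lemma theta_phi_pos: "0 < \<theta>s \<bullet> \<phi>"
 unfolding inner_vec_def inner_real_def
 by (intro sum_pos) (auto intro: mult_pos_pos theta_pos phi_pos)

text \<open>The projection onto the hyperplane orthogonal to \<phi> along \<theta>s. It commutes
  with \<open>A\<close>, since \<theta>s and \<phi> are left and right eigenvectors for the same
  eigenvalue.\<close>

definition proj :: "real ^ 'd \<Rightarrow> real ^ 'd" where "proj v = v - ((v \<bullet> \<phi>) / (\<theta>s \<bullet> \<phi>)) *\<^sub>R \<theta>s"

lemma inner_A_phi: "(v v* A) \<bullet> \<phi> = (1 / cs) * (v \<bullet> \<phi>)"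
 by (simp add: dot_lmul_matrix A_phi)

lemma proj_phi: "proj v \<bullet> \<phi> = 0"
 using theta_phi_pos by (simp add: proj_def inner_diff_left)

lemma proj_A: "proj (v v* A) = proj v v* A"
 by (simp add: proj_def inner_A_phi vector_matrix_mult_diff_distrib vector_matrix_scaleR theta_A)

lemma proj_linear: "proj (x + y) = proj x + proj y" "proj (a *\<^sub>R x) = a *\<^sub>R proj x"
 by (simp_all add: proj_def inner_add_left add_divide_distrib algebra_simps)

lemma bounded_linear_proj: "bounded_linear proj"
 by (intro linear_conv_bounded_linear[THEN iffD1] linearI) (simp_all add: proj_linear)

lemma q0_le_1: "q0 $ x \<le> 1"
proof -
 have "0 \<le> (\<Sum>y\<in>UNIV. P0 $ x $ y)" by (intro sum_nonneg P0_nonneg)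
 then show ?thesis by (simp add: P0_row_sum)
qed

lemma simplex_q0: "x \<in> prob_simplex \<Longrightarrow> 0 \<le> x \<bullet> q0" "x \<in> prob_simplex \<Longrightarrow> x \<bullet> q0 \<le> 1"
proof -
 assume x: "x \<in> prob_simplex"
 show "0 \<le> x \<bullet> q0" using x unfolding inner_vec_def inner_real_def prob_simplex_def
  by (auto intro!: sum_nonneg mult_nonneg_nonneg q0_nonneg)
 have "x \<bullet> q0 \<le> (\<Sum>i\<in>UNIV. x $ i * 1)" using x unfolding inner_vec_def inner_real_def prob_simplex_def
  by (intro sum_mono mult_left_mono q0_le_1) auto
 then show "x \<bullet> q0 \<le> 1" using x by (simp add: prob_simplex_def)
qed

lemma A_minus_I: "v v* P0 v* A = v v* A - v"
proof -
 have "(v - v v* P0) v* A = (v v* (mat 1 - P0)) v* A" by (simp add: vector_matrix_mult_diff_rdistrib)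
 also have "\<dots> = v" by (simp add: vector_matrix_mul_assoc I_minus_P0_inverse)
 finally show ?thesis by (simp add: vector_matrix_mult_diff_distrib algebra_simps)
qed

text \<open>Deterministic: a single path is fed in, with the noise E and the effect of births m' - m
  as null sequences. The Green kernel expresses m by c (\<theta> A) up to a telescoping term, which
  makes \<theta>, suitably corrected, follow a recursion driven by \<open>A\<close>. The coefficient
  c may be small at single times; the conservation of total mass bounds it below up to
  telescoping.\<close>

lemma empirical_recursion_tendsto:
 fixes m m' \<theta> E :: "nat \<Rightarrow> real ^ 'd" and d :: "nat \<Rightarrow> real"
 assumes d: "\<And>n. 0 < d n" "\<And>n. d n \<le> 1" "d \<longlonglongrightarrow> 0" "(\<lambda>n. d (Suc n) / d n) \<longlonglongrightarrow> 1"
   "filterlim (\<lambda>n. \<Sum>k<n. d k) at_top sequentially"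
  and simplex: "\<And>n. m n \<in> prob_simplex" "\<And>n. m' n \<in> prob_simplex" "\<And>n. \<theta> n \<in> prob_simplex"
  and m: "\<And>n. m (Suc n) = m' n v* Kmat P (\<theta> n) + E n"
  and E: "E \<longlonglongrightarrow> 0" "(\<lambda>n. m' n - m n) \<longlonglongrightarrow> 0"
  and \<theta>: "\<And>n. \<theta> (Suc n) = (1 - d n) *\<^sub>R \<theta> n + d n *\<^sub>R m (Suc n)"
 shows "\<theta> \<longlonglongrightarrow> \<theta>s" "m \<longlonglongrightarrow> \<theta>s"
proof -
 define c where "c n = m' n \<bullet> q0" for n
 \<comment> \<open>This is v P0 A, the Green kernel without its zeroth term.\<close>
 define B where "B v = v v* A - v" for v :: "real ^ 'd"
 have Blin: "bounded_linear B" unfolding B_def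
  by (intro bounded_linear_sub bounded_linear_vector_matrix bounded_linear_ident)
 have BA: "bounded_linear (\<lambda>v. B v v* A)" by (rule bounded_linear_compose[OF bounded_linear_vector_matrix Blin])
 obtain b1 where b1: "\<And>v. norm (B v) \<le> norm v * b1" "0 < b1" using bounded_linear.pos_bounded[OF Blin] by blast
 obtain b2 where b2: "\<And>v. norm (B v v* A) \<le> norm v * b2" "0 < b2" using bounded_linear.pos_bounded[OF BA] by blast
 have mB: "norm (B (m n)) \<le> b1" "norm (B (m n) v* A) \<le> b2" for n
  using b1 b2 simplex_norm_le_1[OF simplex(1)[of n]] mult_right_mono[of "norm (m n)" 1 b1] mult_right_mono[of "norm (m n)" 1 b2]
  by (smt (verit))+
 have c: "0 \<le> c n" "c n \<le> 1" for n using simplex_q0 simplex(2) by (auto simp: c_def)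
 define h1 where "h1 n = E n v* A + B (m' n - m n)" for n
 have "(\<lambda>n. E n v* A) \<longlonglongrightarrow> 0" by (rule bounded_linear.tendsto_zero[OF bounded_linear_vector_matrix E(1)])
 moreover have "(\<lambda>n. B (m' n - m n)) \<longlonglongrightarrow> 0" by (rule bounded_linear.tendsto_zero[OF Blin E(2)])
 ultimately have h1: "h1 \<longlonglongrightarrow> 0" unfolding h1_def using tendsto_add by fastforce
 have Bdiff: "B (x - y) = B x - B y" "B (x + y) = B x + B y" "B (a *\<^sub>R x) = a *\<^sub>R B x" for x y a
  using bounded_linear.linear[OF Blin] by (auto simp: linear_diff linear_add linear_cmul)
 have mA: "m (Suc n) = c n *\<^sub>R (\<theta> n v* A) + h1 n + B (m n) - B (m (Suc n))" for n
 proof -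
  have "m (Suc n) - m (Suc n) v* P0 = (m' n - m (Suc n)) v* P0 + c n *\<^sub>R \<theta> n + E n"
   unfolding vector_matrix_mult_diff_distrib by (subst (1) m) (simp add: vector_Kmat c_def)
  then have "(m (Suc n) - m (Suc n) v* P0) v* A = ((m' n - m (Suc n)) v* P0 + c n *\<^sub>R \<theta> n + E n) v* A" by simp
  moreover have "(m (Suc n) - m (Suc n) v* P0) v* A = m (Suc n)"
   unfolding vector_matrix_mult_diff_distrib A_minus_I by simp
  ultimately have "m (Suc n) = B (m' n - m (Suc n)) + c n *\<^sub>R (\<theta> n v* A) + E n v* A"
   unfolding vector_matrix_left_distrib vector_matrix_scaleR A_minus_I B_def by simp
  also have "\<dots> = c n *\<^sub>R (\<theta> n v* A) + h1 n + B (m n) - B (m (Suc n))"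
   unfolding h1_def Bdiff by (simp add: algebra_simps)
  finally show ?thesis .
 qed
 \<comment> \<open>The correction by d B(m) absorbs the telescoping term B (m n) - B (m (n + 1)), so
   that T satisfies a closed recursion up to null terms.\<close>
 define T where "T n = \<theta> n + d n *\<^sub>R B (m n)" for n
 define h2 where "h2 n = h1 n + d n *\<^sub>R B (m n) - (c n * d n) *\<^sub>R (B (m n) v* A)
   + (d (Suc n) / d n - 1) *\<^sub>R B (m (Suc n))" for n
 have h2: "h2 \<longlonglongrightarrow> 0"
 proof -
  have "(\<lambda>n. d n *\<^sub>R B (m n)) \<longlonglongrightarrow> 0" by (rule tendsto_zero_scaleR_bounded[OF d(3) mB(1)])
  moreover have "(\<lambda>n. c n * d n) \<longlonglongrightarrow> 0"
  proof (rule tendsto_sandwich[OF _ _ tendsto_const d(3)])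
   show "eventually (\<lambda>n. 0 \<le> c n * d n) sequentially" using mult_nonneg_nonneg[OF c(1) less_imp_le[OF d(1)]] by (intro always_eventually) auto
   show "eventually (\<lambda>n. c n * d n \<le> d n) sequentially"
    using mult_right_mono[OF c(2) less_imp_le[OF d(1)]] by (auto intro!: always_eventually)
  qed
  then have "(\<lambda>n. (c n * d n) *\<^sub>R (B (m n) v* A)) \<longlonglongrightarrow> 0" by (rule tendsto_zero_scaleR_bounded[OF _ mB(2)])
  moreover have "(\<lambda>n. d (Suc n) / d n - 1) \<longlonglongrightarrow> 0" using d(4) by (rule LIM_zero)
  then have "(\<lambda>n. (d (Suc n) / d n - 1) *\<^sub>R B (m (Suc n))) \<longlonglongrightarrow> 0" by (rule tendsto_zero_scaleR_bounded[OF _ mB(1)])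
  ultimately have "h2 \<longlonglongrightarrow> 0 + 0 - 0 + 0" unfolding h2_def by (intro tendsto_intros h1)
  then show ?thesis by simp
 qed
 have Trec: "T (Suc n) = (1 - d n) *\<^sub>R T n + (d n * c n) *\<^sub>R (T n v* A) + d n *\<^sub>R h2 n" for n
 proof -
  have g0: "d n \<noteq> 0" using d(1)[of n] by simp
  have "T (Suc n) = (1 - d n) *\<^sub>R \<theta> n + d n *\<^sub>R (m (Suc n) + B (m (Suc n))) + (d (Suc n) - d n) *\<^sub>R B (m (Suc n))"
   by (simp add: T_def \<theta> algebra_simps)
  also have "m (Suc n) + B (m (Suc n)) = c n *\<^sub>R (\<theta> n v* A) + h1 n + B (m n)" using mA[of n] by (simp only: eq_diff_eq)
  also have "(d (Suc n) - d n) *\<^sub>R B (m (Suc n)) = d n *\<^sub>R ((d (Suc n) / d n - 1) *\<^sub>R B (m (Suc n)))"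
   using g0 by (simp add: right_diff_distrib)
  finally show ?thesis
   unfolding T_def h2_def vector_matrix_left_distrib vector_matrix_scaleR by (simp add: algebra_simps)
 qed
 define s where "s n = T n \<bullet> \<phi>" for n
 define ob where "ob n = wnorm (proj (T n))" for n
 \<comment> \<open>The mass of the telescoping term; it enters the lower bound on c only through
   differences.\<close>
 define g where "g n = (\<Sum>i\<in>UNIV. B (m n) $ i)" for n
 define h6 where "h6 n = (\<Sum>i\<in>UNIV. h1 n $ i)" for n
 define \<phi>0 where "\<phi>0 = Min (range (($) \<phi>))"
 have \<phi>0: "\<phi>0 \<le> \<phi> $ i" for i unfolding \<phi>0_def by (rule Min_le) auto
 have "\<phi>0 \<in> range (($) \<phi>)" unfolding \<phi>0_def by (rule Min_in) auto
 then have \<phi>0p: "0 < \<phi>0" using phi_pos by auto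
 have Tnorm: "norm (T n) \<le> 1 + b1" for n
 proof -
  have "norm (T n) \<le> norm (\<theta> n) + d n * norm (B (m n))" unfolding T_def
   using norm_triangle_ineq[of "\<theta> n" "d n *\<^sub>R B (m n)"] d(1)[of n] by simp
  also have "\<dots> \<le> 1 + 1 * b1" using simplex_norm_le_1[OF simplex(3)] d(1,2)[of n] mB
   by (intro add_mono mult_mono) auto
  finally show ?thesis by simp
 qed
 obtain pb where pb: "\<And>v. norm (proj v) \<le> norm v * pb" "0 < pb" using bounded_linear.pos_bounded[OF bounded_linear_proj] by blast
 define \<Phi> where "\<Phi> = (\<Sum>i\<in>UNIV. \<phi> $ i)"
 have \<Phi>: "0 \<le> \<Phi>" unfolding \<Phi>_def by (intro sum_nonneg less_imp_le[OF phi_pos])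
 have obC: "ob n \<le> \<Phi> * ((1 + b1) * pb)" for n
 proof -
  have "ob n \<le> \<Phi> * norm (proj (T n))" unfolding ob_def \<Phi>_def by (rule wnorm_le)
  also have "\<dots> \<le> \<Phi> * (norm (T n) * pb)" using \<Phi> by (intro mult_left_mono pb)
  also have "\<dots> \<le> \<Phi> * ((1 + b1) * pb)" using \<Phi> pb(2) by (intro mult_left_mono mult_right_mono Tnorm) auto
  finally show ?thesis .
 qed
 have s_upper: "s n \<le> (1 + b1) * norm \<phi>" for n
 proof -
  have "s n \<le> norm (T n) * norm \<phi>" unfolding s_def by (rule norm_cauchy_schwarz)
  also have "\<dots> \<le> (1 + b1) * norm \<phi>" by (intro mult_right_mono Tnorm) auto
  finally show ?thesis .
 qed
 have s_lower: "eventually (\<lambda>n. \<phi>0 / 2 \<le> s n) sequentially"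
 proof -
  have "(\<lambda>n. d n *\<^sub>R B (m n)) \<longlonglongrightarrow> 0" by (rule tendsto_zero_scaleR_bounded[OF d(3) mB(1)])
  then have "(\<lambda>n. (d n *\<^sub>R B (m n)) \<bullet> \<phi>) \<longlonglongrightarrow> 0 \<bullet> \<phi>" by (intro tendsto_intros)
  then have "eventually (\<lambda>n. - (\<phi>0 / 2) < (d n *\<^sub>R B (m n)) \<bullet> \<phi>) sequentially"
   using \<phi>0p by (intro order_tendstoD(1)) auto
  then show ?thesis
  proof eventually_elim
   case (elim n)
   have "\<phi>0 = (\<Sum>i\<in>UNIV. \<theta> n $ i * \<phi>0)" using simplex(3)[of n] by (simp add: prob_simplex_def sum_distrib_right[symmetric])
   also have "\<dots> \<le> \<theta> n \<bullet> \<phi>" unfolding inner_vec_def inner_real_def using simplex(3)[of n]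
    by (intro sum_mono mult_left_mono \<phi>0) (auto simp: prob_simplex_def)
   finally show ?case using elim by (simp add: s_def T_def inner_add_left)
  qed
 qed
 obtain K where K: "0 < K" "K < 1" "\<And>v. v \<bullet> \<phi> = 0 \<Longrightarrow> wnorm (v v* A) \<le> (1 / cs) * (1 - K) * wnorm v"
  using wnorm_contract by blast
 define amax where "amax = Max (range (\<lambda>i. \<Sum>j\<in>UNIV. A $ i $ j)) + 1"
 have amax: "(\<Sum>j\<in>UNIV. A $ i $ j) \<le> amax" for i
 proof -
  have "(\<Sum>j\<in>UNIV. A $ i $ j) \<le> Max (range (\<lambda>i. \<Sum>j\<in>UNIV. A $ i $ j))" by (rule Max_ge) auto
  then show ?thesis unfolding amax_def by linarith
 qed
 have "0 < (\<Sum>j\<in>UNIV. A $ undefined $ j)" by (intro sum_pos) (auto simp: A_pos)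
 then have amax0: "0 < amax" using amax[of undefined] by linarith
 have h0: "(\<lambda>n. h2 n \<bullet> \<phi>) \<longlonglongrightarrow> 0" "(\<lambda>n. wnorm (proj (h2 n))) \<longlonglongrightarrow> 0" "h6 \<longlonglongrightarrow> 0"
 proof -
  show "(\<lambda>n. h2 n \<bullet> \<phi>) \<longlonglongrightarrow> 0" using tendsto_inner[OF h2 tendsto_const, of \<phi>] by simp
  have "(\<lambda>n. proj (h2 n)) \<longlonglongrightarrow> 0" by (rule bounded_linear.tendsto_zero[OF bounded_linear_proj h2])
  then have "(\<lambda>n. \<Phi> * norm (proj (h2 n))) \<longlonglongrightarrow> \<Phi> * 0" by (intro tendsto_mult tendsto_const tendsto_norm_zero)
  then have lim: "(\<lambda>n. \<Phi> * norm (proj (h2 n))) \<longlonglongrightarrow> 0" by simp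
  show "(\<lambda>n. wnorm (proj (h2 n))) \<longlonglongrightarrow> 0"
   by (rule tendsto_sandwich[OF _ _ tendsto_const lim]) (auto simp: \<Phi>_def wnorm_nonneg wnorm_le)
  have "(\<lambda>n. h1 n $ i) \<longlonglongrightarrow> 0" for i using tendsto_vec_nth[OF h1, of i] by simp
  then have "h6 \<longlonglongrightarrow> (\<Sum>i\<in>(UNIV :: 'd set). 0)" unfolding h6_def by (intro tendsto_sum)
  then show "h6 \<longlonglongrightarrow> 0" by simp
 qed
 have "ob \<longlonglongrightarrow> 0"
 proof (rule ratio_recursion_tendsto[of d ob "\<Phi> * ((1 + b1) * pb)" "\<phi>0 / 2" s "(1 + b1) * norm \<phi>" "\<lambda>n. c n / cs" "1 / cs"
    "\<lambda>n. h2 n \<bullet> \<phi>" K "\<lambda>n. wnorm (proj (h2 n))" g "real CARD('d) * b1" h6 "amax * cs"])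
  show "0 \<le> ob n" "0 \<le> c n / cs" "c n / cs \<le> 1 / cs" for n
   using wnorm_nonneg c cs_pos by (auto simp: ob_def divide_right_mono)
  show "s (Suc n) = (1 - d n + d n * (c n / cs)) * s n + d n * (h2 n \<bullet> \<phi>)" for n
   unfolding s_def Trec inner_add_left inner_scaleR_left inner_A_phi by (simp add: algebra_simps)
  show "ob (Suc n) \<le> (1 - d n + d n * (c n / cs) * (1 - K)) * ob n + d n * wnorm (proj (h2 n))" for n
  proof -
   have "ob (Suc n) \<le> wnorm ((1 - d n) *\<^sub>R proj (T n)) + wnorm ((d n * c n) *\<^sub>R (proj (T n) v* A)) + wnorm (d n *\<^sub>R proj (h2 n))"
    unfolding ob_def Trec proj_linear proj_A
    by (rule order_trans[OF wnorm_triangle add_right_mono[OF wnorm_triangle]])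
   also have "\<dots> = (1 - d n) * ob n + d n * c n * wnorm (proj (T n) v* A) + d n * wnorm (proj (h2 n))"
    using d(1,2)[of n] c(1)[of n] by (simp add: wnorm_scale ob_def abs_mult)
   also have "\<dots> \<le> (1 - d n) * ob n + d n * c n * ((1 / cs) * (1 - K) * ob n) + d n * wnorm (proj (h2 n))"
    unfolding ob_def using d(1,2)[of n] c(1)[of n]
    by (intro add_mono mult_left_mono K(3) proj_phi) auto
   finally show ?thesis by (simp add: algebra_simps)
  qed
  show "\<bar>g n\<bar> \<le> real CARD('d) * b1" for n
  proof -
   have "\<bar>g n\<bar> \<le> l1 (B (m n))" unfolding g_def l1_def by (rule sum_abs)
   also have "\<dots> \<le> real CARD('d) * norm (B (m n))" by (rule l1_le_norm)
   also have "\<dots> \<le> real CARD('d) * b1" by (intro mult_left_mono mB) auto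
   finally show ?thesis .
  qed
  show "1 + g (Suc n) - g n - h6 n \<le> amax * cs * (c n / cs)" for n
  proof -
   \<comment> \<open>The total mass of m is 1, and the mass produced by \<theta> A is at most
     \<open>amax\<close>; hence c cannot stay small.\<close>
   have "1 = (\<Sum>i\<in>UNIV. m (Suc n) $ i)" using simplex(1) by (simp add: prob_simplex_def)
   also have "\<dots> = c n * (\<Sum>j\<in>UNIV. (\<theta> n v* A) $ j) + h6 n + g n - g (Suc n)"
    by (subst mA) (simp add: sum.distrib sum_subtractf sum_distrib_left h6_def g_def)
   finally have "1 + g (Suc n) - g n - h6 n = c n * (\<Sum>j\<in>UNIV. (\<theta> n v* A) $ j)" by simp
   also have "(\<Sum>j\<in>UNIV. (\<theta> n v* A) $ j) = (\<Sum>i\<in>UNIV. \<theta> n $ i * (\<Sum>j\<in>UNIV. A $ i $ j))"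
    unfolding vector_matrix_component sum_distrib_left by (rule sum.swap)
   also have "c n * \<dots> \<le> c n * (\<Sum>i\<in>UNIV. \<theta> n $ i * amax)" using simplex(3)[of n] c
    by (intro mult_left_mono sum_mono amax) (auto simp: prob_simplex_def)
   also have "\<dots> = c n * amax" using simplex(3)[of n] by (simp add: sum_distrib_right[symmetric] prob_simplex_def)
   finally show ?thesis using cs_pos by (simp add: mult.commute)
  qed
  show "0 < amax * cs" using amax0 cs_pos by simp
 qed (use d obC s_lower \<phi>0p s_upper K h0 in auto)
 have proj0: "(\<lambda>n. proj (T n)) \<longlonglongrightarrow> 0"
 proof (rule Lim_null_comparison)
  show "eventually (\<lambda>n. norm (proj (T n)) \<le> ob n / \<phi>0) sequentially"
  proof (intro always_eventually allI)
   fix n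
   have "norm (proj (T n)) * \<phi>0 \<le> l1 (proj (T n)) * \<phi>0" using \<phi>0p by (intro mult_right_mono norm_le_l1) auto
   also have "\<dots> \<le> ob n" unfolding l1_def ob_def wnorm_def sum_distrib_right by (intro sum_mono mult_left_mono \<phi>0) auto
   finally show "norm (proj (T n)) \<le> ob n / \<phi>0" using \<phi>0p by (simp add: pos_le_divide_eq)
  qed
  show "(\<lambda>n. ob n / \<phi>0) \<longlonglongrightarrow> 0" using tendsto_divide[OF \<open>ob \<longlonglongrightarrow> 0\<close> tendsto_const, of \<phi>0] \<phi>0p by simp
 qed
 define t where "t n = (T n \<bullet> \<phi>) / (\<theta>s \<bullet> \<phi>)" for n
 have Tt: "T n = proj (T n) + t n *\<^sub>R \<theta>s" for n by (simp add: proj_def t_def)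
 have gB0: "(\<lambda>n. d n *\<^sub>R B (m n)) \<longlonglongrightarrow> 0" by (rule tendsto_zero_scaleR_bounded[OF d(3) mB(1)])
 have sum0: "(\<lambda>n. \<Sum>i\<in>UNIV. x n $ i) \<longlonglongrightarrow> 0" if "x \<longlonglongrightarrow> 0" for x :: "nat \<Rightarrow> real ^ 'd"
 proof -
  have "(\<lambda>n. \<Sum>i\<in>UNIV. x n $ i) \<longlonglongrightarrow> (\<Sum>i\<in>UNIV. (0 :: real ^ 'd) $ i)" by (intro tendsto_sum tendsto_vec_nth that)
  then show ?thesis by simp
 qed
 \<comment> \<open>The transversal part vanishes and the mass of T tends to 1, which fixes the
   coefficient along \<theta>s.\<close>
 have teq: "t n = 1 + (\<Sum>i\<in>UNIV. (d n *\<^sub>R B (m n)) $ i) - (\<Sum>i\<in>UNIV. proj (T n) $ i)" for n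
 proof -
  have "(\<Sum>i\<in>UNIV. T n $ i) = 1 + (\<Sum>i\<in>UNIV. (d n *\<^sub>R B (m n)) $ i)"
   using simplex(3)[of n] by (simp add: T_def sum.distrib prob_simplex_def)
  moreover have "(\<Sum>i\<in>UNIV. T n $ i) = (\<Sum>i\<in>UNIV. proj (T n) $ i) + t n"
   by (subst Tt) (simp add: sum.distrib sum_distrib_left[symmetric] theta_sum)
  ultimately show ?thesis by simp
 qed
 have "(\<lambda>n. t n) \<longlonglongrightarrow> 1 + 0 - 0"
  unfolding teq by (intro tendsto_diff tendsto_add tendsto_const sum0 gB0 proj0)
 then have "t \<longlonglongrightarrow> 1" by simp
 then have "(\<lambda>n. proj (T n) + t n *\<^sub>R \<theta>s) \<longlonglongrightarrow> 0 + 1 *\<^sub>R \<theta>s" by (intro tendsto_intros proj0)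
 then have "T \<longlonglongrightarrow> \<theta>s" unfolding Tt[symmetric] by simp
 from tendsto_diff[OF this gB0] show \<theta>lim: "\<theta> \<longlonglongrightarrow> \<theta>s" by (simp add: T_def)
 obtain N r C where N: "0 < r" "r < 1" "1 \<le> C" "\<And>x y. N (x + y) \<le> N x + N y"
  "\<And>x. norm x \<le> N x" "\<And>x. N x \<le> C * norm x" "\<And>v. (\<Sum>i\<in>UNIV. v $ i) = 0 \<Longrightarrow> N (v v* Ks) \<le> r * N v"
  by (rule Ks_contraction) blast
 \<comment> \<open>With \<theta> near \<theta>s the measures m follow the fixed kernel
   \<open>Ks\<close> up to the null sequence R, and the one-step contraction of \<open>Ks\<close> on
   mass zero applies with a constant rate.\<close>
 define R where "R n = (m' n - m n) v* P0 + ((m' n - m n) \<bullet> q0) *\<^sub>R \<theta>s + c n *\<^sub>R (\<theta> n - \<theta>s) + E n" for n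
 have R0: "R \<longlonglongrightarrow> 0"
 proof -
  have "(\<lambda>n. (m' n - m n) v* P0) \<longlonglongrightarrow> 0" by (rule bounded_linear.tendsto_zero[OF bounded_linear_vector_matrix E(2)])
  moreover have "(\<lambda>n. ((m' n - m n) \<bullet> q0) *\<^sub>R \<theta>s) \<longlonglongrightarrow> (0 \<bullet> q0) *\<^sub>R \<theta>s" by (intro tendsto_intros E(2))
  moreover have "(\<lambda>n. c n *\<^sub>R (\<theta> n - \<theta>s)) \<longlonglongrightarrow> 0"
  proof (rule Lim_null_comparison)
   show "eventually (\<lambda>n. norm (c n *\<^sub>R (\<theta> n - \<theta>s)) \<le> norm (\<theta> n - \<theta>s)) sequentially"
    using c by (intro always_eventually) (simp add: mult_left_le_one_le)
   show "(\<lambda>n. norm (\<theta> n - \<theta>s)) \<longlonglongrightarrow> 0" by (intro tendsto_norm_zero LIM_zero \<theta>lim)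
  qed
  ultimately have "R \<longlonglongrightarrow> 0 + (0 \<bullet> q0) *\<^sub>R \<theta>s + 0 + 0" unfolding R_def by (intro tendsto_add E)
  then show ?thesis by simp
 qed
 have mrec: "m (Suc n) - \<theta>s = (m n - \<theta>s) v* Ks + R n" for n
  unfolding m vector_matrix_mult_diff_distrib[of _ _ Ks] theta_Ks R_def c_def
  by (simp add: vector_Kmat vector_matrix_mult_diff_distrib inner_diff_left algebra_simps)
 have Nm: "(\<lambda>n. N (m n - \<theta>s)) \<longlonglongrightarrow> 0"
 proof (rule contraction_recursion_tendsto[where g = "\<lambda>n. 1 - r" and e = "\<lambda>n. C * norm (R n) / (1 - r)"])
  show "eventually (\<lambda>n. N (m (Suc n) - \<theta>s) \<le> (1 - (1 - r)) * N (m n - \<theta>s) + (1 - r) * (C * norm (R n) / (1 - r))) sequentially"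
  proof (intro always_eventually allI)
   fix n
   have "N (m (Suc n) - \<theta>s) \<le> N ((m n - \<theta>s) v* Ks) + N (R n)" unfolding mrec by (rule N)
   also have "\<dots> \<le> r * N (m n - \<theta>s) + C * norm (R n)" using simplex(1)[of n] theta_sum
    by (intro add_mono N) (simp add: sum_subtractf prob_simplex_def)
   finally show "N (m (Suc n) - \<theta>s) \<le> (1 - (1 - r)) * N (m n - \<theta>s) + (1 - r) * (C * norm (R n) / (1 - r))" using N by simp
  qed
  show "filterlim (\<lambda>n. \<Sum>k<n. 1 - r) at_top sequentially" using N
   by (simp add: filterlim_at_top_mult_tendsto_pos[OF tendsto_const _ filterlim_real_sequentially])
  have "(\<lambda>n. C * norm (R n) / (1 - r)) \<longlonglongrightarrow> C * 0 / (1 - r)" using N by (intro tendsto_intros tendsto_norm_zero R0) auto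
  then show "(\<lambda>n. C * norm (R n) / (1 - r)) \<longlonglongrightarrow> 0" by simp
  show "eventually (\<lambda>n. 0 \<le> N (m n - \<theta>s)) sequentially" using N(5) by (meson always_eventually norm_ge_zero order_trans)
 qed (use N in auto)
 have "(\<lambda>n. m n - \<theta>s) \<longlonglongrightarrow> 0" by (rule Lim_null_comparison[OF _ Nm]) (simp add: N)
 then show "m \<longlonglongrightarrow> \<theta>s" by (rule LIM_zero_cancel)
qed

end

lemma measurable_mono_source:
 assumes "f \<in> measurable A N" "space A = space B" "sets A \<subseteq> sets B"
 shows "f \<in> measurable B N"
 using assms unfolding measurable_def by auto

lemma sigma_join_props:
 assumes "space A = space M" "space B = space M" "sets A \<subseteq> sets M" "sets B \<subseteq> sets M"
 shows "space (sigma_join A B) = space M" "sets (sigma_join A B) \<subseteq> sets M"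
  "sets A \<subseteq> sets (sigma_join A B)" "sets B \<subseteq> sets (sigma_join A B)"
proof -
 have sub: "sets A \<union> sets B \<subseteq> Pow (space M)" using assms(3,4) sets.sets_into_space by blast
 have sets: "sets (sigma_join A B) = sigma_sets (space M) (sets A \<union> sets B)"
  unfolding sigma_join_def assms(1,2) Un_absorb using sub by (rule sets_measure_of)
 show "space (sigma_join A B) = space M" unfolding sigma_join_def assms(1,2) Un_absorb using sub by (rule space_measure_of)
 show "sets (sigma_join A B) \<subseteq> sets M" unfolding sets
  using assms(3,4) by (intro sets.sigma_sets_subset) auto
 show "sets A \<subseteq> sets (sigma_join A B)" "sets B \<subseteq> sets (sigma_join A B)" unfolding sets by auto
qed

lemma simplex_convex:
 assumes "x \<in> prob_simplex" "y \<in> prob_simplex" "0 \<le> t" "t \<le> 1"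
 shows "(1 - t) *\<^sub>R x + t *\<^sub>R y \<in> prob_simplex"
 using assms by (auto simp: prob_simplex_def sum.distrib sum_distrib_left[symmetric])

lemma simplex_average:
 assumes "1 \<le> k"
 shows "(1 / real k) *\<^sub>R (\<Sum>i=1..k. axis (x i) 1 :: real ^ 'd::finite) \<in> prob_simplex"
proof -
 have nn: "0 \<le> (\<Sum>i=1..k. axis (x i) 1 :: real ^ 'd) $ j" for j
  unfolding sum_component by (intro sum_nonneg) (simp add: axis_def)
 have "(\<Sum>j\<in>UNIV. (\<Sum>i=1..k. axis (x i) 1 :: real ^ 'd) $ j) = (\<Sum>i=1..k. \<Sum>j\<in>UNIV. (axis (x i) 1 :: real ^ 'd) $ j)"
  unfolding sum_component by (rule sum.swap)
 also have "\<dots> = real k" by (simp add: axis_def)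
 finally show ?thesis using nn assms by (simp add: prob_simplex_def sum_distrib_left[symmetric] sum_divide_distrib[symmetric])
qed

section \<open>Step sizes and measurability for the algorithm\<close>

locale interacting_particles = algorithm_II M P \<gamma>s \<zeta> x0 X \<iota> \<theta> F G H + qsd_chain P \<theta>s
 for M :: "'w measure" and P :: "real ^ ('d::finite option) ^ ('d option)" and \<gamma>s \<zeta> :: real and x0 :: 'd
  and X :: "nat \<Rightarrow> nat \<Rightarrow> 'w \<Rightarrow> 'd" and \<iota> :: "nat \<Rightarrow> 'w \<Rightarrow> nat" and \<theta> :: "nat \<Rightarrow> 'w \<Rightarrow> real ^ 'd"
  and F G H :: "nat \<Rightarrow> 'w measure" and \<theta>s :: "real ^ 'd" +
 assumes \<gamma>s: "0 < \<gamma>s" and \<zeta>: "0 < \<zeta>" "\<zeta> < 1"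
begin

abbreviation np :: "nat \<Rightarrow> nat" where "np \<equiv> num_particles \<zeta>"

lemmas np_pos = num_particles_pos[OF \<zeta>]

lemma np_mono1: "np k \<le> np (Suc k)"
 using num_particles_step[OF \<zeta>, of k] by auto

text \<open>Shifted by one: this is the weight used in the passage from time n to time n +
  1.\<close>

definition \<gamma> :: "nat \<Rightarrow> real" where "\<gamma> n = step_size \<gamma>s (Suc n)"

definition Nst :: real where "Nst = of_int (\<lfloor>\<gamma>s\<rfloor> + 1)"

lemma Nst: "\<gamma>s < Nst" "1 \<le> Nst"
proof -
 show "\<gamma>s < Nst" unfolding Nst_def by (simp add: floor_less_iff[symmetric])
 have "0 \<le> \<lfloor>\<gamma>s\<rfloor>" using \<gamma>s by simp
 then show "1 \<le> Nst" unfolding Nst_def by linarith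
qed

lemma \<gamma>_eq: "\<gamma> n = \<gamma>s / (real n + Nst)"
 by (simp add: \<gamma>_def step_size_def Nst_def)

lemma \<gamma>_pos: "0 < \<gamma> n" and \<gamma>_le_1: "\<gamma> n \<le> 1"
 using \<gamma>s Nst by (auto simp: \<gamma>_eq field_simps add_pos_nonneg intro: add_nonneg_pos)

lemma \<gamma>_tendsto: "\<gamma> \<longlonglongrightarrow> 0"
 unfolding \<gamma>_eq[abs_def] by real_asymp

lemma \<gamma>_ratio: "(\<lambda>n. \<gamma> (Suc n) / \<gamma> n) \<longlonglongrightarrow> 1"
proof -
 have "\<gamma> (Suc n) / \<gamma> n = (real n + Nst) / (real n + 1 + Nst)" for n
 proof -
  have "(g / (d + 1)) / (g / d) = d / (d + 1)" if "0 < d" "0 < g" for d g :: real using that by simp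
  from this[of "real n + Nst" \<gamma>s] show ?thesis using \<gamma>s Nst by (simp add: \<gamma>_eq add_ac)
 qed
 moreover have "(\<lambda>n. (real n + Nst) / (real n + 1 + Nst)) \<longlonglongrightarrow> 1" by real_asymp
 ultimately show ?thesis by simp
qed

lemma \<gamma>_diverges: "filterlim (\<lambda>n. \<Sum>k<n. \<gamma> k) at_top sequentially"
proof (rule filterlim_at_top_mono)
 show "filterlim (\<lambda>n. (\<gamma>s / Nst) * (harm n :: real)) at_top sequentially"
  using \<gamma>s Nst by (intro filterlim_tendsto_pos_mult_at_top[OF tendsto_const] harm_at_top) auto
 show "eventually (\<lambda>n. (\<gamma>s / Nst) * (harm n :: real) \<le> (\<Sum>k<n. \<gamma> k)) sequentially"
 proof (intro always_eventually allI)
  fix n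
  have "(\<gamma>s / Nst) * (harm n :: real) = (\<Sum>k<n. (\<gamma>s / Nst) * inverse (real (Suc k)))"
   unfolding harm_def sum_distrib_left by (rule sum.reindex_bij_witness[of _ Suc "\<lambda>k. k - 1"]) auto
  also have "\<dots> \<le> (\<Sum>k<n. \<gamma> k)"
  proof (rule sum_mono)
   fix k
   have "real k + Nst \<le> Nst * (real k + 1)" using Nst mult_left_mono[of 1 Nst "real k"] by (simp add: algebra_simps)
   then have "\<gamma>s / (Nst * (real k + 1)) \<le> \<gamma>s / (real k + Nst)" using \<gamma>s Nst by (intro divide_left_mono) auto
   then show "(\<gamma>s / Nst) * inverse (real (Suc k)) \<le> \<gamma> k" by (simp add: \<gamma>_eq divide_inverse add.commute)
  qed
  finally show "(\<gamma>s / Nst) * (harm n :: real) \<le> (\<Sum>k<n. \<gamma> k)" .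
 qed
qed

section \<open>The filtration\<close>

lemma X_restrict_measurable:
 "(\<lambda>s. \<lambda>i\<in>{1..np (n + 2)}. X (n + 1) i s) \<in> measurable M (\<Pi>\<^sub>M i\<in>{1..np (n + 2)}. count_space UNIV)"
 using X_measurable[of _ "n + 1"] by (intro measurable_restrict) auto

abbreviation Xalg :: "nat \<Rightarrow> 'w measure" where
 "Xalg n \<equiv> vimage_algebra (space M) (\<lambda>s. \<lambda>i\<in>{1..np (n + 2)}. X (n + 1) i s)
   (\<Pi>\<^sub>M i\<in>{1..np (n + 2)}. count_space UNIV)"

lemma Xalg_sub: "space (Xalg n) = space M" "sets (Xalg n) \<subseteq> sets M"
proof -
 show "space (Xalg n) = space M" by simp
 have "sets (Xalg n) = {(\<lambda>s. \<lambda>i\<in>{1..np (n + 2)}. X (n + 1) i s) -` A \<inter> space M | A. A \<in> sets (\<Pi>\<^sub>M i\<in>{1..np (n + 2)}. count_space UNIV)}"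
  using measurable_space[OF X_restrict_measurable[of n]] by (intro sets_vimage_algebra2) blast
 then show "sets (Xalg n) \<subseteq> sets M" using measurable_sets[OF X_restrict_measurable[of n]] by auto
qed

lemma \<iota>alg_sub:
 assumes "f \<in> measurable M (count_space UNIV)"
 shows "space (vimage_algebra (space M) f (count_space UNIV)) = space M"
  "sets (vimage_algebra (space M) f (count_space UNIV)) \<subseteq> sets M"
 using measurable_sets[OF assms] by (auto simp: sets_vimage_algebra2)

text \<open>The three facts are proved together, because each field is generated from its
  predecessor and its space is known only through that construction.\<close>

lemma F_props: "space (F n) = space M \<and> sets (F n) \<subseteq> sets M"
 and G_props: "space (G (Suc n)) = space M \<and> sets (G (Suc n)) \<subseteq> sets M \<and> sets (F n) \<subseteq> sets (G (Suc n))
   \<and> sets (Xalg n) \<subseteq> sets (G (Suc n))"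
 and FG_props: "sets (G (Suc n)) \<subseteq> sets (F (Suc n)) \<and> \<iota> (n + 2) \<in> measurable (F (Suc n)) (count_space UNIV)"
proof -
 have G: "space (G (Suc n)) = space M \<and> sets (G (Suc n)) \<subseteq> sets M \<and> sets (F n) \<subseteq> sets (G (Suc n))
   \<and> sets (Xalg n) \<subseteq> sets (G (Suc n))" if "space (F n) = space M \<and> sets (F n) \<subseteq> sets M" for n
 proof -
  note J = sigma_join_props[OF conjunct1[OF that] Xalg_sub(1)[of n] conjunct2[OF that] Xalg_sub(2)[of n]]
  have eq: "sets (G (Suc n)) = sets (sigma_join (F n) (Xalg n))" using G_step[of n] by simp
  have sp: "space (G (Suc n)) = space (sigma_join (F n) (Xalg n))" by (rule sets_eq_imp_space_eq[OF eq])
  show ?thesis unfolding sp eq by (intro conjI J)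
 qed
 have Fs: "space (F (Suc n)) = space M \<and> sets (F (Suc n)) \<subseteq> sets M \<and> sets (G (Suc n)) \<subseteq> sets (F (Suc n))
   \<and> \<iota> (n + 2) \<in> measurable (F (Suc n)) (count_space UNIV)"
  if F: "space (F n) = space M \<and> sets (F n) \<subseteq> sets M" for n
 proof -
  have Hs: "space (H (Suc n)) = space M" "sets (H (Suc n)) \<subseteq> sets M"
   using H_subfield[of n] by (auto simp: subalgebra_def)
  have G1: "space (G (Suc n)) = space M" "sets (G (Suc n)) \<subseteq> sets M" using G[OF F] by blast+
  note GH = sigma_join_props[OF G1(1) Hs(1) G1(2) Hs(2)]
  have im: "\<iota> (n + 2) \<in> measurable M (count_space UNIV)"
   using measurable_mono_source[OF \<iota>_measurable[of n], of M] GH(1,2) by simp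
  let ?I = "vimage_algebra (space M) (\<iota> (n + 2)) (count_space UNIV)"
  have eq: "sets (F (Suc n)) = sets (sigma_join (G (Suc n)) ?I)" using F_step[of n] by simp
  have sp: "space (F (Suc n)) = space (sigma_join (G (Suc n)) ?I)" by (rule sets_eq_imp_space_eq[OF eq])
  note J = sigma_join_props[OF G1(1) \<iota>alg_sub(1)[OF im] G1(2) \<iota>alg_sub(2)[OF im]]
  have "\<iota> (n + 2) \<in> measurable ?I (count_space UNIV)" by (rule measurable_vimage_algebra1) simp
  then have "\<iota> (n + 2) \<in> measurable (F (Suc n)) (count_space UNIV)"
   by (rule measurable_mono_source) (unfold sp eq J(1), rule \<iota>alg_sub(1)[OF im], rule J(4))
  then show ?thesis using J(1-3) unfolding sp eq by blast
 qed
 show F: "space (F n) = space M \<and> sets (F n) \<subseteq> sets M" for n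
 proof (induction n)
  case 0
  have "space (F 0) \<in> {{}, space M}" unfolding F_init[symmetric] by (rule sets.top)
  moreover have "space M \<subseteq> space (F 0)" by (rule sets.sets_into_space) (simp add: F_init)
  ultimately have "space (F 0) = space M" by blast
  moreover have "sets (F 0) \<subseteq> sets M" unfolding F_init by simp
  ultimately show ?case ..
 next
  case (Suc n)
  show ?case using Fs[OF Suc] by blast
 qed
 show "space (G (Suc n)) = space M \<and> sets (G (Suc n)) \<subseteq> sets M \<and> sets (F n) \<subseteq> sets (G (Suc n))
   \<and> sets (Xalg n) \<subseteq> sets (G (Suc n))" by (rule G[OF F])
 show "sets (G (Suc n)) \<subseteq> sets (F (Suc n)) \<and> \<iota> (n + 2) \<in> measurable (F (Suc n)) (count_space UNIV)"
  using Fs[OF F] by blast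
qed

lemma F_subalgebra: "subalgebra M (F n)"
 using F_props by (simp add: subalgebra_def)

lemma F_mono: "f \<in> measurable (F n) N \<Longrightarrow> f \<in> measurable (F (Suc n)) N"
 by (erule measurable_mono_source) (use F_props G_props[of n] FG_props[of n] in auto)

lemma F_measurable_M: "f \<in> measurable (F n) N \<Longrightarrow> f \<in> measurable M N"
 by (erule measurable_mono_source) (use F_props in auto)

lemma X_F_measurable: "i \<in> {1..np (n + 1)} \<Longrightarrow> X n i \<in> measurable (F n) (count_space UNIV)"
proof (cases n)
 case 0
 assume "i \<in> {1..np (n + 1)}"
 then have "i = 1" using 0 num_particles_1[OF \<zeta>] by simp
 have "(\<lambda>s. x0) \<in> measurable (F n) (count_space UNIV)" by simp
 then show ?thesis using X_init F_props 0 \<open>i = 1\<close> by (subst measurable_cong[of _ _ "\<lambda>s. x0"]) auto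
next
 case (Suc k)
 assume "i \<in> {1..np (n + 1)}"
 then have i: "i \<in> {1..np (k + 2)}" using Suc by simp
 have "(\<lambda>s. \<lambda>i\<in>{1..np (k + 2)}. X (k + 1) i s) \<in> measurable (Xalg k) (\<Pi>\<^sub>M i\<in>{1..np (k + 2)}. count_space UNIV)"
  using measurable_space[OF X_restrict_measurable[of k]] by (intro measurable_vimage_algebra1) blast
 then have "(\<lambda>s. (\<lambda>i\<in>{1..np (k + 2)}. X (k + 1) i s) i) \<in> measurable (Xalg k) (count_space UNIV)"
  by (rule measurable_compose[OF _ measurable_component_singleton[OF i]])
 then have "X n i \<in> measurable (Xalg k) (count_space UNIV)" using i Suc by simp
 then show ?thesis by (rule measurable_mono_source) (use F_props G_props[of k] FG_props[of k] Suc in auto)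
qed

lemma \<iota>_F_measurable: "\<iota> (n + 1) \<in> measurable (F n) (count_space UNIV)"
proof (cases n)
 case 0
 have "(\<lambda>s. 1 :: nat) \<in> measurable (F n) (count_space UNIV)" by simp
 then show ?thesis using \<iota>_init F_props 0 by (subst measurable_cong[of _ _ "\<lambda>s. 1"]) auto
next
 case (Suc k)
 then show ?thesis using FG_props[of k] by simp
qed

text \<open>Only the particles that enter the update of \<theta> at time n are averaged; a particle
  added at time n + 1 already has a position at time n but is left out here.\<close>

definition emp :: "nat \<Rightarrow> 'w \<Rightarrow> real ^ 'd" where
 "emp n s = (1 / real (np n)) *\<^sub>R (\<Sum>i=1..np n. axis (X n i s) 1)"

text \<open>The same average with the particle just added. It is the starting configuration of the
  next transition, so conditional means at time n + 1 are computed from it.\<close>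

definition emp' :: "nat \<Rightarrow> 'w \<Rightarrow> real ^ 'd" where
 "emp' n s = (1 / real (np (Suc n))) *\<^sub>R (\<Sum>i=1..np (Suc n). axis (X n i s) 1)"

lemma emp_simplex: "emp n s \<in> prob_simplex" and emp'_simplex: "emp' n s \<in> prob_simplex"
 unfolding emp_def emp'_def by (intro simplex_average np_pos)+

lemma axis_X_measurable:
 fixes f :: "'d \<Rightarrow> 'b::topological_space"
 assumes "i \<in> {1..np (n + 1)}"
 shows "(\<lambda>s. f (X n i s)) \<in> borel_measurable (F n)"
 by (rule measurable_compose[OF X_F_measurable[OF assms]]) simp

lemma emp'_measurable: "emp' n \<in> borel_measurable (F n)"
 unfolding emp'_def[abs_def]
 by (intro borel_measurable_scaleR borel_measurable_const borel_measurable_sum axis_X_measurable) auto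

lemma emp_measurable: "emp n \<in> borel_measurable (F n)"
 unfolding emp_def[abs_def] using np_mono1[of n]
 by (intro borel_measurable_scaleR borel_measurable_const borel_measurable_sum axis_X_measurable) auto

lemma \<theta>_recursion: "s \<in> space M \<Longrightarrow> \<theta> (Suc n) s = (1 - \<gamma> n) *\<^sub>R \<theta> n s + \<gamma> n *\<^sub>R emp (Suc n) s"
 using \<theta>_step[of s n] by (simp add: \<gamma>_def emp_def)

lemma \<theta>_simplex: "s \<in> space M \<Longrightarrow> \<theta> n s \<in> prob_simplex"
proof (induction n)
 case 0
 then show ?case using \<theta>_init by (simp add: prob_simplex_def axis_def)
next
 case (Suc n)
 then show ?case unfolding \<theta>_recursion[OF Suc.prems]
  by (intro simplex_convex emp_simplex less_imp_le[OF \<gamma>_pos] \<gamma>_le_1) auto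
qed

lemma \<theta>_measurable: "\<theta> n \<in> borel_measurable (F n)"
proof (induction n)
 case 0
 have "(\<lambda>s. axis x0 1 :: real ^ 'd) \<in> borel_measurable (F 0)" by simp
 then show ?case using \<theta>_init F_props by (subst measurable_cong[of _ _ "\<lambda>s. axis x0 1"]) auto
next
 case (Suc n)
 have "(\<lambda>s. (1 - \<gamma> n) *\<^sub>R \<theta> n s + \<gamma> n *\<^sub>R emp (Suc n) s) \<in> borel_measurable (F (Suc n))"
  by (intro borel_measurable_add borel_measurable_scaleR borel_measurable_const F_mono[OF Suc] emp_measurable)
 then show ?case using \<theta>_recursion F_props by (subst measurable_cong) auto
qed

text \<open>The bound is zero unless a particle is born, and then one of np (n + 1) equal masses has
  changed. Keeping the increment of the particle number explicit is what makes the births summable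
  later.\<close>

lemma emp'_minus_emp: "norm (emp' n s - emp n s) \<le> 2 * (real (np (Suc n)) - real (np n)) / real (np (Suc n))"
proof (cases "np (Suc n) = np n")
 case True
 then show ?thesis by (simp add: emp_def emp'_def)
next
 case False
 then have eq: "np (Suc n) = Suc (np n)" using num_particles_step[OF \<zeta>, of n] by simp
 define a where "a = real (np n)"
 have a: "1 \<le> a" using np_pos[of n] by (simp add: a_def)
 define S where "S = (\<Sum>i=1..np n. axis (X n i s) 1 :: real ^ 'd)"
 have "S = a *\<^sub>R emp n s" using a by (simp add: S_def emp_def a_def)
 then have "emp' n s = (1 / (a + 1)) *\<^sub>R (a *\<^sub>R emp n s + axis (X n (Suc (np n)) s) 1)"
  unfolding emp'_def eq by (simp add: S_def a_def add.commute)
 then have "emp' n s - emp n s = (1 / (a + 1)) *\<^sub>R (axis (X n (Suc (np n)) s) 1 - emp n s)"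
 proof -
  have "(1 / (a + 1)) *\<^sub>R (a *\<^sub>R v + w) - v = (1 / (a + 1)) *\<^sub>R (w - v)" for v w :: "real ^ 'd"
  proof -
   have "v = (1 / (a + 1)) *\<^sub>R ((a + 1) *\<^sub>R v)" using a by simp
   then have "(1 / (a + 1)) *\<^sub>R (a *\<^sub>R v + w) - v = (1 / (a + 1)) *\<^sub>R (a *\<^sub>R v + w - (a + 1) *\<^sub>R v)"
    by (metis scaleR_diff_right)
   then show ?thesis by (simp add: scaleR_add_left)
  qed
  then show ?thesis using \<open>emp' n s = _\<close> by simp
 qed
 moreover have "norm (axis (X n (Suc (np n)) s) 1 - emp n s) \<le> 1 + 1"
  using norm_triangle_ineq4[of "axis (X n (Suc (np n)) s) 1" "emp n s"] norm_le_l1[of "emp n s"] emp_simplex[of n s]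
  by (simp add: norm_axis_1 l1_def prob_simplex_def)
 ultimately have "norm (emp' n s - emp n s) \<le> (1 / (a + 1)) * 2"
  using a by (simp add: divide_right_mono)
 then show ?thesis using eq by (simp add: a_def add.commute)
qed

section \<open>The transition kernel\<close>

text \<open>Conditional probabilities are used only in this integrated form, against bounded
  variables measurable at time n.\<close>

lemma cond_exp_integral:
 fixes Y :: "'w \<Rightarrow> real"
 assumes Y: "Y \<in> borel_measurable (F n)" "\<And>s. \<bar>Y s\<bar> \<le> B" and E: "E \<in> sets M"
  and p: "AE s in M. real_cond_exp M (F n) (indicator E) s = p s" "p \<in> borel_measurable M"
 shows "(\<integral>s. Y s * indicator E s \<partial>M) = (\<integral>s. Y s * p s \<partial>M)"
proof -
 interpret fs: finite_measure_subalgebra M "F n" by unfold_locales (rule F_subalgebra)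
 have "integrable M (\<lambda>s. Y s * indicator E s)"
  using F_measurable_M[OF Y(1)] E Y(2) order_trans[OF abs_ge_zero Y(2)]
  by (intro integrable_const_bound[of _ B]) (auto simp: indicator_def)
 then have "(\<integral>s. Y s * indicator E s \<partial>M) = (\<integral>s. Y s * real_cond_exp M (F n) (indicator E) s \<partial>M)"
  using E by (intro fs.real_cond_exp_intg(2)[symmetric] Y) auto
 also have "\<dots> = (\<integral>s. Y s * p s \<partial>M)"
  using p F_measurable_M[OF Y(1)]
  by (intro integral_cong_AE) (auto intro: borel_measurable_times borel_measurable_cond_exp2)
 finally show ?thesis .
qed

definition Kx :: "nat \<Rightarrow> 'w \<Rightarrow> nat \<Rightarrow> 'd \<Rightarrow> real" where
 "Kx n s i y = Kmat P (\<theta> n s) $ X n i s $ y"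

lemma Kx_measurable:
 assumes "i \<in> {1..np (n + 1)}" shows "(\<lambda>s. Kx n s i y) \<in> borel_measurable (F n)"
proof -
 have "Kx n s i y = P0 $ X n i s $ y + q0 $ X n i s * \<theta> n s $ y" for s
  by (simp add: Kx_def Kmat_component)
 then show ?thesis
  using axis_X_measurable[OF assms, of "\<lambda>x. P0 $ x $ y"] axis_X_measurable[OF assms, of "\<lambda>x. q0 $ x"]
   measurable_compose[OF \<theta>_measurable[of n] borel_measurable_nth[of y]]
  by (simp add: borel_measurable_add borel_measurable_times)
qed

lemma Kx_prob: "s \<in> space M \<Longrightarrow> 0 \<le> Kx n s i y" "s \<in> space M \<Longrightarrow> (\<Sum>y\<in>UNIV. Kx n s i y) = 1"
 using Kmat_nonneg[OF \<theta>_simplex] Kmat_row_sum[OF \<theta>_simplex] by (auto simp: Kx_def)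

lemma Kx_le_1: "s \<in> space M \<Longrightarrow> Kx n s i y \<le> 1"
 using member_le_sum[of y UNIV "Kx n s i"] Kx_prob by simp

lemma configuration_set:
 assumes "k \<le> np (n + 1)" shows "{s \<in> space M. \<forall>i\<in>{1..k}. X n i s = y i} \<in> sets M"
proof -
 have "{s \<in> space M. X n i s = y i} \<in> sets M" if "i \<in> {1..k}" for i
  using measurable_sets[OF X_measurable[of i n], of "{y i}"] that assms by (auto simp: vimage_def Int_def conj_commute)
 then show ?thesis by (intro sets.sets_Collect_finite_All) auto
qed

text \<open>Only the first np (n + 1) particles at time n + 1 are specified. If another one is born,
  its position is summed out; the row of the kernel chosen by the parent sums to one, so the rule
  for choosing parents disappears here.\<close>

lemma transition_integral:
 fixes Y :: "'w \<Rightarrow> real"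
 assumes Y: "Y \<in> borel_measurable (F n)" "\<And>s. \<bar>Y s\<bar> \<le> B"
 shows "(\<integral>s. Y s * indicator {s \<in> space M. \<forall>i\<in>{1..np (n + 1)}. X (n + 1) i s = y i} s \<partial>M)
   = (\<integral>s. Y s * (\<Prod>i=1..np (n + 1). Kx n s i (y i)) \<partial>M)"
proof -
 let ?I = "{1..np (n + 1)}"
 have conf: "finite (?I \<rightarrow>\<^sub>E (UNIV :: 'd set))" by (intro finite_PiE) auto
 have pm: "(\<lambda>s. \<Prod>i=1..np (n + 1). Kx n s i (y i)) \<in> borel_measurable (F n)" for y
  by (intro borel_measurable_prod Kx_measurable) auto
 consider "np (n + 2) = np (n + 1)" | "np (n + 2) = np (n + 1) + 1"
  using num_particles_step[OF \<zeta>, of "n + 1"] by auto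
 then show ?thesis
 proof cases
  case 1
  have "AE s in M. \<forall>x\<in>?I \<rightarrow>\<^sub>E UNIV. (\<forall>i\<in>?I. X n i s = x i) \<longrightarrow>
    real_cond_exp M (F n) (indicator {s \<in> space M. \<forall>i\<in>{1..np (n + 2)}. X (n + 1) i s = y i}) s
    = (\<Prod>i=1..np (n + 1). Kmat P (\<theta> n s) $ x i $ y i)"
   by (rule AE_finite_allI[OF conf]) (rule transition_same[OF 1])
  then have "AE s in M. real_cond_exp M (F n) (indicator {s \<in> space M. \<forall>i\<in>{1..np (n + 2)}. X (n + 1) i s = y i}) s
    = (\<Prod>i=1..np (n + 1). Kx n s i (y i))"
  proof eventually_elim
   case (elim s)
   from elim[THEN bspec, of "\<lambda>i\<in>?I. X n i s"] show ?case by (simp add: Kx_def)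
  qed
  then show ?thesis unfolding 1
   by (intro cond_exp_integral[OF Y] configuration_set F_measurable_M[OF pm]) (use 1 in auto)
 next
  case 2
  \<comment> \<open>The index of the newborn, the only factor of the transition law in which the
    parent occurs.\<close>
  define l where "l = np (n + 2)"
  have lI: "{1..np (n + 2)} = insert l ?I" "l \<notin> ?I" unfolding l_def 2 by auto
  have set: "{s \<in> space M. \<forall>i\<in>{1..np (n + 2)}. X (n + 1) i s = (y(l := z)) i} \<in> sets M" for z
   by (rule configuration_set) simp
  have ae: "AE s in M. real_cond_exp M (F n) (indicator {s \<in> space M. \<forall>i\<in>{1..np (n + 2)}. X (n + 1) i s = (y(l := z)) i}) s
    = (\<Prod>i=1..np (n + 1). Kx n s i (y i)) * Kx n s (\<iota> (n + 1) s) z" for z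
  proof -
   have "AE s in M. \<forall>p\<in>(?I \<rightarrow>\<^sub>E UNIV) \<times> ?I. (\<forall>i\<in>?I. X n i s = fst p i) \<and> \<iota> (n + 1) s = snd p \<longrightarrow>
     real_cond_exp M (F n) (indicator {s \<in> space M. \<forall>i\<in>{1..np (n + 2)}. X (n + 1) i s = (y(l := z)) i}) s
     = (\<Prod>i=1..np (n + 1). Kmat P (\<theta> n s) $ fst p i $ (y(l := z)) i)
       * Kmat P (\<theta> n s) $ fst p (snd p) $ (y(l := z)) (np (n + 2))"
   proof (rule AE_finite_allI)
    show "finite ((?I \<rightarrow>\<^sub>E (UNIV :: 'd set)) \<times> ?I)" using conf by simp
   next
    fix p assume "p \<in> (?I \<rightarrow>\<^sub>E (UNIV :: 'd set)) \<times> ?I"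
    then have "snd p \<in> ?I" by auto
    from transition_birth[OF 2 this]
    show "AE s in M. (\<forall>i\<in>?I. X n i s = fst p i) \<and> \<iota> (n + 1) s = snd p \<longrightarrow>
     real_cond_exp M (F n) (indicator {s \<in> space M. \<forall>i\<in>{1..np (n + 2)}. X (n + 1) i s = (y(l := z)) i}) s
     = (\<Prod>i=1..np (n + 1). Kmat P (\<theta> n s) $ fst p i $ (y(l := z)) i)
       * Kmat P (\<theta> n s) $ fst p (snd p) $ (y(l := z)) (np (n + 2))" .
   qed
   moreover have "AE s in M. s \<in> space M" by (rule AE_space)
   ultimately show ?thesis
   proof eventually_elim
    case (elim s)
    have i: "\<iota> (n + 1) s \<in> ?I" using \<iota>_range[OF elim(2)] .
    have pr: "(\<Prod>i=1..np (n + 1). Kx n s i ((y(l := z)) i)) = (\<Prod>i=1..np (n + 1). Kx n s i (y i))"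
     using lI(2) by (intro prod.cong) auto
    from elim(1)[THEN bspec, of "(\<lambda>i\<in>?I. X n i s, \<iota> (n + 1) s)"] i
    have "np (Suc (Suc n)) = l" by (simp add: l_def)
    then show ?case using pr elim(1)[THEN bspec, of "(\<lambda>i\<in>?I. X n i s, \<iota> (n + 1) s)"] i by (simp add: Kx_def)
   qed
  qed
  have ind: "indicator {s \<in> space M. \<forall>i\<in>?I. X (n + 1) i s = y i} s
    = (\<Sum>z\<in>UNIV. indicator {s \<in> space M. \<forall>i\<in>{1..np (n + 2)}. X (n + 1) i s = (y(l := z)) i} s :: real)" for s
  proof -
   have "(\<forall>i\<in>{1..np (n + 2)}. X (n + 1) i s = (y(l := z)) i) \<longleftrightarrow> (\<forall>i\<in>?I. X (n + 1) i s = y i) \<and> z = X (n + 1) l s" for z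
    unfolding lI(1) using lI(2) by (auto simp del: atLeastAtMost_iff)
   then have "(\<Sum>z\<in>UNIV. indicator {s \<in> space M. \<forall>i\<in>{1..np (n + 2)}. X (n + 1) i s = (y(l := z)) i} s :: real)
     = (\<Sum>z\<in>UNIV. if z = X (n + 1) l s then indicator {s \<in> space M. \<forall>i\<in>?I. X (n + 1) i s = y i} s else 0)"
    by (intro sum.cong) (auto simp: indicator_def simp del: atLeastAtMost_iff)
   then show ?thesis by simp
  qed
  have Kim: "(\<lambda>s. Kx n s (\<iota> (n + 1) s) z) \<in> borel_measurable (F n)" for z
  proof -
   have "(\<lambda>s. \<Sum>i=1..np (n + 1). Kx n s i z * indicator {s \<in> space M. \<iota> (n + 1) s = i} s) \<in> borel_measurable (F n)"
   proof (intro borel_measurable_sum borel_measurable_times Kx_measurable borel_measurable_indicator)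
    fix i show "{s \<in> space M. \<iota> (n + 1) s = i} \<in> sets (F n)"
     using measurable_sets[OF \<iota>_F_measurable[of n], of "{i}"] F_props[of n]
     by (auto simp: vimage_def Int_def conj_commute)
   qed
   moreover have "(\<Sum>i=1..np (n + 1). Kx n s i z * indicator {s \<in> space M. \<iota> (n + 1) s = i} s) = Kx n s (\<iota> (n + 1) s) z"
    if "s \<in> space (F n)" for s
   proof -
    have w: "s \<in> space M" using that F_props by simp
    have "(\<Sum>i=1..np (n + 1). Kx n s i z * indicator {s \<in> space M. \<iota> (n + 1) s = i} s)
      = (\<Sum>i=1..np (n + 1). if \<iota> (n + 1) s = i then Kx n s i z else 0)"
     using w by (intro sum.cong) (auto simp: indicator_def)
    then show ?thesis using \<iota>_range[OF w, of "n + 1"] by simp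
   qed
   ultimately show ?thesis by (subst measurable_cong[symmetric]) auto
  qed
  have intS: "integrable M (\<lambda>s. Y s * indicator {s \<in> space M. \<forall>i\<in>{1..np (n + 2)}. X (n + 1) i s = (y(l := z)) i} s)" for z
   using F_measurable_M[OF Y(1)] set[of z] Y(2) order_trans[OF abs_ge_zero Y(2)]
   by (intro integrable_const_bound[of _ B]) (auto simp: indicator_def)
  have intK: "integrable M (\<lambda>s. Y s * ((\<Prod>i=1..np (n + 1). Kx n s i (y i)) * Kx n s (\<iota> (n + 1) s) z))" for z
  proof (rule integrable_const_bound[of _ B])
   have "\<bar>(\<Prod>i=1..np (n + 1). Kx n s i (y i)) * Kx n s (\<iota> (n + 1) s) z\<bar> \<le> 1" if "s \<in> space M" for s
    using Kx_prob(1)[OF that] Kx_le_1[OF that] by (simp add: abs_mult prod_nonneg prod_le_1 mult_le_one)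
   note p1 = this
   have "norm (Y s * t) \<le> B" if "\<bar>t\<bar> \<le> 1" for t s
    using mult_mono[OF Y(2)[of s] that order_trans[OF abs_ge_zero Y(2)[of s]] abs_ge_zero]
    by (simp add: abs_mult)
   then show "AE s in M. norm (Y s * ((\<Prod>i=1..np (n + 1). Kx n s i (y i)) * Kx n s (\<iota> (n + 1) s) z)) \<le> B"
    using p1 by (intro AE_I2) blast
   show "(\<lambda>s. Y s * ((\<Prod>i=1..np (n + 1). Kx n s i (y i)) * Kx n s (\<iota> (n + 1) s) z)) \<in> borel_measurable M"
    by (intro borel_measurable_times F_measurable_M[OF Y(1)] F_measurable_M[OF pm] F_measurable_M[OF Kim])
  qed
  have "(\<integral>s. Y s * indicator {s \<in> space M. \<forall>i\<in>?I. X (n + 1) i s = y i} s \<partial>M)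
    = (\<Sum>z\<in>UNIV. \<integral>s. Y s * indicator {s \<in> space M. \<forall>i\<in>{1..np (n + 2)}. X (n + 1) i s = (y(l := z)) i} s \<partial>M)"
   unfolding ind sum_distrib_left by (intro Bochner_Integration.integral_sum intS)
  also have "\<dots> = (\<Sum>z\<in>UNIV. \<integral>s. Y s * ((\<Prod>i=1..np (n + 1). Kx n s i (y i)) * Kx n s (\<iota> (n + 1) s) z) \<partial>M)"
   by (intro sum.cong refl cond_exp_integral[OF Y set ae] borel_measurable_times F_measurable_M[OF pm] F_measurable_M[OF Kim])
  also have "\<dots> = (\<integral>s. (\<Sum>z\<in>UNIV. Y s * ((\<Prod>i=1..np (n + 1). Kx n s i (y i)) * Kx n s (\<iota> (n + 1) s) z)) \<partial>M)"
   by (intro Bochner_Integration.integral_sum[symmetric] intK)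
  also have "\<dots> = (\<integral>s. Y s * (\<Prod>i=1..np (n + 1). Kx n s i (y i)) \<partial>M)"
   by (intro Bochner_Integration.integral_cong refl)
    (simp add: sum_distrib_left[symmetric] Kx_prob)
  finally show ?thesis .
 qed
qed

end

lemma exp_quadratic_upper:
 fixes x :: real
 assumes "\<bar>x\<bar> \<le> 1" shows "exp x \<le> 1 + x + x\<^sup>2"
proof (cases "0 \<le> x")
 case True
 then show ?thesis using exp_bound[of x] assms by simp
next
 case False
 define y where "y = - x"
 have y: "0 \<le> y" "y \<le> 1" using False assms by (auto simp: y_def)
 have 1: "1 + y + y\<^sup>2 / 2 \<le> exp y" using y by (intro exp_lower_Taylor_quadratic)
 \<comment> \<open>The right-hand side is the product of 1 - y + y^2 with the lower Taylor bound of
   exp y, so that division by exp y gives the claim at -y.\<close>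
 have "1 \<le> 1 + y\<^sup>2 / 2 + y ^ 3 / 2 + y ^ 4 / 2" using y by simp
 also have "\<dots> = (1 - y + y\<^sup>2) * (1 + y + y\<^sup>2 / 2)"
  by (simp add: field_simps power2_eq_square power3_eq_cube power4_eq_xxxx)
 also have "\<dots> \<le> (1 - y + y\<^sup>2) * exp y" using y 1 by (intro mult_left_mono) auto
 finally have "1 * exp (- y) \<le> (1 - y + y\<^sup>2) * exp y * exp (- y)" by (intro mult_right_mono) auto
 then show ?thesis by (simp add: y_def mult.assoc exp_add[symmetric] del: exp_minus)
qed

lemma exp_neg_linear_approx:
 fixes t :: real
 assumes "0 \<le> t" "t \<le> 1" shows "\<bar>exp (- t) - (1 - t)\<bar> \<le> t\<^sup>2"
 using exp_quadratic_upper[of "- t"] exp_ge_add_one_self[of "- t"] assms by (auto simp: abs_le_iff)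

lemma borel_measurable_complex_of_real:
 "f \<in> borel_measurable N \<Longrightarrow> (\<lambda>x. complex_of_real (f x)) \<in> borel_measurable N"
 by (rule measurable_compose[OF _ borel_measurable_of_real])

context interacting_particles begin

lemma transition_integral_complex:
 fixes Y :: "'w \<Rightarrow> complex"
 assumes Y: "Y \<in> borel_measurable (F n)" "\<And>s. norm (Y s) \<le> B"
 shows "(\<integral>s. Y s * of_real (indicator {s \<in> space M. \<forall>i\<in>{1..np (n + 1)}. X (n + 1) i s = y i} s) \<partial>M)
   = (\<integral>s. Y s * of_real (\<Prod>i=1..np (n + 1). Kx n s i (y i)) \<partial>M)"
proof -
 let ?S = "{s \<in> space M. \<forall>i\<in>{1..np (n + 1)}. X (n + 1) i s = y i}"
 have YM: "Y \<in> borel_measurable M" by (rule F_measurable_M[OF Y(1)])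
 have B0: "0 \<le> B" using order_trans[OF norm_ge_zero Y(2)] .
 have S: "?S \<in> sets M" using np_mono1[of "n + 1"] by (intro configuration_set) simp
 have pm: "(\<lambda>s. \<Prod>i=1..np (n + 1). Kx n s i (y i)) \<in> borel_measurable M"
  by (intro borel_measurable_prod F_measurable_M[OF Kx_measurable]) auto
 have p01: "\<bar>\<Prod>i=1..np (n + 1). Kx n s i (y i)\<bar> \<le> 1" if "s \<in> space M" for s
  using Kx_prob(1)[OF that] Kx_le_1[OF that] by (simp add: prod_nonneg prod_le_1)
 have bound: "norm (Y s * of_real t) \<le> B" if "\<bar>t\<bar> \<le> 1" for t s
  using mult_mono[OF Y(2)[of s] that B0 abs_ge_zero] by (simp add: norm_mult)
 have i1: "integrable M (\<lambda>s. Y s * of_real (indicator ?S s))"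
 proof (rule integrable_const_bound[of _ B])
  show "AE s in M. norm (Y s * of_real (indicator ?S s)) \<le> B" by (intro AE_I2 bound) (simp add: indicator_def)
  have "(\<lambda>s. indicator ?S s :: real) \<in> borel_measurable M" by (rule borel_measurable_indicator[OF S])
  then show "(\<lambda>s. Y s * of_real (indicator ?S s)) \<in> borel_measurable M"
   by (intro borel_measurable_times[OF YM] borel_measurable_complex_of_real)
 qed
 have i2: "integrable M (\<lambda>s. Y s * of_real (\<Prod>i=1..np (n + 1). Kx n s i (y i)))"
 proof (rule integrable_const_bound[of _ B])
  show "AE s in M. norm (Y s * of_real (\<Prod>i=1..np (n + 1). Kx n s i (y i))) \<le> B" by (intro AE_I2 bound p01)
 qed (intro borel_measurable_times borel_measurable_complex_of_real YM pm)
 have Re: "(\<lambda>s. Re (Y s)) \<in> borel_measurable (F n)" "(\<lambda>s. Im (Y s)) \<in> borel_measurable (F n)"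
  using Y(1) by simp_all
 have Reb: "\<bar>Re (Y s)\<bar> \<le> B" "\<bar>Im (Y s)\<bar> \<le> B" for s
  using order_trans[OF abs_Re_le_cmod Y(2)] order_trans[OF abs_Im_le_cmod Y(2)] by auto
 have parts: "Re (z * of_real r) = Re z * r" "Im (z * of_real r) = Im z * r" for z r by simp_all
 show ?thesis
 proof (rule complex_eqI)
  show "Re (\<integral>s. Y s * of_real (indicator ?S s) \<partial>M) = Re (\<integral>s. Y s * of_real (\<Prod>i=1..np (n + 1). Kx n s i (y i)) \<partial>M)"
   unfolding integral_Re[OF i1, symmetric] integral_Re[OF i2, symmetric] parts by (rule transition_integral[OF Re(1) Reb(1)])
  show "Im (\<integral>s. Y s * of_real (indicator ?S s) \<partial>M) = Im (\<integral>s. Y s * of_real (\<Prod>i=1..np (n + 1). Kx n s i (y i)) \<partial>M)"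
   unfolding integral_Im[OF i1, symmetric] integral_Im[OF i2, symmetric] parts by (rule transition_integral[OF Re(2) Reb(2)])
 qed
qed

text \<open>Conditional independence of the particles given the past, by expansion over the finitely
  many configurations. Complex factors allow one statement for exponential moments and for
  characteristic functions.\<close>

lemma kernel_product_integral:
 fixes Y :: "'w \<Rightarrow> complex" and f :: "nat \<Rightarrow> 'w \<Rightarrow> 'd \<Rightarrow> complex"
 assumes Y: "Y \<in> borel_measurable (F n)" "\<And>s. norm (Y s) \<le> B"
  and f: "\<And>i y. i \<in> {1..np (n + 1)} \<Longrightarrow> (\<lambda>s. f i s y) \<in> borel_measurable (F n)" "\<And>i s y. norm (f i s y) \<le> C"
 shows "(\<integral>s. Y s * (\<Prod>i=1..np (n + 1). f i s (X (n + 1) i s)) \<partial>M)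
  = (\<integral>s. Y s * (\<Prod>i=1..np (n + 1). \<Sum>y\<in>UNIV. of_real (Kx n s i y) * f i s y) \<partial>M)"
proof -
 let ?I = "{1..np (n + 1)}"
 let ?C = "?I \<rightarrow>\<^sub>E (UNIV :: 'd set)"
 let ?ind = "\<lambda>y s. indicator {s \<in> space M. \<forall>i\<in>?I. X (n + 1) i s = y i} s :: real"
 have conf: "finite ?C" by (intro finite_PiE) auto
 define Z where "Z y s = Y s * (\<Prod>i\<in>?I. f i s (y i))" for y s
 have Zm: "Z y \<in> borel_measurable (F n)" for y unfolding Z_def[abs_def]
  by (intro borel_measurable_times Y borel_measurable_prod f) auto
 have C0: "0 \<le> C" using order_trans[OF norm_ge_zero f(2)] .
 have B0: "0 \<le> B" using order_trans[OF norm_ge_zero Y(2)] .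
 have Zb: "norm (Z y s) \<le> B * C ^ card ?I" for y s
 proof -
  have "norm (\<Prod>i\<in>?I. f i s (y i)) \<le> (\<Prod>i\<in>?I. C)" unfolding prod_norm[symmetric] by (intro prod_mono) (auto simp: f)
  then have "norm (\<Prod>i\<in>?I. f i s (y i)) \<le> C ^ card ?I" by simp
  then show ?thesis unfolding Z_def norm_mult using Y(2)[of s] B0 by (intro mult_mono) auto
 qed
 have intI: "integrable M (\<lambda>s. Z y s * of_real (?ind y s))" for y
 proof (rule integrable_const_bound[of _ "B * C ^ card ?I"])
  show "AE s in M. norm (Z y s * of_real (?ind y s)) \<le> B * C ^ card ?I"
   using Zb[of y] C0 B0 by (intro AE_I2) (auto simp: indicator_def norm_mult)
  show "(\<lambda>s. Z y s * of_real (?ind y s)) \<in> borel_measurable M"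
  proof -
   have "(?ind y) \<in> borel_measurable M" using np_mono1[of "n + 1"] by (intro borel_measurable_indicator configuration_set) simp
   then show ?thesis
    by (intro borel_measurable_times[OF F_measurable_M[OF Zm]]
      borel_measurable_complex_of_real)
  qed
 qed
 have intK: "integrable M (\<lambda>s. Z y s * of_real (\<Prod>i\<in>?I. Kx n s i (y i)))" for y
 proof (rule integrable_const_bound[of _ "B * C ^ card ?I"])
  have "norm (Z y s * of_real t) \<le> B * C ^ card ?I" if "\<bar>t\<bar> \<le> 1" for t s
  proof -
   have "norm (Z y s) * \<bar>t\<bar> \<le> (B * C ^ card ?I) * 1" using Zb C0 B0 that by (intro mult_mono) auto
   then show ?thesis by (simp add: norm_mult)
  qed
  moreover have "\<bar>\<Prod>i\<in>?I. Kx n s i (y i)\<bar> \<le> 1" if "s \<in> space M" for s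
   using Kx_prob(1)[OF that] Kx_le_1[OF that] by (simp add: prod_nonneg prod_le_1)
  ultimately show "AE s in M. norm (Z y s * of_real (\<Prod>i\<in>?I. Kx n s i (y i))) \<le> B * C ^ card ?I"
   by (intro AE_I2) blast
  show "(\<lambda>s. Z y s * of_real (\<Prod>i\<in>?I. Kx n s i (y i))) \<in> borel_measurable M"
   by (intro borel_measurable_times[OF F_measurable_M[OF Zm]] borel_measurable_complex_of_real borel_measurable_prod
     F_measurable_M[OF Kx_measurable]) auto
 qed
 have left: "Y s * (\<Prod>i\<in>?I. f i s (X (n + 1) i s)) = (\<Sum>y\<in>?C. Z y s * of_real (?ind y s))" if "s \<in> space M" for s
 proof -
  define y0 where "y0 = (\<lambda>i\<in>?I. X (n + 1) i s)"
  have y0: "y0 \<in> ?C" by (simp add: y0_def)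
  have "(\<forall>i\<in>?I. X (n + 1) i s = y i) \<longleftrightarrow> y = y0" if "y \<in> ?C" for y
  proof
   assume *: "\<forall>i\<in>?I. X (n + 1) i s = y i"
   show "y = y0" by (rule PiE_ext[OF that y0]) (use * in \<open>simp add: y0_def\<close>)
  qed (simp add: y0_def)
  then have "(\<Sum>y\<in>?C. Z y s * of_real (?ind y s)) = (\<Sum>y\<in>?C. if y = y0 then Z y s else 0)"
   using \<open>s \<in> space M\<close> by (intro sum.cong refl) (simp add: indicator_def del: atLeastAtMost_iff)
  also have "\<dots> = Z y0 s" using conf y0 by simp
  also have "\<dots> = Y s * (\<Prod>i\<in>?I. f i s (X (n + 1) i s))" by (simp add: Z_def y0_def)
  finally show ?thesis by simp
 qed
 have right: "Y s * (\<Prod>i\<in>?I. \<Sum>y\<in>UNIV. of_real (Kx n s i y) * f i s y)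
   = (\<Sum>y\<in>?C. Z y s * of_real (\<Prod>i\<in>?I. Kx n s i (y i)))" for s
  by (subst prod_sum_PiE) (auto simp: sum_distrib_left Z_def prod.distrib mult_ac intro!: sum.cong)
 have "(\<integral>s. Y s * (\<Prod>i\<in>?I. f i s (X (n + 1) i s)) \<partial>M) = (\<integral>s. (\<Sum>y\<in>?C. Z y s * of_real (?ind y s)) \<partial>M)"
  by (intro Bochner_Integration.integral_cong refl left)
 also have "\<dots> = (\<Sum>y\<in>?C. \<integral>s. Z y s * of_real (?ind y s) \<partial>M)" by (intro Bochner_Integration.integral_sum intI)
 also have "\<dots> = (\<Sum>y\<in>?C. \<integral>s. Z y s * of_real (\<Prod>i\<in>?I. Kx n s i (y i)) \<partial>M)"
  by (intro sum.cong refl transition_integral_complex[OF Zm Zb])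
 also have "\<dots> = (\<integral>s. (\<Sum>y\<in>?C. Z y s * of_real (\<Prod>i\<in>?I. Kx n s i (y i))) \<partial>M)"
  by (intro Bochner_Integration.integral_sum[symmetric] intK)
 finally show ?thesis unfolding right .
qed

text \<open>The martingale increment: the conditional mean of the next empirical measure is the
  current one, newborn included, moved by the current kernel.\<close>

definition Mart :: "nat \<Rightarrow> 'w \<Rightarrow> real ^ 'd" where
 "Mart n s = emp (Suc n) s - emp' n s v* Kmat P (\<theta> n s)"

definition dev :: "nat \<Rightarrow> real ^ 'd \<Rightarrow> nat \<Rightarrow> 'w \<Rightarrow> 'd \<Rightarrow> real" where
 "dev n w i s y = w $ y - (\<Sum>z\<in>UNIV. Kx n s i z * w $ z)"

lemma inner_empirical: "w \<bullet> ((1 / real k) *\<^sub>R (\<Sum>i=1..k. axis (x i) 1)) = (1 / real k) * (\<Sum>i=1..k. w $ x i)"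
 for w :: "real ^ 'd"
 by (simp add: inner_sum_right inner_axis)

lemma Mart_inner: "w \<bullet> Mart n s = (1 / real (np (Suc n))) * (\<Sum>i=1..np (Suc n). dev n w i s (X (Suc n) i s))"
proof -
 have "w \<bullet> (emp' n s v* Kmat P (\<theta> n s)) = (Kmat P (\<theta> n s) *v w) \<bullet> emp' n s"
  by (metis dot_lmul_matrix inner_commute)
 also have "\<dots> = (1 / real (np (Suc n))) * (\<Sum>i=1..np (Suc n). \<Sum>z\<in>UNIV. Kx n s i z * w $ z)"
  unfolding emp'_def inner_empirical by (simp add: matrix_vector_component Kx_def)
 finally show ?thesis unfolding Mart_def inner_diff_right emp_def inner_empirical
  by (simp add: dev_def sum_subtractf right_diff_distrib)
qed

lemma dev_measurable: "i \<in> {1..np (n + 1)} \<Longrightarrow> (\<lambda>s. dev n w i s y) \<in> borel_measurable (F n)"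
 unfolding dev_def by (intro borel_measurable_diff borel_measurable_const borel_measurable_sum borel_measurable_times Kx_measurable)

lemma dev_bound: "s \<in> space M \<Longrightarrow> \<bar>dev n w i s y\<bar> \<le> 2 * norm w"
proof -
 assume w: "s \<in> space M"
 have "\<bar>\<Sum>z\<in>UNIV. Kx n s i z * w $ z\<bar> \<le> (\<Sum>z\<in>UNIV. Kx n s i z * norm w)"
  using Kx_prob(1)[OF w] component_le_norm_cart[of w]
  by (intro order_trans[OF sum_abs] sum_mono) (simp add: abs_mult mult_left_mono)
 also have "\<dots> = norm w" using Kx_prob(2)[OF w] by (simp add: sum_distrib_right[symmetric])
 finally show ?thesis using component_le_norm_cart[of w y] unfolding dev_def by linarith
qed

lemma dev_mean: "s \<in> space M \<Longrightarrow> (\<Sum>y\<in>UNIV. Kx n s i y * dev n w i s y) = 0"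
 by (simp add: dev_def right_diff_distrib sum_subtractf sum_distrib_right[symmetric] Kx_prob)

lemma dev_variance:
 assumes "s \<in> space M"
 shows "(\<Sum>y\<in>UNIV. Kx n s i y * (dev n w i s y)\<^sup>2) = cvar (\<theta> n s) (X n i s) w"
proof -
 define m where "m = (\<Sum>z\<in>UNIV. Kx n s i z * w $ z)"
 have "(\<Sum>y\<in>UNIV. Kx n s i y * (dev n w i s y)\<^sup>2)
   = (\<Sum>y\<in>UNIV. Kx n s i y * (w $ y)\<^sup>2 - 2 * m * (Kx n s i y * w $ y) + m\<^sup>2 * Kx n s i y)"
  unfolding dev_def m_def[symmetric] by (intro sum.cong refl) (simp add: power2_eq_square algebra_simps)
 also have "\<dots> = (\<Sum>y\<in>UNIV. Kx n s i y * (w $ y)\<^sup>2) - 2 * m * m + m\<^sup>2"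
  unfolding sum.distrib sum_subtractf sum_distrib_left[symmetric] m_def[symmetric] Kx_prob(2)[OF assms] by simp
 finally show ?thesis unfolding cvar_def m_def Kx_def by (simp add: power2_eq_square)
qed

text \<open>Outside \<open>space M\<close> the transition weights are uncontrolled, so \<open>dev\<close> is cut off there.\<close>

definition dev0 :: "nat \<Rightarrow> real ^ 'd \<Rightarrow> nat \<Rightarrow> 'w \<Rightarrow> 'd \<Rightarrow> real" where
 "dev0 n w i s y = (if s \<in> space M then dev n w i s y else 0)"

lemma dev0_measurable: "i \<in> {1..np (n + 1)} \<Longrightarrow> (\<lambda>s. dev0 n w i s y) \<in> borel_measurable (F n)"
 using dev_measurable[of i n w y] F_props[of n] unfolding dev0_def by (subst measurable_cong[of _ _ "\<lambda>s. dev n w i s y"]) auto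

lemma dev0_bound: "\<bar>dev0 n w i s y\<bar> \<le> 2 * norm w"
 using dev_bound by (simp add: dev0_def)

text \<open>The increment is an average over particles, so its exponential factorises. The constant
  c is 1 for moments and the imaginary unit for characteristic functions.\<close>

lemma kernel_exponential:
 fixes Y :: "'w \<Rightarrow> complex" and c :: complex
 assumes Y: "Y \<in> borel_measurable (F n)" "\<And>s. norm (Y s) \<le> B"
 shows "(\<integral>s. Y s * exp (c * of_real (w \<bullet> Mart n s)) \<partial>M)
  = (\<integral>s. Y s * (\<Prod>i=1..np (Suc n). \<Sum>y\<in>UNIV. of_real (Kx n s i y) * exp (c * of_real (dev n w i s y / real (np (Suc n))))) \<partial>M)"
proof -
 let ?a = "real (np (Suc n))"
 let ?f = "\<lambda>i s y. exp (c * of_real (dev0 n w i s y / ?a))"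
 have fm: "(\<lambda>s. ?f i s y) \<in> borel_measurable (F n)" if "i \<in> {1..np (n + 1)}" for i y
 proof -
  have "continuous_on UNIV (\<lambda>t :: real. exp (c * of_real (t / ?a)))" by (cases "?a = 0") (auto intro!: continuous_intros)
  from borel_measurable_continuous_onI[OF this]
  show ?thesis by (rule measurable_compose[OF dev0_measurable[OF that]])
 qed
 have fb: "norm (?f i s y) \<le> exp (norm c * (2 * norm w / ?a))" for i s y
 proof -
  have "norm (?f i s y) \<le> exp (norm (c * of_real (dev0 n w i s y / ?a)))" by (rule norm_exp)
  also have "\<dots> \<le> exp (norm c * (2 * norm w / ?a))"
   using dev0_bound[of n w i s y] unfolding norm_mult norm_of_real abs_divide
   by (intro exp_le_cancel_iff[THEN iffD2] mult_left_mono) (auto intro: divide_right_mono)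
  finally show ?thesis .
 qed
 have "(\<integral>s. Y s * exp (c * of_real (w \<bullet> Mart n s)) \<partial>M) = (\<integral>s. Y s * (\<Prod>i=1..np (n + 1). ?f i s (X (n + 1) i s)) \<partial>M)"
 proof (intro Bochner_Integration.integral_cong refl)
  fix s assume "s \<in> space M"
  then show "Y s * exp (c * of_real (w \<bullet> Mart n s)) = Y s * (\<Prod>i=1..np (n + 1). ?f i s (X (n + 1) i s))"
   unfolding Mart_inner by (simp add: exp_sum[symmetric] sum_distrib_left dev0_def sum_divide_distrib)
 qed
 also have "\<dots> = (\<integral>s. Y s * (\<Prod>i=1..np (n + 1). \<Sum>y\<in>UNIV. of_real (Kx n s i y) * ?f i s y) \<partial>M)"
  by (rule kernel_product_integral[OF Y fm fb])
 also have "\<dots> = (\<integral>s. Y s * (\<Prod>i=1..np (Suc n). \<Sum>y\<in>UNIV. of_real (Kx n s i y) * exp (c * of_real (dev n w i s y / ?a))) \<partial>M)"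
  by (intro Bochner_Integration.integral_cong refl) (simp add: dev0_def)
 finally show ?thesis .
qed

lemma Mart_measurable: "Mart n \<in> borel_measurable (F (Suc n))"
proof -
 have vk: "v v* Kmat P \<nu> = v v* P0 + (v \<bullet> q0) *\<^sub>R \<nu>" for v \<nu> by (rule vector_Kmat)
 have "(\<lambda>s. emp' n s v* P0) \<in> borel_measurable (F n)"
  using measurable_compose[OF emp'_measurable borel_measurable_continuous_onI[OF linear_continuous_on[OF bounded_linear_vector_matrix]]] .
 moreover have "(\<lambda>s. (emp' n s \<bullet> q0) *\<^sub>R \<theta> n s) \<in> borel_measurable (F n)"
  by (intro borel_measurable_scaleR borel_measurable_inner emp'_measurable \<theta>_measurable borel_measurable_const)
 ultimately have "(\<lambda>s. emp' n s v* Kmat P (\<theta> n s)) \<in> borel_measurable (F n)"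
  unfolding vk by (rule borel_measurable_add)
 then show ?thesis unfolding Mart_def[abs_def] by (intro borel_measurable_diff emp_measurable F_mono)
qed

lemma Mart_bound: "s \<in> space M \<Longrightarrow> norm (Mart n s) \<le> 2"
proof -
 assume w: "s \<in> space M"
 have "emp' n s v* Kmat P (\<theta> n s) \<in> prob_simplex"
  using sum_vector_Kmat[OF \<theta>_simplex[OF w], of "emp' n s"] emp'_simplex[of n s] Kmat_nonneg[OF \<theta>_simplex[OF w]]
  by (auto simp: prob_simplex_def vector_matrix_component intro!: sum_nonneg mult_nonneg_nonneg)
 then show ?thesis unfolding Mart_def
  using norm_triangle_ineq4[of "emp (Suc n) s" "emp' n s v* Kmat P (\<theta> n s)"] simplex_norm_le_1 emp_simplex[of "Suc n" s]
  by (smt (verit))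
qed

lemma Mart_inner_bound: "s \<in> space M \<Longrightarrow> \<bar>w \<bullet> Mart n s\<bar> \<le> 2 * norm w"
 using Cauchy_Schwarz_ineq2[of w "Mart n s"] Mart_bound[of s n] mult_left_mono[of "norm (Mart n s)" 2 "norm w"] by simp

text \<open>Each of the a = np (n + 1) particles contributes a centred variable of size at most 2
  |w| / a, hence a factor at most exp (4 |w|^2 / a^2). The premise on w keeps the exponents within
  [-1, 1], where the quadratic bound on exp holds.\<close>

lemma Mart_exp_moment:
 fixes Y :: "'w \<Rightarrow> real"
 assumes Y: "Y \<in> borel_measurable (F n)" "\<And>s. 0 \<le> Y s" "\<And>s. Y s \<le> B"
  and w: "2 * norm w \<le> real (np (Suc n))"
 shows "(\<integral>s. Y s * exp (w \<bullet> Mart n s) \<partial>M) \<le> exp (4 * (norm w)\<^sup>2 / real (np (Suc n))) * (\<integral>s. Y s \<partial>M)"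
proof -
 define a where "a = real (np (Suc n))"
 have a: "1 \<le> a" using np_pos[of "Suc n"] by (simp add: a_def)
 define S where "S i s = (\<Sum>y\<in>UNIV. Kx n s i y * exp (dev n w i s y / a))" for i s
 have eq: "(\<integral>s. Y s * exp (w \<bullet> Mart n s) \<partial>M) = (\<integral>s. Y s * (\<Prod>i=1..np (Suc n). S i s) \<partial>M)"
 proof -
  have "complex_of_real (\<integral>s. Y s * exp (w \<bullet> Mart n s) \<partial>M) = (\<integral>s. of_real (Y s) * exp (1 * of_real (w \<bullet> Mart n s)) \<partial>M)"
   by (subst integral_complex_of_real[symmetric]) (simp add: exp_of_real)
  also have "\<dots> = (\<integral>s. of_real (Y s) * (\<Prod>i=1..np (Suc n). \<Sum>y\<in>UNIV. of_real (Kx n s i y) * exp (1 * of_real (dev n w i s y / real (np (Suc n))))) \<partial>M)"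
   using Y by (intro kernel_exponential[of _ n B]) auto
  also have "\<dots> = (\<integral>s. of_real (Y s * (\<Prod>i=1..np (Suc n). S i s)) \<partial>M)"
   by (simp add: S_def a_def exp_of_real[symmetric])
  also have "\<dots> = of_real (\<integral>s. Y s * (\<Prod>i=1..np (Suc n). S i s) \<partial>M)" by (rule integral_complex_of_real)
  finally show ?thesis by (simp only: of_real_eq_iff)
 qed
 define q where "q = exp (4 * (norm w)\<^sup>2 / a\<^sup>2)"
 have S: "0 \<le> S i s" "S i s \<le> q" if s: "s \<in> space M" for i s
 proof -
  show "0 \<le> S i s" unfolding S_def by (intro sum_nonneg mult_nonneg_nonneg Kx_prob s) auto
  have d: "\<bar>dev n w i s y / a\<bar> \<le> 2 * norm w / a" for y
   using dev_bound[OF s] a by (simp add: abs_divide divide_right_mono)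
  have d1: "\<bar>dev n w i s y / a\<bar> \<le> 1" for y
   using order_trans[OF d, of 1] w a by (simp add: a_def)
  have "S i s \<le> (\<Sum>y\<in>UNIV. Kx n s i y * (1 + dev n w i s y / a + (2 * norm w / a)\<^sup>2))"
   unfolding S_def
  proof (intro sum_mono mult_left_mono Kx_prob s)
   fix y
   have "(dev n w i s y / a)\<^sup>2 \<le> (2 * norm w / a)\<^sup>2" using power_mono[OF d[of y] abs_ge_zero, of 2] unfolding power2_abs .
   then show "exp (dev n w i s y / a) \<le> 1 + dev n w i s y / a + (2 * norm w / a)\<^sup>2"
    using exp_quadratic_upper[OF d1[of y]] by linarith
  qed
  also have "\<dots> = (\<Sum>y\<in>UNIV. Kx n s i y) + (\<Sum>y\<in>UNIV. Kx n s i y * dev n w i s y) / a + (\<Sum>y\<in>UNIV. Kx n s i y) * (2 * norm w / a)\<^sup>2"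
   by (simp add: distrib_left sum.distrib sum_distrib_right sum_divide_distrib)
  also have "\<dots> = 1 + 4 * (norm w)\<^sup>2 / a\<^sup>2" unfolding Kx_prob(2)[OF s] dev_mean[OF s] by (simp add: power_divide power_mult_distrib)
  also have "\<dots> \<le> q" unfolding q_def by (rule exp_ge_add_one_self)
  finally show "S i s \<le> q" .
 qed
 have qa: "q ^ np (Suc n) = exp (4 * (norm w)\<^sup>2 / a)"
  unfolding q_def exp_of_nat_mult[symmetric] a_def[symmetric] using a by (simp add: power2_eq_square)
 have YM: "Y \<in> borel_measurable M" by (rule F_measurable_M[OF Y(1)])
 have B0: "0 \<le> B" using order_trans[OF Y(2,3)] .
 have Yint: "integrable M Y" using Y YM by (intro integrable_const_bound[of _ B]) auto
 have Sm: "(\<lambda>s. \<Prod>i=1..np (Suc n). S i s) \<in> borel_measurable M"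
  unfolding S_def
  by (intro borel_measurable_prod borel_measurable_sum borel_measurable_times borel_measurable_exp[THEN measurable_compose[rotated]]
    borel_measurable_divide borel_measurable_const F_measurable_M[OF Kx_measurable] F_measurable_M[OF dev_measurable]) auto
 have prod: "(\<Prod>i=1..np (Suc n). S i s) \<le> q ^ np (Suc n)" "0 \<le> (\<Prod>i=1..np (Suc n). S i s)" if "s \<in> space M" for s
  using prod_mono[of "{1..np (Suc n)}" "\<lambda>i. S i s" "\<lambda>i. q"] S[OF that] by (auto intro: prod_nonneg)
 have "(\<integral>s. Y s * (\<Prod>i=1..np (Suc n). S i s) \<partial>M) \<le> (\<integral>s. Y s * q ^ np (Suc n) \<partial>M)"
 proof (rule integral_mono)
  show "integrable M (\<lambda>s. Y s * q ^ np (Suc n))" using Yint by simp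
  show "integrable M (\<lambda>s. Y s * (\<Prod>i=1..np (Suc n). S i s))"
  proof (rule integrable_const_bound[of _ "B * q ^ np (Suc n)"])
   show "AE s in M. norm (Y s * (\<Prod>i=1..np (Suc n). S i s)) \<le> B * q ^ np (Suc n)"
    using prod Y B0 by (intro AE_I2) (auto simp: abs_mult abs_of_nonneg[OF Y(2)] intro!: mult_mono)
  qed (intro borel_measurable_times YM Sm)
 qed (use prod Y in \<open>auto intro: mult_left_mono\<close>)
 also have "\<dots> = q ^ np (Suc n) * (\<integral>s. Y s \<partial>M)" by simp
 finally show ?thesis unfolding eq qa a_def .
qed

text \<open>The conditional variance of w \<bullet> Mart n multiplied by the number of
  particles.\<close>

definition vmean :: "nat \<Rightarrow> 'w \<Rightarrow> real ^ 'd \<Rightarrow> real" where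
 "vmean n s w = (\<Sum>x\<in>UNIV. emp' n s $ x * cvar (\<theta> n s) x w)"

lemma vmean_eq: "vmean n s w = (1 / real (np (Suc n))) * (\<Sum>i=1..np (Suc n). cvar (\<theta> n s) (X n i s) w)"
proof -
 have "vmean n s w = (\<chi> x. cvar (\<theta> n s) x w) \<bullet> emp' n s" by (simp add: vmean_def inner_vec_def mult.commute)
 also have "\<dots> = (1 / real (np (Suc n))) * (\<Sum>i=1..np (Suc n). cvar (\<theta> n s) (X n i s) w)"
  unfolding emp'_def inner_empirical by simp
 finally show ?thesis .
qed

lemma cvar_bounds:
 assumes "s \<in> space M" shows "0 \<le> cvar (\<theta> n s) (X n i s) w" "cvar (\<theta> n s) (X n i s) w \<le> 4 * (norm w)\<^sup>2"
proof -
 show "0 \<le> cvar (\<theta> n s) (X n i s) w" unfolding dev_variance[OF assms, symmetric]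
  by (intro sum_nonneg mult_nonneg_nonneg Kx_prob assms) auto
 have "cvar (\<theta> n s) (X n i s) w \<le> (\<Sum>y\<in>UNIV. Kx n s i y * (4 * (norm w)\<^sup>2))"
  unfolding dev_variance[OF assms, symmetric]
 proof (intro sum_mono mult_left_mono Kx_prob assms)
  fix y show "(dev n w i s y)\<^sup>2 \<le> 4 * (norm w)\<^sup>2"
   using power_mono[OF dev_bound[OF assms, of n w i y] abs_ge_zero, of 2] by (simp add: power_mult_distrib)
 qed
 also have "\<dots> = 4 * (norm w)\<^sup>2" using Kx_prob(2)[OF assms] by (simp add: sum_distrib_right[symmetric])
 finally show "cvar (\<theta> n s) (X n i s) w \<le> 4 * (norm w)\<^sup>2" .
qed

lemma vmean_bounds:
 assumes "s \<in> space M" shows "0 \<le> vmean n s w" "vmean n s w \<le> 4 * (norm w)\<^sup>2"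
proof -
 show "0 \<le> vmean n s w" unfolding vmean_eq
  by (intro mult_nonneg_nonneg sum_nonneg cvar_bounds assms) auto
 have "(\<Sum>i=1..np (Suc n). cvar (\<theta> n s) (X n i s) w) \<le> (\<Sum>i=1..np (Suc n). 4 * (norm w)\<^sup>2)"
  by (intro sum_mono cvar_bounds assms)
 then show "vmean n s w \<le> 4 * (norm w)\<^sup>2" unfolding vmean_eq using np_pos[of "Suc n"]
  by (simp add: field_simps)
qed

lemma vmean_measurable: "(\<lambda>s. vmean n s w) \<in> borel_measurable M"
proof -
 have "(\<lambda>s. Kmat P (\<theta> n s) $ x $ y) \<in> borel_measurable M" for x y
  unfolding Kmat_component
  by (intro borel_measurable_add borel_measurable_times borel_measurable_const
    measurable_compose[OF F_measurable_M[OF \<theta>_measurable] borel_measurable_nth])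
 moreover have "(\<lambda>s. emp' n s $ x) \<in> borel_measurable M" for x
  by (rule measurable_compose[OF F_measurable_M[OF emp'_measurable] borel_measurable_nth])
 ultimately show ?thesis unfolding vmean_def cvar_def
  by (intro borel_measurable_sum borel_measurable_times borel_measurable_diff borel_measurable_power borel_measurable_const)
qed

text \<open>Each particle factor agrees with a Gaussian one up to a multiple of (|w| / a)^3: the
  cubic Taylor term gives 4/3 and the expansion of the Gaussian factor gives 2. All factors have
  modulus at most 1, so the errors of the a factors of the product add up.\<close>

lemma Mart_chf:
 fixes Y :: "'w \<Rightarrow> complex"
 assumes Y: "Y \<in> borel_measurable (F n)" "\<And>s. norm (Y s) \<le> 1" and w: "norm w \<le> 1 / 2"
 shows "norm ((\<integral>s. Y s * iexp (w \<bullet> Mart n s) \<partial>M) - (\<integral>s. Y s * of_real (exp (- (vmean n s w / (2 * real (np (Suc n)))))) \<partial>M))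
  \<le> 4 * norm w ^ 3 / (real (np (Suc n)))\<^sup>2"
proof -
 define a where "a = real (np (Suc n))"
 have a: "1 \<le> a" using np_pos[of "Suc n"] by (simp add: a_def)
 define f where "f i s = (\<Sum>y\<in>UNIV. of_real (Kx n s i y) * iexp (dev n w i s y / a))" for i s
 define t where "t i s = cvar (\<theta> n s) (X n i s) w / (2 * a\<^sup>2)" for i s
 have eq: "(\<integral>s. Y s * iexp (w \<bullet> Mart n s) \<partial>M) = (\<integral>s. Y s * (\<Prod>i=1..np (Suc n). f i s) \<partial>M)"
  unfolding f_def a_def by (rule kernel_exponential[OF Y])
 have vt: "exp (- (vmean n s w / (2 * a))) = (\<Prod>i=1..np (Suc n). exp (- t i s))" for s
 proof -
  have "vmean n s w / (2 * a) = (\<Sum>i=1..np (Suc n). t i s)"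
   unfolding vmean_eq t_def a_def[symmetric] sum_divide_distrib[symmetric] using a by (simp add: power2_eq_square)
  then show ?thesis by (simp add: exp_sum[symmetric] sum_negf)
 qed
 have part: "norm (f i s - of_real (exp (- t i s))) \<le> 4 * norm w ^ 3 / a ^ 3" "norm (f i s) \<le> 1" "0 \<le> t i s"
  if s: "s \<in> space M" for i s
 proof -
  let ?d = "\<lambda>y. dev n w i s y / a"
  let ?K = "\<lambda>y. complex_of_real (Kx n s i y)"
  have "norm (f i s) \<le> (\<Sum>y\<in>UNIV. norm (?K y * iexp (?d y)))" unfolding f_def by (rule norm_sum)
  also have "\<dots> = (\<Sum>y\<in>UNIV. Kx n s i y)" by (intro sum.cong refl) (simp add: norm_mult Kx_prob[OF s])
  also have "\<dots> = 1" by (rule Kx_prob(2)[OF s])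
  finally show "norm (f i s) \<le> 1" .
  show t0: "0 \<le> t i s" unfolding t_def by (intro divide_nonneg_nonneg cvar_bounds s) auto
  have "(\<Sum>k\<le>2. (\<i> * of_real x) ^ k / fact k) = 1 + \<i> * of_real x - of_real (x\<^sup>2 / 2)" for x :: real
   by (simp add: numeral_2_eq_2 power_mult_distrib)
  note taylor = this
  have approx: "norm (iexp x - (1 + \<i> * of_real x - of_real (x\<^sup>2 / 2))) \<le> \<bar>x\<bar> ^ 3 / 6" for x :: real
   using iexp_approx1[of x 2] unfolding taylor by (simp add: numeral_3_eq_3 numeral_2_eq_2 fact_Suc)
  have mid: "(\<Sum>y\<in>UNIV. ?K y * (1 + \<i> * of_real (?d y) - of_real ((?d y)\<^sup>2 / 2))) = of_real (1 - t i s)"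
  proof -
   have "(\<Sum>y\<in>UNIV. ?K y * (1 + \<i> * of_real (?d y) - of_real ((?d y)\<^sup>2 / 2)))
    = of_real (\<Sum>y\<in>UNIV. Kx n s i y) + \<i> * of_real ((\<Sum>y\<in>UNIV. Kx n s i y * dev n w i s y) / a)
     - of_real ((\<Sum>y\<in>UNIV. Kx n s i y * (dev n w i s y)\<^sup>2) / (2 * a\<^sup>2))"
    by (simp add: sum_divide_distrib sum_distrib_left sum.distrib[symmetric] sum_subtractf[symmetric] algebra_simps power_divide)
   then show ?thesis unfolding Kx_prob(2)[OF s] dev_mean[OF s] dev_variance[OF s] t_def by simp
  qed
  have dle: "\<bar>?d y\<bar> \<le> 2 * norm w / a" for y
   using dev_bound[OF s] a by (simp add: abs_divide divide_right_mono)
  have "norm (f i s - of_real (1 - t i s)) = norm (\<Sum>y\<in>UNIV. ?K y * (iexp (?d y) - (1 + \<i> * of_real (?d y) - of_real ((?d y)\<^sup>2 / 2))))"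
   unfolding f_def mid[symmetric] sum_subtractf[symmetric] by (simp only: right_diff_distrib)
  also have "\<dots> \<le> (\<Sum>y\<in>UNIV. Kx n s i y * ((2 * norm w / a) ^ 3 / 6))"
  proof (rule order_trans[OF norm_sum sum_mono])
   fix y
   have "\<bar>?d y\<bar> ^ 3 \<le> (2 * norm w / a) ^ 3" by (intro power_mono dle) auto
   then have "norm (iexp (?d y) - (1 + \<i> * of_real (?d y) - of_real ((?d y)\<^sup>2 / 2))) \<le> (2 * norm w / a) ^ 3 / 6"
    using approx[of "?d y"] by linarith
   then show "norm (?K y * (iexp (?d y) - (1 + \<i> * of_real (?d y) - of_real ((?d y)\<^sup>2 / 2)))) \<le> Kx n s i y * ((2 * norm w / a) ^ 3 / 6)"
    unfolding norm_mult norm_of_real abs_of_nonneg[OF Kx_prob(1)[OF s]] by (rule mult_left_mono[OF _ Kx_prob(1)[OF s]])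
  qed
  also have "\<dots> = (2 * norm w / a) ^ 3 / 6" unfolding sum_distrib_right[symmetric] Kx_prob(2)[OF s] by simp
  also have "\<dots> = 4 / 3 * (norm w ^ 3 / a ^ 3)" by (simp add: power_divide power_mult_distrib)
  finally have 1: "norm (f i s - of_real (1 - t i s)) \<le> 4 / 3 * (norm w ^ 3 / a ^ 3)" .
  have tle: "t i s \<le> 2 * (norm w)\<^sup>2 / a\<^sup>2"
   using divide_right_mono[OF cvar_bounds(2)[OF s, of n i w], of "2 * a\<^sup>2"] by (simp add: t_def)
  have r: "0 \<le> norm w / a" "norm w / a \<le> 1 / 2" using w a by (auto simp: field_simps)
  have r2: "(norm w)\<^sup>2 / a\<^sup>2 = (norm w / a)\<^sup>2" "norm w ^ 3 / a ^ 3 = (norm w / a) ^ 3" by (simp_all add: power_divide)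
  have t1: "t i s \<le> 1"
  proof -
   have "2 * (norm w)\<^sup>2 / a\<^sup>2 = 2 * (norm w / a)\<^sup>2" by (simp add: power_divide)
   moreover have "(norm w / a)\<^sup>2 \<le> 1 / 4" using power_mono[OF r(2,1), of 2] by (simp add: power2_eq_square)
   ultimately show ?thesis using tle by linarith
  qed
  have "(t i s)\<^sup>2 \<le> (2 * (norm w / a)\<^sup>2)\<^sup>2" using tle t0 by (intro power_mono) (auto simp: power_divide)
  also have "\<dots> = 4 * (norm w / a) * (norm w / a) ^ 3" by (simp add: power2_eq_square power3_eq_cube)
  also have "\<dots> \<le> 2 * (norm w / a) ^ 3" using r by (intro mult_right_mono) auto
  finally have 2: "(t i s)\<^sup>2 \<le> 2 * (norm w ^ 3 / a ^ 3)" unfolding r2 .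
  have "norm (of_real (1 - t i s) - of_real (exp (- t i s)) :: complex) = \<bar>exp (- t i s) - (1 - t i s)\<bar>"
   unfolding of_real_diff[symmetric] norm_of_real by linarith
  also have "\<dots> \<le> (t i s)\<^sup>2" by (rule exp_neg_linear_approx[OF t0 t1])
  finally have "norm (of_real (1 - t i s) - of_real (exp (- t i s)) :: complex) \<le> 2 * (norm w ^ 3 / a ^ 3)" using 2 by linarith
  moreover have "norm (f i s - of_real (exp (- t i s))) \<le> norm (f i s - of_real (1 - t i s)) + norm (of_real (1 - t i s) - of_real (exp (- t i s)) :: complex)"
   by (rule norm_diff_triangle_ineq[THEN order_trans[rotated], THEN iffD1[OF refl]]) (simp add: norm_triangle_ineq[THEN order_trans[rotated]])
  moreover have "0 \<le> norm w ^ 3 / a ^ 3" using a by simp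
  ultimately show "norm (f i s - of_real (exp (- t i s))) \<le> 4 * norm w ^ 3 / a ^ 3" using 1 by linarith
 qed
 have diff: "norm (Y s * (\<Prod>i=1..np (Suc n). f i s) - Y s * of_real (exp (- (vmean n s w / (2 * a))))) \<le> 4 * norm w ^ 3 / a\<^sup>2"
  if s: "s \<in> space M" for s
 proof -
  have "norm ((\<Prod>i=1..np (Suc n). f i s) - (\<Prod>i=1..np (Suc n). of_real (exp (- t i s))))
   \<le> (\<Sum>i=1..np (Suc n). norm (f i s - of_real (exp (- t i s))))"
   using part[OF s] by (intro norm_prod_diff) auto
  also have "\<dots> \<le> (\<Sum>i=1..np (Suc n). 4 * norm w ^ 3 / a ^ 3)" by (intro sum_mono part s)
  also have "\<dots> = 4 * norm w ^ 3 / a\<^sup>2" using a by (simp add: a_def[symmetric] power3_eq_cube power2_eq_square)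
  finally have "norm ((\<Prod>i=1..np (Suc n). f i s) - of_real (exp (- (vmean n s w / (2 * a))))) \<le> 4 * norm w ^ 3 / a\<^sup>2"
   unfolding vt of_real_prod .
  then show ?thesis unfolding right_diff_distrib[symmetric] norm_mult
   using mult_mono[OF Y(2)[of s] _ zero_le_one norm_ge_zero] by (metis mult_1)
 qed
 have YM: "Y \<in> borel_measurable M" by (rule F_measurable_M[OF Y(1)])
 have fm: "(\<lambda>s. \<Prod>i=1..np (Suc n). f i s) \<in> borel_measurable M"
  unfolding f_def
  by (intro borel_measurable_prod borel_measurable_sum borel_measurable_times borel_measurable_complex_of_real
    measurable_compose[OF _ borel_measurable_exp] borel_measurable_const borel_measurable_divide
    F_measurable_M[OF Kx_measurable] F_measurable_M[OF dev_measurable]) auto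
 have em: "(\<lambda>s. complex_of_real (exp (- (vmean n s w / (2 * a))))) \<in> borel_measurable M"
  by (intro borel_measurable_complex_of_real measurable_compose[OF _ borel_measurable_exp] borel_measurable_uminus
    borel_measurable_divide vmean_measurable borel_measurable_const)
 have i1: "integrable M (\<lambda>s. Y s * (\<Prod>i=1..np (Suc n). f i s))"
 proof (rule integrable_const_bound[of _ 1])
  show "AE s in M. norm (Y s * (\<Prod>i=1..np (Suc n). f i s)) \<le> 1"
  proof (intro AE_I2)
   fix s assume "s \<in> space M"
   then have "norm (\<Prod>i=1..np (Suc n). f i s) \<le> 1" unfolding prod_norm[symmetric] by (intro prod_le_1) (simp add: part)
   then show "norm (Y s * (\<Prod>i=1..np (Suc n). f i s)) \<le> 1" using Y(2)[of s] by (simp add: norm_mult mult_le_one)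
  qed
 qed (intro borel_measurable_times YM fm)
 have i2: "integrable M (\<lambda>s. Y s * of_real (exp (- (vmean n s w / (2 * a)))))"
 proof (rule integrable_const_bound[of _ 1])
  show "AE s in M. norm (Y s * of_real (exp (- (vmean n s w / (2 * a))))) \<le> 1"
   using Y(2) vmean_bounds(1) a by (intro AE_I2) (simp add: norm_mult mult_le_one)
 qed (intro borel_measurable_times YM em)
 have "norm ((\<integral>s. Y s * (\<Prod>i=1..np (Suc n). f i s) \<partial>M) - (\<integral>s. Y s * of_real (exp (- (vmean n s w / (2 * a)))) \<partial>M))
  \<le> (\<integral>s. norm (Y s * (\<Prod>i=1..np (Suc n). f i s) - Y s * of_real (exp (- (vmean n s w / (2 * a))))) \<partial>M)"
  unfolding Bochner_Integration.integral_diff[OF i1 i2, symmetric] by (rule integral_norm_bound)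
 also have "\<dots> \<le> (\<integral>s. 4 * norm w ^ 3 / a\<^sup>2 \<partial>M)"
  using i1 i2 diff by (intro integral_mono) auto
 also have "\<dots> = 4 * norm w ^ 3 / a\<^sup>2" by (simp add: prob_space)
 finally show ?thesis unfolding eq a_def .
qed

text \<open>The Chernoff bound for the exponential moment above.\<close>

lemma Mart_tail:
 assumes u: "norm u = 1" and \<delta>: "0 < \<delta>" "\<delta> \<le> 1"
 shows "measure M {s \<in> space M. \<delta> \<le> u \<bullet> Mart n s} \<le> exp (- (\<delta>\<^sup>2 / 16 * real (np (Suc n))))"
proof -
 define a where "a = real (np (Suc n))"
 have a: "1 \<le> a" using np_pos[of "Suc n"] by (simp add: a_def)
 let ?E = "{s \<in> space M. \<delta> \<le> u \<bullet> Mart n s}"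
 \<comment> \<open>The size \<delta> a / 8 minimises 4 t^2 / a - \<delta> t over the tilt t.\<close>
 let ?w = "(\<delta> * a / 8) *\<^sub>R u"
 have nw: "norm ?w = \<delta> * a / 8" using u \<delta> a by simp
 have meas: "(\<lambda>s. w \<bullet> Mart n s) \<in> borel_measurable M" for w
  by (intro borel_measurable_inner borel_measurable_const F_measurable_M[OF Mart_measurable])
 have E: "?E \<in> sets M" using meas[of u] by measurable
 have "\<delta> * a \<le> 1 * a" using \<delta> a by (intro mult_right_mono) auto
 then have wa: "2 * norm ?w \<le> real (np (Suc n))" unfolding nw a_def[symmetric] using \<delta> a by simp
 have int: "integrable M (\<lambda>s. exp (?w \<bullet> Mart n s))"
 proof (rule integrable_const_bound[of _ "exp (2 * norm ?w)"])
  show "AE s in M. norm (exp (?w \<bullet> Mart n s)) \<le> exp (2 * norm ?w)"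
  proof (intro AE_I2)
   fix s assume "s \<in> space M"
   from Mart_inner_bound[OF this, of ?w n] have "?w \<bullet> Mart n s \<le> 2 * norm ?w" by linarith
   then show "norm (exp (?w \<bullet> Mart n s)) \<le> exp (2 * norm ?w)" by simp
  qed
 qed (intro measurable_compose[OF meas borel_measurable_exp])
 have "measure M ?E = (\<integral>s. indicator ?E s \<partial>M)" using E by simp
 also have "\<dots> \<le> (\<integral>s. exp (- (\<delta>\<^sup>2 * a / 8)) * exp (?w \<bullet> Mart n s) \<partial>M)"
 proof (rule integral_mono)
  show "integrable M (\<lambda>s. indicator ?E s :: real)" using E by (intro integrable_real_indicator) (auto simp: emeasure_eq_measure)
  fix s assume "s \<in> space M"
  have "\<delta>\<^sup>2 * a / 8 \<le> ?w \<bullet> Mart n s" if "\<delta> \<le> u \<bullet> Mart n s"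
   using mult_left_mono[OF that, of "\<delta> * a / 8"] \<delta> a by (simp add: power2_eq_square mult_ac)
  then show "indicator ?E s \<le> exp (- (\<delta>\<^sup>2 * a / 8)) * exp (?w \<bullet> Mart n s)"
   by (auto simp: indicator_def exp_add[symmetric])
 qed (use int in auto)
 also have "\<dots> = exp (- (\<delta>\<^sup>2 * a / 8)) * (\<integral>s. 1 * exp (?w \<bullet> Mart n s) \<partial>M)" by simp
 also have "\<dots> \<le> exp (- (\<delta>\<^sup>2 * a / 8)) * (exp (4 * (norm ?w)\<^sup>2 / a) * (\<integral>s. 1 \<partial>M))"
  using Mart_exp_moment[of "\<lambda>_. 1" n 1 ?w] wa unfolding a_def by (intro mult_left_mono) auto
 also have "\<dots> = exp (- (\<delta>\<^sup>2 * a / 8) + \<delta>\<^sup>2 * a / 16)"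
 proof -
  have "4 * (norm ?w)\<^sup>2 / a = \<delta>\<^sup>2 * a / 16" unfolding nw using a by (simp add: power2_eq_square)
  then show ?thesis by (simp only: exp_add) (simp add: prob_space)
 qed
 also have "\<dots> = exp (- (\<delta>\<^sup>2 / 16 * a))" by (simp add: field_simps)
 finally show ?thesis unfolding a_def .
qed

text \<open>The tail bound is exponential in a positive power of n, hence summable for every
  \<zeta>, and Borel-Cantelli applies.\<close>

lemma Mart_component_AE:
 assumes u: "norm u = 1" and \<delta>: "0 < \<delta>" "\<delta> \<le> 1"
 shows "AE s in M. eventually (\<lambda>n. u \<bullet> Mart n s < \<delta>) sequentially"
proof -
 let ?E = "\<lambda>n. {s \<in> space M. \<delta> \<le> u \<bullet> Mart n s}"
 define c where "c = \<delta>\<^sup>2 / 16"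
 have c: "0 < c" using \<delta> by (simp add: c_def)
 have "(\<lambda>s. u \<bullet> Mart n s) \<in> borel_measurable M" for n
  by (intro borel_measurable_inner borel_measurable_const F_measurable_M[OF Mart_measurable])
 then have E: "?E n \<in> sets M" for n by measurable
 have "summable (\<lambda>n. measure M (?E n))"
 proof (rule summable_comparison_test_ev)
  have "eventually (\<lambda>n. exp (- (c * ((real n + 1) powr \<zeta> - 1))) \<le> 1 / (real n) ^ 2) sequentially"
   using c \<zeta> by real_asymp
  then show "eventually (\<lambda>n. norm (measure M (?E n)) \<le> 1 / (real n) ^ 2) sequentially"
  proof eventually_elim
   case (elim n)
   have "(real n + 1) powr \<zeta> - 1 \<le> real (np (Suc n))"
    using num_particles_deviation[OF \<zeta>, of "Suc n"] by (simp add: add.commute abs_le_iff)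
   then have "exp (- (c * real (np (Suc n)))) \<le> exp (- (c * ((real n + 1) powr \<zeta> - 1)))" using c by simp
   moreover have "measure M (?E n) \<le> exp (- (c * real (np (Suc n))))" using Mart_tail[OF u \<delta>, of n] by (simp add: c_def)
   ultimately show ?case unfolding real_norm_def abs_of_nonneg[OF measure_nonneg] using elim by linarith
  qed
  show "summable (\<lambda>n. 1 / (real n) ^ 2)" using inverse_power_summable[of 2, where 'a = real] by (simp add: divide_inverse)
 qed
 then have "AE s in M. eventually (\<lambda>n. s \<in> space M - ?E n) sequentially"
  by (intro borel_cantelli_AE1 E) (auto simp: emeasure_eq_measure)
 then show ?thesis by eventually_elim (auto elim: eventually_mono)
qed

lemma Mart_tendsto: "AE s in M. (\<lambda>n. Mart n s) \<longlonglongrightarrow> 0"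
proof -
 have "AE s in M. \<forall>m :: nat. \<forall>j :: 'd. \<forall>b\<in>{1, - 1 :: real}. eventually (\<lambda>n. (b *\<^sub>R axis j 1) \<bullet> Mart n s < 1 / real (Suc m)) sequentially"
  unfolding AE_all_countable
  by (intro allI AE_finite_allI Mart_component_AE) (auto simp: norm_axis_1)
 then show ?thesis
 proof eventually_elim
  case (elim s)
  show ?case
  proof (rule vec_tendstoI, rule tendstoI)
   fix j and e :: real assume e: "0 < e"
   obtain m where m: "1 / real (Suc m) < e" using nat_approx_posE[OF e] by blast
   have 1: "eventually (\<lambda>n. (1 *\<^sub>R axis j 1) \<bullet> Mart n s < 1 / real (Suc m)) sequentially"
    and 2: "eventually (\<lambda>n. (- 1 *\<^sub>R axis j 1) \<bullet> Mart n s < 1 / real (Suc m)) sequentially"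
    by (rule elim[THEN spec, THEN spec, THEN bspec], simp)+
   from 1 2 show "eventually (\<lambda>n. dist (Mart n s $ j) (0 $ j) < e) sequentially"
    by eventually_elim (use m in \<open>auto simp: inner_axis' dist_real_def\<close>)
  qed
 qed
qed

text \<open>The deterministic recursion is applied path by path. Births perturb the empirical
  measure by at most 2 / np (n + 1), which tends to zero because the number of particles grows
  without bound.\<close>

lemma empirical_tendsto:
 "AE s in M. (\<lambda>n. \<theta> n s) \<longlonglongrightarrow> \<theta>s \<and> (\<lambda>n. emp n s) \<longlonglongrightarrow> \<theta>s \<and> (\<lambda>n. emp' n s) \<longlonglongrightarrow> \<theta>s"
 using Mart_tendsto AE_space
proof eventually_elim
 case (elim s)
 have "filterlim (\<lambda>n. real (np (Suc n))) at_infinity sequentially"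
  by (rule filterlim_at_top_imp_at_infinity[OF filterlim_compose[OF num_particles_at_top[OF \<zeta>] filterlim_Suc]])
 then have z: "(\<lambda>n. 2 / real (np (Suc n))) \<longlonglongrightarrow> 0" by (rule tendsto_divide_0[OF tendsto_const])
 have "norm (emp' n s - emp n s) \<le> 2 / real (np (Suc n))" for n
  using num_particles_step[OF \<zeta>, of n] np_pos[of "Suc n"]
  by (intro order_trans[OF emp'_minus_emp[of n s]] divide_right_mono) auto
 then have "eventually (\<lambda>n. norm (emp' n s - emp n s) \<le> 2 / real (np (Suc n))) sequentially" by (intro always_eventually allI)
 then have d: "(\<lambda>n. emp' n s - emp n s) \<longlonglongrightarrow> 0" by (rule Lim_null_comparison[OF _ z])
 have m: "emp (Suc n) s = emp' n s v* Kmat P (\<theta> n s) + Mart n s" for n by (simp add: Mart_def)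
 note lim = empirical_recursion_tendsto[where m = "\<lambda>n. emp n s" and m' = "\<lambda>n. emp' n s" and \<theta> = "\<lambda>n. \<theta> n s"
   and E = "\<lambda>n. Mart n s" and d = \<gamma>, OF \<gamma>_pos \<gamma>_le_1 \<gamma>_tendsto \<gamma>_ratio \<gamma>_diverges emp_simplex emp'_simplex
   \<theta>_simplex[OF elim(2)] m elim(1) d \<theta>_recursion[OF elim(2)]]
 have "(\<lambda>n. (emp' n s - emp n s) + emp n s) \<longlonglongrightarrow> 0 + \<theta>s" by (rule tendsto_add[OF d lim(2)])
 then have "(\<lambda>n. emp' n s) \<longlonglongrightarrow> \<theta>s" by (simp only: diff_add_cancel add_0_left)
 then show ?case using lim by (intro conjI)
qed

end

section \<open>Gaussian limits of linear recursions\<close>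

lemma abs_exp_diff_le:
 fixes x y :: real
 assumes "x \<le> b" "y \<le> b" shows "\<bar>exp x - exp y\<bar> \<le> exp b * \<bar>x - y\<bar>"
proof -
 have *: "exp t - exp s \<le> exp b * (t - s)" if "s \<le> t" "t \<le> b" for s t :: real
 proof -
  have "exp t - exp s = exp t * (1 - exp (- (t - s)))" by (simp add: algebra_simps exp_add[symmetric])
  also have "\<dots> \<le> exp t * (t - s)" using exp_ge_add_one_self[of "- (t - s)"] by (intro mult_left_mono) (linarith, simp)
  also have "\<dots> \<le> exp b * (t - s)" using that by (intro mult_right_mono) auto
  finally show ?thesis .
 qed
 show ?thesis
 proof (cases "x \<le> y")
  case True
  then show ?thesis using *[of x y] assms by (simp add: abs_if)
 next
  case False
  then show ?thesis using *[of y x] assms by (simp add: abs_if)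
 qed
qed

lemma bounded_bilinear_matrix_vector:
 "bounded_bilinear ((*v) :: real ^ 'n::finite ^ 'm::finite \<Rightarrow> real ^ 'n \<Rightarrow> real ^ 'm)"
proof -
 have "bilinear ((*v) :: real ^ 'n ^ 'm \<Rightarrow> real ^ 'n \<Rightarrow> real ^ 'm)"
  unfolding bilinear_def
  by (intro conjI allI linearI)
   (simp_all add: matrix_vector_mult_add_rdistrib matrix_vector_right_distrib scaleR_matrix_vector_assoc[symmetric] matrix_vector_mult_scaleR)
 then show ?thesis by (simp add: bilinear_conv_bounded_bilinear)
qed

lemma norm_matrix_vector_bound:
 obtains K where "0 \<le> K" "\<And>(A :: real ^ 'n::finite ^ 'm::finite) x. norm (A *v x) \<le> norm A * norm x * K"
 using bounded_bilinear.nonneg_bounded[OF bounded_bilinear_matrix_vector] by blast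

text \<open>The drift matrices depend on time and only converge; half of the contraction rate pays
  for the difference.\<close>

lemma adapted_norm_perturbation:
 fixes J :: "real ^ 'd::finite ^ 'd"
 assumes N: "adapted_norm ((*v) J) c N" and c: "0 < c"
  and B: "B \<longlonglongrightarrow> J" and t: "\<And>k. 0 < t k" "t \<longlonglongrightarrow> 0"
 shows "eventually (\<lambda>k. \<forall>x. N (x + t k *\<^sub>R (B k *v x)) \<le> (1 - c / 2 * t k) * N x) sequentially"
proof -
 obtain C where C: "C \<ge> 1" "\<And>x. N x \<le> C * norm x" by (rule adapted_norm_le[OF N]) blast
 obtain g0 where g0: "g0 > 0" "\<And>g x. 0 < g \<Longrightarrow> g \<le> g0 \<Longrightarrow> N (x + g *\<^sub>R (J *v x)) \<le> (1 - c * g) * N x"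
  by (rule adapted_norm_contract[OF N]) blast
 obtain K where K: "0 \<le> K" "\<And>(A :: real ^ 'd ^ 'd) x. norm (A *v x) \<le> norm A * norm x * K"
  by (rule norm_matrix_vector_bound) blast
 have "(\<lambda>k. C * (norm (B k - J) * K)) \<longlonglongrightarrow> C * (0 * K)"
  by (intro tendsto_mult tendsto_const tendsto_norm_zero LIM_zero B)
 then have "(\<lambda>k. C * (norm (B k - J) * K)) \<longlonglongrightarrow> 0" by simp
 then have "eventually (\<lambda>k. C * (norm (B k - J) * K) < c / 2) sequentially"
  using c by (intro order_tendstoD(2)[of _ 0]) auto
 moreover have "eventually (\<lambda>k. t k < g0) sequentially" using g0(1) t(2) by (intro order_tendstoD(2)[of _ 0]) auto
 ultimately show ?thesis
 proof eventually_elim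
  case (elim k)
  show ?case
  proof
   fix x
   have "N (x + t k *\<^sub>R (B k *v x)) = N ((x + t k *\<^sub>R (J *v x)) + t k *\<^sub>R ((B k - J) *v x))"
    by (simp add: matrix_vector_mult_diff_rdistrib scaleR_diff_right)
   also have "\<dots> \<le> N (x + t k *\<^sub>R (J *v x)) + t k * N ((B k - J) *v x)"
    using adapted_norm_triangle[OF N, of "x + t k *\<^sub>R (J *v x)" "t k *\<^sub>R ((B k - J) *v x)"]
     adapted_norm_scale[OF N, of "t k"] less_imp_le[OF t(1)[of k]] by simp
   also have "\<dots> \<le> (1 - c * t k) * N x + t k * (c / 2 * N x)"
   proof (intro add_mono mult_left_mono)
    show "N (x + t k *\<^sub>R (J *v x)) \<le> (1 - c * t k) * N x" using elim t(1)[of k] by (intro g0) auto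
    have "N ((B k - J) *v x) \<le> C * (norm (B k - J) * norm x * K)"
     using C(2)[of "(B k - J) *v x"] mult_left_mono[OF K(2)[of "B k - J" x], of C] C(1) by linarith
    also have "\<dots> = (C * (norm (B k - J) * K)) * norm x" by simp
    also have "\<dots> \<le> c / 2 * norm x" using elim by (intro mult_right_mono) auto
    also have "\<dots> \<le> c / 2 * N x" using adapted_norm_ge[OF N, of x] c by (intro mult_left_mono) auto
    finally show "N ((B k - J) *v x) \<le> c / 2 * N x" .
   qed (use t(1)[of k] in auto)
   also have "\<dots> = (1 - c / 2 * t k) * N x" by (simp add: algebra_simps)
   finally show "N (x + t k *\<^sub>R (B k *v x)) \<le> (1 - c / 2 * t k) * N x" .
  qed
 qed
qed

text \<open>The Gaussian bound exp (c N(u)^2) reproduces itself: the Euler step shrinks N(u)^2,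
  which compensates for the factor exp (C g |u|^2). The ball of radius R in N is mapped into itself,
  so bounds on it suffice.\<close>

lemma exponential_moment_recursion:
 fixes f :: "nat \<Rightarrow> real ^ 'd::finite \<Rightarrow> real"
 assumes N: "adapted_norm ((*v) J) K N" and K: "0 < K"
  and B: "B \<longlonglongrightarrow> J" and g: "\<And>k. 0 < g k" "g \<longlonglongrightarrow> 0" and C: "0 \<le> C"
  and step: "eventually (\<lambda>k. \<forall>u. norm u \<le> R \<longrightarrow>
    f (Suc k) u \<le> f k (u + g k *\<^sub>R (B k *v u)) * exp (C * g k * (norm u)\<^sup>2)) sequentially"
  and init: "\<And>k. \<exists>b. \<forall>u. norm u \<le> R \<longrightarrow> f k u \<le> b"
 shows "\<exists>b. eventually (\<lambda>k. \<forall>u. N u \<le> R \<longrightarrow> f k u \<le> b) sequentially"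
proof -
 have "eventually (\<lambda>k. g k < 1 / K) sequentially" using K g(2) by (intro order_tendstoD(2)[of _ 0]) auto
 then have "eventually (\<lambda>k. (\<forall>u. norm u \<le> R \<longrightarrow>
    f (Suc k) u \<le> f k (u + g k *\<^sub>R (B k *v u)) * exp (C * g k * (norm u)\<^sup>2))
   \<and> (\<forall>x. N (x + g k *\<^sub>R (B k *v x)) \<le> (1 - K / 2 * g k) * N x) \<and> g k < 1 / K) sequentially"
  by (intro eventually_conj step adapted_norm_perturbation[OF N K B g])
 then obtain k1 where k1: "\<And>k u. k \<ge> k1 \<Longrightarrow> norm u \<le> R \<Longrightarrow>
    f (Suc k) u \<le> f k (u + g k *\<^sub>R (B k *v u)) * exp (C * g k * (norm u)\<^sup>2)"
   "\<And>k x. k \<ge> k1 \<Longrightarrow> N (x + g k *\<^sub>R (B k *v x)) \<le> (1 - K / 2 * g k) * N x"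
   "\<And>k. k \<ge> k1 \<Longrightarrow> g k < 1 / K"
  unfolding eventually_sequentially by blast
 obtain b where b: "\<And>u. norm u \<le> R \<Longrightarrow> f k1 u \<le> b" using init[of k1] by blast
 define b' where "b' = max b 0"
 \<comment> \<open>The value at which the gain c K / 2 per unit step equals the cost C.\<close>
 define c where "c = 2 * C / K"
 have c: "0 \<le> c" "c * K = 2 * C" using C K by (auto simp: c_def)
 have main: "\<forall>u. N u \<le> R \<longrightarrow> f k u \<le> b' * exp (c * (N u)\<^sup>2)" if "k \<ge> k1" for k
  using that
 proof (induction k rule: dec_induct)
  case base
  show ?case
  proof (intro allI impI)
   fix u assume "N u \<le> R"
   then have "f k1 u \<le> b' * 1" using b[of u] adapted_norm_ge[OF N, of u] by (simp add: b'_def)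
   also have "\<dots> \<le> b' * exp (c * (N u)\<^sup>2)" using c by (intro mult_left_mono) (auto simp: b'_def)
   finally show "f k1 u \<le> b' * exp (c * (N u)\<^sup>2)" .
  qed
 next
  case (step k)
  show ?case
  proof (intro allI impI)
   fix u assume u: "N u \<le> R"
   define q where "q = 1 - K / 2 * g k"
   have q: "0 \<le> q" "q \<le> 1" using k1(3)[OF step(1)] K g(1)[of k] by (auto simp: q_def field_simps)
   let ?v = "u + g k *\<^sub>R (B k *v u)"
   have N0: "0 \<le> N u" "0 \<le> N ?v" using adapted_norm_nonneg[OF N] by auto
   have Nv: "N ?v \<le> q * N u" using k1(2)[OF step(1)] by (simp add: q_def)
   have NvR: "N ?v \<le> R" using Nv u mult_right_mono[OF q(2) N0(1)] by linarith
   have sq: "(norm u)\<^sup>2 \<le> (N u)\<^sup>2" using adapted_norm_ge[OF N] by (intro power_mono) auto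
   have "(N ?v)\<^sup>2 \<le> (q * N u)\<^sup>2" using Nv N0 by (intro power_mono) auto
   also have "\<dots> = (q * q) * (N u)\<^sup>2" by (simp add: power2_eq_square)
   also have "\<dots> \<le> q * (N u)\<^sup>2" using q mult_left_mono[OF q(2) q(1)] by (intro mult_right_mono) auto
   finally have qN: "(N ?v)\<^sup>2 \<le> q * (N u)\<^sup>2" .
   have "f (Suc k) u \<le> f k ?v * exp (C * g k * (norm u)\<^sup>2)"
    using k1(1)[OF step(1)] u adapted_norm_ge[OF N, of u] by simp
   also have "\<dots> \<le> (b' * exp (c * (N ?v)\<^sup>2)) * exp (C * g k * (norm u)\<^sup>2)"
    using step.IH NvR by (intro mult_right_mono) auto
   also have "\<dots> = b' * exp (c * (N ?v)\<^sup>2 + C * g k * (norm u)\<^sup>2)" by (simp add: exp_add)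
   also have "\<dots> \<le> b' * exp (c * (N u)\<^sup>2)"
   proof (intro mult_left_mono)
    have "c * (N ?v)\<^sup>2 + C * g k * (norm u)\<^sup>2 \<le> c * (q * (N u)\<^sup>2) + C * g k * (N u)\<^sup>2"
     using c C qN sq g(1)[of k] by (intro add_mono mult_left_mono) auto
    also have "\<dots> = c * (N u)\<^sup>2 - (c * K / 2 - C) * (g k * (N u)\<^sup>2)" by (simp add: q_def algebra_simps)
    also have "\<dots> = c * (N u)\<^sup>2" by (simp add: c)
    finally show "exp (c * (N ?v)\<^sup>2 + C * g k * (norm u)\<^sup>2) \<le> exp (c * (N u)\<^sup>2)" by simp
   qed (simp add: b'_def)
   finally show "f (Suc k) u \<le> b' * exp (c * (N u)\<^sup>2)" .
  qed
 qed
 have "f k u \<le> b' * exp (c * R\<^sup>2)" if "k \<ge> k1" "N u \<le> R" for k u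
 proof -
  have "f k u \<le> b' * exp (c * (N u)\<^sup>2)" using main[OF that(1)] that(2) by blast
  also have "\<dots> \<le> b' * exp (c * R\<^sup>2)"
   using c that(2) adapted_norm_nonneg[OF N, of u] by (intro mult_left_mono) (auto simp: b'_def intro!: mult_left_mono power_mono)
  finally show ?thesis .
 qed
 then show ?thesis unfolding eventually_sequentially by blast
qed

text \<open>Comparison of characteristic functions with the Gaussian in the weighted norm
 \<open>sup \<bar>\<phi> u - G u\<bar> / N u\<close> over a ball of the adapted norm, in which one step is a contraction.\<close>

lemma gaussian_recursion_tendsto:
 fixes \<phi> :: "nat \<Rightarrow> real ^ 'd::finite \<Rightarrow> complex" and J U V :: "real ^ 'd ^ 'd"
 assumes N: "adapted_norm ((*v) J) \<kappa> N" and \<kappa>: "0 < \<kappa>"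
  and V: "transpose V = V" and lyap: "U + transpose J ** V + V ** J = 0" and U: "\<And>u. 0 \<le> u \<bullet> (U *v u)"
  and B: "B \<longlonglongrightarrow> J" and t: "\<And>k. 0 < t k" "t \<longlonglongrightarrow> 0" "filterlim (\<lambda>n. \<Sum>k<n. t k) at_top sequentially"
  and r: "(\<lambda>k. r k / t k) \<longlonglongrightarrow> 1" "\<And>k. 0 \<le> r k"
  and init: "\<And>k. \<exists>C. \<forall>u. norm (\<phi> k u - 1) \<le> C * norm u"
  and step: "\<And>R. \<exists>h. h \<longlonglongrightarrow> 0 \<and> eventually (\<lambda>k. \<forall>u. norm u \<le> R \<longrightarrow>
    norm (\<phi> (Suc k) u - \<phi> k (u + t k *\<^sub>R (B k *v u)) * exp (- of_real (r k / 2 * (u \<bullet> (U *v u)))))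
     \<le> t k * h k * norm u) sequentially"
 shows "(\<lambda>k. \<phi> k u0) \<longlonglongrightarrow> exp (- of_real (u0 \<bullet> (V *v u0)) / 2)"
proof -
 define R where "R = N u0"
 define G where "G u = exp (- (u \<bullet> (V *v u)) / 2)" for u :: "real ^ 'd"
 let ?T = "\<lambda>k u. u + t k *\<^sub>R (B k *v u)"
 have R0: "0 \<le> R" using adapted_norm_nonneg[OF N] by (simp add: R_def)
 obtain K where K: "0 \<le> K" "\<And>(A :: real ^ 'd ^ 'd) x. norm (A *v x) \<le> norm A * norm x * K"
  by (rule norm_matrix_vector_bound) blast
 have bil: "\<bar>x \<bullet> (A *v y)\<bar> \<le> norm A * K * (norm x * norm y)" for A :: "real ^ 'd ^ 'd" and x y
 proof -
  have "\<bar>x \<bullet> (A *v y)\<bar> \<le> norm x * norm (A *v y)" by (rule Cauchy_Schwarz_ineq2)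
  also have "\<dots> \<le> norm x * (norm A * norm y * K)" by (intro mult_left_mono K) auto
  finally show ?thesis by (simp add: mult_ac)
 qed
 \<comment> \<open>The form of V is not known to be nonnegative at this point, so the Gaussian
   factor is only bounded on the ball of radius R.\<close>
 define E where "E = norm V * K * R\<^sup>2 / 2"
 have GE: "- (u \<bullet> (V *v u)) / 2 \<le> E" if "norm u \<le> R" for u
 proof -
  have "norm u * norm u \<le> R\<^sup>2" using that unfolding power2_eq_square by (intro mult_mono) (auto intro: R0)
  then have "norm V * K * (norm u * norm u) \<le> norm V * K * R\<^sup>2" using K(1) by (intro mult_left_mono) auto
  then show ?thesis using bil[of u V u] by (simp add: E_def abs_le_iff)
 qed
 have E0: "0 \<le> E" using K(1) by (simp add: E_def)
 obtain h where h: "h \<longlonglongrightarrow> 0" "eventually (\<lambda>k. \<forall>u. norm u \<le> R \<longrightarrow>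
    norm (\<phi> (Suc k) u - \<phi> k (?T k u) * exp (- of_real (r k / 2 * (u \<bullet> (U *v u))))) \<le> t k * h k * norm u) sequentially"
  using step[of R] by blast
 \<comment> \<open>The defect of the Gaussian in the one-step identity. Its three parts stem from
   the convergence of B to J, of r / t to 1, and from the second-order term of the Euler
   step.\<close>
 define h' where "h' k = exp E * ((2 * (norm V * K * (norm (B k - J) * K)) + \<bar>r k / t k - 1\<bar> * (norm U * K)
   + t k * (norm V * K * (norm (B k) * K)\<^sup>2)) / 2) * R" for k
 have "h' \<longlonglongrightarrow> exp E * ((2 * (norm V * K * (0 * K)) + \<bar>1 - 1\<bar> * (norm U * K) + 0 * (norm V * K * (norm J * K)\<^sup>2)) / 2) * R"
  unfolding h'_def[abs_def]
  by (intro tendsto_intros tendsto_norm_zero LIM_zero B t r) simp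
 then have h'0: "h' \<longlonglongrightarrow> 0" by simp
 have gauss: "\<bar>G (?T k u) * exp (- (r k / 2 * (u \<bullet> (U *v u)))) - G u\<bar> \<le> t k * h' k * norm u"
  if u: "norm u \<le> R" "norm (?T k u) \<le> R" for k u
 proof -
  define b where "b = B k *v u"
  define j where "j = J *v u"
  have nb: "norm b \<le> norm (B k) * K * norm u" using K(2)[of "B k" u] by (simp add: b_def mult_ac)
  have nbj: "norm (b - j) \<le> norm (B k - J) * K * norm u"
   using K(2)[of "B k - J" u] by (simp add: b_def j_def matrix_vector_mult_diff_rdistrib mult_ac)
  have sym: "x \<bullet> (V *v y) = y \<bullet> (V *v x)" for x y by (metis V dot_lmul_matrix inner_commute transpose_matrix_vector)
  have quad: "?T k u \<bullet> (V *v ?T k u) = u \<bullet> (V *v u) + 2 * t k * (b \<bullet> (V *v u)) + (t k)\<^sup>2 * (b \<bullet> (V *v b))"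
   using sym[of u b] unfolding b_def[symmetric]
   by (simp add: matrix_vector_right_distrib matrix_vector_mult_scaleR inner_add_left inner_add_right power2_eq_square algebra_simps)
  have "u \<bullet> ((U + transpose J ** V + V ** J) *v u) = 0" unfolding lyap by simp
  moreover have "u \<bullet> ((transpose J ** V) *v u) = j \<bullet> (V *v u)"
   by (metis j_def dot_lmul_matrix inner_commute matrix_vector_mul_assoc transpose_matrix_vector)
  moreover have "u \<bullet> ((V ** J) *v u) = j \<bullet> (V *v u)"
   using sym[of u j] by (simp add: j_def matrix_vector_mul_assoc[symmetric])
  \<comment> \<open>The Lyapunov equation tested with u; it cancels the first-order change of the
    quadratic form of V against the variance injected by the noise.\<close>
  ultimately have UJ: "u \<bullet> (U *v u) = - 2 * (j \<bullet> (V *v u))"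
   by (simp add: matrix_vector_mult_add_rdistrib inner_add_right)
  define X where "X = - (?T k u \<bullet> (V *v ?T k u)) / 2 - r k / 2 * (u \<bullet> (U *v u))"
  define W where "W = - (u \<bullet> (V *v u)) / 2"
  define q where "q = r k / t k - 1"
  have r': "r k = t k + t k * q" using t(1)[of k] by (simp add: q_def field_simps)
  have "X - W = - (t k * (2 * ((b - j) \<bullet> (V *v u)) + (r k / t k - 1) * (u \<bullet> (U *v u)) + t k * (b \<bullet> (V *v b)))) / 2"
  proof -
   have "X - W = - (2 * t k * (b \<bullet> (V *v u)) + (t k)\<^sup>2 * (b \<bullet> (V *v b)) + r k * (u \<bullet> (U *v u))) / 2"
    unfolding X_def W_def quad by (simp add: field_simps)
   also have "\<dots> = - (2 * t k * (b \<bullet> (V *v u)) + (t k)\<^sup>2 * (b \<bullet> (V *v b)) + t k * (u \<bullet> (U *v u)) + t k * q * (u \<bullet> (U *v u))) / 2"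
    unfolding r' by (simp add: algebra_simps)
   also have "t k * (u \<bullet> (U *v u)) = - (2 * t k * (j \<bullet> (V *v u)))" unfolding UJ by simp
   finally show ?thesis unfolding q_def[symmetric] by (simp add: inner_diff_left power2_eq_square algebra_simps)
  qed
  then have "\<bar>X - W\<bar> = t k * \<bar>2 * ((b - j) \<bullet> (V *v u)) + (r k / t k - 1) * (u \<bullet> (U *v u)) + t k * (b \<bullet> (V *v b))\<bar> / 2"
   using t(1)[of k] by (simp add: abs_mult)
  also have "\<dots> \<le> t k * (2 * (norm V * K * (norm (B k - J) * K) * (norm u * norm u)) + \<bar>r k / t k - 1\<bar> * (norm U * K * (norm u * norm u))
    + t k * (norm V * K * (norm (B k) * K)\<^sup>2 * (norm u * norm u))) / 2"
  proof -
   have t1: "\<bar>(b - j) \<bullet> (V *v u)\<bar> \<le> norm V * K * (norm (B k - J) * K) * (norm u * norm u)"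
   proof -
    have "norm V * K * (norm (b - j) * norm u) \<le> norm V * K * ((norm (B k - J) * K * norm u) * norm u)"
     using K(1) nbj by (intro mult_left_mono mult_right_mono) auto
    then show ?thesis using bil[of "b - j" V u] by (simp add: mult_ac)
   qed
   have t2: "\<bar>(r k / t k - 1) * (u \<bullet> (U *v u))\<bar> \<le> \<bar>r k / t k - 1\<bar> * (norm U * K * (norm u * norm u))"
    unfolding abs_mult by (intro mult_left_mono bil) auto
   have t3: "\<bar>t k * (b \<bullet> (V *v b))\<bar> \<le> t k * (norm V * K * (norm (B k) * K)\<^sup>2 * (norm u * norm u))"
   proof -
    have "norm b * norm b \<le> (norm (B k) * K * norm u) * (norm (B k) * K * norm u)"
     using nb by (intro mult_mono) (auto intro: order_trans[OF norm_ge_zero nb])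
    then have "norm V * K * (norm b * norm b) \<le> norm V * K * ((norm (B k) * K * norm u) * (norm (B k) * K * norm u))"
     using K(1) by (intro mult_left_mono) auto
    then have "\<bar>b \<bullet> (V *v b)\<bar> \<le> norm V * K * (norm (B k) * K)\<^sup>2 * (norm u * norm u)"
     using bil[of b V b] by (simp add: power2_eq_square mult_ac)
    then show ?thesis using t(1)[of k] by (simp add: abs_mult mult_left_mono)
   qed
   have "\<bar>2 * ((b - j) \<bullet> (V *v u)) + (r k / t k - 1) * (u \<bullet> (U *v u)) + t k * (b \<bullet> (V *v b))\<bar>
    \<le> 2 * (norm V * K * (norm (B k - J) * K) * (norm u * norm u)) + \<bar>r k / t k - 1\<bar> * (norm U * K * (norm u * norm u))
    + t k * (norm V * K * (norm (B k) * K)\<^sup>2 * (norm u * norm u))"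
    using t1 t2 t3 by linarith
   then show ?thesis using t(1)[of k] by (intro divide_right_mono mult_left_mono) auto
  qed
  also have "\<dots> = t k * ((2 * (norm V * K * (norm (B k - J) * K)) + \<bar>r k / t k - 1\<bar> * (norm U * K)
   + t k * (norm V * K * (norm (B k) * K)\<^sup>2)) / 2) * (norm u * norm u)" by (simp add: algebra_simps)
  also have "\<dots> \<le> t k * ((2 * (norm V * K * (norm (B k - J) * K)) + \<bar>r k / t k - 1\<bar> * (norm U * K)
   + t k * (norm V * K * (norm (B k) * K)\<^sup>2)) / 2) * (R * norm u)"
   using u(1) K(1) t(1)[of k] by (intro mult_left_mono mult_right_mono mult_nonneg_nonneg divide_nonneg_nonneg add_nonneg_nonneg) auto
  finally have XW: "exp E * \<bar>X - W\<bar> \<le> exp E * (t k * ((2 * (norm V * K * (norm (B k - J) * K)) + \<bar>r k / t k - 1\<bar> * (norm U * K)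
   + t k * (norm V * K * (norm (B k) * K)\<^sup>2)) / 2) * (R * norm u))" by (intro mult_left_mono) auto
  have "X \<le> - (?T k u \<bullet> (V *v ?T k u)) / 2" using U[of u] r(2)[of k] by (simp add: X_def)
  then have XE: "X \<le> E" using GE[OF u(2)] by linarith
  have WE: "W \<le> E" unfolding W_def by (rule GE[OF u(1)])
  have "\<bar>exp X - exp W\<bar> \<le> exp E * \<bar>X - W\<bar>" by (rule abs_exp_diff_le[OF XE WE])
  also note XW
  finally have "\<bar>exp X - exp W\<bar> \<le> t k * h' k * norm u" unfolding h'_def by (simp only: mult_ac)
  moreover have "exp X = G (?T k u) * exp (- (r k / 2 * (u \<bullet> (U *v u))))"
   unfolding X_def G_def exp_add[symmetric] by simp
  ultimately show ?thesis unfolding W_def G_def by simp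
 qed
 have "eventually (\<lambda>k. t k < 1 / \<kappa>) sequentially" using \<kappa> t(2) by (intro order_tendstoD(2)[of _ 0]) auto
 then have "eventually (\<lambda>k. (\<forall>u. norm u \<le> R \<longrightarrow>
    norm (\<phi> (Suc k) u - \<phi> k (?T k u) * exp (- of_real (r k / 2 * (u \<bullet> (U *v u))))) \<le> t k * h k * norm u)
   \<and> (\<forall>x. N (?T k x) \<le> (1 - \<kappa> / 2 * t k) * N x) \<and> t k < 1 / \<kappa>) sequentially"
  by (intro eventually_conj h(2) adapted_norm_perturbation[OF N \<kappa> B t(1,2)])
 then obtain k1 where k1: "\<And>k u. k \<ge> k1 \<Longrightarrow> norm u \<le> R \<Longrightarrow>
    norm (\<phi> (Suc k) u - \<phi> k (?T k u) * exp (- of_real (r k / 2 * (u \<bullet> (U *v u))))) \<le> t k * h k * norm u"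
   "\<And>k x. k \<ge> k1 \<Longrightarrow> N (?T k x) \<le> (1 - \<kappa> / 2 * t k) * N x"
   "\<And>k. k \<ge> k1 \<Longrightarrow> t k < 1 / \<kappa>"
  unfolding eventually_sequentially by blast
 obtain C0 where C0: "\<And>u. norm (\<phi> k1 u - 1) \<le> C0 * norm u" using init[of k1] by blast
 define C1 where "C1 = \<bar>C0\<bar> + exp E * (norm V * K * R / 2)"
 have C1: "0 \<le> C1" using K(1) R0 by (simp add: C1_def)
 have start: "norm (\<phi> k1 u - of_real (G u)) \<le> C1 * N u" if u: "norm u \<le> R" for u
 proof -
  have "\<bar>exp 0 - exp (- (u \<bullet> (V *v u)) / 2)\<bar> \<le> exp E * \<bar>0 - (- (u \<bullet> (V *v u)) / 2)\<bar>"
   by (rule abs_exp_diff_le[OF E0 GE[OF u]])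
  also have "\<dots> \<le> exp E * (norm V * K * (R * norm u) / 2)"
  proof (intro mult_left_mono)
   have "norm V * K * (norm u * norm u) \<le> norm V * K * (R * norm u)" using u K(1) by (intro mult_left_mono mult_right_mono) auto
   then show "\<bar>0 - (- (u \<bullet> (V *v u)) / 2)\<bar> \<le> norm V * K * (R * norm u) / 2" using bil[of u V u] by simp
  qed simp
  finally have "\<bar>1 - G u\<bar> \<le> exp E * (norm V * K * R / 2) * norm u" by (simp add: G_def mult_ac)
  moreover have "C0 * norm u \<le> \<bar>C0\<bar> * norm u" by (intro mult_right_mono) auto
  moreover have "norm (\<phi> k1 u - of_real (G u)) \<le> norm (\<phi> k1 u - 1) + norm (1 - complex_of_real (G u))"
   using norm_triangle_ineq[of "\<phi> k1 u - 1" "1 - complex_of_real (G u)"] by simp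
  moreover have "norm (1 - complex_of_real (G u)) = \<bar>1 - G u\<bar>" by (metis norm_of_real of_real_1 of_real_diff)
  ultimately have "norm (\<phi> k1 u - of_real (G u)) \<le> C1 * norm u" using C0[of u] unfolding C1_def distrib_right by linarith
  also have "\<dots> \<le> C1 * N u" using C1 adapted_norm_ge[OF N] by (intro mult_left_mono) auto
  finally show ?thesis .
 qed
 define e where "e k = (\<bar>h k\<bar> + \<bar>h' k\<bar>) * (2 / \<kappa>)" for k
 define g where "g k = \<kappa> / 2 * t k" for k
 \<comment> \<open>A deterministic majorant of the weighted distance, constant up to time k1, where
   the estimates begin.\<close>
 define d where "d = rec_nat C1 (\<lambda>k x. if k < k1 then x else (1 - g k) * x + g k * e k)"
 have d_Suc: "d (Suc k) = (if k < k1 then d k else (1 - g k) * d k + g k * e k)" for k by (simp add: d_def)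
 have d0: "d k = C1" if "k \<le> k1" for k using that by (induction k) (auto simp: d_Suc, simp add: d_def)
 have g01: "0 \<le> g k" "g k \<le> 1" if "k \<ge> k1" for k
  using k1(3)[OF that] \<kappa> t(1)[of k] by (auto simp: g_def field_simps)
 have e0: "0 \<le> e k" for k using \<kappa> by (simp add: e_def)
 have ge: "g k * e k = t k * (\<bar>h k\<bar> + \<bar>h' k\<bar>)" for k using \<kappa> by (simp add: g_def e_def)
 have dpos: "0 \<le> d k" for k
 proof (induction k)
  case 0 then show ?case using d0[of 0] C1 by simp
 next
  case (Suc k)
  then show ?case using g01[of k] e0[of k] by (auto simp: d_Suc)
 qed
 have main: "\<forall>u. N u \<le> R \<longrightarrow> norm (\<phi> k u - of_real (G u)) \<le> d k * N u" if "k \<ge> k1" for k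
  using that
 proof (induction k rule: dec_induct)
  case base
  show ?case
  proof (intro allI impI)
   fix u assume "N u \<le> R"
   then have "norm u \<le> R" using adapted_norm_ge[OF N, of u] by linarith
   then show "norm (\<phi> k1 u - of_real (G u)) \<le> d k1 * N u" using start[of u] d0[of k1] by simp
  qed
 next
  case (step k)
  show ?case
  proof (intro allI impI)
   fix u assume u: "N u \<le> R"
   have N0: "0 \<le> N u" using adapted_norm_nonneg[OF N] by auto
   have Nv: "N (?T k u) \<le> (1 - g k) * N u" using k1(2)[OF step(1)] by (simp add: g_def)
   have NvR: "N (?T k u) \<le> R" using Nv u mult_right_mono[of "1 - g k" 1 "N u"] g01[OF step(1)] N0 by linarith
   have nu: "norm u \<le> R" "norm (?T k u) \<le> R" "norm u \<le> N u"
    using u NvR adapted_norm_ge[OF N, of u] adapted_norm_ge[OF N, of "?T k u"] by linarith+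
   let ?e = "exp (- (r k / 2 * (u \<bullet> (U *v u))))"
   have e1: "0 \<le> ?e" "?e \<le> 1" using U[of u] r(2)[of k] by auto
   have eq: "exp (- complex_of_real (r k / 2 * (u \<bullet> (U *v u)))) = of_real ?e"
    unfolding exp_of_real[symmetric] by simp
   have "norm (\<phi> (Suc k) u - of_real (G u)) \<le> norm (\<phi> (Suc k) u - \<phi> k (?T k u) * of_real ?e)
     + (norm ((\<phi> k (?T k u) - of_real (G (?T k u))) * of_real ?e) + norm (of_real (G (?T k u) * ?e - G u) :: complex))"
   proof -
    have "\<phi> (Suc k) u - of_real (G u) = (\<phi> (Suc k) u - \<phi> k (?T k u) * of_real ?e)
     + ((\<phi> k (?T k u) - of_real (G (?T k u))) * of_real ?e + of_real (G (?T k u) * ?e - G u))"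
     by (simp add: algebra_simps)
    moreover have "norm (a + (b + c)) \<le> norm a + (norm b + norm c)" for a b c :: complex
     using norm_triangle_ineq[of a "b + c"] norm_triangle_ineq[of b c] by linarith
    ultimately show ?thesis by (simp only:)
   qed
   moreover have "norm (\<phi> (Suc k) u - \<phi> k (?T k u) * of_real ?e) \<le> t k * \<bar>h k\<bar> * N u"
   proof -
    have "norm (\<phi> (Suc k) u - \<phi> k (?T k u) * of_real ?e) \<le> t k * h k * norm u"
     using k1(1)[OF step(1) nu(1)] unfolding eq .
    also have "\<dots> \<le> t k * \<bar>h k\<bar> * N u" using nu(3) t(1)[of k] by (intro mult_mono mult_left_mono) auto
    finally show ?thesis .
   qed
   moreover have "norm ((\<phi> k (?T k u) - of_real (G (?T k u))) * of_real ?e) \<le> d k * ((1 - g k) * N u)"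
   proof -
    have "norm ((\<phi> k (?T k u) - of_real (G (?T k u))) * of_real ?e) \<le> norm (\<phi> k (?T k u) - of_real (G (?T k u))) * 1"
     unfolding norm_mult norm_of_real using e1 by (intro mult_left_mono) auto
    also have "\<dots> \<le> d k * N (?T k u)" using step.IH NvR by simp
    also have "\<dots> \<le> d k * ((1 - g k) * N u)" by (intro mult_left_mono Nv dpos)
    finally show ?thesis .
   qed
   moreover have "norm (of_real (G (?T k u) * ?e - G u) :: complex) \<le> t k * \<bar>h' k\<bar> * N u"
   proof -
    have "norm (of_real (G (?T k u) * ?e - G u) :: complex) \<le> t k * h' k * norm u"
     unfolding norm_of_real by (rule gauss[OF nu(1,2)])
    also have "\<dots> \<le> t k * \<bar>h' k\<bar> * N u" using nu(3) t(1)[of k] by (intro mult_mono mult_left_mono) auto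
    finally show ?thesis .
   qed
   ultimately have "norm (\<phi> (Suc k) u - of_real (G u))
    \<le> t k * \<bar>h k\<bar> * N u + (d k * ((1 - g k) * N u) + t k * \<bar>h' k\<bar> * N u)" by linarith
   also have "\<dots> = ((1 - g k) * d k + g k * e k) * N u" unfolding ge by (simp add: algebra_simps)
   also have "\<dots> = d (Suc k) * N u" using step(1) by (simp add: d_Suc)
   finally show "norm (\<phi> (Suc k) u - of_real (G u)) \<le> d (Suc k) * N u" .
  qed
 qed
 have "d \<longlonglongrightarrow> 0"
 proof (rule contraction_recursion_tendsto)
  show "eventually (\<lambda>k. d (Suc k) \<le> (1 - g k) * d k + g k * e k) sequentially"
   using eventually_ge_at_top[of k1] by eventually_elim (simp add: d_Suc)
  show "eventually (\<lambda>k. 0 \<le> g k \<and> g k \<le> 1) sequentially"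
   using eventually_ge_at_top[of k1] by eventually_elim (simp add: g01)
  show "filterlim (\<lambda>n. \<Sum>k<n. g k) at_top sequentially"
   unfolding g_def sum_distrib_left[symmetric] using \<kappa>
   by (intro filterlim_tendsto_pos_mult_at_top[OF tendsto_const] t) auto
  have "e \<longlonglongrightarrow> (\<bar>0\<bar> + \<bar>0\<bar>) * (2 / \<kappa>)" unfolding e_def[abs_def] by (intro tendsto_intros h(1) h'0) (use \<kappa> in auto)
  then show "e \<longlonglongrightarrow> 0" by simp
 qed (use dpos in auto)
 then have "(\<lambda>k. d k * R) \<longlonglongrightarrow> 0 * R" by (intro tendsto_intros)
 then have dR: "(\<lambda>k. d k * R) \<longlonglongrightarrow> 0" by simp
 have "(\<lambda>k. \<phi> k u0 - of_real (G u0)) \<longlonglongrightarrow> 0"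
  by (rule Lim_null_comparison[OF _ dR])
   (use eventually_ge_at_top[of k1] in \<open>eventually_elim, use main in \<open>auto simp: R_def\<close>\<close>)
 then have "(\<lambda>k. \<phi> k u0) \<longlonglongrightarrow> of_real (G u0)" by (simp add: LIM_zero_iff)
 moreover have "complex_of_real (G u0) = exp (- of_real (u0 \<bullet> (V *v u0)) / 2)"
  unfolding G_def exp_of_real[symmetric] by simp
 ultimately show ?thesis by simp
qed

text \<open>At a birth the increment of a is 1, out of proportion to g. Adding h * (1 - (a - f)),
  which lies between 0 and 2 h, trades the increments of a for those of the smooth f.\<close>

lemma recursion_with_births:
 fixes x g e h a f :: "nat \<Rightarrow> real"
 assumes rec: "eventually (\<lambda>n. x (Suc n) \<le> (1 - g n) * x n + g n * e n + h n * (a (Suc n) - a n)) sequentially"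
  and g: "eventually (\<lambda>n. 0 < g n \<and> g n \<le> 1) sequentially"
  and div: "filterlim (\<lambda>n. \<Sum>k<n. g k) at_top sequentially"
  and e: "e \<longlonglongrightarrow> 0" and x: "\<And>n. 0 \<le> x n"
  and h: "\<And>n. 0 \<le> h n" "\<And>n. h (Suc n) \<le> h n" "h \<longlonglongrightarrow> 0"
  and a: "\<And>n. \<bar>a n - f n\<bar> \<le> 1" and f: "(\<lambda>n. h n * (f (Suc n) - f n) / g n) \<longlonglongrightarrow> 0"
 shows "x \<longlonglongrightarrow> 0"
proof -
 define y where "y n = x n + h n * (1 - (a n - f n))" for n
 have a': "0 \<le> 1 - (a n - f n)" "1 - (a n - f n) \<le> 2" for n using a[of n] by (auto simp: abs_le_iff)
 have xy: "x n \<le> y n" for n using mult_nonneg_nonneg[OF h(1)[of n] a'(1)[of n]] by (simp add: y_def)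
 define e' where "e' n = e n + h n * (1 - (a n - f n)) + h n * (f (Suc n) - f n) / g n" for n
 have "y \<longlonglongrightarrow> 0"
 proof (rule contraction_recursion_tendsto)
  show "eventually (\<lambda>n. y (Suc n) \<le> (1 - g n) * y n + g n * e' n) sequentially"
   using rec g
  proof eventually_elim
   case (elim n)
   have "h (Suc n) * (1 - (a (Suc n) - f (Suc n))) \<le> h n * (1 - (a (Suc n) - f (Suc n)))"
    by (intro mult_right_mono h a')
   then have "y (Suc n) \<le> (1 - g n) * x n + g n * e n + h n * (a (Suc n) - a n) + h n * (1 - (a (Suc n) - f (Suc n)))"
    using elim(1) by (simp add: y_def)
   also have "\<dots> = (1 - g n) * x n + g n * e n + h n * (1 - (a n - f n)) + h n * (f (Suc n) - f n)"
    by (simp add: algebra_simps)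
   also have "\<dots> = (1 - g n) * y n + g n * e' n" using elim(2) by (simp add: y_def e'_def field_simps)
   finally show ?case .
  qed
  have "(\<lambda>n. h n * (1 - (a n - f n))) \<longlonglongrightarrow> 0"
  proof (rule Lim_null_comparison)
   show "eventually (\<lambda>n. norm (h n * (1 - (a n - f n))) \<le> h n * 2) sequentially"
    using a' h(1) by (intro always_eventually allI) (simp add: abs_mult mult_left_mono)
   show "(\<lambda>n. h n * 2) \<longlonglongrightarrow> 0" using tendsto_mult[OF h(3) tendsto_const[of 2]] by simp
  qed
  from tendsto_add[OF tendsto_add[OF e this] f] show "e' \<longlonglongrightarrow> 0" by (simp add: e'_def[abs_def])
  show "eventually (\<lambda>n. 0 \<le> y n) sequentially" using x xy order_trans by (intro always_eventually) blast
 qed (use g div in \<open>auto elim: eventually_mono\<close>)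
 then show ?thesis
  by (rule tendsto_sandwich[OF _ _ tendsto_const, rotated 2]) (use x xy in auto)
qed

context qsd_chain begin

lemma simplex_l1: "x \<in> prob_simplex \<Longrightarrow> l1 x = 1"
 by (simp add: l1_def prob_simplex_def)

lemma mean_square_le_norm:
 assumes p: "\<And>y. 0 \<le> p y" "(\<Sum>y\<in>UNIV. p y) = 1"
 shows "\<bar>\<Sum>y\<in>UNIV. p y * (w :: real ^ 'd) $ y\<bar> \<le> norm w" "(\<Sum>y\<in>UNIV. p y * (w $ y)\<^sup>2) \<le> (norm w)\<^sup>2"
proof -
 have "\<bar>\<Sum>y\<in>UNIV. p y * w $ y\<bar> \<le> (\<Sum>y\<in>UNIV. p y * norm w)"
  using p(1) component_le_norm_cart[of w] by (intro order_trans[OF sum_abs] sum_mono) (simp add: abs_mult mult_left_mono)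
 then show "\<bar>\<Sum>y\<in>UNIV. p y * w $ y\<bar> \<le> norm w" using p(2) by (simp add: sum_distrib_right[symmetric])
 have "(w $ y)\<^sup>2 \<le> (norm w)\<^sup>2" for y
  using power_mono[OF component_le_norm_cart[of w y] abs_ge_zero, of 2] by simp
 then have "(\<Sum>y\<in>UNIV. p y * (w $ y)\<^sup>2) \<le> (\<Sum>y\<in>UNIV. p y * (norm w)\<^sup>2)"
  by (intro sum_mono mult_left_mono p)
 then show "(\<Sum>y\<in>UNIV. p y * (w $ y)\<^sup>2) \<le> (norm w)\<^sup>2" using p(2) by (simp add: sum_distrib_right[symmetric])
qed

lemma cvar_le: "\<nu> \<in> prob_simplex \<Longrightarrow> \<bar>cvar \<nu> x w\<bar> \<le> (norm w)\<^sup>2"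
proof -
 assume \<nu>: "\<nu> \<in> prob_simplex"
 note b = mean_square_le_norm[OF Kmat_nonneg[OF \<nu>, of x] Kmat_row_sum[OF \<nu>, of x], of w]
 have "(\<Sum>y\<in>UNIV. Kmat P \<nu> $ x $ y * w $ y)\<^sup>2 \<le> (norm w)\<^sup>2" using power_mono[OF b(1) abs_ge_zero, of 2] by simp
 moreover have "0 \<le> (\<Sum>y\<in>UNIV. Kmat P \<nu> $ x $ y * (w $ y)\<^sup>2)" by (intro sum_nonneg mult_nonneg_nonneg Kmat_nonneg \<nu>) simp
 moreover note b(2) zero_le_power2[of "\<Sum>y\<in>UNIV. Kmat P \<nu> $ x $ y * w $ y"]
 ultimately show ?thesis unfolding cvar_def abs_le_iff by (intro conjI; linarith)
qed

lemma cvar_lipschitz: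
 assumes \<nu>: "\<nu> \<in> prob_simplex" and \<nu>': "\<nu>' \<in> prob_simplex"
 shows "\<bar>cvar \<nu> x w - cvar \<nu>' x w\<bar> \<le> 3 * l1 (\<nu> - \<nu>') * (norm w)\<^sup>2"
proof -
 have q: "0 \<le> q0 $ x" "q0 $ x \<le> 1" by (rule q0_nonneg, rule q0_le_1)
 let ?m = "\<lambda>\<nu>. \<Sum>y\<in>UNIV. Kmat P \<nu> $ x $ y * w $ y"
 have diff: "\<bar>(\<Sum>y\<in>UNIV. Kmat P \<nu> $ x $ y * f y) - (\<Sum>y\<in>UNIV. Kmat P \<nu>' $ x $ y * f y)\<bar> \<le> l1 (\<nu> - \<nu>') * c"
  if "\<And>y. \<bar>f y\<bar> \<le> c" for f c
 proof -
  have "(\<Sum>y\<in>UNIV. Kmat P \<nu> $ x $ y * f y) - (\<Sum>y\<in>UNIV. Kmat P \<nu>' $ x $ y * f y) = (\<Sum>y\<in>UNIV. q0 $ x * ((\<nu> - \<nu>') $ y * f y))"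
   unfolding sum_subtractf[symmetric] Kmat_component by (intro sum.cong refl) (simp add: algebra_simps)
  also have "\<bar>\<dots>\<bar> \<le> (\<Sum>y\<in>UNIV. \<bar>(\<nu> - \<nu>') $ y\<bar> * c)"
  proof (rule order_trans[OF sum_abs sum_mono])
   fix y
   have "\<bar>q0 $ x\<bar> * (\<bar>(\<nu> - \<nu>') $ y\<bar> * \<bar>f y\<bar>) \<le> 1 * (\<bar>(\<nu> - \<nu>') $ y\<bar> * c)"
    using q that[of y] by (intro mult_mono mult_left_mono) auto
   then show "\<bar>q0 $ x * ((\<nu> - \<nu>') $ y * f y)\<bar> \<le> \<bar>(\<nu> - \<nu>') $ y\<bar> * c" unfolding abs_mult by simp
  qed
  also have "\<dots> = l1 (\<nu> - \<nu>') * c" by (simp add: l1_def sum_distrib_right)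
  finally show ?thesis .
 qed
 have sq: "\<bar>(w $ y)\<^sup>2\<bar> \<le> (norm w)\<^sup>2" for y
  using power_mono[OF component_le_norm_cart[of w y] abs_ge_zero, of 2] by simp
 have m: "\<bar>?m \<nu>\<bar> \<le> norm w" "\<bar>?m \<nu>'\<bar> \<le> norm w"
  using mean_square_le_norm(1)[OF Kmat_nonneg[OF \<nu>] Kmat_row_sum[OF \<nu>]] mean_square_le_norm(1)[OF Kmat_nonneg[OF \<nu>'] Kmat_row_sum[OF \<nu>']] by blast+
 have "(?m \<nu>)\<^sup>2 - (?m \<nu>')\<^sup>2 = (?m \<nu> - ?m \<nu>') * (?m \<nu> + ?m \<nu>')" by (simp add: power2_eq_square algebra_simps)
 then have "\<bar>(?m \<nu>)\<^sup>2 - (?m \<nu>')\<^sup>2\<bar> = \<bar>?m \<nu> - ?m \<nu>'\<bar> * \<bar>?m \<nu> + ?m \<nu>'\<bar>" by (simp add: abs_mult)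
 also have "\<dots> \<le> (l1 (\<nu> - \<nu>') * norm w) * (2 * norm w)"
  using m l1_nonneg[of "\<nu> - \<nu>'"] by (intro mult_mono diff component_le_norm_cart) auto
 finally have "\<bar>(?m \<nu>)\<^sup>2 - (?m \<nu>')\<^sup>2\<bar> \<le> 2 * l1 (\<nu> - \<nu>') * (norm w)\<^sup>2" by (simp add: power2_eq_square mult_ac)
 moreover have "\<bar>(\<Sum>y\<in>UNIV. Kmat P \<nu> $ x $ y * (w $ y)\<^sup>2) - (\<Sum>y\<in>UNIV. Kmat P \<nu>' $ x $ y * (w $ y)\<^sup>2)\<bar> \<le> l1 (\<nu> - \<nu>') * (norm w)\<^sup>2"
  by (rule diff[OF sq])
 ultimately show ?thesis unfolding cvar_def by linarith
qed

lemma cvar_scale: "cvar \<nu> x (c *\<^sub>R w) = c\<^sup>2 * cvar \<nu> x w"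
proof -
 have "(\<Sum>y\<in>UNIV. Kmat P \<nu> $ x $ y * ((c *\<^sub>R w) $ y)\<^sup>2) = c\<^sup>2 * (\<Sum>y\<in>UNIV. Kmat P \<nu> $ x $ y * (w $ y)\<^sup>2)"
  by (simp add: sum_distrib_left power_mult_distrib mult_ac)
 moreover have "(\<Sum>y\<in>UNIV. Kmat P \<nu> $ x $ y * (c *\<^sub>R w) $ y) = c * (\<Sum>y\<in>UNIV. Kmat P \<nu> $ x $ y * w $ y)"
  by (simp add: sum_distrib_left mult_ac)
 ultimately show ?thesis by (simp add: cvar_def power_mult_distrib right_diff_distrib)
qed

lemma cvar_nonneg: "\<nu> \<in> prob_simplex \<Longrightarrow> 0 \<le> cvar \<nu> x w"
proof -
 assume \<nu>: "\<nu> \<in> prob_simplex"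
 define m where "m = (\<Sum>y\<in>UNIV. Kmat P \<nu> $ x $ y * w $ y)"
 have "(\<Sum>y\<in>UNIV. Kmat P \<nu> $ x $ y * (w $ y - m)\<^sup>2)
   = (\<Sum>y\<in>UNIV. Kmat P \<nu> $ x $ y * (w $ y)\<^sup>2 - 2 * m * (Kmat P \<nu> $ x $ y * w $ y) + m\<^sup>2 * Kmat P \<nu> $ x $ y)"
  by (intro sum.cong refl) (simp add: power2_eq_square algebra_simps)
 also have "\<dots> = cvar \<nu> x w"
  unfolding sum.distrib sum_subtractf sum_distrib_left[symmetric] m_def[symmetric] Kmat_row_sum[OF \<nu>] cvar_def
  by (simp add: power2_eq_square)
 finally show ?thesis using Kmat_nonneg[OF \<nu>, of x] by (metis (no_types, lifting) mult_nonneg_nonneg sum_nonneg zero_le_power2)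
qed

lemma Us_nonneg: "0 \<le> u \<bullet> (Us *v u)"
 unfolding Us_quadratic by (intro sum_nonneg mult_nonneg_nonneg less_imp_le[OF theta_pos] cvar_nonneg theta_simplex)

text \<open>Controls how far the conditional variance at a given time is from its limit under
  \<theta>s. The distances of the particles and of \<theta> enter linearly.\<close>

lemma mean_cvar_lipschitz:
 assumes m: "m \<in> prob_simplex" and \<nu>: "\<nu> \<in> prob_simplex"
 shows "\<bar>(\<Sum>x\<in>UNIV. m $ x * cvar \<nu> x w) - (\<Sum>x\<in>UNIV. \<theta>s $ x * cvar \<theta>s x w)\<bar>
  \<le> (l1 (m - \<theta>s) + 3 * l1 (\<nu> - \<theta>s)) * (norm w)\<^sup>2"
proof -
 have "(\<Sum>x\<in>UNIV. m $ x * cvar \<nu> x w) - (\<Sum>x\<in>UNIV. \<theta>s $ x * cvar \<theta>s x w)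
  = (\<Sum>x\<in>UNIV. (m - \<theta>s) $ x * cvar \<nu> x w) + (\<Sum>x\<in>UNIV. \<theta>s $ x * (cvar \<nu> x w - cvar \<theta>s x w))"
  unfolding sum_subtractf[symmetric] sum.distrib[symmetric] by (intro sum.cong refl) (simp add: algebra_simps)
 moreover have "\<bar>\<Sum>x\<in>UNIV. (m - \<theta>s) $ x * cvar \<nu> x w\<bar> \<le> (\<Sum>x\<in>UNIV. \<bar>(m - \<theta>s) $ x\<bar> * (norm w)\<^sup>2)"
  using cvar_le[OF \<nu>] by (intro order_trans[OF sum_abs] sum_mono) (simp add: abs_mult mult_left_mono)
 moreover have "\<dots> = l1 (m - \<theta>s) * (norm w)\<^sup>2" by (simp add: l1_def sum_distrib_right)
 moreover have "\<bar>\<Sum>x\<in>UNIV. \<theta>s $ x * (cvar \<nu> x w - cvar \<theta>s x w)\<bar> \<le> (\<Sum>x\<in>UNIV. \<theta>s $ x * (3 * l1 (\<nu> - \<theta>s) * (norm w)\<^sup>2))"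

  by (rule order_trans[OF sum_abs sum_mono]) (simp only: abs_mult abs_of_pos[OF theta_pos] mult_left_mono[OF cvar_lipschitz[OF \<nu> theta_simplex] less_imp_le[OF theta_pos]])
 moreover have "\<dots> = 3 * l1 (\<nu> - \<theta>s) * (norm w)\<^sup>2" by (simp add: sum_distrib_right[symmetric] theta_sum)
 ultimately show ?thesis unfolding distrib_right by linarith
qed

end

section \<open>The normalisation and its asymptotics\<close>

locale supercritical_gain = interacting_particles M P \<gamma>s \<zeta> x0 X \<iota> \<theta> F G H \<theta>s
 for M :: "'w measure" and P :: "real ^ ('d::finite option) ^ ('d option)" and \<gamma>s \<zeta> :: real and x0 :: 'd
  and X :: "nat \<Rightarrow> nat \<Rightarrow> 'w \<Rightarrow> 'd" and \<iota> :: "nat \<Rightarrow> 'w \<Rightarrow> nat" and \<theta> :: "nat \<Rightarrow> 'w \<Rightarrow> real ^ 'd"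
  and F G H :: "nat \<Rightarrow> 'w measure" and \<theta>s :: "real ^ 'd" +
 fixes L :: real
 assumes L: "0 < L" "\<And>c. tangent_eigenvalue (h_jacobian P \<theta>s) c \<Longrightarrow> Re c \<le> - L" and gain: "inverse L < \<gamma>s"
begin

definition \<alpha> :: real where "\<alpha> = (1 + \<zeta>) / 2"

lemma \<alpha>: "1 / 2 < \<alpha>" "\<alpha> < 1" "\<zeta> = 2 * \<alpha> - 1" "\<alpha> / \<gamma>s < L"
proof -
 show 1: "1 / 2 < \<alpha>" "\<alpha> < 1" "\<zeta> = 2 * \<alpha> - 1" using \<zeta> by (auto simp: \<alpha>_def field_simps)
 have "\<alpha> / \<gamma>s < 1 / \<gamma>s" using 1 \<gamma>s by (intro divide_strict_right_mono) auto
 also have "1 / \<gamma>s < L" using gain L(1) \<gamma>s by (simp add: field_simps)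
 finally show "\<alpha> / \<gamma>s < L" .
qed

lemma powr_\<zeta>: "x powr \<zeta> = x powr (2 * \<alpha> - 1)"
 by (simp only: \<alpha>(3)[symmetric])

text \<open>A smooth version of \<sigma>: a(n) / \<gamma>(n) behaves like n^(1 + \<zeta>) /
  \<gamma>s, whose root is n^\<alpha> / sqrt \<gamma>s. Unlike \<sigma> it has no jumps at
  births.\<close>

definition scl :: "nat \<Rightarrow> real" where "scl n = (real n + Nst) powr \<alpha> / sqrt \<gamma>s"

lemma scl_pos: "0 < scl n"
 using Nst \<gamma>s by (simp add: scl_def)

text \<open>The relative growth of the normalisation per unit of step size. Its limit \<alpha> /
  \<gamma>s is the shift added to the drift.\<close>

definition \<tau> :: "nat \<Rightarrow> real" where "\<tau> n = (scl (Suc n) / scl n - 1) / \<gamma> n"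

lemma scl_Suc: "scl (Suc n) = scl n * (1 + \<gamma> n * \<tau> n)"
 using scl_pos[of n] \<gamma>_pos[of n] by (simp add: \<tau>_def)

lemma \<tau>_tendsto: "\<tau> \<longlonglongrightarrow> \<alpha> / \<gamma>s"
proof -
 have N: "1 \<le> Nst" by (rule Nst)
 have "\<tau> n = ((real n + 1 + Nst) powr \<alpha> / (real n + Nst) powr \<alpha> - 1) * ((real n + Nst) / \<gamma>s)" for n
  using \<gamma>s by (simp add: \<tau>_def scl_def \<gamma>_eq add_ac)
 moreover have "(\<lambda>n. ((real n + 1 + Nst) powr \<alpha> / (real n + Nst) powr \<alpha> - 1) * ((real n + Nst) / \<gamma>s)) \<longlonglongrightarrow> \<alpha> / \<gamma>s"
 proof -
  have eq: "\<alpha> / \<gamma>s = ((1 + Nst) * \<alpha> - Nst * \<alpha>) * inverse \<gamma>s" by (simp add: divide_inverse algebra_simps)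
  show ?thesis unfolding eq using \<alpha>(1,2) \<gamma>s N by real_asymp
 qed
 ultimately have "(\<lambda>n. \<tau> n) \<longlonglongrightarrow> \<alpha> / \<gamma>s" by (simp only:)
 then show ?thesis .
qed

lemma scl_\<gamma>_tendsto: "(\<lambda>n. scl (Suc n) * \<gamma> n) \<longlonglongrightarrow> 0"
proof -
 have q: "0 < sqrt \<gamma>s" using \<gamma>s by simp
 have "scl (Suc n) * \<gamma> n = (real n + 1 + Nst) powr \<alpha> / (real n + Nst) * (\<gamma>s / sqrt \<gamma>s)" for n
  by (simp add: scl_def \<gamma>_eq add_ac)
 moreover have "(\<lambda>n. (real n + 1 + Nst) powr \<alpha> / (real n + Nst)) \<longlonglongrightarrow> 0"
  using \<alpha>(1,2) Nst(2) by real_asymp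
 from tendsto_mult[OF this tendsto_const[of "\<gamma>s / sqrt \<gamma>s"]]
 have "(\<lambda>n. (real n + 1 + Nst) powr \<alpha> / (real n + Nst) * (\<gamma>s / sqrt \<gamma>s)) \<longlonglongrightarrow> 0" by simp
 ultimately show ?thesis by simp
qed

text \<open>The variance scale of the normalised noise in one step; the normalisation is chosen so
  that it is asymptotic to \<gamma> n.\<close>

definition \<rho> :: "nat \<Rightarrow> real" where "\<rho> n = (scl (Suc n) * \<gamma> n)\<^sup>2 / real (np (Suc n))"

lemma \<rho>_nonneg: "0 \<le> \<rho> n"
 by (simp add: \<rho>_def)

lemma \<rho>_tendsto: "(\<lambda>n. \<rho> n / \<gamma> n) \<longlonglongrightarrow> 1"
proof -
 have "\<rho> n / \<gamma> n = ((real n + 1 + Nst) powr (2 * \<alpha>) / ((real n + Nst) * (real n + 1) powr (2 * \<alpha> - 1)))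
   * inverse (real (np (Suc n)) / real (Suc n) powr \<zeta>)" for n
 proof -
  have "\<rho> n / \<gamma> n = (scl (Suc n))\<^sup>2 * \<gamma> n / real (np (Suc n))"
   using \<gamma>_pos[of n] by (simp add: \<rho>_def power2_eq_square)
  also have "(scl (Suc n))\<^sup>2 = (real n + 1 + Nst) powr (2 * \<alpha>) / \<gamma>s"
  proof -
   have "((real n + 1 + Nst) powr \<alpha>)\<^sup>2 = (real n + 1 + Nst) powr (2 * \<alpha>)"
    unfolding power2_eq_square powr_add[symmetric] by simp
   then show ?thesis using \<gamma>s by (simp add: scl_def power_divide add_ac)
  qed
  finally show ?thesis using \<gamma>s Nst by (simp add: \<gamma>_eq powr_\<zeta> add_ac)
 qed
 moreover have "(\<lambda>n. (real n + 1 + Nst) powr (2 * \<alpha>) / ((real n + Nst) * (real n + 1) powr (2 * \<alpha> - 1))) \<longlonglongrightarrow> 1"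
  using \<alpha>(1,2) Nst(2) by real_asymp
 from tendsto_mult[OF this tendsto_inverse[OF LIMSEQ_Suc[OF num_particles_asymp[OF \<zeta>]]]]
 have "(\<lambda>n. ((real n + 1 + Nst) powr (2 * \<alpha>) / ((real n + Nst) * (real n + 1) powr (2 * \<alpha> - 1)))
   * inverse (real (np (Suc n)) / real (Suc n) powr \<zeta>)) \<longlonglongrightarrow> 1" by simp
 ultimately show ?thesis by simp
qed

text \<open>The normalised effect of one birth: the exponent \<alpha> - 1 - \<zeta> equals -\<alpha>
  because \<zeta> = 2 \<alpha> - 1.\<close>

lemma birth_weight: "eventually (\<lambda>n. scl (Suc n) * \<gamma> n / real (np (Suc n)) \<le> 2 * sqrt \<gamma>s * (real n + Nst) powr (- \<alpha>)) sequentially"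
proof -
 define H where "H n = ((real n + 1 + Nst) powr \<alpha> * (real n + Nst) powr \<alpha> / ((real n + Nst) * (real n + 1) powr (2 * \<alpha> - 1)))
   * inverse (real (np (Suc n)) / real (Suc n) powr \<zeta>)" for n
 have eq: "scl (Suc n) * \<gamma> n / real (np (Suc n)) = H n * (sqrt \<gamma>s * (real n + Nst) powr (- \<alpha>))" for n
 proof -
  have g: "\<gamma>s / sqrt \<gamma>s = sqrt \<gamma>s" using \<gamma>s by (simp add: real_div_sqrt)
  have "scl (Suc n) * \<gamma> n / real (np (Suc n)) = (real n + 1 + Nst) powr \<alpha> / ((real n + Nst) * real (np (Suc n))) * (\<gamma>s / sqrt \<gamma>s)"
   by (simp add: scl_def \<gamma>_eq add_ac)
  also have "\<dots> = H n * (sqrt \<gamma>s * (real n + Nst) powr (- \<alpha>))"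
     proof -
   have *: "x / (d * a) * g = ((x * b / (d * z)) * inverse (a / z)) * (g * inverse b)"
    if "b \<noteq> 0" "z \<noteq> 0" for a b d g x z :: real
    using that by (simp add: field_simps)
   have "(real n + Nst) powr \<alpha> \<noteq> 0" "(real n + 1) powr (2 * \<alpha> - 1) \<noteq> 0" using Nst by auto
   from *[OF this] show ?thesis unfolding g H_def powr_minus powr_\<zeta> of_nat_Suc add.commute[of 1 "real n"] .
  qed
  finally show ?thesis .
 qed
 have "(\<lambda>n. (real n + 1 + Nst) powr \<alpha> * (real n + Nst) powr \<alpha> / ((real n + Nst) * (real n + 1) powr (2 * \<alpha> - 1))) \<longlonglongrightarrow> 1"
  using \<alpha>(1,2) Nst(2) by real_asymp
 from tendsto_mult[OF this tendsto_inverse[OF LIMSEQ_Suc[OF num_particles_asymp[OF \<zeta>]]]]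
 have "H \<longlonglongrightarrow> 1" unfolding H_def[abs_def] by simp
 then have "eventually (\<lambda>n. H n < 2) sequentially" by (rule order_tendstoD) simp
 then show ?thesis
 proof eventually_elim
  case (elim n)
  then show ?case unfolding eq using mult_right_mono[of "H n" 2 "sqrt \<gamma>s * (real n + Nst) powr (- \<alpha>)"] \<gamma>s by simp
 qed
qed

text \<open>The smooth growth of n^\<zeta>, weighted by the effect of one birth and divided by the
  step size, has order n^(\<zeta> - \<alpha>) = n^(\<alpha> - 1).\<close>

lemma growth_weight: "(\<lambda>n. (real n + Nst) powr (- \<alpha>) * (real (Suc n) powr \<zeta> - real n powr \<zeta>) / \<gamma> n) \<longlonglongrightarrow> 0"
proof -
 have "(\<lambda>n. (real n + Nst) powr (- \<alpha>) * ((real n + 1) powr (2 * \<alpha> - 1) - real n powr (2 * \<alpha> - 1)) * (real n + Nst)) \<longlonglongrightarrow> 0"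
  using \<alpha>(1,2) Nst(2) by real_asymp
 from tendsto_mult[OF this tendsto_const[of "1 / \<gamma>s"]] show ?thesis
  by (simp add: \<gamma>_eq powr_\<zeta> add_ac)
qed

lemma normalisation_ratio: "(\<lambda>n. sqrt (real (np n) / step_size \<gamma>s n) / scl n) \<longlonglongrightarrow> 1"
proof -
 define H where "H n = (real n powr (2 * \<alpha> - 1) * (real n - 1 + Nst) / (real n + Nst) powr (2 * \<alpha>)) * (real (np n) / real n powr \<zeta>)" for n
 have "(\<lambda>n. real n powr (2 * \<alpha> - 1) * (real n - 1 + Nst) / (real n + Nst) powr (2 * \<alpha>)) \<longlonglongrightarrow> 1"
  using \<alpha>(1,2) Nst(2) by real_asymp
 from tendsto_mult[OF this num_particles_asymp[OF \<zeta>]] have "H \<longlonglongrightarrow> 1" unfolding H_def[abs_def] by simp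
 then have lim: "(\<lambda>n. sqrt (H n)) \<longlonglongrightarrow> 1" using tendsto_real_sqrt by fastforce
 have "eventually (\<lambda>n. sqrt (real (np n) / step_size \<gamma>s n) / scl n = sqrt (H n)) sequentially"
  using eventually_gt_at_top[of 0]
 proof eventually_elim
  case (elim n)
  have p: "(real n + Nst) powr (2 * \<alpha>) = ((real n + Nst) powr \<alpha>)\<^sup>2"
   unfolding power2_eq_square powr_add[symmetric] by simp
  have "sqrt (real (np n) / step_size \<gamma>s n) = sqrt (real (np n) * (real n - 1 + Nst)) / sqrt \<gamma>s"
   by (simp add: step_size_def Nst_def real_sqrt_divide real_sqrt_mult)
  moreover have "sqrt (H n) = sqrt (real (np n) * (real n - 1 + Nst)) / (real n + Nst) powr \<alpha>"
   using elim by (simp add: H_def p powr_\<zeta> real_sqrt_divide real_sqrt_mult)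
  ultimately show ?case using \<gamma>s by (simp add: scl_def)
 qed
 then show ?thesis using lim by (simp add: filterlim_cong)
qed

end

section \<open>The linearised recursion\<close>

lemma Js_shift: "(A + c *\<^sub>R mat 1) *v x = A *v x + c *\<^sub>R x" for A :: "real ^ 'n::finite ^ 'n"
 by (simp add: matrix_vector_mult_add_rdistrib scaleR_matrix_vector_assoc[symmetric])

lemma transpose_shift: "transpose (A + c *\<^sub>R mat 1 + d *\<^sub>R A') = transpose A + c *\<^sub>R mat 1 + d *\<^sub>R transpose A'"
 for A A' :: "real ^ 'n::finite ^ 'n"
 by (simp add: vec_eq_iff transpose_def mat_def eq_commute)

lemma complexify_shift:
 "complexify ((*v) (A + c *\<^sub>R mat 1)) z = complexify ((*v) A) z + complex_of_real c *s z"
 for A :: "real ^ 'n::finite ^ 'n"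
 by (simp add: vec_eq_iff complexify_def Js_shift complex_eq_iff)

lemma (in prob_space) integrable_iexp:
 assumes "f \<in> borel_measurable M" shows "integrable M (\<lambda>s. iexp (f s))"
proof (rule integrable_const_bound[of _ 1])
 show "(\<lambda>s. iexp (f s)) \<in> borel_measurable M"
  by (intro measurable_compose[OF _ borel_measurable_exp] borel_measurable_times borel_measurable_const borel_measurable_complex_of_real assms)
qed simp

lemma (in prob_space) norm_integral_diff_le:
 fixes f g :: "'a \<Rightarrow> complex"
 assumes "integrable M f" "integrable M g" "integrable M h" "\<And>s. s \<in> space M \<Longrightarrow> norm (f s - g s) \<le> h s"
 shows "norm ((\<integral>s. f s \<partial>M) - (\<integral>s. g s \<partial>M)) \<le> (\<integral>s. h s \<partial>M)"
proof -
 have "norm ((\<integral>s. f s \<partial>M) - (\<integral>s. g s \<partial>M)) \<le> (\<integral>s. norm (f s - g s) \<partial>M)"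
  unfolding Bochner_Integration.integral_diff[OF assms(1,2), symmetric] by (rule integral_norm_bound)
 also have "\<dots> \<le> (\<integral>s. h s \<partial>M)" using assms by (intro integral_mono) auto
 finally show ?thesis .
qed

lemma iexp_diff_le: "norm (iexp x - iexp y) \<le> \<bar>x - y\<bar>"
proof -
 have "iexp x - iexp y = iexp y * (iexp (x - y) - 1)"
  by (simp add: algebra_simps exp_add[symmetric])
 also have "norm \<dots> = norm (iexp (x - y) - 1)" by (simp add: norm_mult)
 also have "\<dots> \<le> \<bar>x - y\<bar>" using iexp_approx1[of "x - y" 0] by simp
 finally show ?thesis .
qed

context supercritical_gain begin

abbreviation J :: "real ^ 'd ^ 'd" where "J \<equiv> Jm L"

text \<open>The exact drift after normalisation: scl (n + 1) (I + \<gamma> J) = scl n (I + \<gamma>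
  Bm). The last term is the product of the two first-order changes.\<close>

definition Bm :: "nat \<Rightarrow> real ^ 'd ^ 'd" where "Bm n = J + \<tau> n *\<^sub>R mat 1 + (\<tau> n * \<gamma> n) *\<^sub>R J"

definition Js :: "real ^ 'd ^ 'd" where "Js = J + (\<alpha> / \<gamma>s) *\<^sub>R mat 1"

lemma Bm_tendsto: "Bm \<longlonglongrightarrow> Js" "(\<lambda>n. transpose (Bm n)) \<longlonglongrightarrow> transpose Js"
proof -
 have *: "(\<lambda>n. A + \<tau> n *\<^sub>R mat 1 + (\<tau> n * \<gamma> n) *\<^sub>R A) \<longlonglongrightarrow> A + (\<alpha> / \<gamma>s) *\<^sub>R mat 1" for A :: "real ^ 'd ^ 'd"
 proof -
  have "(\<lambda>n. A + \<tau> n *\<^sub>R mat 1 + (\<tau> n * \<gamma> n) *\<^sub>R A) \<longlonglongrightarrow> A + (\<alpha> / \<gamma>s) *\<^sub>R mat 1 + ((\<alpha> / \<gamma>s) * 0) *\<^sub>R A"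
   by (intro tendsto_add tendsto_scaleR tendsto_mult tendsto_const \<tau>_tendsto \<gamma>_tendsto)
  then show ?thesis by simp
 qed
 show "Bm \<longlonglongrightarrow> Js" unfolding Bm_def[abs_def] Js_def by (rule *)
 have "transpose Js = transpose J + (\<alpha> / \<gamma>s) *\<^sub>R mat 1" using transpose_shift[of J "\<alpha> / \<gamma>s" 0] by (simp add: Js_def)
 then show "(\<lambda>n. transpose (Bm n)) \<longlonglongrightarrow> transpose Js" unfolding Bm_def transpose_shift using *[of "transpose J"] by simp
qed

lemma Js_eigenvalue:
 assumes "z \<noteq> 0" "complexify ((*v) Js) z = c *s z" shows "Re c \<le> - (L - \<alpha> / \<gamma>s)"
proof -
 have "complexify ((*v) J) z = (c - of_real (\<alpha> / \<gamma>s)) *s z"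
  using assms(2) unfolding Js_def complexify_shift by (simp add: vec_eq_iff algebra_simps eq_diff_eq)
 from Jm_eigenvalue[OF L(2) assms(1) this] show ?thesis by simp
qed

definition \<kappa> :: real where "\<kappa> = (L - \<alpha> / \<gamma>s) / 2"

lemma \<kappa>: "0 < \<kappa>" "\<kappa> < L - \<alpha> / \<gamma>s"
 using \<alpha>(4) by (auto simp: \<kappa>_def)

lemma adapted_norms: "\<exists>N. adapted_norm ((*v) Js) \<kappa> N" "\<exists>N. adapted_norm ((*v) (transpose Js)) \<kappa> N"
proof -
 show "\<exists>N. adapted_norm ((*v) Js) \<kappa> N"
  by (rule adapted_norm_exists[OF matrix_vector_mul_linear Js_eigenvalue]) (use \<kappa> in auto)
 show "\<exists>N. adapted_norm ((*v) (transpose Js)) \<kappa> N"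
 proof (rule adapted_norm_exists[OF matrix_vector_mul_linear])
  fix c z assume "z \<noteq> 0" "complexify ((*v) (transpose Js)) z = c *s z"
  then obtain z' where "z' \<noteq> 0" "complexify ((*v) Js) z' = c *s z'" using eigenvalue_transpose by blast
  then show "Re c \<le> - (L - \<alpha> / \<gamma>s)" by (rule Js_eigenvalue)
 qed (use \<kappa> in auto)
qed

text \<open>Half of the coefficient (1 + \<zeta>) / \<gamma>s is \<alpha> / \<gamma>s, so the
  shifted drift of the Lyapunov equation is exactly \<open>Js\<close>.\<close>

lemma lyapunov_solution_Js:
 "\<exists>!V. lyapunov_solution Us (h_jacobian P \<theta>s) ((1 + \<zeta>) * inverse \<gamma>s) V"
 "lyapunov_solution Us (h_jacobian P \<theta>s) ((1 + \<zeta>) * inverse \<gamma>s) V \<Longrightarrow> Us + Js ** V + V ** transpose Js = 0"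
proof -
 have c: "(1 + \<zeta>) * inverse \<gamma>s / 2 = \<alpha> / \<gamma>s" using \<gamma>s by (simp add: \<alpha>_def field_simps)
 obtain N where N: "adapted_norm ((*v) Js) \<kappa> N" using adapted_norms(1) by (rule exE)
 obtain N' where N': "adapted_norm ((*v) (transpose Js)) \<kappa> N'" using adapted_norms(2) by (rule exE)
 have Js: "J + ((1 + \<zeta>) * inverse \<gamma>s / 2) *\<^sub>R mat 1 = Js" unfolding c by (simp only: Js_def)
 have cL: "(1 + \<zeta>) * inverse \<gamma>s / 2 < L" unfolding c by (rule \<alpha>(4))
 note u = lyapunov_solution_unique[where c = "(1 + \<zeta>) * inverse \<gamma>s" and L = L, unfolded Js, OF N N' \<kappa>(1) \<kappa>(1) cL]
 show "\<exists>!V. lyapunov_solution Us (h_jacobian P \<theta>s) ((1 + \<zeta>) * inverse \<gamma>s) V" by (rule u(1))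
 show "lyapunov_solution Us (h_jacobian P \<theta>s) ((1 + \<zeta>) * inverse \<gamma>s) V \<Longrightarrow> Us + Js ** V + V ** transpose Js = 0" by (rule u(2))
qed

lemma scl_step: "scl (Suc n) *\<^sub>R (x + \<gamma> n *\<^sub>R (J *v x)) = scl n *\<^sub>R x + \<gamma> n *\<^sub>R (Bm n *v (scl n *\<^sub>R x))"
proof -
 have "Bm n *v y = J *v y + \<tau> n *\<^sub>R y + (\<tau> n * \<gamma> n) *\<^sub>R (J *v y)" for y
  by (simp add: Bm_def matrix_vector_mult_add_rdistrib scaleR_matrix_vector_assoc[symmetric])
 then show ?thesis unfolding scl_Suc
  by (simp add: matrix_vector_mult_scaleR algebra_simps)
qed

text \<open>The linear part of the normalised error: constant-coefficient drift in place of the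
  random one, same noise. It starts at 0 and is set to 0 outside the space, so that each
  \<open>Z n\<close> is bounded everywhere.\<close>

primrec Z :: "nat \<Rightarrow> 'w \<Rightarrow> real ^ 'd" where
 "Z 0 s = 0"
| "Z (Suc n) s = (if s \<in> space M
   then Z n s + \<gamma> n *\<^sub>R (Bm n *v Z n s) + (scl (Suc n) * \<gamma> n) *\<^sub>R (Mart n s v* Qs) else 0)"

lemma linear_measurable:
 fixes f :: "real ^ 'd \<Rightarrow> real ^ 'd"
 assumes "bounded_linear f" "g \<in> borel_measurable N" shows "(\<lambda>s. f (g s)) \<in> borel_measurable N"
 by (rule measurable_compose[OF assms(2) borel_measurable_continuous_onI[OF linear_continuous_on[OF assms(1)]]])

lemma Z_measurable: "Z n \<in> borel_measurable (F n)"
proof (induction n)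
 case 0
 have "Z 0 = (\<lambda>s. 0)" by (rule ext) simp
 then show ?case by simp
next
 case (Suc n)
 have "(\<lambda>s. Z n s + \<gamma> n *\<^sub>R (Bm n *v Z n s) + (scl (Suc n) * \<gamma> n) *\<^sub>R (Mart n s v* Qs)) \<in> borel_measurable (F (Suc n))"
  by (intro borel_measurable_add borel_measurable_scaleR borel_measurable_const F_mono[OF Suc] Mart_measurable
    linear_measurable[OF matrix_vector_mul_bounded_linear] linear_measurable[OF linear_vector_Qs])
 then show ?case using F_props by (subst measurable_cong) auto
qed

lemma Z_bounded: "\<exists>b. \<forall>s. norm (Z n s) \<le> b"
proof (induction n)
 case 0
 show ?case by auto
next
 case (Suc n)
 then obtain b where b: "\<And>s. norm (Z n s) \<le> b" by blast
 obtain K where K: "0 \<le> K" "\<And>x. norm (Bm n *v x) \<le> norm x * K"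
  using bounded_linear.nonneg_bounded[OF matrix_vector_mul_bounded_linear[of "Bm n"]] by auto
 obtain K' where K': "0 \<le> K'" "\<And>x. norm (x v* Qs) \<le> norm x * K'"
  using bounded_linear.nonneg_bounded[OF linear_vector_Qs] by auto
 have b0: "0 \<le> b" using order_trans[OF norm_ge_zero b] .
 have "norm (Z (Suc n) s) \<le> b + \<gamma> n * (b * K) + (scl (Suc n) * \<gamma> n) * (2 * K')" for s
 proof (cases "s \<in> space M")
  case True
  have "norm (Z (Suc n) s) \<le> norm (Z n s) + norm (\<gamma> n *\<^sub>R (Bm n *v Z n s)) + norm ((scl (Suc n) * \<gamma> n) *\<^sub>R (Mart n s v* Qs))"
   using True norm_triangle_ineq[of "Z n s + \<gamma> n *\<^sub>R (Bm n *v Z n s)" "(scl (Suc n) * \<gamma> n) *\<^sub>R (Mart n s v* Qs)"]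
    norm_triangle_ineq[of "Z n s" "\<gamma> n *\<^sub>R (Bm n *v Z n s)"] by simp
  also have "\<dots> \<le> b + \<gamma> n * (b * K) + (scl (Suc n) * \<gamma> n) * (2 * K')"
  proof (intro add_mono)
   show "norm (Z n s) \<le> b" by (rule b)
   have "norm (Bm n *v Z n s) \<le> b * K" using K b[of s] by (intro order_trans[OF K(2)] mult_right_mono)
   then show "norm (\<gamma> n *\<^sub>R (Bm n *v Z n s)) \<le> \<gamma> n * (b * K)" using \<gamma>_pos[of n] by (simp add: mult_left_mono)
   have "norm (Mart n s v* Qs) \<le> 2 * K'" using K' Mart_bound[OF True, of n] by (intro order_trans[OF K'(2)] mult_right_mono)
   then show "norm ((scl (Suc n) * \<gamma> n) *\<^sub>R (Mart n s v* Qs)) \<le> (scl (Suc n) * \<gamma> n) * (2 * K')"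
    using \<gamma>_pos[of n] scl_pos[of "Suc n"] by (simp add: mult_left_mono)
  qed
  finally show ?thesis .
 next
  case False
  then show ?thesis using b0 K(1) K'(1) \<gamma>_pos[of n] scl_pos[of "Suc n"] by simp
 qed
 then show ?case by blast
qed

lemma Z_inner_measurable: "(\<lambda>s. u \<bullet> Z n s) \<in> borel_measurable (F n)"
 by (intro borel_measurable_inner borel_measurable_const Z_measurable)

text \<open>The duality behind both transforms of Z: one step of Z is one Euler step of the argument
  u along the transposed drift, times a noise factor.\<close>

lemma Z_inner_Suc:
 assumes "s \<in> space M"
 shows "u \<bullet> Z (Suc n) s = (u + \<gamma> n *\<^sub>R (transpose (Bm n) *v u)) \<bullet> Z n s + ((scl (Suc n) * \<gamma> n) *\<^sub>R (Qs *v u)) \<bullet> Mart n s"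
proof -
 have "u \<bullet> (Bm n *v Z n s) = (transpose (Bm n) *v u) \<bullet> Z n s" by (simp add: transpose_matrix_vector dot_lmul_matrix)
 moreover have "u \<bullet> (Mart n s v* Qs) = (Qs *v u) \<bullet> Mart n s" by (simp add: inner_commute[of u] dot_lmul_matrix inner_commute[of "Mart n s"])
 ultimately show ?thesis using assms by (simp add: inner_add_right inner_add_left)
qed

lemma Qs_bound: "\<exists>k\<ge>0. \<forall>u. norm (Qs *v u) \<le> k * norm u"
proof -
 obtain K where K: "0 \<le> K" "\<And>x. norm (Qs *v x) \<le> norm x * K"
  using bounded_linear.nonneg_bounded[OF matrix_vector_mul_bounded_linear[of Qs]] by auto
 then show ?thesis by (intro exI[of _ K]) (simp add: mult.commute)
qed

lemma Z_exp_bounded: "\<exists>b. \<forall>s. exp (v \<bullet> Z n s) \<le> b"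
proof -
 obtain b where b: "\<And>s. norm (Z n s) \<le> b" using Z_bounded[of n] by blast
 have "exp (v \<bullet> Z n s) \<le> exp (norm v * b)" for s
  using Cauchy_Schwarz_ineq2[of v "Z n s"] mult_left_mono[OF b[of s], of "norm v"] by simp
 then show ?thesis by blast
qed

text \<open>The moments satisfy a recursion in the dual variable u, to which the Gaussian majorant
  applies; the bound is uniform in time.\<close>

lemma Z_exp_moment:
 assumes N: "adapted_norm ((*v) (transpose Js)) \<kappa> N"
 shows "\<exists>b. eventually (\<lambda>n. \<forall>u. N u \<le> R \<longrightarrow> (\<integral>s. exp (u \<bullet> Z n s) \<partial>M) \<le> b) sequentially"
proof -
 obtain kq where kq: "0 \<le> kq" "\<And>u. norm (Qs *v u) \<le> kq * norm u" using Qs_bound by blast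
 show ?thesis
 proof (rule exponential_moment_recursion[OF N \<kappa>(1) Bm_tendsto(2) \<gamma>_pos \<gamma>_tendsto])
  \<comment> \<open>The noise factor has exponent 4 \<rho> |Q u|^2, and \<rho> is eventually at most
    2 \<gamma>.\<close>
  show "0 \<le> 8 * kq\<^sup>2" by simp
  show "\<exists>b. \<forall>u. norm u \<le> R \<longrightarrow> (\<integral>s. exp (u \<bullet> Z k s) \<partial>M) \<le> b" for k
  proof -
   obtain b where b: "\<And>s. norm (Z k s) \<le> b" using Z_bounded[of k] by blast
   have b0: "0 \<le> b" using order_trans[OF norm_ge_zero b] .
   have "(\<integral>s. exp (u \<bullet> Z k s) \<partial>M) \<le> exp (R * b)" if u: "norm u \<le> R" for u
   proof (rule integral_le_const)
    have e: "exp (u \<bullet> Z k s) \<le> exp (R * b)" for s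
    proof -
     have "u \<bullet> Z k s \<le> norm u * norm (Z k s)" using Cauchy_Schwarz_ineq2[of u "Z k s"] by linarith
     also have "\<dots> \<le> R * b" using u b[of s] b0 order_trans[OF norm_ge_zero u] by (intro mult_mono) auto
     finally show ?thesis by simp
    qed
    then show "AE s in M. exp (u \<bullet> Z k s) \<le> exp (R * b)" by simp
    show "integrable M (\<lambda>s. exp (u \<bullet> Z k s))"
     by (rule integrable_const_bound[of _ "exp (R * b)"])
      (use e in simp, rule measurable_compose[OF F_measurable_M[OF Z_inner_measurable] borel_measurable_exp])
   qed
   then show ?thesis by blast
  qed
  have "(\<lambda>n. scl (Suc n) * \<gamma> n * (kq * \<bar>R\<bar>)) \<longlonglongrightarrow> 0 * (kq * \<bar>R\<bar>)" by (intro tendsto_mult scl_\<gamma>_tendsto tendsto_const)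
  then have "eventually (\<lambda>n. scl (Suc n) * \<gamma> n * (kq * \<bar>R\<bar>) < 1 / 2) sequentially" by (intro order_tendstoD(2)) auto
  moreover have "eventually (\<lambda>n. \<rho> n / \<gamma> n < 2) sequentially" using \<rho>_tendsto by (rule order_tendstoD) simp
  ultimately show "eventually (\<lambda>k. \<forall>u. norm u \<le> R \<longrightarrow> (\<integral>s. exp (u \<bullet> Z (Suc k) s) \<partial>M)
    \<le> (\<integral>s. exp ((u + \<gamma> k *\<^sub>R (transpose (Bm k) *v u)) \<bullet> Z k s) \<partial>M) * exp (8 * kq\<^sup>2 * \<gamma> k * (norm u)\<^sup>2)) sequentially"
  proof eventually_elim
   case (elim n)
   show ?case
   proof (intro allI impI)
    fix u :: "real ^ 'd" assume u: "norm u \<le> R"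
    define v where "v = u + \<gamma> n *\<^sub>R (transpose (Bm n) *v u)"
    define w where "w = (scl (Suc n) * \<gamma> n) *\<^sub>R (Qs *v u)"
    have a: "1 \<le> real (np (Suc n))" using np_pos[of "Suc n"] by simp
    have sg: "0 \<le> scl (Suc n) * \<gamma> n" using scl_pos[of "Suc n"] \<gamma>_pos[of n] by simp
    have nw: "norm w = scl (Suc n) * \<gamma> n * norm (Qs *v u)" using sg by (simp add: w_def)
    have "norm (Qs *v u) \<le> kq * \<bar>R\<bar>" using kq(2)[of u] mult_left_mono[of "norm u" "\<bar>R\<bar>" kq] u kq(1) by linarith
    then have "norm w \<le> scl (Suc n) * \<gamma> n * (kq * \<bar>R\<bar>)" unfolding nw by (rule mult_left_mono[OF _ sg])
    then have w1: "2 * norm w \<le> real (np (Suc n))" using elim(1) a by linarith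
    obtain b where b: "\<And>s. exp (v \<bullet> Z n s) \<le> b" using Z_exp_bounded[of v n] by blast
    have "(\<integral>s. exp (u \<bullet> Z (Suc n) s) \<partial>M) = (\<integral>s. exp (v \<bullet> Z n s) * exp (w \<bullet> Mart n s) \<partial>M)"
     by (intro Bochner_Integration.integral_cong refl) (simp only: Z_inner_Suc v_def w_def exp_add)
    also have "\<dots> \<le> exp (4 * (norm w)\<^sup>2 / real (np (Suc n))) * (\<integral>s. exp (v \<bullet> Z n s) \<partial>M)"
     by (rule Mart_exp_moment[OF measurable_compose[OF Z_inner_measurable borel_measurable_exp] _ b w1]) simp
    also have "\<dots> \<le> exp (8 * kq\<^sup>2 * \<gamma> n * (norm u)\<^sup>2) * (\<integral>s. exp (v \<bullet> Z n s) \<partial>M)"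
    proof (intro mult_right_mono)
     have "4 * (norm w)\<^sup>2 / real (np (Suc n)) = 4 * \<rho> n * (norm (Qs *v u))\<^sup>2"
      unfolding nw \<rho>_def by (simp add: power_mult_distrib)
     also have "\<dots> \<le> 4 * (2 * \<gamma> n) * (kq * norm u)\<^sup>2"
      using elim(2) \<gamma>_pos[of n] \<rho>_nonneg[of n] kq(2)[of u] by (intro mult_mono power_mono) (auto simp: field_simps)
     finally show "exp (4 * (norm w)\<^sup>2 / real (np (Suc n))) \<le> exp (8 * kq\<^sup>2 * \<gamma> n * (norm u)\<^sup>2)"
      by (simp add: power_mult_distrib mult_ac)
    qed simp
    finally show "(\<integral>s. exp (u \<bullet> Z (Suc n) s) \<partial>M)
      \<le> (\<integral>s. exp ((u + \<gamma> n *\<^sub>R (transpose (Bm n) *v u)) \<bullet> Z n s) \<partial>M) * exp (8 * kq\<^sup>2 * \<gamma> n * (norm u)\<^sup>2)"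
     unfolding v_def by (simp add: mult.commute)
   qed
  qed
 qed
qed

lemma Z_norm_integrable: "integrable M (\<lambda>s. norm (Z n s) ^ k)"
proof -
 obtain b where b: "\<And>s. norm (Z n s) \<le> b" using Z_bounded[of n] by blast
 show ?thesis
  by (rule integrable_const_bound[of _ "b ^ k"])
   (use b in \<open>auto intro!: power_mono borel_measurable_power borel_measurable_norm[THEN measurable_compose[rotated]] F_measurable_M[OF Z_measurable]\<close>)
qed

lemma square_le_exp: "t\<^sup>2 \<le> 2 * (exp t + exp (- t))" for t :: real
proof -
 have "1 + \<bar>t\<bar> + \<bar>t\<bar>\<^sup>2 / 2 \<le> exp \<bar>t\<bar>" by (rule exp_lower_Taylor_quadratic) simp
 moreover have "exp \<bar>t\<bar> \<le> exp t + exp (- t)" by (cases "0 \<le> t") auto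
 ultimately show ?thesis by simp
qed

lemma Z_second_moment: "\<exists>b. eventually (\<lambda>n. (\<integral>s. (norm (Z n s))\<^sup>2 \<partial>M) \<le> b) sequentially"
proof -
 obtain N where N: "adapted_norm ((*v) (transpose Js)) \<kappa> N" using adapted_norms(2) by (rule exE)
 obtain C where C: "C \<ge> 1" "\<And>x. N x \<le> C * norm x" by (rule adapted_norm_le[OF N]) blast
 obtain b where b: "eventually (\<lambda>n. \<forall>u. N u \<le> C \<longrightarrow> (\<integral>s. exp (u \<bullet> Z n s) \<partial>M) \<le> b) sequentially"
  using Z_exp_moment[OF N] by blast
 have "eventually (\<lambda>n. (\<integral>s. (norm (Z n s))\<^sup>2 \<partial>M) \<le> (\<Sum>j\<in>(UNIV :: 'd set). 2 * (b + b))) sequentially"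
  using b
 proof eventually_elim
  case (elim n)
  have int: "integrable M (\<lambda>s. exp (v \<bullet> Z n s))" for v
  proof -
   obtain b where b: "\<And>s. exp (v \<bullet> Z n s) \<le> b" using Z_exp_bounded[of v n] by blast
   show ?thesis by (rule integrable_const_bound[of _ b])
     (use b in simp, rule measurable_compose[OF F_measurable_M[OF Z_inner_measurable] borel_measurable_exp])
  qed
  have e: "N (axis j 1) \<le> C" "N (- axis j 1) \<le> C" for j
   using C(2)[of "axis j 1"] C(2)[of "- axis j 1"] by (simp_all add: norm_axis_1)
  have sq: "(norm z)\<^sup>2 = (\<Sum>j\<in>UNIV. (z $ j)\<^sup>2)" for z :: "real ^ 'd"
   unfolding power2_norm_eq_inner inner_vec_def by (simp add: power2_eq_square)
  have "(\<integral>s. (norm (Z n s))\<^sup>2 \<partial>M) \<le> (\<integral>s. (\<Sum>j\<in>UNIV. 2 * (exp (axis j 1 \<bullet> Z n s) + exp ((- axis j 1) \<bullet> Z n s))) \<partial>M)"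
  proof (rule integral_mono[OF Z_norm_integrable])
   show "integrable M (\<lambda>s. \<Sum>j\<in>UNIV. 2 * (exp (axis j 1 \<bullet> Z n s) + exp ((- axis j 1) \<bullet> Z n s)))"
    by (intro Bochner_Integration.integrable_sum Bochner_Integration.integrable_mult_right Bochner_Integration.integrable_add int)
   show "(norm (Z n s))\<^sup>2 \<le> (\<Sum>j\<in>UNIV. 2 * (exp (axis j 1 \<bullet> Z n s) + exp ((- axis j 1) \<bullet> Z n s)))" for s
    unfolding sq
   proof (rule sum_mono)
    fix j show "(Z n s $ j)\<^sup>2 \<le> 2 * (exp (axis j 1 \<bullet> Z n s) + exp ((- axis j 1) \<bullet> Z n s))"
     using square_le_exp[of "Z n s $ j"] by (simp add: inner_axis')
   qed
  qed
  also have "\<dots> = (\<Sum>j\<in>UNIV. 2 * ((\<integral>s. exp (axis j 1 \<bullet> Z n s) \<partial>M) + (\<integral>s. exp ((- axis j 1) \<bullet> Z n s) \<partial>M)))"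
   using int int[of "- v" for v] by (simp add: Bochner_Integration.integral_sum)
  also have "\<dots> \<le> (\<Sum>j\<in>(UNIV :: 'd set). 2 * (b + b))"
   by (intro sum_mono mult_left_mono add_mono elim[rule_format] e) auto
  finally show ?case .
 qed
 then show ?thesis by blast
qed

text \<open>The coefficient in the Lipschitz bound for the conditional variance, evaluated along the
  path. It is bounded and tends to zero almost surely, hence in mean.\<close>

definition kdev :: "nat \<Rightarrow> 'w \<Rightarrow> real" where
 "kdev n s = l1 (emp' n s - \<theta>s) + 3 * l1 (\<theta> n s - \<theta>s)"

lemma l1_measurable:
 assumes "f \<in> borel_measurable N" shows "(\<lambda>s. l1 (f s :: real ^ 'd)) \<in> borel_measurable N"
 unfolding l1_def by (intro borel_measurable_sum borel_measurable_abs measurable_compose[OF assms borel_measurable_nth])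

lemma kdev_measurable: "kdev n \<in> borel_measurable M"
 unfolding kdev_def[abs_def]
 by (rule borel_measurable_add[OF l1_measurable borel_measurable_times[OF borel_measurable_const l1_measurable]])
  (rule borel_measurable_diff[OF F_measurable_M[OF emp'_measurable] borel_measurable_const]
   borel_measurable_diff[OF F_measurable_M[OF \<theta>_measurable] borel_measurable_const])+

lemma kdev_bounds: "0 \<le> kdev n s" "s \<in> space M \<Longrightarrow> kdev n s \<le> 8"
proof -
 show "0 \<le> kdev n s" by (simp add: kdev_def l1_nonneg)
 have "l1 (x - \<theta>s) \<le> 2" if "x \<in> prob_simplex" for x
 proof -
  have "l1 (- \<theta>s) = l1 \<theta>s" by (simp add: l1_def)
  then show ?thesis using l1_triangle[of x "- \<theta>s"] simplex_l1[OF that] simplex_l1[OF theta_simplex] by simp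
 qed
 note l = this
 assume "s \<in> space M"
 then show "kdev n s \<le> 8" unfolding kdev_def using l[OF emp'_simplex, of n s] l[OF \<theta>_simplex[of s n]] by linarith
qed

lemma kdev_integral_tendsto: "(\<lambda>n. \<integral>s. kdev n s \<partial>M) \<longlonglongrightarrow> 0"
proof -
 have "(\<lambda>n. \<integral>s. kdev n s \<partial>M) \<longlonglongrightarrow> (\<integral>s. 0 \<partial>M)"
 proof (rule integral_dominated_convergence[where w = "\<lambda>_. 8"])
  show "AE s in M. (\<lambda>n. kdev n s) \<longlonglongrightarrow> 0"
   using empirical_tendsto
  proof eventually_elim
   case (elim s)
   have l: "(\<lambda>n. l1 (x n - \<theta>s)) \<longlonglongrightarrow> 0" if "x \<longlonglongrightarrow> \<theta>s" for x :: "nat \<Rightarrow> real ^ 'd"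
   proof -
    have "(\<lambda>n. \<Sum>i\<in>UNIV. \<bar>(x n - \<theta>s) $ i\<bar>) \<longlonglongrightarrow> (\<Sum>i\<in>UNIV. \<bar>(\<theta>s - \<theta>s) $ i\<bar>)"
     by (intro tendsto_sum tendsto_rabs tendsto_vec_nth tendsto_diff that tendsto_const)
    then show ?thesis by (simp add: l1_def)
   qed
   have "(\<lambda>n. l1 (emp' n s - \<theta>s) + 3 * l1 (\<theta> n s - \<theta>s)) \<longlonglongrightarrow> 0 + 3 * 0"
    using elim by (intro tendsto_add tendsto_mult tendsto_const l) auto
   then show ?case by (simp add: kdev_def)
  qed
  show "AE s in M. norm (kdev n s) \<le> 8" for n using kdev_bounds by (intro AE_I2) simp
 qed (auto intro: kdev_measurable)
 then show ?thesis by simp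
qed

text \<open>Two errors are made: the Gaussian replacement of the noise factor, and the replacement
  of the random variance by its limit. Both are quadratic in Q u; one factor |u| is kept and the
  other is bounded by R, as the weighted norm in the comparison requires.\<close>

lemma Z_chf_step:
 assumes u: "norm u \<le> R" and kq: "0 \<le> kq" "\<And>u. norm (Qs *v u) \<le> kq * norm u"
  and small: "scl (Suc n) * \<gamma> n * (kq * R) \<le> 1 / 2"
 shows "norm ((\<integral>s. iexp (u \<bullet> Z (Suc n) s) \<partial>M)
   - (\<integral>s. iexp ((u + \<gamma> n *\<^sub>R (transpose (Bm n) *v u)) \<bullet> Z n s) \<partial>M) * exp (- of_real (\<rho> n / 2 * (u \<bullet> (Us *v u)))))
  \<le> \<gamma> n * ((\<rho> n / \<gamma> n) * kq\<^sup>2 * R * (4 * (scl (Suc n) * \<gamma> n * (kq * R)) + (\<integral>s. kdev n s \<partial>M) / 2)) * norm u"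
proof -
 define v where "v = u + \<gamma> n *\<^sub>R (transpose (Bm n) *v u)"
 define q where "q = Qs *v u"
 define g where "g = scl (Suc n) * \<gamma> n"
 define w where "w = g *\<^sub>R q"
 define a where "a = real (np (Suc n))"
 have a: "1 \<le> a" using np_pos[of "Suc n"] by (simp add: a_def)
 have g: "0 \<le> g" using scl_pos[of "Suc n"] \<gamma>_pos[of n] by (simp add: g_def)
 have R: "0 \<le> R" using u order_trans[OF norm_ge_zero] by blast
 have q: "norm q \<le> kq * norm u" "norm q \<le> kq * R"
  using kq(2)[of u] mult_left_mono[OF u kq(1)] by (auto simp: q_def)
 have nw: "norm w = g * norm q" "norm w \<le> g * (kq * R)" using g q(2) by (auto simp: w_def mult_left_mono)
 have w: "norm w \<le> 1 / 2" using nw(2) small by (simp add: g_def)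
 have \<rho>: "\<rho> n = g\<^sup>2 / a" by (simp add: \<rho>_def g_def a_def)
 let ?Y = "\<lambda>s. iexp (v \<bullet> Z n s)"
 have Ym: "?Y \<in> borel_measurable (F n)"
  by (intro measurable_compose[OF _ borel_measurable_exp] borel_measurable_times borel_measurable_const
    borel_measurable_complex_of_real Z_inner_measurable)
 define c where "c = exp (- complex_of_real (\<rho> n / 2 * (u \<bullet> (Us *v u))))"
 let ?I2 = "\<integral>s. ?Y s * of_real (exp (- (vmean n s w / (2 * a)))) \<partial>M"
 have 1: "norm ((\<integral>s. iexp (u \<bullet> Z (Suc n) s) \<partial>M) - ?I2) \<le> 4 * norm w ^ 3 / a\<^sup>2"
 proof -
  have "(\<integral>s. iexp (u \<bullet> Z (Suc n) s) \<partial>M) = (\<integral>s. ?Y s * iexp (w \<bullet> Mart n s) \<partial>M)"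
   by (intro Bochner_Integration.integral_cong refl)
    (simp only: Z_inner_Suc v_def w_def g_def q_def of_real_add distrib_left exp_add)
  then show ?thesis using Mart_chf[OF Ym _ w] unfolding a_def by simp
 qed
 have YM: "?Y \<in> borel_measurable M" by (rule F_measurable_M[OF Ym])
 have i2: "integrable M (\<lambda>s. ?Y s * of_real (exp (- (vmean n s w / (2 * a)))))"
 proof (rule integrable_const_bound[of _ 1])
  show "AE s in M. norm (?Y s * of_real (exp (- (vmean n s w / (2 * a))))) \<le> 1"
   using vmean_bounds(1) a by (intro AE_I2) (simp add: norm_mult)
  show "(\<lambda>s. ?Y s * of_real (exp (- (vmean n s w / (2 * a))))) \<in> borel_measurable M"
   by (intro borel_measurable_times YM borel_measurable_complex_of_real measurable_compose[OF _ borel_measurable_exp] borel_measurable_uminus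
    borel_measurable_divide vmean_measurable borel_measurable_const)
 qed
 have i3: "integrable M (\<lambda>s. ?Y s * c)"
  by (intro integrable_mult_left integrable_iexp F_measurable_M[OF Z_inner_measurable])
 have kint: "integrable M (kdev n)"
  by (rule integrable_const_bound[of _ 8]) (use kdev_bounds in \<open>auto intro!: AE_I2 kdev_measurable\<close>)
 have 2: "norm (?I2 - (\<integral>s. ?Y s * c \<partial>M)) \<le> (\<integral>s. \<rho> n / 2 * (norm q)\<^sup>2 * kdev n s \<partial>M)"
 proof (rule norm_integral_diff_le[OF i2 i3])
  show "integrable M (\<lambda>s. \<rho> n / 2 * (norm q)\<^sup>2 * kdev n s)" using kint by simp
  fix s assume s: "s \<in> space M"
  have vw: "vmean n s w / (2 * a) = \<rho> n / 2 * vmean n s q"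
   unfolding w_def vmean_def cvar_scale \<rho> by (simp add: sum_distrib_left sum_divide_distrib mult_ac)
  have uu: "u \<bullet> (Us *v u) = (\<Sum>x\<in>UNIV. \<theta>s $ x * cvar \<theta>s x q)" unfolding q_def by (rule Us_quadratic)
  have c: "c = of_real (exp (- (\<rho> n / 2 * (u \<bullet> (Us *v u)))))" unfolding c_def exp_of_real[symmetric] by simp
  have "norm (?Y s * of_real (exp (- (vmean n s w / (2 * a)))) - ?Y s * c)
   = \<bar>exp (- (\<rho> n / 2 * vmean n s q)) - exp (- (\<rho> n / 2 * (u \<bullet> (Us *v u))))\<bar>"
   unfolding right_diff_distrib[symmetric] norm_mult vw c of_real_diff[symmetric] norm_of_real by simp
  also have "\<dots> \<le> exp 0 * \<bar>- (\<rho> n / 2 * vmean n s q) - - (\<rho> n / 2 * (u \<bullet> (Us *v u)))\<bar>"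
   using \<rho>_nonneg[of n] vmean_bounds(1)[OF s] Us_nonneg by (intro abs_exp_diff_le) auto
  also have "\<dots> = \<rho> n / 2 * \<bar>vmean n s q - u \<bullet> (Us *v u)\<bar>"
  proof -
   have "- (\<rho> n / 2 * vmean n s q) - - (\<rho> n / 2 * (u \<bullet> (Us *v u))) = - (\<rho> n / 2 * (vmean n s q - u \<bullet> (Us *v u)))"
    by (simp add: algebra_simps)
   then show ?thesis using \<rho>_nonneg[of n] by (simp only: abs_minus_cancel abs_mult) simp
  qed
  also have "\<dots> \<le> \<rho> n / 2 * (kdev n s * (norm q)\<^sup>2)"
   unfolding uu vmean_def kdev_def using \<rho>_nonneg[of n]
   by (intro mult_left_mono mean_cvar_lipschitz emp'_simplex \<theta>_simplex s) auto
  finally show "norm (?Y s * of_real (exp (- (vmean n s w / (2 * a)))) - ?Y s * c) \<le> \<rho> n / 2 * (norm q)\<^sup>2 * kdev n s"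
   by (simp add: mult_ac)
 qed
 define k where "k = (\<integral>s. kdev n s \<partial>M)"
 have k0: "0 \<le> k" unfolding k_def by (intro integral_nonneg_AE AE_I2 kdev_bounds)
 have "norm ((\<integral>s. iexp (u \<bullet> Z (Suc n) s) \<partial>M) - (\<integral>s. ?Y s \<partial>M) * c)
  \<le> 4 * norm w ^ 3 / a\<^sup>2 + \<rho> n / 2 * (norm q)\<^sup>2 * k"
  using norm_triangle_ineq[of "(\<integral>s. iexp (u \<bullet> Z (Suc n) s) \<partial>M) - ?I2" "?I2 - (\<integral>s. ?Y s * c \<partial>M)"] 1 2
  by (simp add: k_def)
 also have "\<dots> \<le> \<rho> n * (norm q)\<^sup>2 * (4 * (g * (kq * R)) + k / 2)"
 proof -
  have "norm w ^ 3 / a\<^sup>2 = \<rho> n * (norm q)\<^sup>2 * (norm w / a)"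
   unfolding \<rho> nw(1) by (simp add: power2_eq_square power3_eq_cube)
  also have "\<dots> \<le> \<rho> n * (norm q)\<^sup>2 * (g * (kq * R))"
  proof (intro mult_left_mono)
   have "norm w / a \<le> norm w" using a by (simp add: divide_le_eq mult_left_le_one_le mult_le_cancel_left1)
   then show "norm w / a \<le> g * (kq * R)" using nw(2) by linarith
  qed (use \<rho>_nonneg[of n] in auto)
  finally show ?thesis by (simp add: algebra_simps)
 qed
 also have "\<dots> \<le> \<rho> n * (kq\<^sup>2 * R * norm u) * (4 * (g * (kq * R)) + k / 2)"
 proof (intro mult_right_mono mult_left_mono)
  have "(norm q)\<^sup>2 \<le> (kq * norm u) * (kq * R)" unfolding power2_eq_square using q kq(1) by (intro mult_mono) auto
  then show "(norm q)\<^sup>2 \<le> kq\<^sup>2 * R * norm u" by (simp add: power2_eq_square mult_ac)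
 qed (use \<rho>_nonneg[of n] g kq(1) R k0 in auto)
 also have "\<dots> = \<gamma> n * ((\<rho> n / \<gamma> n) * kq\<^sup>2 * R * (4 * (g * (kq * R)) + k / 2)) * norm u"
  using \<gamma>_pos[of n] by simp
 finally show ?thesis unfolding v_def[symmetric] g_def k_def c_def .
qed

lemma Z_chf_tendsto:
 assumes V: "transpose V = V" "Us + Js ** V + V ** transpose Js = 0"
 shows "(\<lambda>n. \<integral>s. iexp (u \<bullet> Z n s) \<partial>M) \<longlonglongrightarrow> exp (- of_real (u \<bullet> (V *v u)) / 2)"
proof -
 obtain N where N: "adapted_norm ((*v) (transpose Js)) \<kappa> N" using adapted_norms(2) by (rule exE)
 obtain kq where kq: "0 \<le> kq" "\<And>u. norm (Qs *v u) \<le> kq * norm u" using Qs_bound by blast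
 have V2: "Us + transpose (transpose Js) ** V + V ** transpose Js = 0" using V(2) by simp
 show ?thesis
 proof (rule gaussian_recursion_tendsto[OF N \<kappa>(1) V(1) V2 Us_nonneg Bm_tendsto(2) \<gamma>_pos \<gamma>_tendsto \<gamma>_diverges \<rho>_tendsto \<rho>_nonneg])
  fix k
  obtain b where b: "\<And>s. norm (Z k s) \<le> b" using Z_bounded[of k] by blast
  have "norm ((\<integral>s. iexp (u \<bullet> Z k s) \<partial>M) - 1) \<le> b * norm u" for u
  proof -
   have "norm ((\<integral>s. iexp (u \<bullet> Z k s) \<partial>M) - (\<integral>s. iexp 0 \<partial>M)) \<le> (\<integral>s. b * norm u \<partial>M)"
   proof (intro norm_integral_diff_le integrable_iexp F_measurable_M[OF Z_inner_measurable] borel_measurable_const)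
    fix s
    have "\<bar>u \<bullet> Z k s - 0\<bar> \<le> b * norm u"
     using Cauchy_Schwarz_ineq2[of u "Z k s"] mult_left_mono[OF b[of s], of "norm u"] by (simp add: mult.commute)
    then show "norm (iexp (u \<bullet> Z k s) - iexp 0) \<le> b * norm u" using iexp_diff_le order_trans by blast
   qed simp
   then show ?thesis by (simp add: prob_space)
  qed
  then show "\<exists>C. \<forall>u. norm ((\<integral>s. iexp (u \<bullet> Z k s) \<partial>M) - 1) \<le> C * norm u" by blast
 next
  fix R :: real
  define \<eta> where "\<eta> n = (\<rho> n / \<gamma> n) * kq\<^sup>2 * R * (4 * (scl (Suc n) * \<gamma> n * (kq * R)) + (\<integral>s. kdev n s \<partial>M) / 2)" for n
  have "\<eta> \<longlonglongrightarrow> 1 * kq\<^sup>2 * R * (4 * (0 * (kq * R)) + 0 / 2)" unfolding \<eta>_def[abs_def]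
   by (intro tendsto_mult tendsto_add tendsto_divide tendsto_const \<rho>_tendsto scl_\<gamma>_tendsto kdev_integral_tendsto) simp
  then have \<eta>: "\<eta> \<longlonglongrightarrow> 0" by simp
  have "(\<lambda>n. scl (Suc n) * \<gamma> n * (kq * R)) \<longlonglongrightarrow> 0 * (kq * R)" by (intro tendsto_mult scl_\<gamma>_tendsto tendsto_const)
  then have "eventually (\<lambda>n. scl (Suc n) * \<gamma> n * (kq * R) < 1 / 2) sequentially" by (intro order_tendstoD(2)) auto
  then have "eventually (\<lambda>k. \<forall>u. norm u \<le> R \<longrightarrow>
    norm ((\<integral>s. iexp (u \<bullet> Z (Suc k) s) \<partial>M) - (\<integral>s. iexp ((u + \<gamma> k *\<^sub>R (transpose (Bm k) *v u)) \<bullet> Z k s) \<partial>M)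
     * exp (- of_real (\<rho> k / 2 * (u \<bullet> (Us *v u))))) \<le> \<gamma> k * \<eta> k * norm u) sequentially"
  proof eventually_elim
   case (elim n)
   then have small: "scl (Suc n) * \<gamma> n * (kq * R) \<le> 1 / 2" by simp
   show ?case unfolding \<eta>_def using Z_chf_step[OF _ kq small] by (intro allI impI)
  qed
  with \<eta> show "\<exists>\<eta>. \<eta> \<longlonglongrightarrow> 0 \<and> eventually (\<lambda>k. \<forall>u. norm u \<le> R \<longrightarrow>
    norm ((\<integral>s. iexp (u \<bullet> Z (Suc k) s) \<partial>M) - (\<integral>s. iexp ((u + \<gamma> k *\<^sub>R (transpose (Bm k) *v u)) \<bullet> Z k s) \<partial>M)
     * exp (- of_real (\<rho> k / 2 * (u \<bullet> (Us *v u))))) \<le> \<gamma> k * \<eta> k * norm u) sequentially" by blast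
 qed
qed

end

section \<open>The remainder\<close>

lemma adapted_norm_continuous:
 assumes "adapted_norm T \<kappa> N" shows "continuous_on UNIV N"
proof -
 obtain C where C: "C \<ge> 1" "\<And>x. N x \<le> C * norm x" by (rule adapted_norm_le[OF assms]) blast
 have *: "N x - N y \<le> C * norm (x - y)" for x y
  using adapted_norm_triangle[OF assms, of "x - y" y] C(2)[of "x - y"] by simp
 have "C-lipschitz_on UNIV N"
 proof (rule lipschitz_onI)
  fix x y show "dist (N x) (N y) \<le> C * dist x y"
   using *[of x y] *[of y x] by (simp add: dist_norm norm_minus_commute abs_le_iff)
 qed (use C in simp)
 then show ?thesis by (rule lipschitz_on_continuous_on)
qed

context supercritical_gain begin

text \<open>Q applied after one step of \<open>Ks\<close>: the correction whose increments telescope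
  in the Poisson decomposition.\<close>

definition \<psi> :: "real ^ 'd \<Rightarrow> real ^ 'd" where "\<psi> v = v v* Ks v* Qs"

lemma linear_\<psi>: "bounded_linear \<psi>"
 unfolding \<psi>_def[abs_def]
 by (rule bounded_linear_compose[OF linear_vector_Qs bounded_linear_vector_matrix])

lemma \<psi>_diff: "\<psi> (x - y) = \<psi> x - \<psi> y"
 using linear_diff[OF bounded_linear.linear[OF linear_\<psi>]] .

definition cn :: "nat \<Rightarrow> 'w \<Rightarrow> real" where "cn n s = emp' n s \<bullet> q0"

lemma cn_bound: "\<bar>cn n s - cs\<bar> \<le> 1"
 using simplex_q0[OF emp'_simplex[of n s]] simplex_q0[OF theta_simplex] unfolding cn_def cs_def by linarith

lemma cn_measurable: "cn n \<in> borel_measurable M"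
 unfolding cn_def[abs_def] by (intro borel_measurable_inner F_measurable_M[OF emp'_measurable] borel_measurable_const)

text \<open>The Poisson equation turns the dependence of the particles on their past into the
 telescoping correction \<open>\<psi>\<close>.\<close>

lemma emp_poisson:
 "emp (Suc n) s - \<theta>s = \<psi> (emp' n s) - \<psi> (emp (Suc n) s) + cn n s *\<^sub>R ((\<theta> n s - \<theta>s) v* Qs) + Mart n s v* Qs"
proof -
 interpret Q: bounded_linear "\<lambda>v. v v* Qs" by (rule linear_vector_Qs)
 have "emp (Suc n) s = emp' n s v* Ks + cn n s *\<^sub>R (\<theta> n s - \<theta>s) + Mart n s"
  unfolding Mart_def vector_Kmat cn_def by (simp add: algebra_simps)
 then have "emp (Suc n) s v* Qs = (emp' n s v* Ks + cn n s *\<^sub>R (\<theta> n s - \<theta>s) + Mart n s) v* Qs" by (rule arg_cong)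
 then have 1: "emp (Suc n) s v* Qs = \<psi> (emp' n s) + cn n s *\<^sub>R ((\<theta> n s - \<theta>s) v* Qs) + Mart n s v* Qs"
  unfolding \<psi>_def Q.add Q.scaleR .
 have 2: "emp (Suc n) s v* Qs - \<psi> (emp (Suc n) s) = emp (Suc n) s - \<theta>s"
  using poisson_decomposition[of "emp (Suc n) s"] emp_simplex[of "Suc n" s] by (simp add: \<psi>_def prob_simplex_def)
 have "y = p - a + c + d" if "x = p + c + d" "x - a = y" for x p c d a y :: "real ^ 'd"
  using that by (simp add: algebra_simps)
 from this[OF 1 2] show ?thesis .
qed

text \<open>The error with the telescoping term moved to the left-hand side; the correction has the
  size of the step and is invisible after normalisation.\<close>

definition Wt :: "nat \<Rightarrow> 'w \<Rightarrow> real ^ 'd" where "Wt n s = \<theta> n s - \<theta>s + \<gamma> n *\<^sub>R \<psi> (emp n s)"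

definition err :: "nat \<Rightarrow> 'w \<Rightarrow> real ^ 'd" where
 "err n s = (\<gamma> (Suc n) - \<gamma> n) *\<^sub>R \<psi> (emp (Suc n) s) + \<gamma> n *\<^sub>R \<psi> (emp' n s - emp n s)
   - (\<gamma> n)\<^sup>2 *\<^sub>R (J *v \<psi> (emp n s)) - ((\<gamma> n)\<^sup>2 * (cn n s - cs)) *\<^sub>R (\<psi> (emp n s) v* Qs)"

text \<open>Exact: besides drift and noise there is one bilinear term, carrying the fluctuation of
  the exit rate. \<open>err\<close> collects the change of the step size, the birth, and two terms
  quadratic in the step size.\<close>

lemma Wt_Suc:
 assumes "s \<in> space M"
 shows "Wt (Suc n) s = (Wt n s + \<gamma> n *\<^sub>R (J *v Wt n s)) + \<gamma> n *\<^sub>R (Mart n s v* Qs)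
   + (\<gamma> n * (cn n s - cs)) *\<^sub>R (Wt n s v* Qs) + err n s"
proof -
 interpret Q: bounded_linear "\<lambda>v. v v* Qs" by (rule linear_vector_Qs)
 interpret JJ: bounded_linear "(*v) J" by (rule matrix_vector_mul_bounded_linear)
 define e where "e = \<theta> n s - \<theta>s"
 define p where "p = \<psi> (emp n s)"
 have "(\<Sum>i\<in>UNIV. e $ i) = 0"
  using \<theta>_simplex[OF assms, of n] theta_sum by (simp add: e_def sum_subtractf prob_simplex_def)
 then have Je: "J *v e = cs *\<^sub>R (e v* Qs) - e" by (simp add: Jm_vector)
 have "\<theta> (Suc n) s - \<theta>s = e + \<gamma> n *\<^sub>R ((emp (Suc n) s - \<theta>s) - e)"
  unfolding \<theta>_recursion[OF assms] e_def by (simp add: algebra_simps)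
 also have "\<dots> = e + \<gamma> n *\<^sub>R (\<psi> (emp' n s) - \<psi> (emp (Suc n) s) + cn n s *\<^sub>R (e v* Qs) + Mart n s v* Qs - e)"
  unfolding emp_poisson e_def by simp
 finally have e': "\<theta> (Suc n) s - \<theta>s
   = e + \<gamma> n *\<^sub>R (\<psi> (emp' n s) - \<psi> (emp (Suc n) s) + cn n s *\<^sub>R (e v* Qs) + Mart n s v* Qs - e)" .
 have W: "Wt n s = e + \<gamma> n *\<^sub>R p" by (simp add: Wt_def e_def p_def)
 have JW: "J *v Wt n s = cs *\<^sub>R (e v* Qs) - e + \<gamma> n *\<^sub>R (J *v p)" unfolding W JJ.add JJ.scaleR Je ..
 have WQ: "Wt n s v* Qs = e v* Qs + \<gamma> n *\<^sub>R (p v* Qs)" unfolding W Q.add Q.scaleR ..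
 show ?thesis
  unfolding JW WQ unfolding W err_def \<psi>_diff p_def[symmetric] unfolding Wt_def e'
  by (simp add: algebra_simps power2_eq_square)
qed

definition D :: "nat \<Rightarrow> 'w \<Rightarrow> real ^ 'd" where "D n s = scl n *\<^sub>R Wt n s - Z n s"

text \<open>Subtracting Z removes the martingale noise exactly. What drives D is the bilinear term,
  split into its part in D and its part in Z, and the small errors.\<close>

lemma D_Suc:
 assumes "s \<in> space M"
 shows "D (Suc n) s = (D n s + \<gamma> n *\<^sub>R (Bm n *v D n s))
   + (\<gamma> n * (cn n s - cs) * (scl (Suc n) / scl n)) *\<^sub>R ((D n s + Z n s) v* Qs) + scl (Suc n) *\<^sub>R err n s"
proof -
 interpret Q: bounded_linear "\<lambda>v. v v* Qs" by (rule linear_vector_Qs)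
 interpret B: bounded_linear "(*v) (Bm n)" by (rule matrix_vector_mul_bounded_linear)
 have W: "scl n *\<^sub>R Wt n s = D n s + Z n s" by (simp add: D_def)
 have WQ: "scl (Suc n) *\<^sub>R (Wt n s v* Qs) = (scl (Suc n) / scl n) *\<^sub>R ((D n s + Z n s) v* Qs)"
  unfolding W[symmetric] Q.scaleR using scl_pos[of n] by simp
 have "scl (Suc n) *\<^sub>R Wt (Suc n) s = scl (Suc n) *\<^sub>R (Wt n s + \<gamma> n *\<^sub>R (J *v Wt n s))
   + (scl (Suc n) * \<gamma> n) *\<^sub>R (Mart n s v* Qs) + (\<gamma> n * (cn n s - cs)) *\<^sub>R (scl (Suc n) *\<^sub>R (Wt n s v* Qs)) + scl (Suc n) *\<^sub>R err n s"
  unfolding Wt_Suc[OF assms] scaleR_add_right scaleR_scaleR by (simp add: mult_ac)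
 also have "\<dots> = (D n s + Z n s + \<gamma> n *\<^sub>R (Bm n *v D n s + Bm n *v Z n s))
   + (scl (Suc n) * \<gamma> n) *\<^sub>R (Mart n s v* Qs) + (\<gamma> n * (cn n s - cs)) *\<^sub>R ((scl (Suc n) / scl n) *\<^sub>R ((D n s + Z n s) v* Qs)) + scl (Suc n) *\<^sub>R err n s"
  unfolding WQ scl_step W B.add by simp
 finally show ?thesis unfolding D_def[of "Suc n"] using assms by (simp add: scaleR_add_right)
qed

lemma err_bound: "\<exists>C\<ge>0. \<forall>n. \<forall>s\<in>space M.
  norm (err n s) \<le> C * ((\<gamma> n)\<^sup>2 + \<gamma> n * (real (np (Suc n)) - real (np n)) / real (np (Suc n)))"
proof -
 obtain kp where kp: "0 \<le> kp" "\<And>x. norm (\<psi> x) \<le> norm x * kp" using bounded_linear.nonneg_bounded[OF linear_\<psi>] by auto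
 obtain kq where kq: "0 \<le> kq" "\<And>x. norm (x v* Qs) \<le> norm x * kq" using bounded_linear.nonneg_bounded[OF linear_vector_Qs] by auto
 obtain kj where kj: "0 \<le> kj" "\<And>x. norm (J *v x) \<le> norm x * kj"
  using bounded_linear.nonneg_bounded[OF matrix_vector_mul_bounded_linear[of J]] by auto
 define C where "C = kp / \<gamma>s + 2 * kp + kp * kj + kp * kq"
 have C: "0 \<le> C" using kp kq kj \<gamma>s by (simp add: C_def)
 have "norm (err n s) \<le> C * ((\<gamma> n)\<^sup>2 + \<gamma> n * (real (np (Suc n)) - real (np n)) / real (np (Suc n)))" if "s \<in> space M" for n s
 proof -
  define b where "b = (real (np (Suc n)) - real (np n)) / real (np (Suc n))"
  have b: "0 \<le> b" using np_mono1[of n] by (simp add: b_def)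
  have p1: "norm (\<psi> x) \<le> kp" if "x \<in> prob_simplex" for x
   using kp(2)[of x] mult_right_mono[OF simplex_norm_le_1[OF that] kp(1)] by simp
  have gd: "\<bar>\<gamma> (Suc n) - \<gamma> n\<bar> \<le> (\<gamma> n)\<^sup>2 / \<gamma>s"
  proof -
   define m where "m = real n + Nst"
   have m: "1 \<le> m" using Nst by (simp add: m_def)
   have "\<gamma>s / m - \<gamma>s / (m + 1) = \<gamma>s / (m * (m + 1))" using m by (simp add: field_simps)
   also have "\<dots> \<le> \<gamma>s / (m * m)" using m \<gamma>s by (intro divide_left_mono mult_left_mono) auto
   also have "\<dots> = (\<gamma>s / m)\<^sup>2 / \<gamma>s" using \<gamma>s by (simp add: power2_eq_square)
   finally have "\<gamma>s / m - \<gamma>s / (m + 1) \<le> (\<gamma>s / m)\<^sup>2 / \<gamma>s" .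
   moreover have "\<gamma>s / (m + 1) \<le> \<gamma>s / m" using m \<gamma>s by (intro divide_left_mono) auto
   moreover have "\<gamma> n = \<gamma>s / m" "\<gamma> (Suc n) = \<gamma>s / (m + 1)" by (simp_all add: \<gamma>_eq m_def add_ac)
   ultimately show ?thesis by simp
  qed
  have t1: "norm ((\<gamma> (Suc n) - \<gamma> n) *\<^sub>R \<psi> (emp (Suc n) s)) \<le> (\<gamma> n)\<^sup>2 / \<gamma>s * kp"
   unfolding norm_scaleR using gd \<gamma>s p1[OF emp_simplex] by (intro mult_mono) auto
  have t2: "norm (\<gamma> n *\<^sub>R \<psi> (emp' n s - emp n s)) \<le> \<gamma> n * (2 * b * kp)"
  proof -
   have "norm (\<psi> (emp' n s - emp n s)) \<le> 2 * b * kp"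
    using kp(2)[of "emp' n s - emp n s"] mult_right_mono[OF emp'_minus_emp[of n s] kp(1)] by (simp add: b_def)
   then show ?thesis using \<gamma>_pos[of n] by (simp add: mult_left_mono)
  qed
  have t3: "norm ((\<gamma> n)\<^sup>2 *\<^sub>R (J *v \<psi> (emp n s))) \<le> (\<gamma> n)\<^sup>2 * (kp * kj)"
   using order_trans[OF kj(2) mult_right_mono[OF p1[OF emp_simplex] kj(1)]] by (simp add: mult_left_mono)
  have t4: "norm (((\<gamma> n)\<^sup>2 * (cn n s - cs)) *\<^sub>R (\<psi> (emp n s) v* Qs)) \<le> (\<gamma> n)\<^sup>2 * 1 * (kp * kq)"
   unfolding norm_scaleR abs_mult
   using order_trans[OF kq(2) mult_right_mono[OF p1[OF emp_simplex] kq(1)]] cn_bound kp kq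
   by (intro mult_mono) auto
  have "norm (err n s) \<le> (\<gamma> n)\<^sup>2 / \<gamma>s * kp + \<gamma> n * (2 * b * kp) + (\<gamma> n)\<^sup>2 * (kp * kj) + (\<gamma> n)\<^sup>2 * 1 * (kp * kq)"
   unfolding err_def
   by (intro order_trans[OF norm_triangle_ineq4] order_trans[OF norm_triangle_ineq] add_mono t1 t2 t3 t4)
  also have "\<dots> = (kp / \<gamma>s + kp * kj + kp * kq) * (\<gamma> n)\<^sup>2 + (2 * kp) * (\<gamma> n * b)" by (simp add: algebra_simps)
  also have "\<dots> \<le> C * (\<gamma> n)\<^sup>2 + C * (\<gamma> n * b)"
   using kp kq kj \<gamma>s b \<gamma>_pos[of n] by (intro add_mono mult_right_mono) (auto simp: C_def)
  finally show ?thesis by (simp add: b_def distrib_left)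
 qed
 then show ?thesis using C by blast
qed

lemma D_measurable: "D n \<in> borel_measurable M"
 unfolding D_def[abs_def] Wt_def
 by (intro borel_measurable_diff borel_measurable_scaleR borel_measurable_const borel_measurable_add F_measurable_M[OF \<theta>_measurable]
   F_measurable_M[OF Z_measurable] linear_measurable[OF linear_\<psi>] F_measurable_M[OF emp_measurable])

lemma D_bounded: "\<exists>b\<ge>0. \<forall>s\<in>space M. norm (D n s) \<le> b"
proof -
 obtain kp where kp: "0 \<le> kp" "\<And>x. norm (\<psi> x) \<le> norm x * kp" using bounded_linear.nonneg_bounded[OF linear_\<psi>] by auto
 obtain b where b: "\<And>s. norm (Z n s) \<le> b" using Z_bounded[of n] by blast
 have "norm (D n s) \<le> scl n * (2 + \<gamma> n * kp) + b" if s: "s \<in> space M" for s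
 proof -
  have "norm (\<theta> n s - \<theta>s) \<le> 2"
   using norm_triangle_ineq4[of "\<theta> n s" \<theta>s] simplex_norm_le_1[OF \<theta>_simplex[OF s, of n]] simplex_norm_le_1[OF theta_simplex] by linarith
  moreover have "norm (\<gamma> n *\<^sub>R \<psi> (emp n s)) \<le> \<gamma> n * kp"
   using kp(2)[of "emp n s"] mult_right_mono[OF simplex_norm_le_1[OF emp_simplex[of n s]] kp(1)] \<gamma>_pos[of n] by (simp add: mult_left_mono)
  ultimately have "norm (Wt n s) \<le> 2 + \<gamma> n * kp" unfolding Wt_def by (intro order_trans[OF norm_triangle_ineq] add_mono)
  then have "norm (scl n *\<^sub>R Wt n s) \<le> scl n * (2 + \<gamma> n * kp)" using scl_pos[of n] by (simp add: mult_left_mono)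
  then show ?thesis unfolding D_def using b[of s] by (intro order_trans[OF norm_triangle_ineq4] add_mono)
 qed
 moreover have "0 \<le> scl n * (2 + \<gamma> n * kp) + b"
  using order_trans[OF norm_ge_zero b] scl_pos[of n] \<gamma>_pos[of n] kp(1) by simp
 ultimately show ?thesis by blast
qed

lemma cn_tendsto: "AE s in M. (\<lambda>n. cn n s) \<longlonglongrightarrow> cs"
 using empirical_tendsto unfolding cn_def cs_def by eventually_elim (auto intro: tendsto_inner)

lemma cross_integrable: "integrable M (\<lambda>s. \<bar>cn n s - cs\<bar> * norm (Z n s))"
proof -
 obtain b where b: "\<And>s. norm (Z n s) \<le> b" using Z_bounded[of n] by blast
 have b0: "0 \<le> b" using order_trans[OF norm_ge_zero b] .
 show ?thesis
 proof (rule integrable_const_bound[of _ "1 * b"])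
  have "\<bar>cn n s - cs\<bar> * norm (Z n s) \<le> 1 * b" for s by (rule mult_mono[OF cn_bound b]) auto
  then show "AE s in M. norm (\<bar>cn n s - cs\<bar> * norm (Z n s)) \<le> 1 * b" by simp
  show "(\<lambda>s. \<bar>cn n s - cs\<bar> * norm (Z n s)) \<in> borel_measurable M"
   by (intro borel_measurable_times borel_measurable_abs borel_measurable_diff cn_measurable borel_measurable_const
    measurable_compose[OF F_measurable_M[OF Z_measurable] borel_measurable_norm])
 qed
qed

text \<open>The fluctuation of the exit rate is bounded and vanishes almost surely, hence in mean
  square, while the second moments of Z stay bounded; a weighted product inequality combines the
  two.\<close>

lemma cross_tendsto: "(\<lambda>n. \<integral>s. \<bar>cn n s - cs\<bar> * norm (Z n s) \<partial>M) \<longlonglongrightarrow> 0"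
proof -
 obtain b where b: "eventually (\<lambda>n. (\<integral>s. (norm (Z n s))\<^sup>2 \<partial>M) \<le> b) sequentially" using Z_second_moment by blast
 have meas: "(\<lambda>s. (cn n s - cs)\<^sup>2) \<in> borel_measurable M" for n
  by (intro borel_measurable_power borel_measurable_diff cn_measurable borel_measurable_const)
 have sq1: "(cn n s - cs)\<^sup>2 \<le> 1" for n s using power_mono[OF cn_bound[of n s] abs_ge_zero, of 2] by simp
 have int: "integrable M (\<lambda>s. (cn n s - cs)\<^sup>2)" for n
  by (rule integrable_const_bound[of _ 1]) (use sq1 meas in auto)
 have "(\<lambda>n. \<integral>s. (cn n s - cs)\<^sup>2 \<partial>M) \<longlonglongrightarrow> (\<integral>s. 0 \<partial>M)"
 proof (rule integral_dominated_convergence[where w = "\<lambda>_. 1"])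
  show "AE s in M. (\<lambda>n. (cn n s - cs)\<^sup>2) \<longlonglongrightarrow> 0"
   using cn_tendsto
  proof eventually_elim
   case (elim s)
   have "(\<lambda>n. (cn n s - cs)\<^sup>2) \<longlonglongrightarrow> (cs - cs)\<^sup>2" by (intro tendsto_power tendsto_diff elim tendsto_const)
   then show ?case by simp
  qed
 qed (use meas sq1 in auto)
 then have v: "(\<lambda>n. \<integral>s. (cn n s - cs)\<^sup>2 \<partial>M) \<longlonglongrightarrow> 0" by simp
 show ?thesis
 proof (rule tendstoI)
  fix r :: real assume r: "0 < r"
  define e where "e = r / (2 * (\<bar>b\<bar> + 1))"
  have e: "0 < e" "e * \<bar>b\<bar> < r / 2"
  proof -
   show "0 < e" using r by (simp add: e_def add_nonneg_pos)
   then have "e * \<bar>b\<bar> < e * (\<bar>b\<bar> + 1)" by (intro mult_strict_left_mono) auto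
   also have "\<dots> = r / 2"
   proof -
    have "x / (2 * c) * c = x / 2" if "c \<noteq> 0" for x c :: real using that by simp
    from this[of "\<bar>b\<bar> + 1" r] show ?thesis unfolding e_def by linarith
   qed
   finally show "e * \<bar>b\<bar> < r / 2" .
  qed
  have "eventually (\<lambda>n. (\<integral>s. (cn n s - cs)\<^sup>2 \<partial>M) < r / 2 * e) sequentially" using v r e by (intro order_tendstoD(2)[of _ 0]) auto
  with b show "eventually (\<lambda>n. dist (\<integral>s. \<bar>cn n s - cs\<bar> * norm (Z n s) \<partial>M) 0 < r) sequentially"
  proof eventually_elim
   case (elim n)
   have amgm: "x * y \<le> x\<^sup>2 / e + e * y\<^sup>2" if "0 \<le> x" "0 \<le> y" for x y :: real
   proof -
    have "0 \<le> (x / sqrt e - sqrt e * y)\<^sup>2" by simp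
    also have "\<dots> = x\<^sup>2 / e - 2 * (x * y) + e * y\<^sup>2" using e(1) by (simp add: power2_diff power_divide power_mult_distrib)
    finally show ?thesis using mult_nonneg_nonneg[OF that] by linarith
   qed
   have "(\<integral>s. \<bar>cn n s - cs\<bar> * norm (Z n s) \<partial>M) \<le> (\<integral>s. (cn n s - cs)\<^sup>2 / e + e * (norm (Z n s))\<^sup>2 \<partial>M)"
   proof (rule integral_mono[OF cross_integrable])
    show "integrable M (\<lambda>s. (cn n s - cs)\<^sup>2 / e + e * (norm (Z n s))\<^sup>2)"
     by (intro Bochner_Integration.integrable_add integrable_divide integrable_mult_right int Z_norm_integrable)
    show "\<bar>cn n s - cs\<bar> * norm (Z n s) \<le> (cn n s - cs)\<^sup>2 / e + e * (norm (Z n s))\<^sup>2" for s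
     using amgm[of "\<bar>cn n s - cs\<bar>" "norm (Z n s)"] by simp
   qed
   also have "\<dots> = (\<integral>s. (cn n s - cs)\<^sup>2 \<partial>M) / e + e * (\<integral>s. (norm (Z n s))\<^sup>2 \<partial>M)"
    using int Z_norm_integrable by simp
   also have "\<dots> < r / 2 + r / 2"
   proof (rule add_strict_mono)
    show "(\<integral>s. (cn n s - cs)\<^sup>2 \<partial>M) / e < r / 2" using elim(2) e(1) by (simp add: divide_less_eq)
    have "e * (\<integral>s. (norm (Z n s))\<^sup>2 \<partial>M) \<le> e * \<bar>b\<bar>" using elim(1) e(1) by (intro mult_left_mono) auto
    then show "e * (\<integral>s. (norm (Z n s))\<^sup>2 \<partial>M) < r / 2" using e(2) by linarith
   qed
   finally have "(\<integral>s. \<bar>cn n s - cs\<bar> * norm (Z n s) \<partial>M) < r" by simp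
   moreover have "0 \<le> (\<integral>s. \<bar>cn n s - cs\<bar> * norm (Z n s) \<partial>M)" by (intro integral_nonneg_AE AE_I2) simp
   ultimately show ?case by (simp add: dist_real_def)
  qed
 qed
qed

text \<open>After time m the exit rate stays within \<delta> of its limit. A condition on the whole
  future makes the same indicator usable at all later times; no adaptedness is required, since D has
  no martingale part.\<close>

definition stable :: "real \<Rightarrow> nat \<Rightarrow> 'w set" where
 "stable \<delta> m = {s \<in> space M. \<forall>k\<ge>m. \<bar>cn k s - cs\<bar> \<le> \<delta>}"

lemma stable_sets: "stable \<delta> m \<in> sets M"
proof -
 have *: "{s \<in> space M. \<bar>cn k s - cs\<bar> \<le> \<delta>} \<in> sets M" for k
  using borel_measurable_le[OF borel_measurable_abs[OF borel_measurable_diff[OF cn_measurable[of k] borel_measurable_const[of cs]]] borel_measurable_const[of \<delta>]] .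
 have "stable \<delta> m = {s \<in> space M. \<forall>k. m \<le> k \<longrightarrow> \<bar>cn k s - cs\<bar> \<le> \<delta>}" by (simp add: stable_def)
 also have "\<dots> \<in> sets M"
 proof (rule sets.sets_Collect_countable_All)
  fix k show "{s \<in> space M. m \<le> k \<longrightarrow> \<bar>cn k s - cs\<bar> \<le> \<delta>} \<in> sets M" using *[of k] by (cases "m \<le> k") auto
 qed
 finally show ?thesis .
qed

lemma stable_tendsto:
 assumes "0 < \<delta>" shows "(\<lambda>m. measure M (stable \<delta> m)) \<longlonglongrightarrow> 1"
proof -
 have "(\<lambda>m. measure M (stable \<delta> m)) \<longlonglongrightarrow> measure M (\<Union>m. stable \<delta> m)"
 proof (rule finite_Lim_measure_incseq)
  show "range (stable \<delta>) \<subseteq> sets M" using stable_sets by blast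
  show "incseq (stable \<delta>)" unfolding incseq_def stable_def by (intro allI impI subsetI CollectI) simp
 qed
 moreover have "measure M (\<Union>m. stable \<delta> m) = 1"
 proof (rule prob_eq_1[THEN iffD2])
  show "(\<Union>m. stable \<delta> m) \<in> sets M" using stable_sets by auto
  show "AE s in M. s \<in> (\<Union>m. stable \<delta> m)"
   using cn_tendsto AE_space
  proof eventually_elim
   case (elim s)
   from tendstoD[OF elim(1) assms] obtain m where "\<And>k. k \<ge> m \<Longrightarrow> dist (cn k s) cs < \<delta>"
    unfolding eventually_sequentially by blast
   then have "s \<in> stable \<delta> m" using elim(2) unfolding stable_def dist_real_def by (simp add: less_imp_le)
   then show ?case by (rule UN_I[OF UNIV_I])
  qed
 qed
 ultimately show ?thesis by simp
qed

text \<open>On a stable event the bilinear term in D costs only part of the contraction rate: from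
  \<kappa> / 2 a quarter of \<kappa> is left. The integral of N (D n) over the event then satisfies
  a contraction recursion with births.\<close>

lemma D_tendsto: "\<exists>\<delta>>0. \<forall>m. (\<lambda>n. \<integral>s. indicator (stable \<delta> m) s * norm (D n s) \<partial>M) \<longlonglongrightarrow> 0"
proof -
 obtain N where N: "adapted_norm ((*v) Js) \<kappa> N" using adapted_norms(1) by (rule exE)
 obtain CN where CN: "CN \<ge> 1" "\<And>x. N x \<le> CN * norm x" by (rule adapted_norm_le[OF N]) blast
 obtain kq where kq: "0 \<le> kq" "\<And>x. norm (x v* Qs) \<le> norm x * kq" using bounded_linear.nonneg_bounded[OF linear_vector_Qs] by auto
 obtain C where C: "0 \<le> C" "\<And>n s. s \<in> space M \<Longrightarrow>
   norm (err n s) \<le> C * ((\<gamma> n)\<^sup>2 + \<gamma> n * (real (np (Suc n)) - real (np n)) / real (np (Suc n)))" using err_bound by blast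
 \<comment> \<open>The factor 2 bounds the growth of the normalisation in one step,
   \<open>CN\<close> compares the norms, and \<open>kq\<close> bounds Q.\<close>
 define K where "K = 2 * CN * kq"
 have K: "0 \<le> K" using CN kq by (simp add: K_def)
 define \<delta> where "\<delta> = \<kappa> / (4 * (K + 1))"
 have \<delta>: "0 < \<delta>" "K * \<delta> \<le> \<kappa> / 4"
 proof -
  show "0 < \<delta>" using K \<kappa>(1) by (simp add: \<delta>_def)
  then have "K * \<delta> \<le> (K + 1) * \<delta>" by (intro mult_right_mono) auto
  also have "\<dots> = \<kappa> / 4"
  proof -
   have "c * (x / (4 * c)) = x / 4" if "c \<noteq> 0" for x c :: real using that by simp
   from this[of "K + 1" \<kappa>] show ?thesis unfolding \<delta>_def using K by linarith
  qed
  finally show "K * \<delta> \<le> \<kappa> / 4" .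
 qed
 have Nm: "(\<lambda>s. N (D n s)) \<in> borel_measurable M" for n
  by (rule measurable_compose[OF D_measurable borel_measurable_continuous_onI[OF adapted_norm_continuous[OF N]]])
 have N0: "0 \<le> N x" for x by (rule adapted_norm_nonneg[OF N])
 have Nint: "integrable M (\<lambda>s. indicator (stable \<delta> m) s * N (D n s))" for m n
 proof -
  obtain b where b: "b \<ge> 0" "\<And>s. s \<in> space M \<Longrightarrow> norm (D n s) \<le> b" using D_bounded[of n] by blast
  show ?thesis
  proof (rule integrable_const_bound[of _ "CN * b"])
   show "AE s in M. norm (indicator (stable \<delta> m) s * N (D n s)) \<le> CN * b"
   proof (intro AE_I2)
    fix s assume "s \<in> space M"
    then have "norm (D n s) \<le> b" by (rule b(2))
    then have "CN * norm (D n s) \<le> CN * b" using CN(1) by (intro mult_left_mono) auto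
    then have "N (D n s) \<le> CN * b" using CN(2)[of "D n s"] by linarith
    then show "norm (indicator (stable \<delta> m) s * N (D n s)) \<le> CN * b"
     using N0[of "D n s"] b(1) CN(1) by (auto simp: indicator_def)
   qed
  qed (intro borel_measurable_times borel_measurable_indicator stable_sets Nm)
 qed
 have "eventually (\<lambda>n. 1 + \<gamma> n * \<tau> n < 2) sequentially"
 proof -
  have "(\<lambda>n. 1 + \<gamma> n * \<tau> n) \<longlonglongrightarrow> 1 + 0 * (\<alpha> / \<gamma>s)" by (intro tendsto_add tendsto_mult tendsto_const \<gamma>_tendsto \<tau>_tendsto)
  then show ?thesis by (rule order_tendstoD) simp
 qed
 note ratio = this
 have "(\<lambda>n. \<integral>s. indicator (stable \<delta> m) s * norm (D n s) \<partial>M) \<longlonglongrightarrow> 0" for m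
 proof -
  define d where "d n = (\<integral>s. indicator (stable \<delta> m) s * N (D n s) \<partial>M)" for n
  define z where "z n = (\<integral>s. \<bar>cn n s - cs\<bar> * norm (Z n s) \<partial>M)" for n
  define g where "g n = \<kappa> / 4 * \<gamma> n" for n
  define e where "e n = (4 / \<kappa>) * (K * z n + CN * C * (scl (Suc n) * \<gamma> n))" for n
  \<comment> \<open>The effect of one birth on D, of order n^(-\<alpha>) and decreasing, as the
    absorption of the births demands.\<close>
  define h where "h n = CN * C * (2 * sqrt \<gamma>s) * (real n + Nst) powr (- \<alpha>)" for n
  have lim: "d \<longlonglongrightarrow> 0"
  proof (rule recursion_with_births)
   show "eventually (\<lambda>n. d (Suc n) \<le> (1 - g n) * d n + g n * e n + h n * (real (np (Suc n)) - real (np n))) sequentially"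
    using adapted_norm_perturbation[OF N \<kappa>(1) Bm_tendsto(1) \<gamma>_pos \<gamma>_tendsto] ratio birth_weight eventually_ge_at_top[of m]
   proof eventually_elim
    case (elim n)
    define b where "b = real (np (Suc n)) - real (np n)"
    have b: "0 \<le> b" using np_mono1[of n] by (simp add: b_def)
    define T where "T = CN * C * (scl (Suc n) * \<gamma> n) * \<gamma> n + h n * b"
    have gpos: "0 < \<gamma> n" "0 < scl (Suc n)" by (rule \<gamma>_pos, rule scl_pos)
    have T0: "0 \<le> T" using CN C b \<gamma>_pos[of n] scl_pos[of "Suc n"] \<gamma>s unfolding T_def h_def
     by (intro add_nonneg_nonneg mult_nonneg_nonneg) auto
    have point: "indicator (stable \<delta> m) s * N (D (Suc n) s)
      \<le> (1 - g n) * (indicator (stable \<delta> m) s * N (D n s)) + \<gamma> n * K * (\<bar>cn n s - cs\<bar> * norm (Z n s)) + T"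
     if s: "s \<in> space M" for s
    proof (cases "s \<in> stable \<delta> m")
     case False
     then show ?thesis using T0 K gpos by simp
    next
     case True
     define t where "t = \<bar>cn n s - cs\<bar>"
     have t: "0 \<le> t" "t \<le> \<delta>" using True elim(4) by (auto simp: t_def stable_def)
     have r: "0 \<le> scl (Suc n) / scl n" "scl (Suc n) / scl n \<le> 2"
     proof -
      show "0 \<le> scl (Suc n) / scl n" using scl_pos[of n] scl_pos[of "Suc n"] by simp
      have "scl (Suc n) / scl n = 1 + \<gamma> n * \<tau> n" unfolding scl_Suc using scl_pos[of n] by simp
      then show "scl (Suc n) / scl n \<le> 2" using elim(2) by linarith
     qed
     define x where "x = D n s + \<gamma> n *\<^sub>R (Bm n *v D n s)"
     define y where "y = (\<gamma> n * (cn n s - cs) * (scl (Suc n) / scl n)) *\<^sub>R ((D n s + Z n s) v* Qs)"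
     define er where "er = scl (Suc n) *\<^sub>R err n s"
     have "N (D (Suc n) s) \<le> N x + N y + N er"
      unfolding D_Suc[OF s] x_def[symmetric] y_def[symmetric] er_def[symmetric]
      using adapted_norm_triangle[OF N, of "x + y" er] adapted_norm_triangle[OF N, of x y] by linarith
     moreover have "N x \<le> (1 - \<kappa> / 2 * \<gamma> n) * N (D n s)" using elim(1) by (simp add: x_def)
     moreover have "N y \<le> \<gamma> n * K * t * (N (D n s) + norm (Z n s))"
     proof -
      have "norm ((D n s + Z n s) v* Qs) \<le> (N (D n s) + norm (Z n s)) * kq"
       using norm_triangle_ineq[of "D n s" "Z n s"] adapted_norm_ge[OF N, of "D n s"]
       by (intro order_trans[OF kq(2) mult_right_mono[OF _ kq(1)]]) linarith
      moreover have "\<bar>\<gamma> n * (cn n s - cs) * (scl (Suc n) / scl n)\<bar> \<le> \<gamma> n * t * 2"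
       unfolding abs_mult t_def using r gpos by (intro mult_mono) auto
      ultimately have "norm y \<le> (\<gamma> n * t * 2) * ((N (D n s) + norm (Z n s)) * kq)"
       unfolding y_def norm_scaleR using gpos t by (intro mult_mono) auto
      then have "CN * norm y \<le> CN * ((\<gamma> n * t * 2) * ((N (D n s) + norm (Z n s)) * kq))" using CN(1) by (intro mult_left_mono) auto
      then show ?thesis using CN(2)[of y] by (simp add: K_def mult_ac)
     qed
     moreover have "\<gamma> n * K * t * N (D n s) \<le> \<kappa> / 4 * \<gamma> n * N (D n s)"
     proof (intro mult_right_mono N0)
      have "K * t \<le> \<kappa> / 4" using mult_left_mono[OF t(2) K] \<delta>(2) by linarith
      then show "\<gamma> n * K * t \<le> \<kappa> / 4 * \<gamma> n" using gpos mult_left_mono[of "K * t" "\<kappa> / 4" "\<gamma> n"] by (simp add: mult_ac)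
     qed
     moreover have "N er \<le> T"
     proof -
      have "norm er = scl (Suc n) * norm (err n s)" using gpos by (simp add: er_def)
      also have "\<dots> \<le> scl (Suc n) * (C * ((\<gamma> n)\<^sup>2 + \<gamma> n * b / real (np (Suc n))))"
       using C(2)[OF s, of n] gpos by (intro mult_left_mono) (auto simp: b_def)
      also have "\<dots> = C * ((scl (Suc n) * \<gamma> n) * \<gamma> n + (scl (Suc n) * \<gamma> n / real (np (Suc n))) * b)"
       by (simp add: power2_eq_square algebra_simps)
      also have "\<dots> \<le> C * ((scl (Suc n) * \<gamma> n) * \<gamma> n + (2 * sqrt \<gamma>s * (real n + Nst) powr (- \<alpha>)) * b)"
       using elim(3) b C(1) by (intro mult_left_mono add_left_mono mult_right_mono)
      finally have "CN * norm er \<le> CN * (C * ((scl (Suc n) * \<gamma> n) * \<gamma> n + (2 * sqrt \<gamma>s * (real n + Nst) powr (- \<alpha>)) * b))"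
       using CN(1) by (intro mult_left_mono) auto
      then show ?thesis using CN(2)[of er] by (simp add: T_def h_def algebra_simps)
     qed
     ultimately have "N (D (Suc n) s) \<le> (1 - \<kappa> / 2 * \<gamma> n) * N (D n s) + \<kappa> / 4 * \<gamma> n * N (D n s) + \<gamma> n * K * (t * norm (Z n s)) + T"
      by (simp add: algebra_simps)
     also have "\<dots> = (1 - g n) * N (D n s) + \<gamma> n * K * (t * norm (Z n s)) + T" by (simp add: g_def algebra_simps)
     finally show ?thesis using True by (simp add: t_def)
    qed
    have "d (Suc n) \<le> (\<integral>s. (1 - g n) * (indicator (stable \<delta> m) s * N (D n s)) + \<gamma> n * K * (\<bar>cn n s - cs\<bar> * norm (Z n s)) + T \<partial>M)"
     unfolding d_def
     by (intro integral_mono[OF Nint] Bochner_Integration.integrable_add integrable_mult_right Nint cross_integrable integrable_const point)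
    also have "\<dots> = (1 - g n) * d n + \<gamma> n * K * z n + T"
     using Nint cross_integrable by (simp add: d_def z_def prob_space)
    also have "\<dots> = (1 - g n) * d n + g n * e n + h n * b"
     using \<kappa>(1) by (simp add: T_def g_def e_def field_simps)
    finally show ?case by (simp add: b_def)
   qed
   have "(\<lambda>n. \<kappa> / 4 * \<gamma> n) \<longlonglongrightarrow> \<kappa> / 4 * 0" by (intro tendsto_mult tendsto_const \<gamma>_tendsto)
   then have "eventually (\<lambda>n. g n < 1) sequentially" unfolding g_def by (rule order_tendstoD) simp
   then show "eventually (\<lambda>n. 0 < g n \<and> g n \<le> 1) sequentially"
    by eventually_elim (use \<kappa>(1) \<gamma>_pos in \<open>simp add: g_def\<close>)
   show "filterlim (\<lambda>n. \<Sum>k<n. g k) at_top sequentially"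
    unfolding g_def sum_distrib_left[symmetric] using \<kappa>(1)
    by (intro filterlim_tendsto_pos_mult_at_top[OF tendsto_const] \<gamma>_diverges) auto
   have "e \<longlonglongrightarrow> (4 / \<kappa>) * (K * 0 + CN * C * 0)"
    unfolding e_def[abs_def] z_def by (intro tendsto_mult tendsto_add tendsto_const scl_\<gamma>_tendsto cross_tendsto)
   then show "e \<longlonglongrightarrow> 0" by simp
   show "0 \<le> d n" for n unfolding d_def by (intro integral_nonneg_AE AE_I2) (simp add: N0)
   have c0: "0 \<le> CN * C * (2 * sqrt \<gamma>s)" using CN C \<gamma>s by simp
   show "0 \<le> h n" for n unfolding h_def by (rule mult_nonneg_nonneg[OF c0 powr_ge_zero])
   show "h (Suc n) \<le> h n" for n unfolding h_def using Nst \<alpha> by (intro mult_left_mono[OF _ c0] powr_mono2') auto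
   have "(\<lambda>n. (real n + Nst) powr (- \<alpha>)) \<longlonglongrightarrow> 0" using \<alpha>(1,2) Nst(2) by real_asymp
   from tendsto_mult[OF tendsto_const[of "CN * C * (2 * sqrt \<gamma>s)"] this] show "h \<longlonglongrightarrow> 0" unfolding h_def[abs_def] by simp
   show "\<bar>real (np n) - real n powr \<zeta>\<bar> \<le> 1" for n by (rule num_particles_deviation[OF \<zeta>])
   show "(\<lambda>n. h n * (real (Suc n) powr \<zeta> - real n powr \<zeta>) / g n) \<longlonglongrightarrow> 0"
   proof -
    have "c * p * x / (\<kappa> / 4 * y) = c * (4 / \<kappa>) * (p * x / y)" for c p x y using \<kappa>(1) by simp
    then have eq: "h n * (real (Suc n) powr \<zeta> - real n powr \<zeta>) / g n
     = CN * C * (2 * sqrt \<gamma>s) * (4 / \<kappa>) * ((real n + Nst) powr (- \<alpha>) * (real (Suc n) powr \<zeta> - real n powr \<zeta>) / \<gamma> n)" for n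
     unfolding h_def g_def .
    show ?thesis unfolding eq
     using tendsto_mult[OF tendsto_const[of "CN * C * (2 * sqrt \<gamma>s) * (4 / \<kappa>)"] growth_weight] unfolding mult_zero_right .
   qed
  qed
  have le: "(\<integral>s. indicator (stable \<delta> m) s * norm (D n s) \<partial>M) \<le> d n" for n
   unfolding d_def
  proof (rule integral_mono')
   show "integrable M (\<lambda>s. indicator (stable \<delta> m) s * N (D n s))" by (rule Nint)
  qed (auto intro!: mult_left_mono adapted_norm_ge[OF N] simp: N0)
  have nn: "0 \<le> (\<integral>s. indicator (stable \<delta> m) s * norm (D n s) \<partial>M)" for n by (intro integral_nonneg_AE AE_I2) simp
  show ?thesis
  proof (rule Lim_null_comparison[OF _ lim])
   show "eventually (\<lambda>n. norm (\<integral>s. indicator (stable \<delta> m) s * norm (D n s) \<partial>M) \<le> d n) sequentially"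
    unfolding real_norm_def abs_of_nonneg[OF nn] by (rule always_eventually[OF allI[OF le]])
  qed
 qed
 with \<delta>(1) show ?thesis by (intro exI[of _ \<delta>] conjI allI)
qed

section \<open>From the linear recursion to the normalised error\<close>

abbreviation Rn :: "nat \<Rightarrow> 'w \<Rightarrow> real ^ 'd" where
 "Rn n s \<equiv> sqrt (real (np n) / step_size \<gamma>s n) *\<^sub>R (\<theta> n s - \<theta>s)"

lemma Rn_measurable: "Rn n \<in> borel_measurable M"
 by (intro borel_measurable_scaleR borel_measurable_const borel_measurable_diff F_measurable_M[OF \<theta>_measurable])

text \<open>The exchange of \<open>scl\<close> for \<sigma> costs a null factor times the moments of
  Z, the telescoping correction has order scl * \<gamma>, and D is small on a stable event of
  probability near one. Off this event the two exponentials differ by at most 2.\<close>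

lemma Rn_chf_compare:
 "(\<lambda>n. (\<integral>s. iexp (u \<bullet> Rn n s) \<partial>M) - (\<integral>s. iexp (u \<bullet> Z n s) \<partial>M)) \<longlonglongrightarrow> 0"
proof -
 obtain \<delta> where \<delta>: "\<delta> > 0" "\<And>m. (\<lambda>n. \<integral>s. indicator (stable \<delta> m) s * norm (D n s) \<partial>M) \<longlonglongrightarrow> 0" using D_tendsto by blast
 obtain kp where kp: "0 \<le> kp" "\<And>x. norm (\<psi> x) \<le> norm x * kp" using bounded_linear.nonneg_bounded[OF linear_\<psi>] by auto
 obtain b where b: "eventually (\<lambda>n. (\<integral>s. (norm (Z n s))\<^sup>2 \<partial>M) \<le> b) sequentially" using Z_second_moment by blast
 define r where "r n = sqrt (real (np n) / step_size \<gamma>s n) / scl n" for n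
 have r: "r \<longlonglongrightarrow> 1" unfolding r_def by (rule normalisation_ratio)
 have Rn: "Rn n s - Z n s = (r n - 1) *\<^sub>R Z n s + r n *\<^sub>R (D n s - (scl n * \<gamma> n) *\<^sub>R \<psi> (emp n s))" for n s
 proof -
  have "scl n *\<^sub>R (\<theta> n s - \<theta>s) = D n s + Z n s - (scl n * \<gamma> n) *\<^sub>R \<psi> (emp n s)"
   unfolding D_def Wt_def by (simp add: algebra_simps)
  moreover have "Rn n s = r n *\<^sub>R (scl n *\<^sub>R (\<theta> n s - \<theta>s))" using scl_pos[of n] by (simp add: r_def)
  ultimately have E: "Rn n s = r n *\<^sub>R (D n s + Z n s - (scl n * \<gamma> n) *\<^sub>R \<psi> (emp n s))" by (simp only:)
  show ?thesis unfolding E by (simp add: algebra_simps)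
 qed
 define q where "q m n = norm u * (\<bar>r n - 1\<bar> * (1 + \<bar>b\<bar>) + \<bar>r n\<bar> * ((\<integral>s. indicator (stable \<delta> m) s * norm (D n s) \<partial>M) + scl (Suc n) * \<gamma> n * kp))" for m n
 have q: "q m \<longlonglongrightarrow> 0" for m
 proof -
  have "(\<lambda>n. r n - 1) \<longlonglongrightarrow> 0" using r by (simp add: LIM_zero)
  then have "q m \<longlonglongrightarrow> norm u * (\<bar>0\<bar> * (1 + \<bar>b\<bar>) + \<bar>1\<bar> * (0 + 0 * kp))"
   unfolding q_def[abs_def] by (intro tendsto_mult tendsto_add tendsto_const tendsto_rabs r \<delta>(2) scl_\<gamma>_tendsto)
  then show ?thesis by simp
 qed
 have main: "eventually (\<lambda>n. norm ((\<integral>s. iexp (u \<bullet> Rn n s) \<partial>M) - (\<integral>s. iexp (u \<bullet> Z n s) \<partial>M))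
   \<le> 2 * (1 - measure M (stable \<delta> m)) + q m n) sequentially" for m
  using b
 proof eventually_elim
  case (elim n)
  let ?i = "\<lambda>s. indicator (stable \<delta> m) s :: real"
  have sg: "scl n * \<gamma> n \<le> scl (Suc n) * \<gamma> n" "0 \<le> scl n * \<gamma> n"
  proof -
   have "scl n \<le> scl (Suc n)" unfolding scl_def using Nst \<alpha> \<gamma>s by (intro divide_right_mono powr_mono2) auto
   then show "scl n * \<gamma> n \<le> scl (Suc n) * \<gamma> n" using \<gamma>_pos[of n] by (intro mult_right_mono) auto
   show "0 \<le> scl n * \<gamma> n" using scl_pos[of n] \<gamma>_pos[of n] by simp
  qed
  have im: "integrable M ?i" using stable_sets by (intro integrable_real_indicator) (auto simp: emeasure_eq_measure)
  have Dint: "integrable M (\<lambda>s. ?i s * norm (D n s))"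
  proof -
   obtain b where b: "b \<ge> 0" "\<And>s. s \<in> space M \<Longrightarrow> norm (D n s) \<le> b" using D_bounded[of n] by blast
   show ?thesis
   proof (rule integrable_const_bound[of _ b])
    show "AE s in M. norm (?i s * norm (D n s)) \<le> b" using b by (intro AE_I2) (auto simp: indicator_def)
   qed (intro borel_measurable_times borel_measurable_indicator stable_sets measurable_compose[OF D_measurable borel_measurable_norm])
  qed
  have Z1: "integrable M (\<lambda>s. norm (Z n s))" using Z_norm_integrable[of n 1] by simp
  define h where "h s = 2 * (1 - ?i s) + norm u * (\<bar>r n - 1\<bar> * norm (Z n s) + \<bar>r n\<bar> * (?i s * norm (D n s) + scl (Suc n) * \<gamma> n * kp))" for s
  have hint: "integrable M h" unfolding h_def
   by (intro Bochner_Integration.integrable_add Bochner_Integration.integrable_diff integrable_mult_right integrable_const im Z1 Dint)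
  have "norm ((\<integral>s. iexp (u \<bullet> Rn n s) \<partial>M) - (\<integral>s. iexp (u \<bullet> Z n s) \<partial>M)) \<le> (\<integral>s. h s \<partial>M)"
  proof (rule norm_integral_diff_le[OF integrable_iexp integrable_iexp hint])
   show "(\<lambda>s. u \<bullet> Rn n s) \<in> borel_measurable M" by (rule borel_measurable_inner[OF borel_measurable_const Rn_measurable])
   show "(\<lambda>s. u \<bullet> Z n s) \<in> borel_measurable M" by (rule F_measurable_M[OF Z_inner_measurable])
   fix s assume s: "s \<in> space M"
   show "norm (iexp (u \<bullet> Rn n s) - iexp (u \<bullet> Z n s)) \<le> h s"
   proof (cases "s \<in> stable \<delta> m")
    case True
    have "norm (iexp (u \<bullet> Rn n s) - iexp (u \<bullet> Z n s)) \<le> \<bar>u \<bullet> (Rn n s - Z n s)\<bar>"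
     using iexp_diff_le[of "u \<bullet> Rn n s" "u \<bullet> Z n s"] by (simp only: inner_diff_right)
    also have "\<dots> \<le> norm u * norm (Rn n s - Z n s)" by (rule Cauchy_Schwarz_ineq2)
    also have "\<dots> \<le> norm u * (\<bar>r n - 1\<bar> * norm (Z n s) + \<bar>r n\<bar> * (norm (D n s) + scl (Suc n) * \<gamma> n * kp))"
    proof (intro mult_left_mono norm_ge_zero)
     have "norm (\<psi> (emp n s)) \<le> kp" using kp(2)[of "emp n s"] mult_right_mono[OF simplex_norm_le_1[OF emp_simplex[of n s]] kp(1)] by simp
     then have "norm ((scl n * \<gamma> n) *\<^sub>R \<psi> (emp n s)) \<le> scl (Suc n) * \<gamma> n * kp"
      unfolding norm_scaleR abs_of_nonneg[OF sg(2)] by (rule mult_mono[OF sg(1) _ order_trans[OF sg(2) sg(1)] norm_ge_zero])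
     then have "norm (D n s - (scl n * \<gamma> n) *\<^sub>R \<psi> (emp n s)) \<le> norm (D n s) + scl (Suc n) * \<gamma> n * kp"
      by (intro order_trans[OF norm_triangle_ineq4] add_left_mono)
     then show "norm (Rn n s - Z n s) \<le> \<bar>r n - 1\<bar> * norm (Z n s) + \<bar>r n\<bar> * (norm (D n s) + scl (Suc n) * \<gamma> n * kp)"
      unfolding Rn by (intro order_trans[OF norm_triangle_ineq] add_mono) (simp_all add: mult_left_mono)
    qed
    finally show ?thesis using True by (simp add: h_def)
   next
    case False
    have "norm (iexp (u \<bullet> Rn n s) - iexp (u \<bullet> Z n s)) \<le> 2"
     using norm_triangle_ineq4[of "iexp (u \<bullet> Rn n s)" "iexp (u \<bullet> Z n s)"] by simp
    also have "2 \<le> h s" using False sg kp(1) order_trans[OF sg(2) sg(1)] by (simp add: h_def)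
    finally show ?thesis .
   qed
  qed
  also have "(\<integral>s. h s \<partial>M) = 2 * (1 - measure M (stable \<delta> m)) + norm u * (\<bar>r n - 1\<bar> * (\<integral>s. norm (Z n s) \<partial>M)
    + \<bar>r n\<bar> * ((\<integral>s. ?i s * norm (D n s) \<partial>M) + scl (Suc n) * \<gamma> n * kp))"
   unfolding h_def using im Z1 Dint stable_sets by (simp add: prob_space)
  also have "\<dots> \<le> 2 * (1 - measure M (stable \<delta> m)) + q m n"
  proof -
   have "(\<integral>s. norm (Z n s) \<partial>M) \<le> (\<integral>s. 1 + (norm (Z n s))\<^sup>2 \<partial>M)"
   proof (rule integral_mono[OF Z1])
    show "norm (Z n s) \<le> 1 + (norm (Z n s))\<^sup>2" for s
    proof -
     have "2 * norm (Z n s) \<le> 1 + (norm (Z n s))\<^sup>2"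
      using zero_le_power2[of "norm (Z n s) - 1"] by (simp add: power2_eq_square algebra_simps)
     then show ?thesis using norm_ge_zero[of "Z n s"] by linarith
    qed
   qed (intro Bochner_Integration.integrable_add integrable_const Z_norm_integrable)
   also have "\<dots> \<le> 1 + \<bar>b\<bar>" using elim Z_norm_integrable[of n 2] by (simp add: prob_space)
   finally have "(\<integral>s. norm (Z n s) \<partial>M) \<le> 1 + \<bar>b\<bar>" .
   then show ?thesis unfolding q_def by (intro add_left_mono mult_left_mono add_right_mono) auto
  qed
  finally show ?case .
 qed
 show ?thesis
 proof (rule tendstoI)
  fix t :: real assume t: "0 < t"
  have "eventually (\<lambda>m. 1 - t / 4 < measure M (stable \<delta> m)) sequentially"
   using stable_tendsto[OF \<delta>(1)] t by (intro order_tendstoD(1)) auto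
  then obtain m where m: "1 - t / 4 < measure M (stable \<delta> m)" unfolding eventually_sequentially by blast
  have "eventually (\<lambda>n. q m n < t / 2) sequentially" using q[of m] t by (intro order_tendstoD(2)) auto
  with main[of m] show "eventually (\<lambda>n. dist ((\<integral>s. iexp (u \<bullet> Rn n s) \<partial>M) - (\<integral>s. iexp (u \<bullet> Z n s) \<partial>M)) 0 < t) sequentially"
  proof eventually_elim
   case (elim n)
   have "2 * (1 - measure M (stable \<delta> m)) + q m n < t" using elim(2) m by argo
   with elim(1) show ?case unfolding dist_norm diff_0_right by (rule le_less_trans)
  qed
 qed
qed

text \<open>The two comparisons give the limit of the characteristic functions; it remains to
  exhibit a law that has it, and then Levy continuity applies.\<close>

lemma fluctuations_converge:
 assumes V: "lyapunov_solution Us (h_jacobian P \<theta>s) ((1 + \<zeta>) * inverse \<gamma>s) V"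
 shows "\<exists>N. normal_law 0 V N \<and> converges_weakly (\<lambda>n. distr M borel (Rn n)) N"
proof -
 have sym: "transpose V = V" using V by (simp add: lyapunov_solution_def)
 have chf: "(\<lambda>n. \<integral>s. iexp (u \<bullet> Rn n s) \<partial>M) \<longlonglongrightarrow> exp (- of_real (u \<bullet> (V *v u)) / 2)" for u
  using tendsto_add[OF Rn_chf_compare[of u] Z_chf_tendsto[OF sym lyapunov_solution_Js(2)[OF V], of u]] by simp
 \<comment> \<open>Semidefiniteness of V is read off the limit: characteristic functions have
   modulus at most 1, so the exponential does as well.\<close>
 have psd: "0 \<le> u \<bullet> (V *v u)" for u
 proof -
  have n1: "norm (\<integral>s. iexp (u \<bullet> Rn n s) \<partial>M) \<le> 1" for n
  proof -
   have "norm (\<integral>s. iexp (u \<bullet> Rn n s) \<partial>M) \<le> (\<integral>s. norm (iexp (u \<bullet> Rn n s)) \<partial>M)" by (rule integral_norm_bound)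
   then show ?thesis by (simp add: prob_space)
  qed
  have "norm (exp (- complex_of_real (u \<bullet> (V *v u)) / 2)) \<le> 1"
   by (rule LIMSEQ_le_const2[OF tendsto_norm[OF chf[of u]]]) (use n1 in auto)
  then show ?thesis by simp
 qed
 obtain N where N: "normal_law 0 V N" using normal_law_exists[OF sym psd] by (rule exE)
 have Nchf: "(CLINT x|N. iexp (u \<bullet> x)) = exp (- of_real (u \<bullet> (V *v u)) / 2)" for u
  using N by (simp add: normal_law_def)
 have "converges_weakly (\<lambda>n. distr M borel (Rn n)) N"
 proof (rule multivariate_levy_continuity)
  show "prob_space (distr M borel (Rn n))" for n by (rule prob_space_distr[OF Rn_measurable])
  show "prob_space N" "sets N = sets borel" using N by (auto simp: normal_law_def)
  fix u
  have "(CLINT x|distr M borel (Rn n). iexp (u \<bullet> x)) = (\<integral>s. iexp (u \<bullet> Rn n s) \<partial>M)" for n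
   by (rule integral_distr[OF Rn_measurable]) (intro borel_measurable_continuous_onI continuous_intros)
  then show "(\<lambda>n. CLINT x|distr M borel (Rn n). iexp (u \<bullet> x)) \<longlonglongrightarrow> (CLINT x|N. iexp (u \<bullet> x))"
   unfolding Nchf using chf[of u] by simp
 qed simp
 with N show ?thesis by blast
qed

end

text \<open>The first conjunct gives meaning to speaking of the solution of the Lyapunov equation.
  The limit law is given by an existential, because with singular covariance it is identified by its
  characteristic function.\<close>

theorem theorem1p4:
  fixes P :: "real ^ ('d::finite option) ^ ('d option)"
    and \<theta>s :: "real ^ 'd"
    and L \<gamma>s \<zeta> :: real
    and M :: "'w measure"
    and x0 :: 'd
    and X :: "nat \<Rightarrow> nat \<Rightarrow> 'w \<Rightarrow> 'd"
    and \<iota> :: "nat \<Rightarrow> 'w \<Rightarrow> nat"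
    and \<theta> :: "nat \<Rightarrow> 'w \<Rightarrow> real ^ 'd"
    and F G H :: "nat \<Rightarrow> 'w measure"
  assumes chain: "absorbed_chain P"
    and qsd: "quasi_stationary P \<theta>s"
    and L: "L > 0" "\<And>c. tangent_eigenvalue (h_jacobian P \<theta>s) c \<Longrightarrow> Re c \<le> - L"
    and gam: "\<gamma>s > 0"
    and zeta: "0 < \<zeta>" "\<zeta> < 1"
    and alg: "algorithm_II M P \<gamma>s \<zeta> x0 X \<iota> \<theta> F G H"
    and sublinear: "(\<lambda>n. real (num_particles \<zeta> n) / real n) \<longlonglongrightarrow> 0"
    and gam_L: "\<gamma>s > inverse L"
  shows "(\<exists>!V. lyapunov_solution (Umat P \<theta>s) (h_jacobian P \<theta>s) ((1 + \<zeta>) * inverse \<gamma>s) V) \<and>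
    (\<forall>V. lyapunov_solution (Umat P \<theta>s) (h_jacobian P \<theta>s) ((1 + \<zeta>) * inverse \<gamma>s) V \<longrightarrow>
      (\<exists>N. normal_law 0 V N \<and>
        converges_weakly
          (\<lambda>n. distr M borel
             (\<lambda>\<omega>. sqrt (real (num_particles \<zeta> n) / step_size \<gamma>s n) *\<^sub>R (\<theta> n \<omega> - \<theta>s)))
          N))"
proof -
  interpret supercritical_gain M P \<gamma>s \<zeta> x0 X \<iota> \<theta> F G H \<theta>s L
    by (intro supercritical_gain.intro supercritical_gain_axioms.intro interacting_particles.intro interacting_particles_axioms.intro
        qsd_chain.intro alg chain qsd gam zeta L gam_L)
  show ?thesis using lyapunov_solution_Js(1) fluctuations_converge by blast
qed

end
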